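(* Let $n\ge1$, let $(\mathcal D,\mathcal X)$ be an $n$-exact category with small extension groups and let $\mathcal B\subseteq\mathcal D$ be an $n$-extension closed additive subcategory. Then $(\mathcal B,\mathcal X_{\mathcal B})$ is an $n$-exact category with small extension groups, where $\mathcal X_{\mathcal B}:=\mathcal X\cap\mathbf C^{n+2}_{\mathcal B}$ is the class of all sequences in $\mathcal X$ with all terms in $\mathcal B$.
   Context: **Complexes.** For an additive category $\mathcal D$, $\mathbf C^{n+2}_{\mathcal D}$ is the category of complexes $X_\bullet\colon X_0\xrightarrow{d^X_0}X_1\to\cdots\to X_n\xrightarrow{d^X_n}X_{n+1}$ over $\mathcal D$ concentrated in degrees $0,\dots,n+1$, with chain maps $f_\bullet=(f_0,\dots,f_{n+1})$. For $A,C\in\mathcal D$, $\mathbf C^{n+2}_{(\mathcal D;A,C)}$ is its subcategory of complexes with $X_0=A$, $X_{n+1}=C$ and chain maps with $f_0=\mathrm{id}_A$, $f_{n+1}=\mathrm{id}_C$; two of its morphisms are homotopic if their difference is null-homotopic as a chain map, and $[X_\bullet]_{\mathcal D}$ is the resulting homotopy equivalence class of $X_\bullet$ in $\mathbf C^{n+2}_{(\mathcal D;A,C)}$. **$n$-exact categories (Jasso).** $X_\bullet\in\mathbf C^{n+2}_{\mathcal D}$ is an $n$-exact sequence if for all $X\in\mathcal D$ the sequences $0\to\mathcal D(X,X_0)\to\cdots\to\mathcal D(X,X_{n+1})$ and $0\to\mathcal D(X_{n+1},X)\to\cdots\to\mathcal D(X_0,X)$ are exact. A weak isomorphism of $n$-exact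 sequences is a chain map $f_\bullet$ such that $f_k$ and $f_{k+1}$ are isomorphisms for some $k\in\{0,\dots,n+1\}$, where $f_{n+2}:=f_0$. Given a chain map $(f_0,\dots,f_n)$ from $X_0\to\cdots\to X_n$ to $Y_0\to\cdots\to Y_n$, its cone is $X_0\to X_1\oplus Y_0\to\cdots\to X_n\oplus Y_{n-1}\to Y_n$ with differentials $\begin{bmatrix}-d^X_0\\ f_0\end{bmatrix}$, $\begin{bmatrix}-d^X_i&0\\ f_i&d^Y_{i-1}\end{bmatrix}$ ($1\le i\le n-1$), $\begin{bmatrix}f_n&d^Y_{n-1}\end{bmatrix}$. It is an $n$-pushout diagram (of $X_0\to\cdots\to X_n$ along $f_0$) if for all $X\in\mathcal D$ applying $\mathcal D(-,X)$ to the cone gives an exact sequence $0\to\mathcal D(Y_n,X)\to\mathcal D(X_n\oplus Y_{n-1},X)\to\cdots\to\mathcal D(X_0,X)$. Dually, it is an $n$-pullback diagram (of $Y_0\to\cdots\to Y_n$ along $f_n$) if for all $X$ applying $\mathcal D(X,-)$ to the cone gives an exact sequence $0\to\mathcal D(X,X_0)\to\cdots\to\mathcal D(X,Y_n)$. An $n$-exact structure on $\mathcal D$ is a class $\mathcal X$ of $n$-exact sequences closed under weak isomorphisms of $n$-exact sequences (if one of two $n$-exact sequences connected by a weak isomorphism is in $\mathcal X$, so is the other) such that, calling $d^X_0$ (resp. $d^X_n$) for $X_\bullet\in\mathcal X$ an admissible monomorphism (resp. admissible epimorphism): (E0) the zero complex is in $\mathcal X$; (E1) admissible monomorphisms are closed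 under composition; (E1$^{\mathrm{op}}$) admissible epimorphisms are closed under composition; (E2) for $X_\bullet\in\mathcal X$ and $f\colon X_0\to Y_0$ there is an $n$-pushout diagram of $X_0\to\cdots\to X_n$ along $f$, with target $Y_0\to\cdots\to Y_n$, such that $Y_0\to Y_1$ is an admissible monomorphism; (E2$^{\mathrm{op}}$) for $X_\bullet\in\mathcal X$ and $g\colon Y_{n+1}\to X_{n+1}$ there is an $n$-pullback diagram of $X_1\to\cdots\to X_{n+1}$ along $g$, with source $Y_1\to\cdots\to Y_{n+1}$, such that $Y_n\to Y_{n+1}$ is an admissible epimorphism. The pair $(\mathcal D,\mathcal X)$ is then an $n$-exact category. **Small extension groups.** $(\mathcal D,\mathcal X)$ has small extension groups if for all $A,C\in\mathcal D$ the class $\{[X_\bullet]_{\mathcal D}: X_\bullet\in\mathcal X\cap\mathbf C^{n+2}_{(\mathcal D;A,C)}\}$ is a set. **Subcategories.** An additive subcategory is a full subcategory closed under isomorphisms and finite direct sums and containing $0$ (not necessarily closed under direct summands). An additive subcategory $\mathcal B$ of an $n$-exact category $(\mathcal D,\mathcal X)$ is $n$-extension closed if for all $X_\bullet\in\mathcal X$ with $X_0,X_{n+1}\in\mathcal B$ there is $Y_\bullet\in\mathbf C^{n+2}_{\mathcal B}\cap\mathcal X$ with $[X_\bullet]_{\mathcal D}=[Y_\bullet]_{\mathcal D}$ (in particular $Y_0=X_0$, $Y_{n+1}=X_{n+1}$). *)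

theory Defs
  imports "HOL-Algebra.Coset" "HOL-Library.Equipollence"
begin

section \<open>Additive categories\<close>

text \<open>
  Categories are carrier-based: only objects in \<open>obj D\<close> and, between two such objects, only
  morphisms in \<open>mor D A B\<close> are meaningful. Hom-sets need not be disjoint, so predicates on
  morphisms carry source and target explicitly. A full subcategory is obtained by
  shrinking \<open>obj D\<close> alone.
\<close>

record ('o, 'm) category_data =
  obj :: "'o set"
  mor :: "'o \<Rightarrow> 'o \<Rightarrow> 'm set"
  ident :: "'o \<Rightarrow> 'm"
  comp :: "'m \<Rightarrow> 'm \<Rightarrow> 'm"  (infixl \<open>\<cdot>\<index>\<close> 75)
  plus_mor :: "'m \<Rightarrow> 'm \<Rightarrow> 'm"  (infixl \<open>\<boxplus>\<index>\<close> 65)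
  zero_mor :: "'o \<Rightarrow> 'o \<Rightarrow> 'm"

definition mor_group :: "('o, 'm) category_data \<Rightarrow> 'o \<Rightarrow> 'o \<Rightarrow> 'm monoid" where
  "mor_group D A B = \<lparr>carrier = mor D A B, monoid.mult = plus_mor D, one = zero_mor D A B\<rparr>"

definition neg_mor :: "('o, 'm) category_data \<Rightarrow> 'o \<Rightarrow> 'o \<Rightarrow> 'm \<Rightarrow> 'm" where
  "neg_mor D A B f = inv\<^bsub>mor_group D A B\<^esub> f"

definition is_iso :: "('o, 'm) category_data \<Rightarrow> 'o \<Rightarrow> 'o \<Rightarrow> 'm \<Rightarrow> bool" where
  "is_iso D A B f \<longleftrightarrow> f \<in> mor D A B \<and>
     (\<exists>g \<in> mor D B A. g \<cdot>\<^bsub>D\<^esub> f = ident D A \<and> f \<cdot>\<^bsub>D\<^esub> g = ident D B)"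

definition is_zero_object :: "('o, 'm) category_data \<Rightarrow> 'o \<Rightarrow> bool" where
  "is_zero_object D Z \<longleftrightarrow> Z \<in> obj D \<and>
     (\<forall>A \<in> obj D. (\<exists>!f. f \<in> mor D A Z) \<and> (\<exists>!f. f \<in> mor D Z A))"

definition is_biproduct ::
  "('o, 'm) category_data \<Rightarrow> 'o \<Rightarrow> 'o \<Rightarrow> 'o \<Rightarrow> 'm \<Rightarrow> 'm \<Rightarrow> 'm \<Rightarrow> 'm \<Rightarrow> bool" where
  "is_biproduct D A B S i\<^sub>1 i\<^sub>2 p\<^sub>1 p\<^sub>2 \<longleftrightarrow> S \<in> obj D \<and>
     i\<^sub>1 \<in> mor D A S \<and> i\<^sub>2 \<in> mor D B S \<and> p\<^sub>1 \<in> mor D S A \<and> p\<^sub>2 \<in> mor D S B \<and>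
     p\<^sub>1 \<cdot>\<^bsub>D\<^esub> i\<^sub>1 = ident D A \<and> p\<^sub>2 \<cdot>\<^bsub>D\<^esub> i\<^sub>2 = ident D B \<and>
     p\<^sub>1 \<cdot>\<^bsub>D\<^esub> i\<^sub>2 = zero_mor D B A \<and> p\<^sub>2 \<cdot>\<^bsub>D\<^esub> i\<^sub>1 = zero_mor D A B \<and>
     (i\<^sub>1 \<cdot>\<^bsub>D\<^esub> p\<^sub>1) \<boxplus>\<^bsub>D\<^esub> (i\<^sub>2 \<cdot>\<^bsub>D\<^esub> p\<^sub>2) = ident D S"

locale additive_category =
  fixes D :: "('o, 'm) category_data" (structure)
  assumes ident_closed: "A \<in> obj D \<Longrightarrow> ident D A \<in> mor D A A"
    and comp_closed: "\<lbrakk>A \<in> obj D; B \<in> obj D; C \<in> obj D; f \<in> mor D A B; g \<in> mor D B C\<rbrakk>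
      \<Longrightarrow> g \<cdot> f \<in> mor D A C"
    and comp_assoc: "\<lbrakk>A \<in> obj D; B \<in> obj D; C \<in> obj D; E \<in> obj D;
        f \<in> mor D A B; g \<in> mor D B C; h \<in> mor D C E\<rbrakk> \<Longrightarrow> (h \<cdot> g) \<cdot> f = h \<cdot> (g \<cdot> f)"
    and comp_ident: "\<lbrakk>A \<in> obj D; B \<in> obj D; f \<in> mor D A B\<rbrakk> \<Longrightarrow> f \<cdot> ident D A = f"
    and ident_comp: "\<lbrakk>A \<in> obj D; B \<in> obj D; f \<in> mor D A B\<rbrakk> \<Longrightarrow> ident D B \<cdot> f = f"
    and mor_comm_group: "\<lbrakk>A \<in> obj D; B \<in> obj D\<rbrakk> \<Longrightarrow> comm_group (mor_group D A B)"
    and comp_plus: "\<lbrakk>A \<in> obj D; B \<in> obj D; C \<in> obj D;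
        f \<in> mor D A B; f' \<in> mor D A B; g \<in> mor D B C\<rbrakk>
      \<Longrightarrow> g \<cdot> (f \<boxplus> f') = (g \<cdot> f) \<boxplus> (g \<cdot> f')"
    and plus_comp: "\<lbrakk>A \<in> obj D; B \<in> obj D; C \<in> obj D;
        f \<in> mor D A B; g \<in> mor D B C; g' \<in> mor D B C\<rbrakk>
      \<Longrightarrow> (g \<boxplus> g') \<cdot> f = (g \<cdot> f) \<boxplus> (g' \<cdot> f)"
    and zero_object_exists: "\<exists>Z. is_zero_object D Z"
    and biproduct_exists: "\<lbrakk>A \<in> obj D; B \<in> obj D\<rbrakk>
      \<Longrightarrow> \<exists>S i\<^sub>1 i\<^sub>2 p\<^sub>1 p\<^sub>2. is_biproduct D A B S i\<^sub>1 i\<^sub>2 p\<^sub>1 p\<^sub>2"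

definition full_subcategory ::
  "('o, 'm) category_data \<Rightarrow> 'o set \<Rightarrow> ('o, 'm) category_data" where
  "full_subcategory D \<B> = D\<lparr>obj := \<B>\<rparr>"

definition additive_subcategory :: "('o, 'm) category_data \<Rightarrow> 'o set \<Rightarrow> bool" where
  "additive_subcategory D \<B> \<longleftrightarrow> \<B> \<subseteq> obj D \<and>
     (\<forall>A \<in> \<B>. \<forall>B \<in> obj D. \<forall>f. is_iso D A B f \<longrightarrow> B \<in> \<B>) \<and>
     (\<exists>Z \<in> \<B>. is_zero_object D Z) \<and>
     (\<forall>A \<in> \<B>. \<forall>B \<in> \<B>. \<forall>S i\<^sub>1 i\<^sub>2 p\<^sub>1 p\<^sub>2. is_biproduct D A B S i\<^sub>1 i\<^sub>2 p\<^sub>1 p\<^sub>2 \<longrightarrow> S \<in> \<B>)"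


section \<open>Complexes\<close>

record ('o, 'm) cpx =
  cobj :: "nat \<Rightarrow> 'o"
  cdiff :: "nat \<Rightarrow> 'm"

text \<open>
  \<open>complexes D m\<close> consists of the complexes in degrees \<open>0, \<dots>, m\<close>; both component functions are
  extensional, so a complex is determined by its data in these degrees. The category of
  complexes in degrees \<open>0, \<dots>, n + 1\<close> thus has the objects \<open>complexes D (Suc n)\<close>.
\<close>

definition complexes :: "('o, 'm) category_data \<Rightarrow> nat \<Rightarrow> ('o, 'm) cpx set" where
  "complexes D m = {X. cobj X \<in> {..m} \<rightarrow>\<^sub>E obj D \<and>
     cdiff X \<in> (\<Pi>\<^sub>E i\<in>{..<m}. mor D (cobj X i) (cobj X (Suc i))) \<and>
     (\<forall>i. Suc i < m \<longrightarrow>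
       cdiff X (Suc i) \<cdot>\<^bsub>D\<^esub> cdiff X i = zero_mor D (cobj X i) (cobj X (Suc (Suc i))))}"

definition chain_map ::
  "('o, 'm) category_data \<Rightarrow> nat \<Rightarrow> ('o, 'm) cpx \<Rightarrow> ('o, 'm) cpx \<Rightarrow> (nat \<Rightarrow> 'm) \<Rightarrow> bool" where
  "chain_map D m X Y f \<longleftrightarrow> X \<in> complexes D m \<and> Y \<in> complexes D m \<and>
     (\<forall>i\<le>m. f i \<in> mor D (cobj X i) (cobj Y i)) \<and>
     (\<forall>i<m. f (Suc i) \<cdot>\<^bsub>D\<^esub> cdiff X i = cdiff Y i \<cdot>\<^bsub>D\<^esub> f i)"

text \<open>A homotopy has components \<open>s i : X\<^bsub>i+1\<^esub> \<rightarrow> Y\<^bsub>i\<^esub>\<close> for \<open>i < m\<close>; here \<open>m \<ge> 1\<close>.\<close>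

definition null_homotopic ::
  "('o, 'm) category_data \<Rightarrow> nat \<Rightarrow> ('o, 'm) cpx \<Rightarrow> ('o, 'm) cpx \<Rightarrow> (nat \<Rightarrow> 'm) \<Rightarrow> bool" where
  "null_homotopic D m X Y f \<longleftrightarrow>
     (\<exists>s. (\<forall>i<m. s i \<in> mor D (cobj X (Suc i)) (cobj Y i)) \<and>
       f 0 = s 0 \<cdot>\<^bsub>D\<^esub> cdiff X 0 \<and>
       (\<forall>i. Suc i < m \<longrightarrow>
         f (Suc i) = (cdiff Y i \<cdot>\<^bsub>D\<^esub> s i) \<boxplus>\<^bsub>D\<^esub> (s (Suc i) \<cdot>\<^bsub>D\<^esub> cdiff X (Suc i))) \<and>
       f m = cdiff Y (m - 1) \<cdot>\<^bsub>D\<^esub> s (m - 1))"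

definition homotopic ::
  "('o, 'm) category_data \<Rightarrow> nat \<Rightarrow> ('o, 'm) cpx \<Rightarrow> ('o, 'm) cpx \<Rightarrow>
     (nat \<Rightarrow> 'm) \<Rightarrow> (nat \<Rightarrow> 'm) \<Rightarrow> bool" where
  "homotopic D m X Y f g \<longleftrightarrow>
     null_homotopic D m X Y (\<lambda>i. f i \<boxplus>\<^bsub>D\<^esub> neg_mor D (cobj X i) (cobj Y i) (g i))"

definition complexes_between ::
  "('o, 'm) category_data \<Rightarrow> nat \<Rightarrow> 'o \<Rightarrow> 'o \<Rightarrow> ('o, 'm) cpx set" where
  "complexes_between D n A C = {X \<in> complexes D (Suc n). cobj X 0 = A \<and> cobj X (Suc n) = C}"

definition chain_map_between ::
  "('o, 'm) category_data \<Rightarrow> nat \<Rightarrow> 'o \<Rightarrow> 'o \<Rightarrow>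
     ('o, 'm) cpx \<Rightarrow> ('o, 'm) cpx \<Rightarrow> (nat \<Rightarrow> 'm) \<Rightarrow> bool" where
  "chain_map_between D n A C X Y f \<longleftrightarrow>
     X \<in> complexes_between D n A C \<and> Y \<in> complexes_between D n A C \<and>
     chain_map D (Suc n) X Y f \<and> f 0 = ident D A \<and> f (Suc n) = ident D C"

definition homotopy_equivalent_between ::
  "('o, 'm) category_data \<Rightarrow> nat \<Rightarrow> 'o \<Rightarrow> 'o \<Rightarrow> ('o, 'm) cpx \<Rightarrow> ('o, 'm) cpx \<Rightarrow> bool" where
  "homotopy_equivalent_between D n A C X Y \<longleftrightarrow>
     (\<exists>f g. chain_map_between D n A C X Y f \<and> chain_map_between D n A C Y X g \<and>
       homotopic D (Suc n) X X (\<lambda>i. g i \<cdot>\<^bsub>D\<^esub> f i) (\<lambda>i. ident D (cobj X i)) \<and>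
       homotopic D (Suc n) Y Y (\<lambda>i. f i \<cdot>\<^bsub>D\<^esub> g i) (\<lambda>i. ident D (cobj Y i)))"

definition homotopy_class ::
  "('o, 'm) category_data \<Rightarrow> nat \<Rightarrow> ('o, 'm) cpx \<Rightarrow> ('o, 'm) cpx set" where
  "homotopy_class D n X =
     {Y. homotopy_equivalent_between D n (cobj X 0) (cobj X (Suc n)) X Y}"


section \<open>\<open>n\<close>-exact sequences, \<open>n\<close>-pushouts and \<open>n\<close>-pullbacks\<close>

text \<open>
  For \<open>X\<close> in degrees \<open>0, \<dots>, n + 1\<close>, these say that
  \<open>0 \<rightarrow> D(T, X\<^sub>0) \<rightarrow> \<dots> \<rightarrow> D(T, X\<^bsub>n+1\<^esub>)\<close>, respectively
  \<open>0 \<rightarrow> D(X\<^bsub>n+1\<^esub>, T) \<rightarrow> \<dots> \<rightarrow> D(X\<^sub>0, T)\<close>, is exact for all \<open>T\<close>; nothing is required at the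
  last term.
\<close>

definition covariantly_exact ::
  "('o, 'm) category_data \<Rightarrow> nat \<Rightarrow> ('o, 'm) cpx \<Rightarrow> bool" where
  "covariantly_exact D n X \<longleftrightarrow>
     (\<forall>T \<in> obj D.
       kernel (mor_group D T (cobj X 0)) (mor_group D T (cobj X 1)) (\<lambda>g. cdiff X 0 \<cdot>\<^bsub>D\<^esub> g)
         = {zero_mor D T (cobj X 0)} \<and>
       (\<forall>i<n.
         kernel (mor_group D T (cobj X (Suc i))) (mor_group D T (cobj X (Suc (Suc i))))
             (\<lambda>g. cdiff X (Suc i) \<cdot>\<^bsub>D\<^esub> g)
           = (\<lambda>g. cdiff X i \<cdot>\<^bsub>D\<^esub> g) ` mor D T (cobj X i)))"

definition contravariantly_exact ::
  "('o, 'm) category_data \<Rightarrow> nat \<Rightarrow> ('o, 'm) cpx \<Rightarrow> bool" where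
  "contravariantly_exact D n X \<longleftrightarrow>
     (\<forall>T \<in> obj D.
       kernel (mor_group D (cobj X (Suc n)) T) (mor_group D (cobj X n) T) (\<lambda>g. g \<cdot>\<^bsub>D\<^esub> cdiff X n)
         = {zero_mor D (cobj X (Suc n)) T} \<and>
       (\<forall>i<n.
         kernel (mor_group D (cobj X (Suc i)) T) (mor_group D (cobj X i) T)
             (\<lambda>g. g \<cdot>\<^bsub>D\<^esub> cdiff X i)
           = (\<lambda>g. g \<cdot>\<^bsub>D\<^esub> cdiff X (Suc i)) ` mor D (cobj X (Suc (Suc i))) T))"

definition n_exact_sequence :: "('o, 'm) category_data \<Rightarrow> nat \<Rightarrow> ('o, 'm) cpx \<Rightarrow> bool" where
  "n_exact_sequence D n X \<longleftrightarrow>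
     X \<in> complexes D (Suc n) \<and> covariantly_exact D n X \<and> contravariantly_exact D n X"

definition weak_isomorphism ::
  "('o, 'm) category_data \<Rightarrow> nat \<Rightarrow> ('o, 'm) cpx \<Rightarrow> ('o, 'm) cpx \<Rightarrow> (nat \<Rightarrow> 'm) \<Rightarrow> bool" where
  "weak_isomorphism D n X Y f \<longleftrightarrow>
     n_exact_sequence D n X \<and> n_exact_sequence D n Y \<and> chain_map D (Suc n) X Y f \<and>
     (\<exists>k \<le> Suc n. let l = Suc k mod (n + 2) in
       is_iso D (cobj X k) (cobj Y k) (f k) \<and> is_iso D (cobj X l) (cobj Y l) (f l))"

text \<open>
  \<open>W\<close> is a cone of the chain map \<open>f\<close> between complexes \<open>X\<close>, \<open>Y\<close> in degrees \<open>0, \<dots>, n\<close>, where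
  \<open>n \<ge> 1\<close>. The term \<open>W\<^bsub>k+1\<^esub>\<close>, for \<open>k < n\<close>, is some biproduct of \<open>X\<^bsub>k+1\<^esub>\<close> and \<open>Y\<^bsub>k\<^esub>\<close>, so a cone is
  only determined up to isomorphism. The differentials are the column
  \<open>(-d\<^sub>0, f\<^sub>0)\<close>, the lower triangular matrices with diagonal \<open>(-d\<^bsub>k+1\<^esub>, d\<^bsub>k\<^esub>)\<close> and off-diagonal
  entry \<open>f\<^bsub>k+1\<^esub>\<close>, and the row \<open>(f\<^bsub>n\<^esub>, d\<^bsub>n-1\<^esub>)\<close>.
\<close>

definition is_cone ::
  "('o, 'm) category_data \<Rightarrow> nat \<Rightarrow> ('o, 'm) cpx \<Rightarrow> ('o, 'm) cpx \<Rightarrow> (nat \<Rightarrow> 'm) \<Rightarrow>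
     ('o, 'm) cpx \<Rightarrow> bool" where
  "is_cone D n X Y f W \<longleftrightarrow>
     W \<in> complexes D (Suc n) \<and> cobj W 0 = cobj X 0 \<and> cobj W (Suc n) = cobj Y n \<and>
     (\<exists>i\<^sub>1 i\<^sub>2 p\<^sub>1 p\<^sub>2 :: nat \<Rightarrow> 'm.
       (\<forall>k<n. is_biproduct D (cobj X (Suc k)) (cobj Y k) (cobj W (Suc k))
         (i\<^sub>1 (Suc k)) (i\<^sub>2 (Suc k)) (p\<^sub>1 (Suc k)) (p\<^sub>2 (Suc k))) \<and>
       cdiff W 0 = (i\<^sub>1 1 \<cdot>\<^bsub>D\<^esub> neg_mor D (cobj X 0) (cobj X 1) (cdiff X 0)) \<boxplus>\<^bsub>D\<^esub> (i\<^sub>2 1 \<cdot>\<^bsub>D\<^esub> f 0) \<and>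
       (\<forall>k. Suc k < n \<longrightarrow> cdiff W (Suc k) =
          (i\<^sub>1 (Suc (Suc k)) \<cdot>\<^bsub>D\<^esub>
             neg_mor D (cobj X (Suc k)) (cobj X (Suc (Suc k))) (cdiff X (Suc k)) \<cdot>\<^bsub>D\<^esub> p\<^sub>1 (Suc k))
          \<boxplus>\<^bsub>D\<^esub> (i\<^sub>2 (Suc (Suc k)) \<cdot>\<^bsub>D\<^esub> f (Suc k) \<cdot>\<^bsub>D\<^esub> p\<^sub>1 (Suc k))
          \<boxplus>\<^bsub>D\<^esub> (i\<^sub>2 (Suc (Suc k)) \<cdot>\<^bsub>D\<^esub> cdiff Y k \<cdot>\<^bsub>D\<^esub> p\<^sub>2 (Suc k))) \<and>
       cdiff W n = (f n \<cdot>\<^bsub>D\<^esub> p\<^sub>1 n) \<boxplus>\<^bsub>D\<^esub> (cdiff Y (n - 1) \<cdot>\<^bsub>D\<^esub> p\<^sub>2 n))"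

definition n_pushout_diagram ::
  "('o, 'm) category_data \<Rightarrow> nat \<Rightarrow> ('o, 'm) cpx \<Rightarrow> ('o, 'm) cpx \<Rightarrow> (nat \<Rightarrow> 'm) \<Rightarrow> bool" where
  "n_pushout_diagram D n X Y f \<longleftrightarrow>
     chain_map D n X Y f \<and> (\<exists>W. is_cone D n X Y f W \<and> contravariantly_exact D n W)"

definition n_pullback_diagram ::
  "('o, 'm) category_data \<Rightarrow> nat \<Rightarrow> ('o, 'm) cpx \<Rightarrow> ('o, 'm) cpx \<Rightarrow> (nat \<Rightarrow> 'm) \<Rightarrow> bool" where
  "n_pullback_diagram D n X Y f \<longleftrightarrow>
     chain_map D n X Y f \<and> (\<exists>W. is_cone D n X Y f W \<and> covariantly_exact D n W)"

text \<open>The parts \<open>X\<^sub>0 \<rightarrow> \<dots> \<rightarrow> X\<^bsub>n\<^esub>\<close> and \<open>X\<^sub>1 \<rightarrow> \<dots> \<rightarrow> X\<^bsub>n+1\<^esub>\<close>, the latter reindexed to start in degree 0.\<close>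

definition drop_last :: "nat \<Rightarrow> ('o, 'm) cpx \<Rightarrow> ('o, 'm) cpx" where
  "drop_last n X = \<lparr>cobj = restrict (cobj X) {..n}, cdiff = restrict (cdiff X) {..<n}\<rparr>"

definition drop_first :: "nat \<Rightarrow> ('o, 'm) cpx \<Rightarrow> ('o, 'm) cpx" where
  "drop_first n X =
     \<lparr>cobj = (\<lambda>i\<in>{..n}. cobj X (Suc i)), cdiff = (\<lambda>i\<in>{..<n}. cdiff X (Suc i))\<rparr>"


section \<open>\<open>n\<close>-exact categories\<close>

definition admissible_mono :: "('o, 'm) cpx set \<Rightarrow> 'o \<Rightarrow> 'o \<Rightarrow> 'm \<Rightarrow> bool" where
  "admissible_mono \<X> A B f \<longleftrightarrow> (\<exists>X \<in> \<X>. cobj X 0 = A \<and> cobj X 1 = B \<and> cdiff X 0 = f)"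

definition admissible_epi :: "nat \<Rightarrow> ('o, 'm) cpx set \<Rightarrow> 'o \<Rightarrow> 'o \<Rightarrow> 'm \<Rightarrow> bool" where
  "admissible_epi n \<X> A B f \<longleftrightarrow>
     (\<exists>X \<in> \<X>. cobj X n = A \<and> cobj X (Suc n) = B \<and> cdiff X n = f)"

locale n_exact_category = additive_category D
  for D :: "('o, 'm) category_data" (structure) +
  fixes n :: nat and \<X> :: "('o, 'm) cpx set"
  assumes n_exact: "X \<in> \<X> \<Longrightarrow> n_exact_sequence D n X"
    and weak_iso_closed: "weak_isomorphism D n X Y \<phi> \<Longrightarrow> X \<in> \<X> \<longleftrightarrow> Y \<in> \<X>"
    and E0: "\<lbrakk>X \<in> complexes D (Suc n); \<forall>i\<le>Suc n. is_zero_object D (cobj X i)\<rbrakk> \<Longrightarrow> X \<in> \<X>"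
    and E1: "\<lbrakk>admissible_mono \<X> A B f; admissible_mono \<X> B C g\<rbrakk>
      \<Longrightarrow> admissible_mono \<X> A C (g \<cdot> f)"
    and E1_op: "\<lbrakk>admissible_epi n \<X> A B f; admissible_epi n \<X> B C g\<rbrakk>
      \<Longrightarrow> admissible_epi n \<X> A C (g \<cdot> f)"
    and E2: "\<lbrakk>X \<in> \<X>; B \<in> obj D; f \<in> mor D (cobj X 0) B\<rbrakk>
      \<Longrightarrow> \<exists>Y h. n_pushout_diagram D n (drop_last n X) Y h \<and> cobj Y 0 = B \<and> h 0 = f \<and>
            admissible_mono \<X> (cobj Y 0) (cobj Y 1) (cdiff Y 0)"
    \<comment> \<open>\<open>Y\<close> lives in degrees \<open>0, \<dots>, n\<close> and stands for \<open>Y\<^sub>1 \<rightarrow> \<dots> \<rightarrow> Y\<^bsub>n+1\<^esub>\<close>\<close>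
    and E2_op: "\<lbrakk>X \<in> \<X>; C \<in> obj D; g \<in> mor D C (cobj X (Suc n))\<rbrakk>
      \<Longrightarrow> \<exists>Y h. n_pullback_diagram D n Y (drop_first n X) h \<and> cobj Y n = C \<and> h n = g \<and>
            admissible_epi n \<X> (cobj Y (n - 1)) (cobj Y n) (cdiff Y (n - 1))"

text \<open>
  \<open>U\<close> plays the role of the universe of all sets: following limitation of size, a collection
  counts as a set, rather than a proper class, iff it is strictly smaller than \<open>U\<close>. Without
  such a parameter smallness would hold vacuously in HOL.
\<close>

definition small_extension_groups ::
  "('o, 'm) category_data \<Rightarrow> nat \<Rightarrow> ('o, 'm) cpx set \<Rightarrow> 'u set \<Rightarrow> bool" where
  "small_extension_groups D n \<X> U \<longleftrightarrow>
     (\<forall>A \<in> obj D. \<forall>C \<in> obj D. homotopy_class D n ` (\<X> \<inter> complexes_between D n A C) \<prec> U)"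

definition n_extension_closed ::
  "('o, 'm) category_data \<Rightarrow> nat \<Rightarrow> ('o, 'm) cpx set \<Rightarrow> 'o set \<Rightarrow> bool" where
  "n_extension_closed D n \<X> \<B> \<longleftrightarrow>
     (\<forall>X \<in> \<X>. cobj X 0 \<in> \<B> \<and> cobj X (Suc n) \<in> \<B> \<longrightarrow>
       (\<exists>Y \<in> complexes (full_subcategory D \<B>) (Suc n) \<inter> \<X>.
         homotopy_class D n X = homotopy_class D n Y))"

end

theory Submission
  imports Defs
begin

text \<open>
  The class \<open>\<X>\<^sub>\<B>\<close> of the members of \<open>\<X>\<close> with terms in \<open>\<B>\<close> consists of sequences that are \<open>n\<close>-exact in \<open>D\<close>,
  whereas the axioms for \<open>\<B>\<close> speak of sequences, cones and diagrams that are exact for test objects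
  in \<open>\<B>\<close> only. The proof therefore treats exactness relative to a class \<open>S\<close> of test objects, and
  has to move from \<open>S = \<B>\<close> to all objects.

  \<^emph>\<open>Base change.\<close> The pullback axiom is equivalent to the following statement: for \<open>X\<close> in the class and
  \<open>t : T \<rightarrow> X\<^bsub>n+1\<^esub>\<close> there are \<open>P\<close> in the class and a chain map \<open>P \<rightarrow> X\<close> which is the identity in degree
  \<open>0\<close> and \<open>t\<close> in degree \<open>n + 1\<close> (lemmas \<open>has_base_changes_if_has_pullbacks\<close> and
  \<open>has_pullbacks_if_has_base_changes\<close>). In this form the axiom passes to \<open>\<B>\<close> at once, since \<open>P\<close> may be
  replaced by a sequence with terms in \<open>\<B>\<close> that is homotopy equivalent to it relative to the ends.

  \<^emph>\<open>Weak isomorphisms.\<close> Let \<open>X \<rightarrow> Y\<close> be a weak isomorphism of sequences that are \<open>n\<close>-exact in \<open>\<B>\<close>, where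
  \<open>X\<close> is in \<open>\<X>\<^sub>\<B>\<close>. It has a homotopy inverse: if two neighbouring components are isomorphisms, their
  inverses extend by exactness; if the components at both ends are, the inverse in degree
  \<open>n + 1\<close> lifts to degree \<open>n\<close> because the base change along the morphism to be lifted splits
  (\<open>lift_along_last\<close>). Exactness for all test objects in \<open>D\<close> is transferred along such a homotopy
  equivalence, so \<open>Y\<close> is \<open>n\<close>-exact in \<open>D\<close> (\<open>n_exact_of_weak_iso_map\<close>), and \<open>\<X>\<close> is closed under weak
  isomorphisms.

  \<^emph>\<open>Composition.\<close> Let \<open>f\<close> and \<open>g\<close> be the first differentials of \<open>X\<close> and \<open>Y\<close> in \<open>\<X>\<^sub>\<B>\<close>, with \<open>Y\<^sub>0 = X\<^sub>1\<close>. The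
  axiom in \<open>D\<close> gives a member of \<open>\<X>\<close> with first differential \<open>g f\<close>, but not one with terms in \<open>\<B>\<close>.
  However, the cobase change of \<open>Y\<close> along \<open>X\<^sub>1 \<rightarrow> X\<^sub>2\<close> can be taken in \<open>\<B>\<close>; its cone is an \<open>n\<close>-exact sequence \<open>W\<close>
  starting with \<open>X\<^sub>1 \<rightarrow> Y\<^sub>1 \<oplus> X\<^sub>2\<close>, and splicing \<open>X\<close> with \<open>W\<close> (\<open>splice_n_exact\<close>) yields an \<open>n\<close>-exact
  sequence
  \<open>X\<^sub>0 \<rightarrow> Y\<^sub>1 \<rightarrow> W\<^sub>2 \<rightarrow> W\<^sub>3 \<oplus> X\<^sub>3 \<rightarrow> \<dots> \<rightarrow> W\<^bsub>n+1\<^esub> \<oplus> X\<^bsub>n+1\<^esub>\<close>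
  with terms in \<open>\<B>\<close> and first differential \<open>g f\<close>. It is weakly isomorphic to every \<open>n\<close>-exact sequence with the
  same first differential, hence in \<open>\<X>\<close>.

  The axioms for admissible epimorphisms and pushouts follow by passing to the opposite
  category. Extension groups stay small because a homotopy class in \<open>\<B>\<close> is the intersection of a
  homotopy class in \<open>D\<close> with the complexes over \<open>\<B>\<close>.

  To make duality a substitution and to avoid case distinctions at the ends of a complex, all this
  is carried out in a structure whose elements are arrows with total operations, and for complexes
  indexed by the integers and padded by a zero object. The last sections translate between these and
  the complexes, cones and diagrams of the theorem.
\<close>

section \<open>Additive categories in terms of arrows\<close>

text \<open>
  An arrow determines its domain and codomain, so that a complex is a mere sequence of arrows,
  and the opposite category is a record of the same type. The chosen zero object \<open>zo\<close> is the term
  with which complexes will be padded.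
\<close>

record ('o, 'a) arrows =
  Ob :: "'o set"
  arr :: "'a \<Rightarrow> bool"
  dm :: "'a \<Rightarrow> 'o"
  cd :: "'a \<Rightarrow> 'o"
  cmp :: "'a \<Rightarrow> 'a \<Rightarrow> 'a"  (infixr \<open>\<odot>\<index>\<close> 75)
  pls :: "'a \<Rightarrow> 'a \<Rightarrow> 'a"  (infixr \<open>\<oplus>\<index>\<close> 65)
  neg :: "'a \<Rightarrow> 'a"
  zer :: "'o \<Rightarrow> 'o \<Rightarrow> 'a"
  idt :: "'o \<Rightarrow> 'a"
  zo :: 'o

definition homset :: "('o, 'a) arrows \<Rightarrow> 'o \<Rightarrow> 'o \<Rightarrow> 'a set" where
  "homset C A B = {f. arr C f \<and> dm C f = A \<and> cd C f = B}"

lemma homset_iff [simp]: "f \<in> homset C A B \<longleftrightarrow> arr C f \<and> dm C f = A \<and> cd C f = B"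
  by (simp add: homset_def)

definition opp :: "('o, 'a) arrows \<Rightarrow> ('o, 'a) arrows" where
  "opp C = \<lparr>Ob = Ob C, arr = arr C, dm = cd C, cd = dm C, cmp = (\<lambda>g f. cmp C f g),
     pls = pls C, neg = neg C, zer = (\<lambda>A B. zer C B A), idt = idt C, zo = zo C\<rparr>"

lemma opp_sel [simp]:
  "Ob (opp C) = Ob C" "arr (opp C) = arr C" "dm (opp C) = cd C" "cd (opp C) = dm C"
  "cmp (opp C) g f = cmp C f g" "pls (opp C) = pls C" "neg (opp C) = neg C"
  "zer (opp C) A B = zer C B A" "idt (opp C) = idt C" "zo (opp C) = zo C"
  by (simp_all add: opp_def)

text \<open>
  By the first three axioms, all undefined composites are equal, all undefined sums are equal,
  and \<open>neg\<close> fixes everything that is not an arrow. Associativity, commutativity, distributivity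
  and the rules for signs thus hold without side conditions, which makes them usable for
  rewriting.
\<close>

locale arrow_category =
  fixes C :: "('o, 'a) arrows" (structure)
  assumes junk_cmp: "\<not> arr C (g \<odot> f) \<Longrightarrow> \<not> arr C (g' \<odot> f') \<Longrightarrow> g \<odot> f = g' \<odot> f'"
    and junk_pls: "\<not> arr C (g \<oplus> f) \<Longrightarrow> \<not> arr C (g' \<oplus> f') \<Longrightarrow> g \<oplus> f = g' \<oplus> f'"
    and junk_neg: "\<not> arr C f \<Longrightarrow> neg C f = f"
    and arr_Ob: "arr C f \<Longrightarrow> dm C f \<in> Ob C \<and> cd C f \<in> Ob C"
    and arr_cmp [simp]: "arr C (g \<odot> f) \<longleftrightarrow> arr C f \<and> arr C g \<and> cd C f = dm C g"
    and dm_cmp [simp]: "\<lbrakk>arr C f; arr C g; cd C f = dm C g\<rbrakk> \<Longrightarrow> dm C (g \<odot> f) = dm C f"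
    and cd_cmp [simp]: "\<lbrakk>arr C f; arr C g; cd C f = dm C g\<rbrakk> \<Longrightarrow> cd C (g \<odot> f) = cd C g"
    and cmp_assoc: "(h \<odot> g) \<odot> f = h \<odot> g \<odot> f"
    and arr_pls [simp]: "arr C (f \<oplus> g) \<longleftrightarrow>
      arr C f \<and> arr C g \<and> dm C f = dm C g \<and> cd C f = cd C g"
    and dm_pls [simp]:
      "\<lbrakk>arr C f; arr C g; dm C f = dm C g; cd C f = cd C g\<rbrakk> \<Longrightarrow> dm C (f \<oplus> g) = dm C g"
    and cd_pls [simp]:
      "\<lbrakk>arr C f; arr C g; dm C f = dm C g; cd C f = cd C g\<rbrakk> \<Longrightarrow> cd C (f \<oplus> g) = cd C g"
    and pls_assoc: "(h \<oplus> g) \<oplus> f = h \<oplus> g \<oplus> f"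
    and pls_commute: "g \<oplus> f = f \<oplus> g"
    and arr_neg [simp]: "arr C (neg C f) \<longleftrightarrow> arr C f"
    and dm_neg [simp]: "arr C f \<Longrightarrow> dm C (neg C f) = dm C f"
    and cd_neg [simp]: "arr C f \<Longrightarrow> cd C (neg C f) = cd C f"
    and arr_zer [simp]: "arr C (zer C A B) \<longleftrightarrow> A \<in> Ob C \<and> B \<in> Ob C"
    and dm_zer [simp]: "\<lbrakk>A \<in> Ob C; B \<in> Ob C\<rbrakk> \<Longrightarrow> dm C (zer C A B) = A"
    and cd_zer [simp]: "\<lbrakk>A \<in> Ob C; B \<in> Ob C\<rbrakk> \<Longrightarrow> cd C (zer C A B) = B"
    and pls_zer: "\<lbrakk>arr C f; dm C f = A; cd C f = B\<rbrakk> \<Longrightarrow> f \<oplus> zer C A B = f"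
    and pls_neg: "arr C f \<Longrightarrow> f \<oplus> neg C f = zer C (dm C f) (cd C f)"
    and cmp_pls: "h \<odot> (f \<oplus> g) = h \<odot> f \<oplus> h \<odot> g"
    and pls_cmp: "(f \<oplus> g) \<odot> h = f \<odot> h \<oplus> g \<odot> h"
    and arr_idt [simp]: "arr C (idt C A) \<longleftrightarrow> A \<in> Ob C"
    and dm_idt [simp]: "A \<in> Ob C \<Longrightarrow> dm C (idt C A) = A"
    and cd_idt [simp]: "A \<in> Ob C \<Longrightarrow> cd C (idt C A) = A"
    and cmp_idt: "\<lbrakk>arr C f; dm C f = A\<rbrakk> \<Longrightarrow> f \<odot> idt C A = f"
    and idt_cmp: "\<lbrakk>arr C f; cd C f = A\<rbrakk> \<Longrightarrow> idt C A \<odot> f = f"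
    and zo_Ob [simp]: "zo C \<in> Ob C"
    and zo_zero: "idt C (zo C) = zer C (zo C) (zo C)"
begin

lemma dm_Ob [simp]: "arr C f \<Longrightarrow> dm C f \<in> Ob C" and cd_Ob [simp]: "arr C f \<Longrightarrow> cd C f \<in> Ob C"
  using arr_Ob by blast+

lemma opp_arrow_category: "arrow_category (opp C)"
  by unfold_locales
    (simp_all add: arr_Ob cmp_assoc pls_assoc pls_neg cmp_pls pls_cmp zo_zero pls_zer cmp_idt idt_cmp,
     auto intro: junk_cmp junk_pls junk_neg pls_commute)

declare pls_zer [simp] cmp_idt [simp] idt_cmp [simp]

lemma zer_pls [simp]: "\<lbrakk>arr C f; dm C f = A; cd C f = B\<rbrakk> \<Longrightarrow> zer C A B \<oplus> f = f"
  by (subst pls_commute) simp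

lemma pls_left_commute: "h \<oplus> g \<oplus> f = g \<oplus> h \<oplus> f"
  by (metis pls_assoc pls_commute)

lemmas pls_ac = pls_assoc pls_commute pls_left_commute

lemma pls_cancel:
  assumes "x \<oplus> y = x \<oplus> z" "arr C x" "arr C y" "arr C z" "dm C y = dm C x" "cd C y = cd C x"
    "dm C z = dm C x" "cd C z = cd C x"
  shows "y = z"
proof -
  have "(neg C x \<oplus> x) \<oplus> y = (neg C x \<oplus> x) \<oplus> z"
    using assms(1) by (simp add: pls_assoc)
  then show ?thesis using assms by (simp add: pls_commute[of "neg C x"] pls_neg)
qed

lemma pls_eq_zer_neg:
  assumes "x \<oplus> y = zer C A B" "arr C x" "arr C y" "dm C x = A" "cd C x = B" "dm C y = A" "cd C y = B"
  shows "y = neg C x"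
  by (rule pls_cancel[of x]) (use assms in \<open>auto simp: pls_neg\<close>)

lemma zer_cmp [simp]:
  assumes "arr C f" "cd C f = B" "D \<in> Ob C"
  shows "zer C B D \<odot> f = zer C (dm C f) D"
proof -
  have B: "B \<in> Ob C" using assms by auto
  have "zer C B D \<odot> f \<oplus> zer C B D \<odot> f = zer C B D \<odot> f \<oplus> zer C (dm C f) D"
    using assms B by (simp add: pls_cmp[symmetric])
  then show ?thesis by (rule pls_cancel) (use assms B in auto)
qed

lemma cmp_zer [simp]:
  assumes "arr C f" "dm C f = B" "D \<in> Ob C"
  shows "f \<odot> zer C D B = zer C D (cd C f)"
proof -
  have B: "B \<in> Ob C" using assms by auto
  have "f \<odot> zer C D B \<oplus> f \<odot> zer C D B = f \<odot> zer C D B \<oplus> zer C D (cd C f)"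
    using assms B by (simp add: cmp_pls[symmetric])
  then show ?thesis by (rule pls_cancel) (use assms B in auto)
qed

lemma neg_neg [simp]: "neg C (neg C f) = f"
proof (cases "arr C f")
  case True
  then show ?thesis
    by (intro pls_eq_zer_neg[symmetric, of "neg C f" f "dm C f" "cd C f"])
       (auto simp: pls_neg pls_commute[of "neg C f"])
qed (simp add: junk_neg)

lemma neg_zer [simp]:
  assumes "A \<in> Ob C" "B \<in> Ob C" shows "neg C (zer C A B) = zer C A B"
  by (rule pls_eq_zer_neg[symmetric, of _ _ A B]) (use assms in auto)

lemma cmp_neg: "g \<odot> neg C f = neg C (g \<odot> f)"
proof (cases "arr C (g \<odot> f)")
  case True
  then show ?thesis
    by (intro pls_eq_zer_neg[of "g \<odot> f" _ "dm C f" "cd C g"]) (auto simp: cmp_pls[symmetric] pls_neg)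
next
  case False
  then have "\<not> arr C (g \<odot> neg C f)" by auto
  then show ?thesis using junk_cmp[OF _ False] False by (simp only: junk_neg)
qed

lemma neg_cmp: "neg C g \<odot> f = neg C (g \<odot> f)"
proof (cases "arr C (g \<odot> f)")
  case True
  then show ?thesis
    by (intro pls_eq_zer_neg[of "g \<odot> f" _ "dm C f" "cd C g"]) (auto simp: pls_cmp[symmetric] pls_neg)
next
  case False
  then have "\<not> arr C (neg C g \<odot> f)" by auto
  then show ?thesis using junk_cmp[OF _ False] False by (simp only: junk_neg)
qed

lemma neg_pls: "neg C (f \<oplus> g) = neg C f \<oplus> neg C g"
proof (cases "arr C (f \<oplus> g)")
  case True
  have "(f \<oplus> g) \<oplus> neg C f \<oplus> neg C g = (f \<oplus> neg C f) \<oplus> g \<oplus> neg C g"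
    by (simp add: pls_ac)
  then show ?thesis using True
    by (intro pls_eq_zer_neg[symmetric, of "f \<oplus> g" _ "dm C g" "cd C g"]) (auto simp: pls_neg)
next
  case False
  then have "\<not> arr C (neg C f \<oplus> neg C g)" by auto
  then show ?thesis using junk_pls[OF False] False by (simp only: junk_neg)
qed

lemma pls_neg_eq_zer:
  assumes "x \<oplus> neg C y = zer C A B" "arr C x" "arr C y" "dm C x = A" "cd C x = B" "dm C y = A" "cd C y = B"
  shows "x = y"
proof -
  have "neg C y = neg C x" using assms by (intro pls_eq_zer_neg[of x]) auto
  then show ?thesis by (metis neg_neg)
qed

lemma neg_eq_iff: "neg C x = y \<longleftrightarrow> x = neg C y"
  by (metis neg_neg)

lemma into_zo: "\<lbrakk>arr C f; cd C f = zo C\<rbrakk> \<Longrightarrow> f = zer C (dm C f) (zo C)"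
  by (metis cd_Ob dm_Ob idt_cmp zer_cmp zo_zero)

lemma from_zo: "\<lbrakk>arr C f; dm C f = zo C\<rbrakk> \<Longrightarrow> f = zer C (zo C) (cd C f)"
  by (metis cd_Ob cmp_idt cmp_zer zo_Ob zo_zero)

end

section \<open>Complexes indexed by the integers\<close>

text \<open>
  A complex is given by its differentials: \<open>X i\<close> leads from degree \<open>i\<close> to degree \<open>i + 1\<close>, and the
  term in degree \<open>i\<close> is \<open>dm C (X i)\<close>. A complex in degrees \<open>0, \<dots>, N + 1\<close> has the zero object \<open>zo\<close>
  in all other degrees.
\<close>

definition int_complex :: "('o, 'a) arrows \<Rightarrow> 'o set \<Rightarrow> (int \<Rightarrow> 'a) \<Rightarrow> bool" where
  "int_complex C S X \<longleftrightarrow> (\<forall>i. arr C (X i) \<and> dm C (X i) \<in> S \<and> cd C (X i) = dm C (X (i + 1)) \<and>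
     X (i + 1) \<odot>\<^bsub>C\<^esub> X i = zer C (dm C (X i)) (dm C (X (i + 2))))"

definition int_chain_map :: "('o, 'a) arrows \<Rightarrow> (int \<Rightarrow> 'a) \<Rightarrow> (int \<Rightarrow> 'a) \<Rightarrow> (int \<Rightarrow> 'a) \<Rightarrow> bool" where
  "int_chain_map C X Y f \<longleftrightarrow> (\<forall>i. f i \<in> homset C (dm C (X i)) (dm C (Y i)) \<and>
     f (i + 1) \<odot>\<^bsub>C\<^esub> X i = Y i \<odot>\<^bsub>C\<^esub> f i)"

text \<open>
  The class \<open>S\<close> of test objects is a parameter because the same complex is considered in a
  category and in a full subcategory.
\<close>

definition cov_exact_at :: "('o, 'a) arrows \<Rightarrow> 'o set \<Rightarrow> (int \<Rightarrow> 'a) \<Rightarrow> int \<Rightarrow> bool" where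
  "cov_exact_at C S X i \<longleftrightarrow> (\<forall>T\<in>S. \<forall>u\<in>homset C T (dm C (X i)). X i \<odot>\<^bsub>C\<^esub> u = zer C T (cd C (X i)) \<longrightarrow>
     (\<exists>v\<in>homset C T (dm C (X (i - 1))). u = X (i - 1) \<odot>\<^bsub>C\<^esub> v))"

definition contra_exact_at :: "('o, 'a) arrows \<Rightarrow> 'o set \<Rightarrow> (int \<Rightarrow> 'a) \<Rightarrow> int \<Rightarrow> bool" where
  "contra_exact_at C S X i \<longleftrightarrow> (\<forall>T\<in>S. \<forall>u\<in>homset C (cd C (X (i - 1))) T.
     u \<odot>\<^bsub>C\<^esub> X (i - 1) = zer C (dm C (X (i - 1))) T \<longrightarrow>
     (\<exists>v\<in>homset C (cd C (X i)) T. u = v \<odot>\<^bsub>C\<^esub> X i))"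

text \<open>
  The condition that a homotopy from \<open>g\<close> to \<open>f\<close> imposes on degree \<open>i\<close> alone. The arrows \<open>a\<close> and
  \<open>b\<close> found in different degrees need not fit together; a single degree is what the arguments
  below start from and end with.
\<close>

definition homotopic_at ::
  "('o, 'a) arrows \<Rightarrow> (int \<Rightarrow> 'a) \<Rightarrow> (int \<Rightarrow> 'a) \<Rightarrow> (int \<Rightarrow> 'a) \<Rightarrow> (int \<Rightarrow> 'a) \<Rightarrow> int \<Rightarrow> bool" where
  "homotopic_at C X Y f g i \<longleftrightarrow> (\<exists>a\<in>homset C (dm C (X i)) (dm C (Y (i - 1))). \<exists>b\<in>homset C (cd C (X i)) (cd C (Y (i - 1))).
     f i = g i \<oplus>\<^bsub>C\<^esub> Y (i - 1) \<odot>\<^bsub>C\<^esub> a \<oplus>\<^bsub>C\<^esub> b \<odot>\<^bsub>C\<^esub> X i)"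

text \<open>
  Duality: reversing the arrows of a complex \<open>X\<close> gives the complex \<open>reflect k X\<close> over \<open>opp C\<close>,
  and a chain map \<open>f : X \<rightarrow> Y\<close> gives \<open>reflect (k + 1) f\<close> from \<open>reflect k Y\<close> to \<open>reflect k X\<close>. The
  shift by one arises because the term in degree \<open>i\<close> is the domain of \<open>X i\<close>, but the codomain of
  \<open>X (i - 1)\<close>.
\<close>

definition reflect :: "int \<Rightarrow> (int \<Rightarrow> 'a) \<Rightarrow> int \<Rightarrow> 'a" where
  "reflect k X = (\<lambda>i. X (k - i))"

lemma reflect_reflect [simp]: "reflect k (reflect k X) = X"
  by (simp add: reflect_def)

lemma opp_opp [simp]: "opp (opp C) = C"
  by (simp add: opp_def)

lemma cov_exact_opp: "cov_exact_at (opp C) S (reflect k X) i = contra_exact_at C S X (k + 1 - i)"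
proof -
  have e: "k - (i - 1) = k + 1 - i" "k + 1 - i - 1 = k - i" by auto
  show ?thesis unfolding cov_exact_at_def contra_exact_at_def reflect_def e homset_def by simp (metis)
qed

lemma contra_exact_opp: "contra_exact_at (opp C) S (reflect k X) i = cov_exact_at C S X (k + 1 - i)"
  using cov_exact_opp[of "opp C" S k "reflect k X" "k + 1 - i"] by simp

context arrow_category
begin

lemma int_complexD:
  assumes "int_complex C S X"
  shows "arr C (X i)" "dm C (X i) \<in> S" "cd C (X i) = dm C (X (i + 1))"
    "X (i + 1) \<odot> X i = zer C (dm C (X i)) (dm C (X (i + 2)))"
  using assms unfolding int_complex_def by auto

lemma int_complex_sq:
  assumes "int_complex C S X" "j = i + 1"
  shows "X j \<odot> X i = zer C (dm C (X i)) (dm C (X (i + 2)))"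
  using assms int_complexD(4) by auto

lemma int_complex_sq_cmp:
  assumes "int_complex C S X" "j = i + 1" "arr C u" "cd C u = dm C (X i)"
  shows "X j \<odot> X i \<odot> u = zer C (dm C u) (dm C (X (i + 2)))"
  using assms int_complex_sq[OF assms(1,2)] int_complexD(1)[OF assms(1)]
  by (simp add: cmp_assoc[symmetric])

lemma int_chain_mapD:
  assumes "int_chain_map C X Y f"
  shows "arr C (f i)" "dm C (f i) = dm C (X i)" "cd C (f i) = dm C (Y i)"
    "f (i + 1) \<odot> X i = Y i \<odot> f i"
  using assms unfolding int_chain_map_def by auto

lemma int_chain_map_cmp:
  assumes "int_chain_map C X Y f" "j = i + 1"
  shows "f j \<odot> X i \<odot> u = Y i \<odot> f i \<odot> u"
  using int_chain_mapD(4)[OF assms(1), of i] assms(2) by (metis cmp_assoc)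

lemma int_complex_opp: "int_complex C S X \<Longrightarrow> int_complex (opp C) S (reflect k X)"
proof -
  assume a: "int_complex C S X"
  have e: "k - (i + 1) + 1 = k - i" "k - (i+2) + 2 = k - i" "k - (i+2) + 1 = k - (i + 1)" for i :: int by auto
  note d = int_complexD[OF a]
  show ?thesis unfolding int_complex_def reflect_def
  proof (intro allI conjI)
    fix i
    show "arr (opp C) (X (k - i))" using d by simp
    show "dm (opp C) (X (k - i)) \<in> S" using d by simp
    show "cd (opp C) (X (k - i)) = dm (opp C) (X (k - (i + 1)))" using d(3)[of "k - (i + 1)"] by (simp add: e)
    show "X (k - (i + 1)) \<odot>\<^bsub>opp C\<^esub> X (k - i) =
         zer (opp C) (dm (opp C) (X (k - i))) (dm (opp C) (X (k - (i + 2))))"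
      using d(4)[of "k - (i + 1)"] d(3)[of "k - (i+2)"] d(3)[of "k - i"]
      by (simp add: e algebra_simps)
  qed
qed

lemma int_chain_map_opp: 
  assumes "int_complex C S X" "int_complex C S Y" "int_chain_map C X Y f"
  shows "int_chain_map (opp C) (reflect k Y) (reflect k X) (reflect (k + 1) f)"
proof -
  note d = int_complexD[OF assms(1)] int_complexD[OF assms(2)] int_chain_mapD[OF assms(3)]
  have e: "k + 1 - (i + 1) = k - i" "k + 1 - i = k - i + 1" for i :: int by auto
  show ?thesis unfolding int_chain_map_def reflect_def e by (simp add: d)
qed

lemma homotopic_at_opp:
  assumes "int_complex C S X" "int_complex C S Y" "homotopic_at C X Y f g i"
  shows "homotopic_at (opp C) (reflect k Y) (reflect k X) (reflect (k + 1) f) (reflect (k + 1) g) (k + 1 - i)"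
proof -
  note d = int_complexD[OF assms(1)] int_complexD[OF assms(2)]
  have e: "k - (k + 1 - i) = i - 1" "k + 1 - (k + 1 - i) = i" "k - (k + 1 - i - 1) = i" by auto
  obtain a b where ab: "a \<in> homset C (dm C (X i)) (dm C (Y (i - 1)))" "b \<in> homset C (cd C (X i)) (cd C (Y (i - 1)))"
    "f i = g i \<oplus> Y (i - 1) \<odot> a \<oplus> b \<odot> X i" using assms(3) unfolding homotopic_at_def by blast
  show ?thesis unfolding homotopic_at_def reflect_def e
    by (rule bexI[of _ b], rule bexI[of _ a]) (use ab in \<open>auto simp: pls_ac\<close>)
qed

lemma cov_exactD:
  assumes "cov_exact_at C S X i" "int_complex C S' X" "u \<in> homset C T (dm C (X i))" "T \<in> S"
    "X i \<odot> u = zer C T (dm C (X (i + 1)))"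
  obtains v where "v \<in> homset C T (dm C (X (i - 1)))" "u = X (i - 1) \<odot> v"
  using assms unfolding cov_exact_at_def by (metis int_complexD(3))

text \<open>
  Exactness is mostly applied to correct one arrow by another; this form of it contains no signs.
\<close>

lemma cov_exact_diff:
  assumes ex: "cov_exact_at C S X i" and X: "int_complex C S' X"
    and u: "u \<in> homset C T (dm C (X i))" "u' \<in> homset C T (dm C (X i))" and T: "T \<in> S"
    and e: "X i \<odot> u = X i \<odot> u'"
  obtains v where "v \<in> homset C T (dm C (X (i - 1)))" "u = u' \<oplus> X (i - 1) \<odot> v"
proof -
  note d = int_complexD[OF X]
  have "X i \<odot> (u \<oplus> neg C u') = zer C T (dm C (X (i + 1)))"
    using u d e by (simp add: cmp_pls cmp_neg pls_neg)
  then obtain v where v: "v \<in> homset C T (dm C (X (i - 1)))" "u \<oplus> neg C u' = X (i - 1) \<odot> v"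
    by (rule cov_exactD[OF ex X, rotated 2]) (use u T in auto)
  have "u' \<oplus> (u \<oplus> neg C u') = u \<oplus> (u' \<oplus> neg C u')" by (simp add: pls_ac)
  also have "\<dots> = u" using u by (simp add: pls_neg)
  finally show ?thesis using that v by metis
qed

lemma contra_exactD:
  assumes "contra_exact_at C S X i" "int_complex C S' X" "u \<in> homset C (dm C (X i)) T" "T \<in> S"
    "u \<odot> X (i - 1) = zer C (dm C (X (i - 1))) T"
  obtains v where "v \<in> homset C (dm C (X (i + 1))) T" "u = v \<odot> X i"
proof -
  have "cd C (X (i - 1)) = dm C (X i)" using int_complexD(3)[OF assms(2), of "i-1"] by simp
  then show ?thesis using assms that unfolding contra_exact_at_def by (metis int_complexD(3))
qed

lemma contra_exact_diff:
  assumes ex: "contra_exact_at C S X i" and X: "int_complex C S' X"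
    and u: "u \<in> homset C (dm C (X i)) T" "u' \<in> homset C (dm C (X i)) T" and T: "T \<in> S"
    and e: "u \<odot> X (i - 1) = u' \<odot> X (i - 1)"
  obtains v where "v \<in> homset C (dm C (X (i + 1))) T" "u = u' \<oplus> v \<odot> X i"
proof -
  have c: "cd C (X (i - 1)) = dm C (X i)" using int_complexD(3)[OF X, of "i-1"] by simp
  note d = int_complexD[OF X] c
  have "(u \<oplus> neg C u') \<odot> X (i - 1) = zer C (dm C (X (i - 1))) T"
    using u d e by (simp add: pls_cmp neg_cmp pls_neg)
  then obtain v where v: "v \<in> homset C (dm C (X (i + 1))) T" "u \<oplus> neg C u' = v \<odot> X i"
    by (rule contra_exactD[OF ex X, rotated 2]) (use u T in auto)
  have "u' \<oplus> (u \<oplus> neg C u') = u \<oplus> (u' \<oplus> neg C u')" by (simp add: pls_ac)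
  also have "\<dots> = u" using u by (simp add: pls_neg)
  finally show ?thesis using that v by metis
qed

end

definition id_map :: "('o, 'a) arrows \<Rightarrow> (int \<Rightarrow> 'a) \<Rightarrow> int \<Rightarrow> 'a" where
  "id_map C X = (\<lambda>i. idt C (dm C (X i)))"

definition iso_arr :: "('o, 'a) arrows \<Rightarrow> 'a \<Rightarrow> bool" where
  "iso_arr C f \<longleftrightarrow> arr C f \<and> (\<exists>g\<in>homset C (cd C f) (dm C f).
     g \<odot>\<^bsub>C\<^esub> f = idt C (dm C f) \<and> f \<odot>\<^bsub>C\<^esub> g = idt C (cd C f))"

lemma iso_arr_opp [simp]: "iso_arr (opp C) = iso_arr C"
  by (rule ext) (auto simp: iso_arr_def)

definition bounded_in :: "('o, 'a) arrows \<Rightarrow> int \<Rightarrow> int \<Rightarrow> (int \<Rightarrow> 'a) \<Rightarrow> bool" where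
  "bounded_in C p q X \<longleftrightarrow> (\<forall>i. i < p \<or> i > q \<longrightarrow> dm C (X i) = zo C)"

text \<open>
  For a complex in degrees \<open>0, \<dots>, N + 1\<close> exactness is automatic below degree \<open>0\<close> and above degree
  \<open>N + 1\<close>, so each range of degrees needs only one bound.
\<close>

definition n_exact_for :: "('o, 'a) arrows \<Rightarrow> int \<Rightarrow> 'o set \<Rightarrow> (int \<Rightarrow> 'a) \<Rightarrow> bool" where
  "n_exact_for C N S X \<longleftrightarrow> (\<forall>i\<le>N. cov_exact_at C S X i) \<and> (\<forall>i\<ge>1. contra_exact_at C S X i)"

definition n_exact_complex :: "('o, 'a) arrows \<Rightarrow> int \<Rightarrow> 'o set \<Rightarrow> (int \<Rightarrow> 'a) \<Rightarrow> bool" where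
  "n_exact_complex C N S X \<longleftrightarrow> int_complex C S X \<and> bounded_in C 0 (N + 1) X \<and> n_exact_for C N S X"

lemma n_exact_for_opp: "n_exact_for (opp C) N S (reflect N X) \<longleftrightarrow> n_exact_for C N S X"
proof -
  have "(\<forall>i\<le>N. P (N + 1 - i)) \<longleftrightarrow> (\<forall>i\<ge>1. P i)" for P :: "int \<Rightarrow> bool"
    by (metis add.commute diff_add_cancel diff_diff_eq2 diff_left_mono le_diff_eq)
  moreover have "(\<forall>i\<ge>1. P (N + 1 - i)) \<longleftrightarrow> (\<forall>i\<le>N. P i)" for P :: "int \<Rightarrow> bool"
    by (metis add.commute diff_add_cancel diff_diff_eq2 diff_left_mono le_diff_eq)
  ultimately show ?thesis unfolding n_exact_for_def cov_exact_opp contra_exact_opp by auto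
qed

context arrow_category
begin

lemma id_map_opp:
  "int_complex C S X \<Longrightarrow> id_map (opp C) (reflect k X) = reflect (k + 1) (id_map C X)"
  by (rule ext) (simp add: id_map_def reflect_def int_complexD algebra_simps)

lemma int_complex_Ob: "int_complex C S X \<Longrightarrow> int_complex C (Ob C) X"
  by (simp add: int_complex_def)

lemma bounded_in_opp:
  assumes "int_complex C S X" "bounded_in C p q X"
  shows "bounded_in (opp C) (k + 1 - q) (k + 1 - p) (reflect k X)"
  unfolding bounded_in_def
proof (intro allI impI)
  fix i assume "i < k + 1 - q \<or> i > k + 1 - p"
  then have "k - i + 1 < p \<or> k - i + 1 > q" by auto
  then have "dm C (X (k - i + 1)) = zo C" using assms(2) unfolding bounded_in_def by blast
  then show "dm (opp C) (reflect k X i) = zo (opp C)"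
    using int_complexD(3)[OF assms(1), of "k - i"] by (simp add: reflect_def)
qed

lemma n_exact_complex_opp:
  assumes "n_exact_complex C N S X" shows "n_exact_complex (opp C) N S (reflect N X)"
  using assms bounded_in_opp[of S X 0 "N+1" N] by (auto simp: n_exact_complex_def n_exact_for_opp int_complex_opp)

lemma int_chain_map_id: "int_complex C S X \<Longrightarrow> int_chain_map C X X (id_map C X)"
  by (auto simp: int_chain_map_def id_map_def int_complexD)

lemma int_chain_map_comp:
  assumes "int_chain_map C X Y f" "int_chain_map C Y Z g"
  shows "int_chain_map C X Z (\<lambda>i. g i \<odot> f i)"
proof -
  note d = int_chain_mapD[OF assms(1)] int_chain_mapD[OF assms(2)]
  show ?thesis unfolding int_chain_map_def
  proof (intro allI conjI)
    fix i
    show "g i \<odot> f i \<in> homset C (dm C (X i)) (dm C (Z i))" using d by auto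
    show "(g (i + 1) \<odot> f (i + 1)) \<odot> X i = Z i \<odot> g i \<odot> f i"
      using d int_chain_map_cmp[OF assms(2) refl] by (simp add: cmp_assoc)
  qed
qed

section \<open>Homotopies and exactness\<close>

text \<open>
  If \<open>a\<close> and \<open>b\<close> belong to degree \<open>i + 1\<close>, then \<open>f i\<close> and \<open>g i \<oplus> a \<odot> X i\<close> have the same composite
  with the differential of \<open>Y\<close>; by exactness they differ by a boundary, and \<open>a\<close> takes the role of
  \<open>b\<close> in degree \<open>i\<close>.
\<close>

lemma homotopic_at_pred:
  assumes X: "int_complex C S X" and Y: "int_complex C S' Y" and f: "int_chain_map C X Y f" and g: "int_chain_map C X Y g"
    and ex: "cov_exact_at C S Y i" and h: "homotopic_at C X Y f g (i + 1)"
  shows "homotopic_at C X Y f g i"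
proof -
  note d = int_complexD[OF X] int_complexD[OF Y] int_chain_mapD[OF f] int_chain_mapD[OF g]
  have y: "i + 1 - 1 = i" by simp
  have c2: "cd C (X (i + 1)) = dm C (X (i + 2))" using d(3)[of "i + 1"] by (simp add: add.commute)
  obtain a b where a: "a \<in> homset C (dm C (X (i + 1))) (dm C (Y i))"
    and b: "b \<in> homset C (dm C (X (i + 2))) (dm C (Y (i + 1)))"
    and e: "f (i + 1) = g (i + 1) \<oplus> Y i \<odot> a \<oplus> b \<odot> X (i + 1)"
    using h unfolding homotopic_at_def y c2 d(7)[of i] by blast
  have "Y i \<odot> f i = (g (i + 1) \<oplus> Y i \<odot> a \<oplus> b \<odot> X (i + 1)) \<odot> X i"
    using d(12)[of i] e by simp
  also have "\<dots> = Y i \<odot> (g i \<oplus> a \<odot> X i)"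
    using a b by (simp add: d pls_cmp cmp_pls cmp_assoc)
  finally have "Y i \<odot> f i = Y i \<odot> (g i \<oplus> a \<odot> X i)" .
  then obtain v where v: "v \<in> homset C (dm C (X i)) (dm C (Y (i - 1)))"
    "f i = (g i \<oplus> a \<odot> X i) \<oplus> Y (i - 1) \<odot> v"
    by (rule cov_exact_diff[OF ex Y, rotated 3]) (use a d in auto)
  have "cd C (Y (i - 1)) = dm C (Y i)" using d(7)[of "i - 1"] by simp
  then show ?thesis unfolding homotopic_at_def
    by (intro bexI[of _ v] bexI[of _ a]) (use v a d in \<open>auto simp: pls_ac\<close>)
qed

lemma homotopic_at_succ:
  assumes X: "int_complex C S' X" and Y: "int_complex C S Y" and f: "int_chain_map C X Y f" and g: "int_chain_map C X Y g"
    and ex: "contra_exact_at C S X (i + 1)" and h: "homotopic_at C X Y f g i"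
  shows "homotopic_at C X Y f g (i + 1)"
proof -
  interpret o: arrow_category "opp C" by (rule opp_arrow_category)
  note XO = int_complex_Ob[OF X] and YO = int_complex_Ob[OF Y]
  have "homotopic_at (opp C) (reflect 0 Y) (reflect 0 X) (reflect (0 + 1) f) (reflect (0 + 1) g) (- i)"
  proof (rule o.homotopic_at_pred[OF int_complex_opp[OF Y] int_complex_opp[OF X]])
    show "int_chain_map (opp C) (reflect 0 Y) (reflect 0 X) (reflect (0 + 1) f)"
      "int_chain_map (opp C) (reflect 0 Y) (reflect 0 X) (reflect (0 + 1) g)"
      by (rule int_chain_map_opp[OF XO YO f], rule int_chain_map_opp[OF XO YO g])
    show "cov_exact_at (opp C) S (reflect 0 X) (- i)" using ex by (simp add: cov_exact_opp add.commute)
    have "homotopic_at (opp C) (reflect 0 Y) (reflect 0 X) (reflect (0 + 1) f) (reflect (0 + 1) g) (0 + 1 - i)"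
      by (rule homotopic_at_opp[OF XO YO h])
    then show "homotopic_at (opp C) (reflect 0 Y) (reflect 0 X) (reflect (0 + 1) f) (reflect (0 + 1) g) (- i + 1)"
      by (simp add: add.commute)
  qed
  then have "homotopic_at (opp (opp C)) (reflect 0 (reflect 0 X)) (reflect 0 (reflect 0 Y))
    (reflect (0 + 1) (reflect (0 + 1) f)) (reflect (0 + 1) (reflect (0 + 1) g)) (0 + 1 - (- i))"
    by (rule o.homotopic_at_opp[OF int_complex_opp[OF YO] int_complex_opp[OF XO]])
  then show ?thesis by (simp add: add.commute)
qed

lemma homotopic_below:
  assumes "int_complex C S X" "int_complex C S' Y" "int_chain_map C X Y f" "int_chain_map C X Y g"
    and ex: "\<And>i. i < k \<Longrightarrow> cov_exact_at C S Y i" and h: "homotopic_at C X Y f g k" and i: "i \<le> k"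
  shows "homotopic_at C X Y f g i"
  using i
proof (induction rule: int_le_induct)
  case base then show ?case using h .
next
  case (step i)
  show ?case by (rule homotopic_at_pred[OF assms(1-4)]) (use step ex[of "i - 1"] in auto)
qed

lemma homotopic_above:
  assumes "int_complex C S' X" "int_complex C S Y" "int_chain_map C X Y f" "int_chain_map C X Y g"
    and ex: "\<And>i. i > k \<Longrightarrow> contra_exact_at C S X i" and h: "homotopic_at C X Y f g k" and i: "k \<le> i"
  shows "homotopic_at C X Y f g i"
  using i
proof (induction rule: int_ge_induct)
  case base then show ?case using h .
next
  case (step i)
  show ?case by (rule homotopic_at_succ[OF assms(1-4)]) (use step ex[of "i + 1"] in auto)
qed

lemma homotopic_at_refl:
  assumes X: "int_complex C S X" and Y: "int_complex C S' Y" and f: "int_chain_map C X Y f" and e: "f i = g i"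
  shows "homotopic_at C X Y f g i"
proof -
  note d = int_complexD[OF X] int_complexD[OF Y] int_chain_mapD[OF f]
  have c: "cd C (Y (i - 1)) = dm C (Y i)" using d(7)[of "i - 1"] by simp
  have "g i \<oplus> Y (i - 1) \<odot> zer C (dm C (X i)) (dm C (Y (i - 1))) \<oplus>
      zer C (dm C (X (i + 1))) (dm C (Y i)) \<odot> X i = f i"
    using d(9-)[of i, unfolded e] by (simp add: d(1-8) c e)
  then show ?thesis unfolding homotopic_at_def
    by (intro bexI[of _ "zer C (dm C (X i)) (dm C (Y (i - 1)))"]
        bexI[of _ "zer C (dm C (X (i + 1))) (dm C (Y i))"]) (auto simp: d c)
qed

text \<open>
  Let \<open>u\<close> be a cycle of \<open>Y\<close>. Then \<open>g u\<close> is a cycle of \<open>X\<close>, hence a boundary, so \<open>f g u\<close> is a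
  boundary; and \<open>u\<close> differs from \<open>f g u\<close> by a boundary since \<open>f g\<close> is homotopic to the identity.
\<close>

lemma cov_exact_transfer:
  assumes X: "int_complex C S1 X" and Y: "int_complex C S2 Y" and f: "int_chain_map C X Y f" and g: "int_chain_map C Y X g"
    and h: "homotopic_at C Y Y (id_map C Y) (\<lambda>i. f i \<odot> g i) i" and ex: "cov_exact_at C S X i"
  shows "cov_exact_at C S Y i"
  unfolding cov_exact_at_def
proof (intro ballI impI)
  note d = int_complexD[OF X] int_complexD[OF Y] int_chain_mapD[OF f] int_chain_mapD[OF g]
  fix T u assume T: "T \<in> S" and u: "u \<in> homset C T (dm C (Y i))"
    and z: "Y i \<odot> u = zer C T (cd C (Y i))"
  obtain a b where a: "a \<in> homset C (dm C (Y i)) (dm C (Y (i - 1)))"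
    and b: "b \<in> homset C (cd C (Y i)) (cd C (Y (i - 1)))"
    and e: "idt C (dm C (Y i)) = f i \<odot> g i \<oplus> Y (i - 1) \<odot> a \<oplus> b \<odot> Y i"
    using h unfolding homotopic_at_def id_map_def by blast
  have c: "cd C (Y (i - 1)) = dm C (Y i)" using d(7)[of "i - 1"] by simp
  have TO: "T \<in> Ob C" using u by auto
  have fg: "f i \<odot> X (i - 1) \<odot> w = Y (i - 1) \<odot> f (i - 1) \<odot> w" for w
    using int_chain_map_cmp[OF f, of i "i - 1"] by simp
  have "X i \<odot> g i \<odot> u = zer C T (dm C (X (i + 1)))"
    using int_chain_map_cmp[OF g refl, of i u] u z TO by (simp add: d)
  then obtain v where v: "v \<in> homset C T (dm C (X (i - 1)))" "g i \<odot> u = X (i - 1) \<odot> v"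
    by (rule cov_exactD[OF ex X, rotated 2]) (use u T d in auto)
  have "u = (f i \<odot> g i \<oplus> Y (i - 1) \<odot> a \<oplus> b \<odot> Y i) \<odot> u"
    using u e by (metis homset_iff idt_cmp)
  also have "\<dots> = Y (i - 1) \<odot> (f (i - 1) \<odot> v \<oplus> a \<odot> u)"
    using u v a b z TO c by (simp add: pls_cmp cmp_pls cmp_assoc fg d)
  finally show "\<exists>w\<in>homset C T (dm C (Y (i - 1))). u = Y (i - 1) \<odot> w"
    by (intro bexI[of _ "f (i - 1) \<odot> v \<oplus> a \<odot> u"]) (use u v a d in auto)
qed

lemma contra_exact_transfer:
  assumes X: "int_complex C S1 X" and Y: "int_complex C S2 Y" and f: "int_chain_map C X Y f" and g: "int_chain_map C Y X g"
    and h: "homotopic_at C Y Y (id_map C Y) (\<lambda>i. f i \<odot> g i) i" and ex: "contra_exact_at C S X i"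
  shows "contra_exact_at C S Y i"
proof -
  interpret o: arrow_category "opp C" by (rule opp_arrow_category)
  note XO = int_complex_Ob[OF X] and YO = int_complex_Ob[OF Y]
  have "cov_exact_at (opp C) S (reflect 0 Y) (1 - i)"
  proof (rule o.cov_exact_transfer[OF int_complex_opp[OF X] int_complex_opp[OF Y]])
    show "int_chain_map (opp C) (reflect 0 X) (reflect 0 Y) (reflect (0 + 1) g)"
      by (rule int_chain_map_opp[OF YO XO g])
    show "int_chain_map (opp C) (reflect 0 Y) (reflect 0 X) (reflect (0 + 1) f)"
      by (rule int_chain_map_opp[OF XO YO f])
    show "cov_exact_at (opp C) S (reflect 0 X) (1 - i)" using ex by (simp add: cov_exact_opp)
    have "homotopic_at (opp C) (reflect 0 Y) (reflect 0 Y) (reflect (0 + 1) (id_map C Y))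
        (reflect (0 + 1) (\<lambda>i. f i \<odot> g i)) (0 + 1 - i)"
      by (rule homotopic_at_opp[OF YO YO h])
    then show "homotopic_at (opp C) (reflect 0 Y) (reflect 0 Y) (id_map (opp C) (reflect 0 Y))
     (\<lambda>i. reflect (0 + 1) g i \<odot>\<^bsub>opp C\<^esub> reflect (0 + 1) f i) (1 - i)"
      by (simp add: id_map_opp[OF Y]) (simp add: reflect_def)
  qed
  then show ?thesis by (simp add: cov_exact_opp)
qed

text \<open>
  Since \<open>f g\<close> agrees with the identity in degree \<open>k\<close>, it is homotopic to the identity in all
  degrees: covariant exactness of \<open>Y\<close> carries the homotopy downwards, contravariant exactness
  upwards. The terms of \<open>Y\<close> are the only test objects that this requires, whence exactness of \<open>X\<close>
  for an arbitrary class \<open>S'\<close> passes to \<open>Y\<close>.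
\<close>

lemma n_exact_transfer:
  assumes X: "int_complex C S1 X" and Y: "int_complex C S Y" and f: "int_chain_map C X Y f" and g: "int_chain_map C Y X g"
    and ex: "n_exact_for C N S Y" and k: "0 \<le> k" "k \<le> N + 1" "f k \<odot> g k = idt C (dm C (Y k))"
    and nX: "n_exact_for C N S' X"
  shows "n_exact_for C N S' Y"
proof -
  have lk: "homotopic_at C Y Y (id_map C Y) (\<lambda>i. f i \<odot> g i) k"
    by (rule homotopic_at_refl[OF Y Y int_chain_map_id[OF Y]]) (use k in \<open>simp add: id_map_def\<close>)
  have below: "cov_exact_at C S Y i" if "i < k" for i using ex k(2) that by (simp add: n_exact_for_def)
  have above: "contra_exact_at C S Y i" if "k < i" for i using ex k(1) that by (simp add: n_exact_for_def)
  have l: "homotopic_at C Y Y (id_map C Y) (\<lambda>i. f i \<odot> g i) i" for i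
  proof (cases "i \<le> k")
    case True
    show ?thesis
      by (rule homotopic_below[OF Y Y int_chain_map_id[OF Y] int_chain_map_comp[OF g f] below lk True])
  next
    case False
    then have ki: "k \<le> i" by simp
    show ?thesis
      by (rule homotopic_above[OF Y Y int_chain_map_id[OF Y] int_chain_map_comp[OF g f] above lk ki])
  qed
  show ?thesis
    using nX cov_exact_transfer[OF X Y f g l] contra_exact_transfer[OF X Y f g l] unfolding n_exact_for_def by blast
qed

text \<open>
  The comparison argument: \<open>a\<close> composed with a differential of \<open>X\<close> is a cycle of \<open>Y\<close>, and
  exactness provides the next component.
\<close>

lemma chain_map_extends_below:
  assumes X: "int_complex C S X" and Y: "int_complex C S' Y"
    and ex: "\<And>i. i \<le> k \<Longrightarrow> cov_exact_at C S Y i"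
    and a: "a \<in> homset C (dm C (X k)) (dm C (Y k))"
    and b: "b \<in> homset C (dm C (X (k + 1))) (dm C (Y (k + 1)))"
    and e: "b \<odot> X k = Y k \<odot> a"
  shows "\<exists>f. f k = a \<and> f (k + 1) = b \<and> (\<forall>i\<le>k + 1. f i \<in> homset C (dm C (X i)) (dm C (Y i))) \<and>
    (\<forall>i\<le>k. f (i + 1) \<odot> X i = Y i \<odot> f i)"
proof -
  note d = int_complexD[OF X] int_complexD[OF Y]
  (* The recursion builds pairs of components in the degrees k - m and k - m + 1. Condition m = 0
     fixes the start; neighbouring pairs share a component. *)
  define P where "P m z \<longleftrightarrow> fst z \<in> homset C (dm C (X (k - int m))) (dm C (Y (k - int m))) \<and>
    snd z \<in> homset C (dm C (X (k - int m + 1))) (dm C (Y (k - int m + 1))) \<and>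
    snd z \<odot> X (k - int m) = Y (k - int m) \<odot> fst z \<and> (m = 0 \<longrightarrow> z = (a, b))" for m z
  have "\<exists>F. \<forall>m. P m (F m) \<and> snd (F (Suc m)) = fst (F m)"
  proof (rule dependent_nat_choice)
    show "\<exists>z. P 0 z" using a b e by (intro exI[of _ "(a, b)"]) (simp add: P_def)
    fix z m assume z: "P m z"
    define j where "j = k - int m"
    have z1: "fst z \<in> homset C (dm C (X j)) (dm C (Y j))" and
      z2: "snd z \<in> homset C (dm C (X (j + 1))) (dm C (Y (j + 1)))" and
      z3: "snd z \<odot> X j = Y j \<odot> fst z" and j: "j \<le> k"
      using z by (auto simp: P_def j_def)
    have c: "cd C (X (j - 1)) = dm C (X j)" using d(3)[of "j - 1"] by simp
    have eq: "Y j \<odot> fst z \<odot> X (j - 1) = zer C (dm C (X (j - 1))) (dm C (Y (j + 1)))"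
    proof -
      have "Y j \<odot> fst z \<odot> X (j - 1) = (snd z \<odot> X j) \<odot> X (j - 1)"
        by (simp only: z3 cmp_assoc)
      also have "\<dots> = snd z \<odot> zer C (dm C (X (j - 1))) (dm C (X (j + 1)))"
        using int_complex_sq[OF X, of j "j - 1"] by (simp add: cmp_assoc add.commute)
      finally show ?thesis using z2 by (simp add: d)
    qed
    obtain v where v: "v \<in> homset C (dm C (X (j - 1))) (dm C (Y (j - 1)))" "fst z \<odot> X (j - 1) = Y (j - 1) \<odot> v"
      by (rule cov_exactD[OF ex[OF j] Y _ _ eq]) (use z1 d c in auto)
    have jS: "k - int (Suc m) = j - 1" by (simp add: j_def)
    show "\<exists>y. P (Suc m) y \<and> snd y = fst z"
      unfolding P_def jS using v z1 by (intro exI[of _ "(v, fst z)"]) simp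
  qed
  then obtain F where F: "P m (F m)" "snd (F (Suc m)) = fst (F m)" for m by blast
  define f where "f i = (if i = k + 1 then b else fst (F (nat (k - i))))" for i
  have fF: "f i = fst (F (nat (k - i)))" "f (i + 1) = snd (F (nat (k - i)))" if "i \<le> k" for i
  proof -
    show "f i = fst (F (nat (k - i)))" using that by (simp add: f_def)
    show "f (i + 1) = snd (F (nat (k - i)))"
    proof (cases "i = k")
      case True then show ?thesis using F(1)[of 0] by (simp add: f_def P_def)
    next
      case False
      then have "nat (k - i) = Suc (nat (k - (i + 1)))" using that by simp
      then show ?thesis using F(2) False by (simp add: f_def)
    qed
  qed
  have ty: "f i \<in> homset C (dm C (X i)) (dm C (Y i)) \<and> f (i + 1) \<odot> X i = Y i \<odot> f i" if "i \<le> k" for i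
    using F(1)[of "nat (k - i)"] that unfolding P_def fF[OF that] by simp
  have "f i \<in> homset C (dm C (X i)) (dm C (Y i))" if "i \<le> k + 1" for i
    using ty[of i] that b by (cases "i = k + 1") (auto simp: f_def)
  moreover have "f k = a" using F(1)[of 0] by (simp add: f_def P_def)
  ultimately show ?thesis using ty by (intro exI[of _ f]) (auto simp: f_def)
qed

lemma chain_map_extends_above:
  assumes X: "int_complex C S' X" and Y: "int_complex C S Y"
    and ex: "\<And>i. i > k \<Longrightarrow> contra_exact_at C S X i"
    and a: "a \<in> homset C (dm C (X k)) (dm C (Y k))"
    and b: "b \<in> homset C (dm C (X (k + 1))) (dm C (Y (k + 1)))"
    and e: "b \<odot> X k = Y k \<odot> a"
  shows "\<exists>f. f k = a \<and> f (k + 1) = b \<and> (\<forall>i\<ge>k. f i \<in> homset C (dm C (X i)) (dm C (Y i))) \<and>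
    (\<forall>i\<ge>k. f (i + 1) \<odot> X i = Y i \<odot> f i)"
proof -
  interpret o: arrow_category "opp C" by (rule opp_arrow_category)
  note d = int_complexD[OF X] int_complexD[OF Y]
  have "\<exists>f. f (- k) = b \<and> f (- k + 1) = a \<and>
    (\<forall>i\<le>- k + 1. f i \<in> homset (opp C) (dm (opp C) (reflect 0 Y i)) (dm (opp C) (reflect 0 X i))) \<and>
    (\<forall>i\<le>- k. f (i + 1) \<odot>\<^bsub>opp C\<^esub> reflect 0 Y i = reflect 0 X i \<odot>\<^bsub>opp C\<^esub> f i)"
  proof (rule o.chain_map_extends_below[OF int_complex_opp[OF Y] int_complex_opp[OF X]])
    show "cov_exact_at (opp C) S (reflect 0 X) i" if "i \<le> - k" for i
      using ex[of "1 - i"] that by (simp add: cov_exact_opp)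
  qed (use a b e d in \<open>auto simp: reflect_def\<close>)
  then obtain f where f: "f (- k) = b" "f (- k + 1) = a"
    "\<And>i. i \<le> - k + 1 \<Longrightarrow> f i \<in> homset (opp C) (dm (opp C) (reflect 0 Y i)) (dm (opp C) (reflect 0 X i))"
    "\<And>i. i\<le>- k \<Longrightarrow> f (i + 1) \<odot>\<^bsub>opp C\<^esub> reflect 0 Y i = reflect 0 X i \<odot>\<^bsub>opp C\<^esub> f i"
    by blast
  define g where "g i = f (1 - i)" for i
  have t: "g i \<in> homset C (dm C (X i)) (dm C (Y i))" if "i \<ge> k" for i
    using f(3)[of "1 - i"] d(3)[of "i - 1"] d(7)[of "i - 1"] that by (auto simp: g_def reflect_def)
  have s: "g (i + 1) \<odot> X i = Y i \<odot> g i" if "i \<ge> k" for i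
    using f(4)[of "- i"] that by (auto simp: g_def reflect_def)
  show ?thesis
    by (rule exI[of _ g]) (use f t s in \<open>auto simp: g_def algebra_simps\<close>)
qed

lemma int_chain_map_extend:
  assumes X: "int_complex C S X" and Y: "int_complex C S Y"
    and ex: "\<And>i. i \<le> k \<Longrightarrow> cov_exact_at C S Y i" "\<And>i. i > k \<Longrightarrow> contra_exact_at C S X i"
    and a: "a \<in> homset C (dm C (X k)) (dm C (Y k))"
    and b: "b \<in> homset C (dm C (X (k + 1))) (dm C (Y (k + 1)))"
    and e: "b \<odot> X k = Y k \<odot> a"
  obtains f where "int_chain_map C X Y f" "f k = a" "f (k + 1) = b"
proof -
  obtain f where f: "f k = a" "f (k + 1) = b" "\<And>i. i\<le>k + 1 \<Longrightarrow> f i \<in> homset C (dm C (X i)) (dm C (Y i))"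
    "\<And>i. i\<le>k \<Longrightarrow> f (i + 1) \<odot> X i = Y i \<odot> f i"
    using chain_map_extends_below[OF X Y ex(1) a b e] by blast
  obtain g where g: "g k = a" "g (k + 1) = b" "\<And>i. i\<ge>k \<Longrightarrow> g i \<in> homset C (dm C (X i)) (dm C (Y i))"
    "\<And>i. i\<ge>k \<Longrightarrow> g (i + 1) \<odot> X i = Y i \<odot> g i"
    using chain_map_extends_above[OF X Y ex(2) a b e] by blast
  define h where "h i = (if i \<le> k then f i else g i)" for i
  have h1: "h i = f i" if "i \<le> k + 1" for i using that f g by (cases "i = k + 1") (auto simp: h_def)
  have h2: "h i = g i" if "i \<ge> k" for i using that f g by (cases "i = k") (auto simp: h_def)
  have "int_chain_map C X Y h" unfolding int_chain_map_def
  proof (intro allI conjI)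
    fix i
    show "h i \<in> homset C (dm C (X i)) (dm C (Y i))" 
      by (cases "i \<le> k") (use h1[of i] h2[of i] f g in auto)
    show "h (i + 1) \<odot> X i = Y i \<odot> h i"
      by (cases "i \<le> k") (use h1[of i] h2[of i] h1[of "i+1"] h2[of "i+1"] f g in auto)
  qed
  with h1 f show ?thesis by (intro that[of h]) auto
qed

text \<open>
  Where the target vanishes, the chain map is extended upwards by zero.
\<close>

lemma int_chain_map_extend_below:
  assumes X: "int_complex C S X" and Y: "int_complex C S' Y"
    and ex: "\<And>i. i \<le> k \<Longrightarrow> cov_exact_at C S Y i" and z: "\<And>i. i > k + 1 \<Longrightarrow> dm C (Y i) = zo C"
    and a: "a \<in> homset C (dm C (X k)) (dm C (Y k))"
    and b: "b \<in> homset C (dm C (X (k + 1))) (dm C (Y (k + 1)))"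
    and e: "b \<odot> X k = Y k \<odot> a"
  obtains f where "int_chain_map C X Y f" "f k = a" "f (k + 1) = b"
proof -
  note d = int_complexD[OF X] int_complexD[OF Y]
  obtain f where f: "f k = a" "f (k + 1) = b" "\<And>i. i\<le>k + 1 \<Longrightarrow> f i \<in> homset C (dm C (X i)) (dm C (Y i))"
    "\<And>i. i\<le>k \<Longrightarrow> f (i + 1) \<odot> X i = Y i \<odot> f i"
    using chain_map_extends_below[OF X Y ex a b e] by blast
  define h where "h i = (if i \<le> k + 1 then f i else zer C (dm C (X i)) (zo C))" for i
  have t: "h i \<in> homset C (dm C (X i)) (dm C (Y i))" for i
    using f z d by (auto simp: h_def)
  have "int_chain_map C X Y h" unfolding int_chain_map_def
  proof (intro allI conjI)
    fix i
    show "h i \<in> homset C (dm C (X i)) (dm C (Y i))" by (rule t)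
    show "h (i + 1) \<odot> X i = Y i \<odot> h i"
    proof (cases "i \<le> k")
      case True then show ?thesis using f by (auto simp: h_def)
    next
      case False
      then have "dm C (Y (i + 1)) = zo C" using z by simp
      then show ?thesis
        using t[of i] t[of "i + 1"] d into_zo[of "h (i + 1) \<odot> X i"] into_zo[of "Y i \<odot> h i"] by simp
    qed
  qed
  then show ?thesis using f by (intro that[of h]) (auto simp: h_def)
qed

end

section \<open>Base change along an arrow into the last term\<close>

text \<open>
  Brutal truncations. Since a complex has an arrow in every degree, the differential that is cut
  off becomes the zero arrow from or to \<open>zo\<close>.
\<close>

definition trunc_ge :: "('o, 'a) arrows \<Rightarrow> int \<Rightarrow> (int \<Rightarrow> 'a) \<Rightarrow> int \<Rightarrow> 'a" where
  "trunc_ge C k X i = (if k \<le> i then X i else zer C (zo C) (if i = k - 1 then dm C (X k) else zo C))"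

definition trunc_le :: "('o, 'a) arrows \<Rightarrow> int \<Rightarrow> (int \<Rightarrow> 'a) \<Rightarrow> int \<Rightarrow> 'a" where
  "trunc_le C k X i = (if i < k then X i else zer C (if i = k then dm C (X k) else zo C) (zo C))"

text \<open>
  Covariant exactness of the cone of \<open>h : P \<rightarrow> Y\<close> at its term \<open>P\<^bsub>i\<^esub> \<oplus> Y\<^bsub>i-1\<^esub>\<close>, in terms of
  components. Expressing the cycle condition by the equation \<open>h u = d v\<close> makes this independent
  of the signs in the differential of the cone and of the choice of the biproducts.
\<close>

definition pullback_exact_at ::
  "('o, 'a) arrows \<Rightarrow> 'o set \<Rightarrow> (int \<Rightarrow> 'a) \<Rightarrow> (int \<Rightarrow> 'a) \<Rightarrow> (int \<Rightarrow> 'a) \<Rightarrow> int \<Rightarrow> bool" where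
  "pullback_exact_at C S h P Y i \<longleftrightarrow> (\<forall>T\<in>S. \<forall>u\<in>homset C T (dm C (P i)). \<forall>v\<in>homset C T (dm C (Y (i - 1))).
     P i \<odot>\<^bsub>C\<^esub> u = zer C T (cd C (P i)) \<and> h i \<odot>\<^bsub>C\<^esub> u = Y (i - 1) \<odot>\<^bsub>C\<^esub> v \<longrightarrow>
     (\<exists>u'\<in>homset C T (dm C (P (i - 1))). \<exists>v'\<in>homset C T (dm C (Y (i - 2))).
        u = P (i - 1) \<odot>\<^bsub>C\<^esub> u' \<and> v = h (i - 1) \<odot>\<^bsub>C\<^esub> u' \<oplus>\<^bsub>C\<^esub> Y (i - 2) \<odot>\<^bsub>C\<^esub> v'))"

text \<open>
  The pairs of consecutive degrees are cyclic; the second alternative is the pair \<open>(N + 1, 0)\<close>.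
\<close>

definition weak_iso_map :: "('o, 'a) arrows \<Rightarrow> int \<Rightarrow> (int \<Rightarrow> 'a) \<Rightarrow> (int \<Rightarrow> 'a) \<Rightarrow> (int \<Rightarrow> 'a) \<Rightarrow> bool" where
  "weak_iso_map C N X Y f \<longleftrightarrow> int_chain_map C X Y f \<and>
     ((\<exists>k. 0 \<le> k \<and> k \<le> N \<and> iso_arr C (f k) \<and> iso_arr C (f (k + 1))) \<or>
      iso_arr C (f 0) \<and> iso_arr C (f (N + 1)))"

definition weak_iso_class :: "('o, 'a) arrows \<Rightarrow> int \<Rightarrow> 'o set \<Rightarrow> (int \<Rightarrow> 'a) set \<Rightarrow> bool" where
  "weak_iso_class C N S XX \<longleftrightarrow> (\<forall>X Y f. n_exact_complex C N S X \<longrightarrow> n_exact_complex C N S Y \<longrightarrow> weak_iso_map C N X Y f \<longrightarrow>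
     (X \<in> XX \<longleftrightarrow> Y \<in> XX))"

text \<open>
  The \<open>n\<close>-pullback diagram ends in the truncation \<open>X\<^sub>1 \<rightarrow> \<dots> \<rightarrow> X\<^bsub>N+1\<^esub>\<close>, whose degrees are kept. The
  sequence \<open>Q\<close> witnesses that the last differential of \<open>P\<close> is an admissible epimorphism.
\<close>

definition has_pullbacks :: "('o, 'a) arrows \<Rightarrow> int \<Rightarrow> 'o set \<Rightarrow> (int \<Rightarrow> 'a) set \<Rightarrow> bool" where
  "has_pullbacks C N S XX \<longleftrightarrow> (\<forall>X\<in>XX. \<forall>t. arr C t \<and> dm C t \<in> S \<and> cd C t = dm C (X (N + 1)) \<longrightarrow>
     (\<exists>P h. int_complex C S P \<and> bounded_in C 1 (N + 1) P \<and> int_chain_map C P (trunc_ge C 1 X) h \<and> h (N + 1) = t \<and>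
        (\<forall>i\<le>N + 1. pullback_exact_at C S h P (trunc_ge C 1 X) i) \<and> (\<exists>Q\<in>XX. Q N = P N)))"

text \<open>
  A reformulation of the pullback axiom in which \<open>P\<close> is a member of the class starting at \<open>X\<^sub>0\<close>,
  and no cone occurs. This makes it easy to pass to a subcategory.
\<close>

definition has_base_changes :: "('o, 'a) arrows \<Rightarrow> int \<Rightarrow> 'o set \<Rightarrow> (int \<Rightarrow> 'a) set \<Rightarrow> bool" where
  "has_base_changes C N S XX \<longleftrightarrow> (\<forall>X\<in>XX. \<forall>t. arr C t \<and> dm C t \<in> S \<and> cd C t = dm C (X (N + 1)) \<longrightarrow>
     (\<exists>P\<in>XX. \<exists>h. int_chain_map C P X h \<and> h 0 = idt C (dm C (X 0)) \<and> h (N + 1) = t))"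

lemma base_changeE:
  assumes "has_base_changes C N S XX" "X \<in> XX" "t \<in> homset C T (dm C (X (N + 1)))" "T \<in> S"
  obtains P h where "P \<in> XX" "int_chain_map C P X h" "h 0 = idt C (dm C (X 0))" "h (N + 1) = t"
  using assms unfolding has_base_changes_def by fastforce

context arrow_category
begin

lemma to_zo: "\<lbrakk>f \<in> homset C T A; A = zo C\<rbrakk> \<Longrightarrow> f = zer C T (zo C)"
  using into_zo[of f] by simp

lemma of_zo: "\<lbrakk>f \<in> homset C A T; A = zo C\<rbrakk> \<Longrightarrow> f = zer C (zo C) T"
  using from_zo[of f] by simp

lemma cmp_through_zo:
  "\<lbrakk>f \<in> homset C A B; B = zo C; g \<in> homset C B T\<rbrakk> \<Longrightarrow> g \<odot> f = zer C A T"
  using to_zo[of f A B] by auto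

lemma trunc_ge_opp:
  assumes "int_complex C S X"
  shows "reflect n (trunc_ge C k X) = trunc_le (opp C) (n + 1 - k) (reflect n X)"
  using int_complexD(3)[OF assms, of "k - 1"] by (auto simp: reflect_def trunc_ge_def trunc_le_def)

lemma trunc_ge_dm:
  assumes "int_complex C S X"
  shows "dm C (trunc_ge C k X i) = (if k \<le> i then dm C (X i) else zo C)"
  using int_complexD[OF assms] by (auto simp: trunc_ge_def)

lemma int_complex_trunc_ge:
  assumes X: "int_complex C S X" and z: "zo C \<in> S"
  shows "int_complex C S (trunc_ge C k X)"
proof -
  note d = int_complexD[OF X]
  note td = trunc_ge_dm[OF X]
  have a: "arr C (trunc_ge C k X i)" for i using d by (auto simp: trunc_ge_def)
  have c: "cd C (trunc_ge C k X i) = dm C (trunc_ge C k X (i + 1))" for i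
    using d by (cases "i = k - 1") (auto simp: td, auto simp: trunc_ge_def)
  have s: "trunc_ge C k X (i + 1) \<odot> trunc_ge C k X i = zer C (dm C (trunc_ge C k X i)) (dm C (trunc_ge C k X (i + 2)))" for i
  proof (cases "k \<le> i")
    case True then show ?thesis using d by (auto simp: trunc_ge_def)
  next
    case False
    have c2: "cd C (trunc_ge C k X (i + 1)) = dm C (trunc_ge C k X (i + 2))"
      using c[of "i + 1"] by (simp add: add.commute)
    have "dm C (trunc_ge C k X i) = zo C" using False td by simp
    then show ?thesis
      using of_zo[of "trunc_ge C k X (i + 1) \<odot> trunc_ge C k X i" _ _] a c c2 by simp
  qed
  show ?thesis unfolding int_complex_def using a c s td d z by auto
qed

text \<open>
  Let \<open>f : X \<rightarrow> Y\<close> be a split monomorphism in degree \<open>0\<close> and let \<open>t : T \<rightarrow> X\<^bsub>N+1\<^esub>\<close> become liftable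
  to \<open>Y\<^bsub>N\<^esub>\<close> after composition with \<open>f\<close>. Then \<open>t\<close> lifts to \<open>X\<^bsub>N\<^esub>\<close>. The base change \<open>p : P \<rightarrow> X\<close>
  along \<open>t\<close> shows this: the lift makes \<open>f p\<close> homotopic to zero in degree \<open>N + 1\<close>, hence in degree
  \<open>0\<close>, where \<open>f p\<close> is a split monomorphism. So the first differential of \<open>P\<close> splits, the identity
  of \<open>P\<close> is homotopic to zero, first in degree \<open>0\<close> and then in degree \<open>N + 1\<close>, and the section of
  the last differential of \<open>P\<close> gives the lift of \<open>t\<close>.
\<close>

lemma lift_along_last:
  assumes N: "1 \<le> N" and X: "int_complex C S X" and Y: "int_complex C S Y" and f: "int_chain_map C X Y f"
    and r: "r \<in> homset C (dm C (Y 0)) (dm C (X 0))" "r \<odot> f 0 = idt C (dm C (X 0))"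
    and exY: "\<And>i. i \<le> N \<Longrightarrow> cov_exact_at C S Y i" and bY: "dm C (Y (- 1)) = zo C"
    and P: "n_exact_complex C N S P" and p: "int_chain_map C P X p" and p0: "p 0 = idt C (dm C (X 0))"
    and pN: "p (N + 1) = t" and u: "u \<in> homset C (dm C t) (dm C (Y N))" "f (N + 1) \<odot> t = Y N \<odot> u"
  shows "\<exists>v\<in>homset C (dm C t) (dm C (X N)). t = X N \<odot> v"
proof -
  have PC: "int_complex C S P" and bP: "dm C (P (N + 2)) = zo C" "dm C (P (-1)) = zo C" and
    exP: "\<And>i. i \<ge> 1 \<Longrightarrow> contra_exact_at C S P i"
    using P by (auto simp: n_exact_complex_def n_exact_for_def bounded_in_def)
  note d = int_complexD[OF X] int_complexD[OF Y] int_complexD[OF PC] int_chain_mapD[OF f] int_chain_mapD[OF p]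
  have P0: "dm C (P 0) = dm C (X 0)" using d(18)[of 0] p0 d by simp
  have PN: "dm C (P (N + 1)) = dm C t" using d(18)[of "N + 1"] pN by simp
  have tc: "arr C t" "cd C t = dm C (X (N + 1))" using d(17,19)[of "N + 1"] pN by auto
  have cm1: "cd C (Y (- 1)) = dm C (Y 0)" "cd C (P (- 1)) = dm C (P 0)" using d(7)[of "-1"] d(11)[of "-1"] by auto
  have z: "int_chain_map C P Z (\<lambda>i. zer C (dm C (P i)) (dm C (Z i)))" if "int_complex C S Z" for Z
    using int_complexD[OF that] d by (auto simp: int_chain_map_def)
  note g = int_chain_map_comp[OF p f]
  have "homotopic_at C P Y (\<lambda>i. f i \<odot> p i) (\<lambda>i. zer C (dm C (P i)) (dm C (Y i))) (N + 1)"
    unfolding homotopic_at_def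
    by (rule bexI[of _ u], rule bexI[of _ "zer C (cd C (P (N + 1))) (cd C (Y N))"])
      (use u pN tc in \<open>auto simp: d PN\<close>)
  then have "homotopic_at C P Y (\<lambda>i. f i \<odot> p i) (\<lambda>i. zer C (dm C (P i)) (dm C (Y i))) 0"
    by (rule homotopic_below[OF PC Y g z[OF Y], rotated]) (use exY N in auto)
  then obtain a b where a: "a \<in> homset C (dm C (P 0)) (zo C)" and b: "b \<in> homset C (dm C (P 1)) (dm C (Y 0))"
    and e: "f 0 \<odot> p 0 = zer C (dm C (P 0)) (dm C (Y 0)) \<oplus> Y (- 1) \<odot> a \<oplus> b \<odot> P 0"
    unfolding homotopic_at_def using bY cm1 d(11)[of 0] by auto
  have "a = zer C (dm C (P 0)) (zo C)" using to_zo[of a] a by simp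
  then have "f 0 = b \<odot> P 0" using e a b p0 P0 bY cm1 by (simp add: d)
  (* The first differential of P is a split monomorphism. *)
  then have rb: "(r \<odot> b) \<odot> P 0 = idt C (dm C (P 0))" using r P0 by (simp add: cmp_assoc)
  have "homotopic_at C P P (id_map C P) (\<lambda>i. zer C (dm C (P i)) (dm C (P i))) 0"
    unfolding homotopic_at_def
    by (rule bexI[of _ "zer C (dm C (P 0)) (dm C (P (- 1)))"], rule bexI[of _ "r \<odot> b"])
      (use r b rb P0 cm1 bP in \<open>auto simp: d id_map_def\<close>)
  then have "homotopic_at C P P (id_map C P) (\<lambda>i. zer C (dm C (P i)) (dm C (P i))) (N + 1)"
    by (rule homotopic_above[OF PC PC int_chain_map_id[OF PC] z[OF PC], rotated]) (use exP N in auto)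
  then obtain a' b' where a': "a' \<in> homset C (dm C (P (N + 1))) (dm C (P N))"
    and b': "b' \<in> homset C (cd C (P (N + 1))) (dm C (P (N + 1)))"
    and e': "idt C (dm C (P (N + 1))) = zer C (dm C (P (N + 1))) (dm C (P (N + 1))) \<oplus> P N \<odot> a' \<oplus> b' \<odot> P (N + 1)"
    unfolding homotopic_at_def id_map_def using d(11)[of N] by auto
  have cN: "cd C (P (N + 1)) = zo C" using bP d(11)[of "N + 1"] by (simp add: add.commute)
  have "b' \<odot> P (N + 1) = zer C (dm C (P (N + 1))) (dm C (P (N + 1)))"
    by (rule cmp_through_zo[OF _ cN b']) (simp add: d(9))
  (* The last differential of P is a split epimorphism, with section a'. *)
  then have "idt C (dm C t) = P N \<odot> a'" using e' a' d PN by auto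
  then have "t = p (N + 1) \<odot> P N \<odot> a'" using pN tc by (metis cmp_idt)
  also have "\<dots> = X N \<odot> p N \<odot> a'" by (rule int_chain_map_cmp[OF p refl])
  finally have tt: "t = X N \<odot> p N \<odot> a'" .
  have "p N \<odot> a' \<in> homset C (dm C t) (dm C (X N))" using a' PN by (simp add: d)
  with tt show ?thesis by blast
qed

text \<open>
  Let \<open>(u, v)\<close> be a cycle of the cone in degree \<open>i\<close>. Exactness of \<open>P\<close>, or for \<open>i = N + 1\<close> the
  assumption \<open>lift\<close>, gives \<open>u = P (i - 1) \<odot> w\<close>, and then exactness of \<open>X\<close> gives \<open>v = h (i - 1) \<odot>
  w \<oplus> X (i - 2) \<odot> w'\<close>. Only low degrees feel the truncation, and there \<open>h 0 = 1\<close> compensates for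
  the missing term.
\<close>

lemma cone_base_change:
  assumes N: "1 \<le> N" and zS: "zo C \<in> S" and X: "n_exact_complex C N S X" and P: "n_exact_complex C N S P"
    and h: "int_chain_map C P X h" and h0: "h 0 = idt C (dm C (X 0))"
    and lift: "\<And>T u v. \<lbrakk>T \<in> S; u \<in> homset C T (dm C (P (N + 1))); v \<in> homset C T (dm C (X N));
      h (N + 1) \<odot> u = X N \<odot> v\<rbrakk> \<Longrightarrow> \<exists>w\<in>homset C T (dm C (P N)). u = P N \<odot> w"
    and i: "i \<le> N + 1"
  shows "pullback_exact_at C S (\<lambda>i. if 1 \<le> i then h i else zer C (zo C) (zo C)) (trunc_ge C 1 P) (trunc_ge C 1 X) i"
proof -
  have XC: "int_complex C S X" and PC: "int_complex C S P" and bX: "dm C (X (-1)) = zo C" and bP: "dm C (P (-1)) = zo C"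
    and ex: "\<And>i. i \<le> N \<Longrightarrow> cov_exact_at C S X i" "\<And>i. i \<le> N \<Longrightarrow> cov_exact_at C S P i"
    using X P by (auto simp: n_exact_complex_def bounded_in_def n_exact_for_def)
  note d = int_complexD[OF XC] int_complexD[OF PC] int_chain_mapD[OF h]
  note td = trunc_ge_dm[OF XC] trunc_ge_dm[OF PC]
  have tP: "arr C (trunc_ge C 1 P j)" "cd C (trunc_ge C 1 P j) = dm C (trunc_ge C 1 P (j + 1))" for j
    using int_complexD[OF int_complex_trunc_ge[OF PC zS]] by auto
  have tX: "arr C (trunc_ge C 1 X j)" "cd C (trunc_ge C 1 X j) = dm C (trunc_ge C 1 X (j + 1))" for j
    using int_complexD[OF int_complex_trunc_ge[OF XC zS]] by auto
  show ?thesis unfolding pullback_exact_at_def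
  proof (intro ballI impI, elim conjE)
    fix T u v assume T: "T \<in> S" and u: "u \<in> homset C T (dm C (trunc_ge C 1 P i))"
      and v: "v \<in> homset C T (dm C (trunc_ge C 1 X (i - 1)))"
      and e1: "trunc_ge C 1 P i \<odot> u = zer C T (cd C (trunc_ge C 1 P i))"
      and e2: "(if 1 \<le> i then h i else zer C (zo C) (zo C)) \<odot> u = trunc_ge C 1 X (i - 1) \<odot> v"
    have TO: "T \<in> Ob C" using u by auto
    have c: "cd C (X (j - 1)) = dm C (X j)" "cd C (P (j - 1)) = dm C (P j)" for j
      using d(3)[of "j - 1"] d(7)[of "j - 1"] by simp_all
    have XP: "\<exists>w\<in>homset C T (dm C (P (i - 1))). u = P (i - 1) \<odot> w" if i1: "1 \<le> i" and
      v': "v' \<in> homset C T (dm C (X (i - 1)))" "h i \<odot> u = X (i - 1) \<odot> v'" for v'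
    proof (cases "i = N + 1")
      case True
      then show ?thesis using lift[OF T, of u v'] u v' i1 by (simp add: td)
    next
      case False
      then have iN: "i \<le> N" using i by simp
      have uP: "u \<in> homset C T (dm C (P i))" "P i \<odot> u = zer C T (dm C (P (i + 1)))" using u e1 i1 by (auto simp: td trunc_ge_def d)
      then show ?thesis by (metis cov_exactD[OF ex(2)[OF iN] PC _ T])
    qed
    consider (low) "i < 1" | (one) "i = 1" | (mid) "2 \<le> i" by linarith
    then show "\<exists>u'\<in>homset C T (dm C (trunc_ge C 1 P (i - 1))). \<exists>v'\<in>homset C T (dm C (trunc_ge C 1 X (i - 2))).
        u = trunc_ge C 1 P (i - 1) \<odot> u' \<and>
        v = (if 1 \<le> i - 1 then h (i - 1) else zer C (zo C) (zo C)) \<odot> u' \<oplus> trunc_ge C 1 X (i - 2) \<odot> v'"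
    proof cases
      case low
      then have "u = zer C T (zo C)" "v = zer C T (zo C)" using u v to_zo[of u] to_zo[of v] by (auto simp: td)
      then show ?thesis using low TO
        by (intro bexI[of _ "zer C T (zo C)"]) (auto simp: td trunc_ge_def)
    next
      case one
      (* u = P 0 w is to vanish. As h 0 = 1, X 0 w = h 1 u = 0, and X 0 is a monomorphism. *)
      have v0: "v = zer C T (zo C)" using v to_zo[of v] one by (auto simp: td)
      have hu: "h 1 \<odot> u = zer C T (dm C (X 1))" using e2 one v0 v TO by (auto simp: trunc_ge_def d)
      obtain w where w: "w \<in> homset C T (dm C (P 0))" "u = P 0 \<odot> w"
        using XP[of "zer C T (dm C (X 0))"] one hu TO d c[of 1] by auto
      have "X 0 \<odot> w = X 0 \<odot> h 0 \<odot> w" using w h0 d(10)[of 0] d(11)[of 0] by (simp add: d)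
      also have "\<dots> = zer C T (dm C (X 1))" using int_chain_map_cmp[OF h, of 1 0 w] hu w by simp
      also have "\<dots> = X 0 \<odot> zer C T (dm C (X 0))" using TO by (simp add: d)
      finally obtain w' where w': "w' \<in> homset C T (dm C (X (0 - 1)))" "w = zer C T (dm C (X 0)) \<oplus> X (0 - 1) \<odot> w'"
        by (rule cov_exact_diff[OF ex(1) XC, rotated 4]) (use w N T TO h0 d(10)[of 0] in \<open>auto simp: d\<close>)
      have "w' = zer C T (zo C)" using to_zo[of w'] w' bX by simp
      then have "w = zer C T (dm C (P 0))" using w' TO c[of 0] bX d(10)[of 0] h0 by (simp add: d)
      then have "u = zer C T (dm C (P 1))" using w TO by (simp add: d)
      then show ?thesis using one TO v0
        by (intro bexI[of _ "zer C T (zo C)"]) (auto simp: td trunc_ge_def d)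
    next
      case mid
      have v1: "v \<in> homset C T (dm C (X (i - 1)))" "h i \<odot> u = X (i - 1) \<odot> v"
        using v e2 mid by (auto simp: td trunc_ge_def)
      obtain w where w: "w \<in> homset C T (dm C (P (i - 1)))" "u = P (i - 1) \<odot> w"
        using XP[OF _ v1] mid by auto
      have "X (i - 1) \<odot> v = X (i - 1) \<odot> h (i - 1) \<odot> w"
        using int_chain_map_cmp[OF h, of i "i - 1" w] w v1 by simp
      then obtain w' where w': "w' \<in> homset C T (dm C (X (i - 1 - 1)))" "v = h (i - 1) \<odot> w \<oplus> X (i - 1 - 1) \<odot> w'"
        by (rule cov_exact_diff[OF ex(1) XC, rotated 4]) (use v1 w T i d in auto)
      show ?thesis
      proof (cases "i = 2")
        case False
        then show ?thesis using mid w w'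
          by (intro bexI[of _ w] bexI[of _ w']) (auto simp: td trunc_ge_def)
      next
        case True
        (* The boundary X 0 w' comes from a term that is cut off. Since X 0 = h 1 P 0, adding P 0 w' to w
           absorbs it, without changing P 1 w. *)
        have P0: "dm C (P 0) = dm C (X 0)" using d(10)[of 0] h0 by (simp add: d)
        have w'0: "w' \<in> homset C T (dm C (P 0))" using w' True P0 by simp
        have e3: "h 1 \<odot> P 0 \<odot> w' = X 0 \<odot> w'"
          using int_chain_map_cmp[OF h, of 1 0 w'] h0 w'0 P0 by simp
        have e4: "P 1 \<odot> P 0 \<odot> w' = zer C T (dm C (P 2))"
          using int_complex_sq_cmp[OF PC, of 1 0 w'] w'0 by simp
        have w1: "w \<in> homset C T (dm C (P 1))" "u = P 1 \<odot> w" "v = h 1 \<odot> w \<oplus> X 0 \<odot> w'" using w w' True by auto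
        have cc: "cd C (P 0) = dm C (P 1)" "cd C (P 1) = dm C (P 2)" "cd C (h 1) = dm C (X 1)" "dm C (h 1) = dm C (P 1)"
          using c(2)[of 1] c(2)[of 2] d by auto
        show ?thesis unfolding True
        proof (rule bexI[of _ "w \<oplus> P 0 \<odot> w'"], rule bexI[of _ "zer C T (zo C)"], intro conjI)
          show "u = trunc_ge C 1 P (2 - 1) \<odot> (w \<oplus> P 0 \<odot> w')"
            using w1 w'0 e4 TO cc by (simp add: trunc_ge_def cmp_pls d)
          show "v = (if 1 \<le> (2::int) - 1 then h (2 - 1) else zer C (zo C) (zo C)) \<odot> (w \<oplus> P 0 \<odot> w') \<oplus>
              trunc_ge C 1 X (2 - 2) \<odot> zer C T (zo C)"
            using w1 w'0 e3 TO cc P0 d(1,9) by (simp add: trunc_ge_def cmp_pls d(2-8))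
        qed (use w1 w'0 cc TO d in \<open>auto simp: td\<close>)
      qed
    qed
  qed
qed

text \<open>
  The base change \<open>P\<close>, truncated, is an \<open>n\<close>-pullback. The assumption \<open>lift\<close> of \<open>cone_base_change\<close>
  is the case \<open>r = 1\<close> of \<open>lift_along_last\<close>, applied to \<open>P \<rightarrow> X\<close> and the base change of \<open>P\<close> along
  \<open>u\<close>.
\<close>

lemma has_pullbacks_if_has_base_changes:
  assumes N: "1 \<le> N" and zS: "zo C \<in> S" and nX: "\<And>X. X \<in> XX \<Longrightarrow> n_exact_complex C N S X" and bc: "has_base_changes C N S XX"
  shows "has_pullbacks C N S XX"
  unfolding has_pullbacks_def
proof (intro ballI allI impI, elim conjE)
  fix X t assume X: "X \<in> XX" and t: "arr C t" "dm C t \<in> S" "cd C t = dm C (X (N + 1))"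
  obtain P h where P: "P \<in> XX" "int_chain_map C P X h" "h 0 = idt C (dm C (X 0))" "h (N + 1) = t"
    using base_changeE[OF bc X, of t "dm C t"] t by auto
  have XC: "int_complex C S X" and PC: "int_complex C S P" and bX: "dm C (X (-1)) = zo C" and bP: "bounded_in C 0 (N + 1) P"
    and ex: "\<And>i. i \<le> N \<Longrightarrow> cov_exact_at C S X i"
    using nX[OF X] nX[OF P(1)] by (auto simp: n_exact_complex_def bounded_in_def n_exact_for_def)
  note d = int_complexD[OF XC] int_complexD[OF PC] int_chain_mapD[OF P(2)]
  define h' where "h' i = (if 1 \<le> i then h i else zer C (zo C) (zo C))" for i :: int
  have h': "int_chain_map C (trunc_ge C 1 P) (trunc_ge C 1 X) h'"
    unfolding int_chain_map_def
  proof (intro allI conjI)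
    fix i
    show t: "h' i \<in> homset C (dm C (trunc_ge C 1 P i)) (dm C (trunc_ge C 1 X i))"
      using d by (auto simp: h'_def trunc_ge_dm[OF XC] trunc_ge_dm[OF PC])
    show "h' (i + 1) \<odot> trunc_ge C 1 P i = trunc_ge C 1 X i \<odot> h' i"
      using d by (auto simp: h'_def trunc_ge_def)
  qed
  have lift: "\<exists>w\<in>homset C T (dm C (P N)). u = P N \<odot> w"
    if T: "T \<in> S" and u: "u \<in> homset C T (dm C (P (N + 1)))" and v: "v \<in> homset C T (dm C (X N))"
      "h (N + 1) \<odot> u = X N \<odot> v" for T u v
  proof -
    obtain R p where R: "R \<in> XX" "int_chain_map C R P p" "p 0 = idt C (dm C (P 0))" "p (N + 1) = u"
      by (rule base_changeE[OF bc P(1) u T])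
    have "dm C (P 0) = dm C (X 0)" using d(10)[of 0] P(3) by (simp add: d)
    then have "\<exists>v\<in>homset C (dm C u) (dm C (P N)). u = P N \<odot> v"
      using u v P(3)
      by (intro lift_along_last[where r = "idt C (dm C (P 0))", OF N PC XC P(2) _ _ ex bX nX[OF R(1)] R(2-4)])
        (auto simp: d)
    then show ?thesis using u by auto
  qed
  have bt: "bounded_in C 1 (N + 1) (trunc_ge C 1 P)"
    using bP by (auto simp: bounded_in_def trunc_ge_dm[OF PC])
  show "\<exists>P h. int_complex C S P \<and> bounded_in C 1 (N + 1) P \<and> int_chain_map C P (trunc_ge C 1 X) h \<and> h (N + 1) = t \<and>
        (\<forall>i\<le>N + 1. pullback_exact_at C S h P (trunc_ge C 1 X) i) \<and> (\<exists>Q\<in>XX. Q N = P N)"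
    using h' bt P int_complex_trunc_ge[OF PC zS] cone_base_change[OF N zS nX[OF X] nX[OF P(1)] P(2,3) lift, folded h'_def] N
    by (intro exI[of _ "trunc_ge C 1 P"] exI[of _ h'] conjI)
      (auto simp: h'_def[of "N + 1"] trunc_ge_def[of _ _ _ N])
qed

text \<open>
  The \<open>n\<close>-pullback \<open>P\<close> is completed on the left by an arrow \<open>\<delta> : X\<^sub>0 \<rightarrow> P\<^sub>1\<close> to a sequence \<open>R\<close>
  mapping to \<open>X\<close>. It inherits covariant exactness from \<open>X\<close> and the cone. Moreover \<open>R\<close> has the
  same last differential as a member \<open>Q\<close> of the class, hence is homotopy equivalent to \<open>Q\<close>; this
  yields contravariant exactness, and \<open>R\<close> is in the class because it is weakly isomorphic to \<open>Q\<close>.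
\<close>

lemma has_base_changes_if_has_pullbacks:
  assumes N: "1 \<le> N" and SO: "S \<subseteq> Ob C" and nX: "\<And>X. X \<in> XX \<Longrightarrow> n_exact_complex C N S X"
    and wk: "weak_iso_class C N S XX" and pull: "has_pullbacks C N S XX"
  shows "has_base_changes C N S XX"
  unfolding has_base_changes_def
proof (intro ballI allI impI, elim conjE)
  fix X t assume X: "X \<in> XX" and t: "arr C t" "dm C t \<in> S" "cd C t = dm C (X (N + 1))"
  obtain P h Q where PC: "int_complex C S P" and bP: "bounded_in C 1 (N + 1) P" and h: "int_chain_map C P (trunc_ge C 1 X) h" and
    hN: "h (N + 1) = t" and cone: "\<And>i. i \<le> N + 1 \<Longrightarrow> pullback_exact_at C S h P (trunc_ge C 1 X) i" and
    Q: "Q \<in> XX" "Q N = P N"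
    using pull X t unfolding has_pullbacks_def by blast
  have XC: "int_complex C S X" and QC: "int_complex C S Q" and bX: "\<And>i. i < 0 \<Longrightarrow> dm C (X i) = zo C" and
    bQ: "\<And>i. i > N + 1 \<Longrightarrow> dm C (Q i) = zo C" and
    ex: "\<And>i. i \<le> N \<Longrightarrow> cov_exact_at C S X i" "\<And>i. i \<le> N \<Longrightarrow> cov_exact_at C S Q i" "\<And>i. i \<ge> 1 \<Longrightarrow> contra_exact_at C S Q i"
    using nX[OF X] nX[OF Q(1)] by (auto simp: n_exact_complex_def bounded_in_def n_exact_for_def)
  have zS: "zo C \<in> S" using bX[of "-1"] int_complexD(2)[OF XC, of "-1"] by simp
  note d = int_complexD[OF XC] int_complexD[OF PC] int_chain_mapD[OF h]
  note tX = int_complexD[OF int_complex_trunc_ge[OF XC zS, of 1]]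
  note td = trunc_ge_dm[OF XC]
  have hd: "dm C (h i) = dm C (P i)" "arr C (h i)" "cd C (h i) = (if 1 \<le> i then dm C (X i) else zo C)" for i
    using d td by auto
  have bP': "dm C (P i) = zo C" if "i \<le> 0 \<or> i > N + 1" for i using bP that by (auto simp: bounded_in_def)
  have cX: "cd C (X 0) = dm C (X 1)" "cd C (X (-1)) = dm C (X 0)" using d(3)[of 0] d(3)[of "-1"] by auto
  have cP: "cd C (P 0) = dm C (P 1)" "cd C (P 1) = dm C (P 2)" using d(7)[of 0] d(7)[of 1] by auto
  have cover: "\<exists>u'\<in>homset C T (dm C (P (i - 1))). \<exists>v'\<in>homset C T (dm C (trunc_ge C 1 X (i - 2))).
      u = P (i - 1) \<odot> u' \<and> v = h (i - 1) \<odot> u' \<oplus> trunc_ge C 1 X (i - 2) \<odot> v'"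
    if "i \<le> N + 1" "T \<in> S" "u \<in> homset C T (dm C (P i))" "v \<in> homset C T (dm C (trunc_ge C 1 X (i - 1)))"
      "P i \<odot> u = zer C T (dm C (P (i + 1)))" "h i \<odot> u = trunc_ge C 1 X (i - 1) \<odot> v" for i T u v
    using cone[OF that(1)] that(2-) unfolding pullback_exact_at_def d(7) by blast
  (* The pair (0, X 0) is a cycle of the cone in degree 2; that it is a boundary amounts to the
     existence of \<delta> with P 1 \<delta> = 0 and h 1 \<delta> = X 0. *)
  have "\<exists>u'\<in>homset C (dm C (X 0)) (dm C (P (2 - 1))). \<exists>v'\<in>homset C (dm C (X 0)) (dm C (trunc_ge C 1 X (2 - 2))).
      zer C (dm C (X 0)) (dm C (P 2)) = P (2 - 1) \<odot> u' \<and> X 0 = h (2 - 1) \<odot> u' \<oplus> trunc_ge C 1 X (2 - 2) \<odot> v'"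
    using N int_complex_sq[OF XC, of 1 0]
    by (intro cover) (auto simp: d(1-8) hd td cX trunc_ge_def)
  then obtain \<delta> v' where \<delta>: "\<delta> \<in> homset C (dm C (X 0)) (dm C (P 1))" "P 1 \<odot> \<delta> = zer C (dm C (X 0)) (dm C (P 2))"
    and v': "v' \<in> homset C (dm C (X 0)) (zo C)" "X 0 = h 1 \<odot> \<delta> \<oplus> trunc_ge C 1 X 0 \<odot> v'"
    by (auto simp: td)
  have h\<delta>: "h 1 \<odot> \<delta> = X 0"
  proof -
    have "trunc_ge C 1 X 0 \<odot> v' = zer C (dm C (X 0)) (dm C (X 1))"
      unfolding to_zo[OF v'(1) refl] by (simp add: trunc_ge_def d(1))
    then have "h 1 \<odot> \<delta> = h 1 \<odot> \<delta> \<oplus> trunc_ge C 1 X 0 \<odot> v'" using \<delta>(1) by (simp add: hd)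
    also have "\<dots> = X 0" by (rule v'(2)[symmetric])
    finally show ?thesis .
  qed
  define R where "R i = (if 1 \<le> i then P i else if i = 0 then \<delta> else X i)" for i
  have Rd: "dm C (R i) = (if 1 \<le> i then dm C (P i) else dm C (X i))" for i using \<delta> by (auto simp: R_def)
  have RC: "int_complex C S R" unfolding int_complex_def
  proof (intro allI conjI)
    fix i
    show ar: "arr C (R i)" "dm C (R i) \<in> S" using \<delta> d by (auto simp: R_def)
    show cr: "cd C (R i) = dm C (R (i + 1))" using \<delta> by (cases "i = 0") (auto simp: Rd d(1-8) R_def)
    show "R (i + 1) \<odot> R i = zer C (dm C (R i)) (dm C (R (i + 2)))"
    proof (cases "i < 0")
      case True
      have z: "dm C (X i) = zo C" using True bX by simp
      have "cd C (R (i + 1)) = dm C (R (i + 2))"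
      proof (cases "i = -1")
        case True then show ?thesis using \<delta> by (simp add: R_def)
      next
        case False
        then have "i + 1 < 0" "i + 2 \<le> 0" using \<open>i < 0\<close> by auto
        then show ?thesis using d(3)[of "i + 1"] \<delta> by (simp add: R_def Rd add.commute)
      qed
      moreover have "arr C (R (i + 1))" using \<delta> d by (auto simp: R_def)
      ultimately show ?thesis using of_zo[of "R (i + 1) \<odot> R i" _ _] ar cr z True by (simp add: Rd)
    next
      case False
      then show ?thesis using \<delta> d by (cases "i = 0") (auto simp: R_def)
    qed
  qed
  define p where "p i = (if 1 \<le> i then h i else idt C (dm C (X i)))" for i
  have p: "int_chain_map C R X p"
    unfolding int_chain_map_def
  proof (intro allI conjI)
    fix i
    show "p i \<in> homset C (dm C (R i)) (dm C (X i))" by (auto simp: Rd p_def hd d(1-8))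
    show "p (i + 1) \<odot> R i = X i \<odot> p i"
    proof (cases "1 \<le> i")
      case True then show ?thesis using d(12)[of i] by (simp add: p_def R_def trunc_ge_def)
    next
      case False then show ?thesis using h\<delta> by (auto simp: p_def R_def d(1-8) not_le)
    qed
  qed
  (* Let u be a cycle of R. Exactness of X yields x with p u = X x, and (u, x) is a cycle of the cone.
     In degree 1 the term x belongs to the part of X that is cut off, so u - \<delta> x is considered. *)
  have exR: "cov_exact_at C S R i" if iN: "i \<le> N" for i
    unfolding cov_exact_at_def
  proof (intro ballI impI)
    fix T u assume T: "T \<in> S" and u: "u \<in> homset C T (dm C (R i))" "R i \<odot> u = zer C T (cd C (R i))"
    have TO: "T \<in> Ob C" using u by auto
    have pu: "X i \<odot> p i \<odot> u = zer C T (dm C (X (i + 1)))"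
      using int_chain_map_cmp[OF p refl, of i u] u int_complexD[OF RC] int_chain_mapD[OF p] TO by simp
    then obtain x where x: "x \<in> homset C T (dm C (X (i - 1)))" "p i \<odot> u = X (i - 1) \<odot> x"
      using u T int_chain_mapD[OF p] by (elim cov_exactD[OF ex(1)[OF iN] XC, rotated 2]) auto
    consider (low) "i \<le> 0" | (one) "i = 1" | (mid) "2 \<le> i" by linarith
    then show "\<exists>v\<in>homset C T (dm C (R (i - 1))). u = R (i - 1) \<odot> v"
    proof cases
      case low
      then have "u = X (i - 1) \<odot> x" using x u by (auto simp: p_def Rd)
      then show ?thesis using low x by (intro bexI[of _ x]) (auto simp: R_def)
    next
      case one
      have u1: "u \<in> homset C T (dm C (P 1))" "P 1 \<odot> u = zer C T (dm C (P 2))" "h 1 \<odot> u = X 0 \<odot> x" "x \<in> homset C T (dm C (X 0))"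
        using u x one cP by (auto simp: R_def p_def)
      define y where "y = u \<oplus> neg C (\<delta> \<odot> x)"
      have P\<delta>: "P 1 \<odot> \<delta> \<odot> x = zer C T (dm C (P 2))"
      proof -
        have "P 1 \<odot> \<delta> \<odot> x = (P 1 \<odot> \<delta>) \<odot> x" by (simp add: cmp_assoc)
        also have "\<dots> = zer C T (dm C (P 2))" unfolding \<delta>(2) using u1 d by simp
        finally show ?thesis .
      qed
      have h\<delta>': "h 1 \<odot> \<delta> \<odot> x = X 0 \<odot> x" using h\<delta> by (metis cmp_assoc)
      have y: "y \<in> homset C T (dm C (P 1))" using u1 \<delta> by (auto simp: y_def)
      have y1: "P 1 \<odot> y = zer C T (dm C (P 2))"
        using u1 P\<delta> TO by (simp add: y_def cmp_pls cmp_neg d(1-8))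
      have y2: "h 1 \<odot> y = zer C T (dm C (X 1))"
        using u1 h\<delta>' TO by (simp add: y_def cmp_pls cmp_neg pls_neg d(1-8) cX)
      have "\<exists>u'\<in>homset C T (dm C (P (1 - 1))). \<exists>v'\<in>homset C T (dm C (trunc_ge C 1 X (1 - 2))).
         y = P (1 - 1) \<odot> u' \<and> zer C T (zo C) = h (1 - 1) \<odot> u' \<oplus> trunc_ge C 1 X (1 - 2) \<odot> v'"
        using N T y y1 y2 TO by (intro cover) (auto simp: td trunc_ge_def d(1-8))
      then obtain u' where u': "u' \<in> homset C T (dm C (P 0))" "y = P 0 \<odot> u'" by auto
      have "u' = zer C T (zo C)" using u' to_zo[of u'] bP'[of 0] by simp
      then have "y = zer C T (dm C (P 1))" using u' TO bP'[of 0] by (simp add: d(1-8))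
      then have "u = \<delta> \<odot> x" unfolding y_def
        by (rule pls_neg_eq_zer) (use u1 \<delta> in auto)
      then show ?thesis using one u1 \<delta> by (intro bexI[of _ x]) (auto simp: R_def)
    next
      case mid
      have u2: "u \<in> homset C T (dm C (P i))" "P i \<odot> u = zer C T (dm C (P (i + 1)))"
        "h i \<odot> u = X (i - 1) \<odot> x" using u x mid by (auto simp: R_def p_def d(1-8))
      have "\<exists>u'\<in>homset C T (dm C (P (i - 1))). \<exists>v'\<in>homset C T (dm C (trunc_ge C 1 X (i - 2))).
         u = P (i - 1) \<odot> u' \<and> x = h (i - 1) \<odot> u' \<oplus> trunc_ge C 1 X (i - 2) \<odot> v'"
        using iN T u2 x mid by (intro cover) (auto simp: td trunc_ge_def)
      then show ?thesis using mid by (auto simp: R_def)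
    qed
  qed
  have bR: "dm C (R i) = zo C" if "i < 0 \<or> i > N + 1" for i
    using that N bX bP' by (auto simp: Rd)
  (* The identities of the terms in degrees N and N + 1 extend to chain maps in both directions. *)
  have RQ: "R N = Q N" using Q N by (simp add: R_def)
  have dRQ: "dm C (R N) = dm C (Q N)" "dm C (R (N + 1)) = dm C (Q (N + 1))"
    using RQ int_complexD(3)[OF RC, of N] int_complexD(3)[OF QC, of N] by auto
  have idc: "idt C (dm C (R (N + 1))) \<odot> R N = Q N \<odot> idt C (dm C (R N))"
    "idt C (dm C (R (N + 1))) \<odot> Q N = R N \<odot> idt C (dm C (R N))"
    using int_complexD(1,3)[OF RC] by (simp_all add: RQ[symmetric])
  have RO: "dm C (R i) \<in> Ob C" for i using int_complexD(1)[OF RC] by simp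
  obtain f where f: "int_chain_map C R Q f" "f N = idt C (dm C (R N))" "f (N + 1) = idt C (dm C (R (N + 1)))"
    by (rule int_chain_map_extend_below[OF RC QC ex(2) bQ _ _ idc(1)]) (use RO dRQ[symmetric] in auto)
  obtain g where g: "int_chain_map C Q R g" "g N = idt C (dm C (R N))" "g (N + 1) = idt C (dm C (R (N + 1)))"
    by (rule int_chain_map_extend_below[OF QC RC exR _ _ _ idc(2)]) (use RO dRQ[symmetric] bR in auto)
  have lo: "homotopic_at C R R (id_map C R) (\<lambda>i. g i \<odot> f i) i" for i
  proof -
    have top: "homotopic_at C R R (id_map C R) (\<lambda>i. g i \<odot> f i) (N + 1)"
      by (rule homotopic_at_refl[OF RC RC int_chain_map_id[OF RC]]) (use f g RO in \<open>simp add: id_map_def\<close>)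
    show ?thesis
    proof (cases "i \<le> N + 1")
      case True
      show ?thesis
        by (rule homotopic_below[OF RC RC int_chain_map_id[OF RC] int_chain_map_comp[OF f(1) g(1)] _ top True]) (use exR in auto)
    next
      case False
      then have "dm C (R i) = zo C" using bR by simp
      then have "id_map C R i = g i \<odot> f i"
        using to_zo[of "g i \<odot> f i" "dm C (R i)" "dm C (R i)"] to_zo[of "id_map C R i" "dm C (R i)" "dm C (R i)"]
          int_chain_mapD[OF f(1)] int_chain_mapD[OF g(1)] RO
        by (simp add: id_map_def)
      then show ?thesis by (rule homotopic_at_refl[OF RC RC int_chain_map_id[OF RC]])
    qed
  qed
  have "n_exact_for C N S R" unfolding n_exact_for_def
    using exR contra_exact_transfer[OF QC RC g(1) f(1) lo ex(3)] by blast
  then have nR: "n_exact_complex C N S R" using RC bR by (auto simp: n_exact_complex_def bounded_in_def)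
  have "weak_iso_map C N R Q f" unfolding weak_iso_map_def
    using N f RO by (auto simp: iso_arr_def intro!: exI[of _ N])
  then have "R \<in> XX" using wk nR nX[OF Q(1)] Q(1) unfolding weak_iso_class_def by blast
  then show "\<exists>P\<in>XX. \<exists>h. int_chain_map C P X h \<and> h 0 = idt C (dm C (X 0)) \<and> h (N + 1) = t"
    using p hN N by (intro bexI[of _ R] exI[of _ p]) (auto simp: p_def)
qed

section \<open>Weak isomorphisms\<close>

text \<open>
  By \<open>n_exact_transfer\<close> it suffices to find a chain map \<open>g : Y \<rightarrow> X\<close> that is right inverse to \<open>f\<close>
  in a single degree. If \<open>f\<close> is invertible in two neighbouring degrees, the inverses commute with
  the differentials and extend to \<open>g\<close>. If it is invertible in degrees \<open>0\<close> and \<open>N + 1\<close>, with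
  inverse \<open>s\<close> in degree \<open>N + 1\<close>, then \<open>lift_along_last\<close> lifts \<open>t = s \<odot> Y N\<close> to \<open>v : Y\<^bsub>N\<^esub> \<rightarrow> X\<^bsub>N\<^esub>\<close>,
  and \<open>(v, s)\<close> extends downwards.
\<close>

lemma n_exact_of_weak_iso_map:
  assumes N: "1 \<le> N" and X: "n_exact_complex C N S X" and Y: "n_exact_complex C N S Y" and f: "weak_iso_map C N X Y f"
    and bc: "has_base_changes C N S XX" and nXX: "\<And>X. X \<in> XX \<Longrightarrow> n_exact_complex C N S X" and XX: "X \<in> XX"
    and nX: "n_exact_for C N S' X"
  shows "n_exact_for C N S' Y"
proof -
  have XC: "int_complex C S X" and YC: "int_complex C S Y" and bX: "\<And>i. i > N + 1 \<Longrightarrow> dm C (X i) = zo C"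
    and bY: "dm C (Y (- 1)) = zo C"
    and exX: "\<And>i. i \<le> N \<Longrightarrow> cov_exact_at C S X i" and exY: "\<And>i. i \<le> N \<Longrightarrow> cov_exact_at C S Y i"
    "\<And>i. i \<ge> 1 \<Longrightarrow> contra_exact_at C S Y i" and nY: "n_exact_for C N S Y"
    using X Y by (auto simp: n_exact_complex_def n_exact_for_def bounded_in_def)
  have fm: "int_chain_map C X Y f" using f by (simp add: weak_iso_map_def)
  note d = int_complexD[OF XC] int_complexD[OF YC] int_chain_mapD[OF fm]
  have inv: "\<exists>g\<in>homset C (dm C (Y k)) (dm C (X k)). g \<odot> f k = idt C (dm C (X k)) \<and> f k \<odot> g = idt C (dm C (Y k))"
    if "iso_arr C (f k)" for k using that unfolding iso_arr_def d(10,11) by blast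
  have "\<exists>g k. int_chain_map C Y X g \<and> 0 \<le> k \<and> k \<le> N + 1 \<and> f k \<odot> g k = idt C (dm C (Y k))"
  proof (cases "\<exists>k. 0 \<le> k \<and> k \<le> N \<and> iso_arr C (f k) \<and> iso_arr C (f (k + 1))")
    case True
    then obtain k where k: "0 \<le> k" "k \<le> N" and i: "iso_arr C (f k)" "iso_arr C (f (k + 1))" by blast
    obtain a where a: "a \<in> homset C (dm C (Y k)) (dm C (X k))" "f k \<odot> a = idt C (dm C (Y k))"
      using inv[OF i(1)] by blast
    obtain b where b: "b \<in> homset C (dm C (Y (k + 1))) (dm C (X (k + 1)))" "b \<odot> f (k + 1) = idt C (dm C (X (k + 1)))"
      using inv[OF i(2)] by blast
    have "b \<odot> Y k = b \<odot> Y k \<odot> f k \<odot> a" using a b by (simp add: d)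
    also have "\<dots> = (b \<odot> f (k + 1)) \<odot> X k \<odot> a" using int_chain_map_cmp[OF fm refl, of k a] by (simp add: cmp_assoc)
    also have "\<dots> = X k \<odot> a" using a b by (simp add: d)
    finally have e: "b \<odot> Y k = X k \<odot> a" .
    obtain g where "int_chain_map C Y X g" "g k = a" "g (k + 1) = b"
      by (rule int_chain_map_extend[OF YC XC _ _ a(1) b(1) e]) (use exX exY k in auto)
    then show ?thesis using a k by (intro exI[of _ g] exI[of _ k]) auto
  next
    case False
    then have i: "iso_arr C (f 0)" "iso_arr C (f (N + 1))" using f unfolding weak_iso_map_def by auto
    obtain r where r: "r \<in> homset C (dm C (Y 0)) (dm C (X 0))" "r \<odot> f 0 = idt C (dm C (X 0))"
      using inv[OF i(1)] by blast
    obtain s where s: "s \<in> homset C (dm C (Y (N + 1))) (dm C (X (N + 1)))" "f (N + 1) \<odot> s = idt C (dm C (Y (N + 1)))"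
      using inv[OF i(2)] by blast
    define t where "t = s \<odot> Y N"
    have t: "t \<in> homset C (dm C (Y N)) (dm C (X (N + 1)))" using s by (auto simp: t_def d)
    obtain P p where P: "P \<in> XX" "int_chain_map C P X p" "p 0 = idt C (dm C (X 0))" "p (N + 1) = t"
      by (rule base_changeE[OF bc XX t]) (use d in auto)
    have "f (N + 1) \<odot> t = (f (N + 1) \<odot> s) \<odot> Y N" by (simp add: t_def cmp_assoc)
    also have "\<dots> = Y N \<odot> idt C (dm C (Y N))" unfolding s(2) by (simp add: d)
    finally have ft: "f (N + 1) \<odot> t = Y N \<odot> idt C (dm C (Y N))" .
    have "\<exists>v\<in>homset C (dm C t) (dm C (X N)). t = X N \<odot> v"
      by (rule lift_along_last[OF N XC YC fm r exY(1) bY nXX[OF P(1)] P(2-4) _ ft]) (use t d in auto)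
    then obtain v where v: "v \<in> homset C (dm C (Y N)) (dm C (X N))" "s \<odot> Y N = X N \<odot> v"
      using t by (auto simp: t_def)
    obtain g where "int_chain_map C Y X g" "g N = v" "g (N + 1) = s"
      by (rule int_chain_map_extend_below[OF YC XC exX bX v(1) s(1) v(2)]) auto
    then show ?thesis using s N by (intro exI[of _ g] exI[of _ "N + 1"]) auto
  qed
  then obtain g k where g: "int_chain_map C Y X g" and k: "0 \<le> k" "k \<le> N + 1" "f k \<odot> g k = idt C (dm C (Y k))"
    by blast
  show ?thesis by (rule n_exact_transfer[OF XC YC fm g nY k nX])
qed

end

section \<open>Passage to sequences with terms in a subclass\<close>

text \<open>
  The chain maps of a homotopy equivalence relative to the ends. Both directions are recorded
  because passing to the opposite category exchanges them.
\<close>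

definition extension_closed_in :: "('o, 'a) arrows \<Rightarrow> int \<Rightarrow> 'o set \<Rightarrow> (int \<Rightarrow> 'a) set \<Rightarrow> bool" where
  "extension_closed_in C N B XX \<longleftrightarrow> (\<forall>X\<in>XX. dm C (X 0) \<in> B \<and> dm C (X (N + 1)) \<in> B \<longrightarrow>
     (\<exists>Y\<in>XX. (\<forall>i. dm C (Y i) \<in> B) \<and> (\<exists>f g. int_chain_map C X Y f \<and> int_chain_map C Y X g \<and>
        f 0 = idt C (dm C (X 0)) \<and> f (N + 1) = idt C (dm C (X (N + 1))) \<and>
        g 0 = idt C (dm C (X 0)) \<and> g (N + 1) = idt C (dm C (X (N + 1))))))"

definition with_terms_in :: "('o, 'a) arrows \<Rightarrow> 'o set \<Rightarrow> (int \<Rightarrow> 'a) set \<Rightarrow> (int \<Rightarrow> 'a) set" where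
  "with_terms_in C B XX = {X \<in> XX. \<forall>i. dm C (X i) \<in> B}"

context arrow_category
begin

lemma with_terms_in_opp:
  assumes "\<And>X. X \<in> XX \<Longrightarrow> int_complex C S X"
  shows "with_terms_in (opp C) B (reflect N ` XX) = reflect N ` with_terms_in C B XX"
proof -
  have "(\<forall>i. cd C (X (N - i)) \<in> B) \<longleftrightarrow> (\<forall>i. dm C (X i) \<in> B)" if "X \<in> XX" for X
  proof -
    have "cd C (X (N - i)) = dm C (X (N + 1 - i))" for i
      using int_complexD(3)[OF assms[OF that], of "N - i"] by (simp add: algebra_simps)
    moreover have "(\<forall>i. Q (N + 1 - i)) \<longleftrightarrow> (\<forall>i. Q i)" for Q
    proof
      assume a: "\<forall>i. Q (N + 1 - i)"
      show "\<forall>i. Q i"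
      proof
        fix i show "Q i" using a[rule_format, of "N + 1 - i"] by simp
      qed
    qed blast
    ultimately show ?thesis by simp
  qed
  then show ?thesis by (auto simp: with_terms_in_def reflect_def)
qed

lemma extension_closed_in_opp:
  assumes c: "\<And>X. X \<in> XX \<Longrightarrow> int_complex C S X" and e: "extension_closed_in C N B XX"
  shows "extension_closed_in (opp C) N B (reflect N ` XX)"
  unfolding extension_closed_in_def
proof (intro ballI impI, elim conjE)
  fix X' assume "X' \<in> reflect N ` XX"
  then obtain X where X: "X \<in> XX" "X' = reflect N X" by blast
  have e0: "dm (opp C) (reflect N Z 0) = dm C (Z (N + 1))" "dm (opp C) (reflect N Z (N + 1)) = dm C (Z 0)"
    if "Z \<in> XX" for Z
    using int_complexD(3)[OF c[OF that], of "-1"] int_complexD(3)[OF c[OF that], of N] by (simp_all add: reflect_def)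
  assume "dm (opp C) (X' 0) \<in> B" "dm (opp C) (X' (N + 1)) \<in> B"
  then obtain Y f g where Y: "Y \<in> XX" "\<And>i. dm C (Y i) \<in> B" and fg: "int_chain_map C X Y f" "int_chain_map C Y X g"
    "f 0 = idt C (dm C (X 0))" "f (N + 1) = idt C (dm C (X (N + 1)))"
    "g 0 = idt C (dm C (X 0))" "g (N + 1) = idt C (dm C (X (N + 1)))"
    using e X e0[OF X(1)] unfolding extension_closed_in_def by metis
  note O = int_complex_Ob[OF c[OF X(1)]] int_complex_Ob[OF c[OF Y(1)]]
  show "\<exists>Y\<in>reflect N ` XX. (\<forall>i. dm (opp C) (Y i) \<in> B) \<and> (\<exists>f g. int_chain_map (opp C) X' Y f \<and> int_chain_map (opp C) Y X' g \<and>
        f 0 = idt (opp C) (dm (opp C) (X' 0)) \<and> f (N + 1) = idt (opp C) (dm (opp C) (X' (N + 1))) \<and>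
        g 0 = idt (opp C) (dm (opp C) (X' 0)) \<and> g (N + 1) = idt (opp C) (dm (opp C) (X' (N + 1))))"
    unfolding X(2) e0[OF X(1)]
    using Y int_chain_map_opp[OF O fg(1), of N] int_chain_map_opp[OF O(2,1) fg(2), of N] fg(3-6)
    by (intro bexI[of _ "reflect N Y"] conjI exI[of _ "reflect (N + 1) g"] exI[of _ "reflect (N + 1) f"])
      (auto simp: reflect_def int_complexD(3)[OF O(2)])
qed

text \<open>
  Replace a base change \<open>P\<close> by a sequence \<open>Y\<close> with terms in \<open>B\<close>: the map \<open>Y \<rightarrow> P\<close> is the identity
  at both ends, so \<open>Y \<rightarrow> P \<rightarrow> X\<close> is again a base change.
\<close>

lemma has_base_changes_with_terms_in:
  assumes B: "B \<subseteq> Ob C" and bc: "has_base_changes C N (Ob C) XX" and c: "\<And>X. X \<in> XX \<Longrightarrow> int_complex C (Ob C) X"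
    and e: "extension_closed_in C N B XX"
  shows "has_base_changes C N B (with_terms_in C B XX)"
  unfolding has_base_changes_def
proof (intro ballI allI impI, elim conjE)
  fix X t assume X: "X \<in> with_terms_in C B XX" and t: "arr C t" "dm C t \<in> B" "cd C t = dm C (X (N + 1))"
  have X1: "X \<in> XX" "\<And>i. dm C (X i) \<in> B" using X by (auto simp: with_terms_in_def)
  obtain P h where P: "P \<in> XX" "int_chain_map C P X h" "h 0 = idt C (dm C (X 0))" "h (N + 1) = t"
    using base_changeE[OF bc X1(1), of t "dm C t"] t by auto
  note d = int_chain_mapD[OF P(2)] int_complexD[OF c[OF P(1)]] int_complexD[OF c[OF X1(1)]]
  have P0: "dm C (P 0) = dm C (X 0)" using d(2)[of 0] P(3) d by simp
  have PN: "dm C (P (N + 1)) = dm C t" using d(2)[of "N + 1"] P(4) by simp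
  obtain Y g where Y: "Y \<in> XX" "\<And>i. dm C (Y i) \<in> B" and g: "int_chain_map C Y P g"
    "g 0 = idt C (dm C (P 0))" "g (N + 1) = idt C (dm C (P (N + 1)))"
    using e P(1) P0 PN X1(2)[of 0] t(2) unfolding extension_closed_in_def by metis
  have "int_chain_map C Y X (\<lambda>i. h i \<odot> g i)" by (rule int_chain_map_comp[OF g(1) P(2)])
  moreover have "h 0 \<odot> g 0 = idt C (dm C (X 0))" using P(3) g(2) P0 d by simp
  moreover have "h (N + 1) \<odot> g (N + 1) = t" using P(4) g(3) PN t by simp
  ultimately show "\<exists>P\<in>with_terms_in C B XX. \<exists>h. int_chain_map C P X h \<and> h 0 = idt C (dm C (X 0)) \<and> h (N + 1) = t"
    using Y by (intro bexI[of _ Y] exI[of _ "\<lambda>i. h i \<odot> g i"]) (auto simp: with_terms_in_def)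
qed

end

section \<open>Cones as triangular complexes\<close>

definition biproduct :: "('o, 'a) arrows \<Rightarrow> 'o \<Rightarrow> 'o \<Rightarrow> 'o \<Rightarrow> 'a \<Rightarrow> 'a \<Rightarrow> 'a \<Rightarrow> 'a \<Rightarrow> bool" where
  "biproduct C A B s i1 i2 p1 p2 \<longleftrightarrow> i1 \<in> homset C A s \<and> i2 \<in> homset C B s \<and> p1 \<in> homset C s A \<and> p2 \<in> homset C s B \<and>
     p1 \<odot>\<^bsub>C\<^esub> i1 = idt C A \<and> p2 \<odot>\<^bsub>C\<^esub> i2 = idt C B \<and> p1 \<odot>\<^bsub>C\<^esub> i2 = zer C B A \<and> p2 \<odot>\<^bsub>C\<^esub> i1 = zer C A B \<and>
     i1 \<odot>\<^bsub>C\<^esub> p1 \<oplus>\<^bsub>C\<^esub> i2 \<odot>\<^bsub>C\<^esub> p2 = idt C s"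

text \<open>
  The terms of \<open>W\<close> are biproducts of those of \<open>a\<close> and \<open>c\<close>, and its differential is the lower
  triangular matrix with diagonal \<open>(a, c)\<close> and corner \<open>b\<close>. Arbitrary diagonals are allowed
  because the cone of \<open>h : P \<rightarrow> Y\<close> can be formed with diagonal \<open>(P, -Y)\<close> or with \<open>(-P, Y)\<close>, and
  duality exchanges these conventions.
\<close>

definition triangular :: "('o, 'a) arrows \<Rightarrow> (int \<Rightarrow> 'a) \<Rightarrow> (int \<Rightarrow> 'a) \<Rightarrow> (int \<Rightarrow> 'a) \<Rightarrow> (int \<Rightarrow> 'a) \<Rightarrow>
    (int \<Rightarrow> 'a) \<Rightarrow> (int \<Rightarrow> 'a) \<Rightarrow> (int \<Rightarrow> 'a) \<Rightarrow> (int \<Rightarrow> 'a) \<Rightarrow> bool" where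
  "triangular C a b c W i1 i2 p1 p2 \<longleftrightarrow> (\<forall>i. biproduct C (dm C (a i)) (dm C (c i)) (dm C (W i)) (i1 i) (i2 i) (p1 i) (p2 i) \<and>
     b i \<in> homset C (dm C (a i)) (cd C (c i)) \<and>
     W i = i1 (i + 1) \<odot>\<^bsub>C\<^esub> a i \<odot>\<^bsub>C\<^esub> p1 i \<oplus>\<^bsub>C\<^esub> i2 (i + 1) \<odot>\<^bsub>C\<^esub> b i \<odot>\<^bsub>C\<^esub> p1 i \<oplus>\<^bsub>C\<^esub> i2 (i + 1) \<odot>\<^bsub>C\<^esub> c i \<odot>\<^bsub>C\<^esub> p2 i)"

definition triangular_exact_at ::
  "('o, 'a) arrows \<Rightarrow> 'o set \<Rightarrow> (int \<Rightarrow> 'a) \<Rightarrow> (int \<Rightarrow> 'a) \<Rightarrow> (int \<Rightarrow> 'a) \<Rightarrow> int \<Rightarrow> bool" where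
  "triangular_exact_at C S a b c i \<longleftrightarrow> (\<forall>T\<in>S. \<forall>u\<in>homset C T (dm C (a i)). \<forall>v\<in>homset C T (dm C (c i)).
     a i \<odot>\<^bsub>C\<^esub> u = zer C T (cd C (a i)) \<and> b i \<odot>\<^bsub>C\<^esub> u \<oplus>\<^bsub>C\<^esub> c i \<odot>\<^bsub>C\<^esub> v = zer C T (cd C (c i)) \<longrightarrow>
     (\<exists>u'\<in>homset C T (dm C (a (i - 1))). \<exists>v'\<in>homset C T (dm C (c (i - 1))).
        u = a (i - 1) \<odot>\<^bsub>C\<^esub> u' \<and> v = b (i - 1) \<odot>\<^bsub>C\<^esub> u' \<oplus>\<^bsub>C\<^esub> c (i - 1) \<odot>\<^bsub>C\<^esub> v'))"

text \<open>
  The dual of \<open>pullback_exact_at\<close>: contravariant exactness of the cone of \<open>h : P \<rightarrow> Y\<close> at its term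
  \<open>P\<^bsub>i+1\<^esub> \<oplus> Y\<^bsub>i\<^esub>\<close>.
\<close>

definition pushout_exact_at ::
  "('o, 'a) arrows \<Rightarrow> 'o set \<Rightarrow> (int \<Rightarrow> 'a) \<Rightarrow> (int \<Rightarrow> 'a) \<Rightarrow> (int \<Rightarrow> 'a) \<Rightarrow> int \<Rightarrow> bool" where
  "pushout_exact_at C S h P Y i \<longleftrightarrow> (\<forall>T\<in>S. \<forall>u\<in>homset C (cd C (Y (i - 1))) T. \<forall>v\<in>homset C (cd C (P i)) T.
     u \<odot>\<^bsub>C\<^esub> Y (i - 1) = zer C (dm C (Y (i - 1))) T \<and> u \<odot>\<^bsub>C\<^esub> h i = v \<odot>\<^bsub>C\<^esub> P i \<longrightarrow>
     (\<exists>u'\<in>homset C (cd C (Y i)) T. \<exists>v'\<in>homset C (cd C (P (i + 1))) T.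
        u = u' \<odot>\<^bsub>C\<^esub> Y i \<and> v = u' \<odot>\<^bsub>C\<^esub> h (i + 1) \<oplus>\<^bsub>C\<^esub> v' \<odot>\<^bsub>C\<^esub> P (i + 1)))"

lemma homset_opp: "homset (opp C) A B = homset C B A"
  by (auto simp: homset_def)

lemma pullback_exact_opp:
  "pullback_exact_at (opp C) S (reflect (k + 1) h) (reflect k Y) (reflect k P) i = pushout_exact_at C S h P Y (k + 1 - i)"
proof -
  have e: "k - (i - 1) = k + 1 - i" "k + 1 - i - 1 = k - i" "k - (i - 2) = k + 1 - i + 1" "k + 1 - (i - 1) = k + 1 - i + 1"
    by auto
  show ?thesis unfolding pullback_exact_at_def pushout_exact_at_def reflect_def e homset_opp by (simp del: homset_iff)
qed

lemma biproduct_opp: "biproduct (opp C) B A s p2 p1 i2 i1 = biproduct C A B s i1 i2 p1 p2" if "\<And>f g. pls C f g = pls C g f"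
  using that by (auto simp: biproduct_def)

context arrow_category
begin

lemma triangular_opp:
  assumes a: "int_complex C S a" and c: "int_complex C S c" and W: "int_complex C S' W" and t: "triangular C a b c W i1 i2 p1 p2"
  shows "triangular (opp C) (reflect k c) (reflect k b) (reflect k a) (reflect k W)
    (reflect (k + 1) p2) (reflect (k + 1) p1) (reflect (k + 1) i2) (reflect (k + 1) i1)"
proof -
  note d = int_complexD[OF a] int_complexD[OF c] int_complexD[OF W]
  have e: "k + 1 - i = k - i + 1" "k + 1 - (i + 1) = k - i" for i :: int by auto
  have o: "biproduct (opp C) (dm C (c j)) (dm C (a j)) (dm C (W j)) (p2 j) (p1 j) (i2 j) (i1 j)" for j
    unfolding biproduct_opp[OF pls_commute] using t unfolding triangular_def by blast
  show ?thesis
    unfolding triangular_def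
  proof (intro allI conjI)
    fix i
    have ti: "b (k - i) \<in> homset C (dm C (a (k - i))) (cd C (c (k - i)))"
      "W (k - i) = i1 (k - i + 1) \<odot> a (k - i) \<odot> p1 (k - i) \<oplus> i2 (k - i + 1) \<odot> b (k - i) \<odot> p1 (k - i) \<oplus>
        i2 (k - i + 1) \<odot> c (k - i) \<odot> p2 (k - i)"
      using t unfolding triangular_def by blast+
    show "biproduct (opp C) (dm (opp C) (reflect k c i)) (dm (opp C) (reflect k a i)) (dm (opp C) (reflect k W i))
      (reflect (k + 1) p2 i) (reflect (k + 1) p1 i) (reflect (k + 1) i2 i) (reflect (k + 1) i1 i)"
      using o[of "k - i + 1"] unfolding reflect_def e(1) opp_sel d(3,7,11) .
    show "reflect k b i \<in> homset (opp C) (dm (opp C) (reflect k c i)) (cd (opp C) (reflect k a i))"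
      using ti(1) by (simp add: reflect_def)
    show "reflect k W i = reflect (k + 1) p2 (i + 1) \<odot>\<^bsub>opp C\<^esub> reflect k c i \<odot>\<^bsub>opp C\<^esub> reflect (k + 1) i2 i \<oplus>\<^bsub>opp C\<^esub>
        reflect (k + 1) p1 (i + 1) \<odot>\<^bsub>opp C\<^esub> reflect k b i \<odot>\<^bsub>opp C\<^esub> reflect (k + 1) i2 i \<oplus>\<^bsub>opp C\<^esub>
        reflect (k + 1) p1 (i + 1) \<odot>\<^bsub>opp C\<^esub> reflect k a i \<odot>\<^bsub>opp C\<^esub> reflect (k + 1) i1 i"
      unfolding reflect_def e(2) unfolding e(1) opp_sel ti(2) by (simp only: cmp_assoc pls_ac)
  qed
qed

lemma triangularD:
  assumes a: "int_complex C S a" and c: "int_complex C S c" and t: "triangular C a b c W i1 i2 p1 p2"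
  shows "arr C (i1 i)" "dm C (i1 i) = dm C (a i)" "cd C (i1 i) = dm C (W i)"
    "arr C (i2 i)" "dm C (i2 i) = dm C (c i)" "cd C (i2 i) = dm C (W i)"
    "arr C (p1 i)" "dm C (p1 i) = dm C (W i)" "cd C (p1 i) = dm C (a i)"
    "arr C (p2 i)" "dm C (p2 i) = dm C (W i)" "cd C (p2 i) = dm C (c i)"
    "arr C (b i)" "dm C (b i) = dm C (a i)" "cd C (b i) = dm C (c (i + 1))"
  using t int_complexD[OF c] unfolding triangular_def biproduct_def by auto

lemma triangular_biproduct:
  assumes t: "triangular C a b c W i1 i2 p1 p2"
  shows "p1 i \<odot> i1 i = idt C (dm C (a i))" "p2 i \<odot> i2 i = idt C (dm C (c i))"
    "p1 i \<odot> i2 i = zer C (dm C (c i)) (dm C (a i))" "p2 i \<odot> i1 i = zer C (dm C (a i)) (dm C (c i))"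
    "i1 i \<odot> p1 i \<oplus> i2 i \<odot> p2 i = idt C (dm C (W i))"
  using t unfolding triangular_def biproduct_def by auto

lemma triangular_biproduct_cmp:
  assumes t: "triangular C a b c W i1 i2 p1 p2" and u: "arr C u"
  shows "cd C u = dm C (a i) \<Longrightarrow> p1 i \<odot> i1 i \<odot> u = u" "cd C u = dm C (c i) \<Longrightarrow> p2 i \<odot> i2 i \<odot> u = u"
    "\<lbrakk>cd C u = dm C (c i); dm C (a i) \<in> Ob C\<rbrakk> \<Longrightarrow> p1 i \<odot> i2 i \<odot> u = zer C (dm C u) (dm C (a i))"
    "\<lbrakk>cd C u = dm C (a i); dm C (c i) \<in> Ob C\<rbrakk> \<Longrightarrow> p2 i \<odot> i1 i \<odot> u = zer C (dm C u) (dm C (c i))"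
  using u by (simp_all add: cmp_assoc[symmetric] triangular_biproduct[OF t])

lemma triangular_eq:
  assumes t: "triangular C a b c W i1 i2 p1 p2"
  shows "W i = i1 (i + 1) \<odot> a i \<odot> p1 i \<oplus> i2 (i + 1) \<odot> b i \<odot> p1 i \<oplus> i2 (i + 1) \<odot> c i \<odot> p2 i"
  using t unfolding triangular_def by blast

lemma triangular_cov_exact_iff:
  assumes a: "int_complex C S1 a" and c: "int_complex C S1 c" and W: "int_complex C S2 W" and t: "triangular C a b c W i1 i2 p1 p2"
  shows "cov_exact_at C S W i \<longleftrightarrow> triangular_exact_at C S a b c i"
proof -
  note d = int_complexD[OF a] int_complexD[OF c] int_complexD(1,2)[OF W]
  note td = triangularD[OF a c t]
  have Wc: "cd C (W i) = dm C (W (i + 1))" for i by (rule int_complexD(3)[OF W])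
  have im: "cd C (a (i - 1)) = dm C (a i)" "cd C (c (i - 1)) = dm C (c i)" "cd C (b (i - 1)) = dm C (c i)"
    using d(3)[of "i - 1"] d(7)[of "i - 1"] td(15)[of "i - 1"] by auto
  have W1: "W i \<odot> w = i1 (i + 1) \<odot> a i \<odot> p1 i \<odot> w \<oplus> i2 (i + 1) \<odot> (b i \<odot> p1 i \<odot> w \<oplus> c i \<odot> p2 i \<odot> w)" for w i
    by (subst triangular_eq[OF t]) (simp add: pls_cmp cmp_pls cmp_assoc)
  have W2: "W (i - 1) \<odot> (i1 (i - 1) \<odot> u \<oplus> i2 (i - 1) \<odot> v) =
      i1 i \<odot> a (i - 1) \<odot> u \<oplus> i2 i \<odot> (b (i - 1) \<odot> u \<oplus> c (i - 1) \<odot> v)"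
    if "u \<in> homset C T (dm C (a (i - 1)))" "v \<in> homset C T (dm C (c (i - 1)))" for u v T
    using that by (subst W1) (simp add: cmp_pls triangular_biproduct_cmp[OF t] td d im)
  show ?thesis
  proof
    assume ex: "cov_exact_at C S W i"
    show "triangular_exact_at C S a b c i" unfolding triangular_exact_at_def
    proof (intro ballI impI, elim conjE)
      fix T u v assume T: "T \<in> S" and u: "u \<in> homset C T (dm C (a i))" and v: "v \<in> homset C T (dm C (c i))"
        and e: "a i \<odot> u = zer C T (cd C (a i))" "b i \<odot> u \<oplus> c i \<odot> v = zer C T (cd C (c i))"
      have TO: "T \<in> Ob C" using u by auto
      let ?w = "i1 i \<odot> u \<oplus> i2 i \<odot> v"
      have pw: "p1 i \<odot> ?w = u" "p2 i \<odot> ?w = v"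
        using u v TO by (simp_all add: cmp_pls triangular_biproduct_cmp[OF t] td d)
      have w: "?w \<in> homset C T (dm C (W i))" using u v by (simp add: td)
      have "W i \<odot> ?w = zer C T (dm C (W (i + 1)))"
        unfolding W1 pw e using TO by (simp add: td d)
      then obtain w' where w': "w' \<in> homset C T (dm C (W (i - 1)))" "?w = W (i - 1) \<odot> w'"
        by (rule cov_exactD[OF ex W w T])
      have "u = p1 i \<odot> W (i - 1) \<odot> w'" using pw(1) w'(2) by simp
      also have "\<dots> = a (i - 1) \<odot> p1 (i - 1) \<odot> w'"
        unfolding W1 using w' TO by (simp add: cmp_pls triangular_biproduct_cmp[OF t] td d im)
      finally have u': "u = a (i - 1) \<odot> p1 (i - 1) \<odot> w'" .
      have "v = p2 i \<odot> W (i - 1) \<odot> w'" using pw(2) w'(2) by simp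
      also have "\<dots> = b (i - 1) \<odot> p1 (i - 1) \<odot> w' \<oplus> c (i - 1) \<odot> p2 (i - 1) \<odot> w'"
        unfolding W1 using w' TO by (simp add: cmp_pls triangular_biproduct_cmp[OF t] td d im)
      finally have v': "v = b (i - 1) \<odot> p1 (i - 1) \<odot> w' \<oplus> c (i - 1) \<odot> p2 (i - 1) \<odot> w'" .
      have "p1 (i - 1) \<odot> w' \<in> homset C T (dm C (a (i - 1)))" "p2 (i - 1) \<odot> w' \<in> homset C T (dm C (c (i - 1)))"
        using w' by (simp_all add: td)
      then show "\<exists>u'\<in>homset C T (dm C (a (i - 1))). \<exists>v'\<in>homset C T (dm C (c (i - 1))).
        u = a (i - 1) \<odot> u' \<and> v = b (i - 1) \<odot> u' \<oplus> c (i - 1) \<odot> v'"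
        using u' v' by blast
    qed
  next
    assume ex: "triangular_exact_at C S a b c i"
    show "cov_exact_at C S W i" unfolding cov_exact_at_def
    proof (intro ballI impI)
      fix T w assume T: "T \<in> S" and w: "w \<in> homset C T (dm C (W i))" and e: "W i \<odot> w = zer C T (cd C (W i))"
      have TO: "T \<in> Ob C" using w by auto
      let ?u = "p1 i \<odot> w" and ?v = "p2 i \<odot> w"
      have u: "?u \<in> homset C T (dm C (a i))" "?v \<in> homset C T (dm C (c i))" using w by (simp_all add: td)
      have "p1 (i + 1) \<odot> W i \<odot> w = zer C T (dm C (a (i + 1)))" "p2 (i + 1) \<odot> W i \<odot> w = zer C T (dm C (c (i + 1)))"
        unfolding e using TO by (simp_all add: td Wc d)
      then have "a i \<odot> ?u = zer C T (cd C (a i))" "b i \<odot> ?u \<oplus> c i \<odot> ?v = zer C T (cd C (c i))"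
        unfolding W1 using u TO by (simp_all add: cmp_pls triangular_biproduct_cmp[OF t] td d w)
      then obtain u' v' where u': "u' \<in> homset C T (dm C (a (i - 1)))" "v' \<in> homset C T (dm C (c (i - 1)))"
        "?u = a (i - 1) \<odot> u'" "?v = b (i - 1) \<odot> u' \<oplus> c (i - 1) \<odot> v'"
        using ex T u unfolding triangular_exact_at_def by blast
      have "w = (i1 i \<odot> p1 i \<oplus> i2 i \<odot> p2 i) \<odot> w" unfolding triangular_biproduct(5)[OF t] using w by simp
      also have "\<dots> = i1 i \<odot> ?u \<oplus> i2 i \<odot> ?v" by (simp add: pls_cmp cmp_assoc)
      also have "\<dots> = W (i - 1) \<odot> (i1 (i - 1) \<odot> u' \<oplus> i2 (i - 1) \<odot> v')"
        unfolding u'(3,4) by (rule W2[OF u'(1,2), symmetric])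
      finally have "w = W (i - 1) \<odot> (i1 (i - 1) \<odot> u' \<oplus> i2 (i - 1) \<odot> v')" .
      moreover have "i1 (i - 1) \<odot> u' \<oplus> i2 (i - 1) \<odot> v' \<in> homset C T (dm C (W (i - 1)))"
        using u' by (simp add: td)
      ultimately show "\<exists>v\<in>homset C T (dm C (W (i - 1))). w = W (i - 1) \<odot> v" by blast
    qed
  qed
qed

lemma pls_neg_zer_iff:
  assumes "x \<in> homset C A B" "y \<in> homset C A B"
  shows "x \<oplus> neg C y = zer C A B \<longleftrightarrow> x = y"
  using assms pls_neg_eq_zer[of x y A B] by (auto simp: pls_neg)

lemma neg_zer_iff:
  assumes "x \<in> homset C A B"
  shows "neg C x = zer C A B \<longleftrightarrow> x = zer C A B"
proof -
  have "A \<in> Ob C" "B \<in> Ob C" using assms by auto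
  then show ?thesis by (simp add: neg_eq_iff)
qed

text \<open>
  Replace \<open>v'\<close> by \<open>-v'\<close>.
\<close>

lemma triangular_exact_neg_right:
  assumes P: "int_complex C S1 P" and Y: "int_complex C S2 Y" and h: "\<And>i. h i \<in> homset C (dm C (P i)) (dm C (Y i))"
  shows "triangular_exact_at C S P h (\<lambda>i. neg C (Y (i - 1))) i \<longleftrightarrow> pullback_exact_at C S h P Y i"
proof -
  note d = int_complexD[OF P] int_complexD[OF Y]
  have c: "cd C (Y (i - 1)) = dm C (Y i)" using d(7)[of "i - 1"] by simp
  have h': "arr C (h i)" "dm C (h i) = dm C (P i)" "cd C (h i) = dm C (Y i)" for i using h[of i] by auto
  have 1: "h i \<odot> u \<oplus> neg C (Y (i - 1)) \<odot> v = zer C T (dm C (Y i)) \<longleftrightarrow> h i \<odot> u = Y (i - 1) \<odot> v"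
    if "u \<in> homset C T (dm C (P i))" "v \<in> homset C T (dm C (Y (i - 1)))" for u v T
    unfolding neg_cmp by (rule pls_neg_zer_iff) (use that in \<open>auto simp: d h' c\<close>)
  have 2: "(\<exists>u'\<in>homset C T (dm C (P (i - 1))). \<exists>v'\<in>homset C T (dm C (Y (i - 2))).
        u = P (i - 1) \<odot> u' \<and> v = h (i - 1) \<odot> u' \<oplus> neg C (Y (i - 2)) \<odot> v') \<longleftrightarrow>
     (\<exists>u'\<in>homset C T (dm C (P (i - 1))). \<exists>v'\<in>homset C T (dm C (Y (i - 2))).
        u = P (i - 1) \<odot> u' \<and> v = h (i - 1) \<odot> u' \<oplus> Y (i - 2) \<odot> v')" for u v T
  proof -
    have n: "neg C (Y (i - 2)) \<odot> v' = Y (i - 2) \<odot> neg C v'" "Y (i - 2) \<odot> v' = neg C (Y (i - 2)) \<odot> neg C v'" for v'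
      by (simp_all add: neg_cmp cmp_neg)
    have m: "v' \<in> homset C T (dm C (Y (i - 2))) \<Longrightarrow> neg C v' \<in> homset C T (dm C (Y (i - 2)))" for v' by simp
    show ?thesis using n m by metis
  qed
  have e: "i - 1 - 1 = i - 2" by simp
  have "triangular_exact_at C S P h (\<lambda>i. neg C (Y (i - 1))) i \<longleftrightarrow> (\<forall>T\<in>S. \<forall>u\<in>homset C T (dm C (P i)). \<forall>v\<in>homset C T (dm C (Y (i - 1))).
     P i \<odot> u = zer C T (cd C (P i)) \<and> h i \<odot> u \<oplus> neg C (Y (i - 1)) \<odot> v = zer C T (cd C (Y (i - 1))) \<longrightarrow>
     (\<exists>u'\<in>homset C T (dm C (P (i - 1))). \<exists>v'\<in>homset C T (dm C (Y (i - 2))).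
        u = P (i - 1) \<odot> u' \<and> v = h (i - 1) \<odot> u' \<oplus> neg C (Y (i - 2)) \<odot> v'))"
    unfolding triangular_exact_at_def e by (simp only: dm_neg[OF d(5)] cd_neg[OF d(5)])
  then show ?thesis unfolding pullback_exact_at_def by (simp only: 1 2 c cong: ball_cong)
qed

text \<open>
  Replace \<open>v\<close>, \<open>u'\<close> and \<open>v'\<close> by their negatives.
\<close>

lemma triangular_exact_neg_left:
  assumes P: "int_complex C S1 P" and Y: "int_complex C S2 Y" and h: "\<And>i. h i \<in> homset C (dm C (P i)) (dm C (Y i))"
  shows "triangular_exact_at C S (\<lambda>i. neg C (P i)) h (\<lambda>i. Y (i - 1)) i \<longleftrightarrow> pullback_exact_at C S h P Y i"
proof -
  note d = int_complexD[OF P] int_complexD[OF Y]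
  have c: "cd C (Y (i - 1)) = dm C (Y i)" using d(7)[of "i - 1"] by simp
  have h': "arr C (h i)" "dm C (h i) = dm C (P i)" "cd C (h i) = dm C (Y i)" for i using h[of i] by auto
  have e: "i - 1 - 1 = i - 2" by simp
  have 1: "neg C (P i) \<odot> u = zer C T (cd C (P i)) \<longleftrightarrow> P i \<odot> u = zer C T (cd C (P i))"
    if "u \<in> homset C T (dm C (P i))" for u T
    unfolding neg_cmp by (rule neg_zer_iff) (use that in \<open>auto simp: d\<close>)
  have 2: "h i \<odot> u \<oplus> Y (i - 1) \<odot> neg C v = zer C T (dm C (Y i)) \<longleftrightarrow> h i \<odot> u = Y (i - 1) \<odot> v"
    if "u \<in> homset C T (dm C (P i))" "v \<in> homset C T (dm C (Y (i - 1)))" for u v T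
    unfolding cmp_neg by (rule pls_neg_zer_iff) (use that in \<open>auto simp: d h' c\<close>)
  have nn: "neg C x = neg C y \<longleftrightarrow> x = y" for x y by (metis neg_neg)
  let ?A = "\<lambda>T u v. \<exists>u'\<in>homset C T (dm C (P (i - 1))). \<exists>v'\<in>homset C T (dm C (Y (i - 2))).
        u = neg C (P (i - 1)) \<odot> u' \<and> v = h (i - 1) \<odot> u' \<oplus> Y (i - 2) \<odot> v'"
  let ?B = "\<lambda>T u v. \<exists>u'\<in>homset C T (dm C (P (i - 1))). \<exists>v'\<in>homset C T (dm C (Y (i - 2))).
        u = P (i - 1) \<odot> u' \<and> v = h (i - 1) \<odot> u' \<oplus> Y (i - 2) \<odot> v'"
  have 3: "?A T u (neg C v) \<longleftrightarrow> ?B T u v" for u v T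
  proof
    assume "?A T u (neg C v)"
    then obtain u' v' where u: "u' \<in> homset C T (dm C (P (i - 1)))" "v' \<in> homset C T (dm C (Y (i - 2)))"
      "u = neg C (P (i - 1)) \<odot> u'" "neg C v = h (i - 1) \<odot> u' \<oplus> Y (i - 2) \<odot> v'" by blast
    have "v = h (i - 1) \<odot> neg C u' \<oplus> Y (i - 2) \<odot> neg C v'"
      unfolding nn[of v, symmetric] u(4) by (simp add: cmp_neg neg_pls)
    moreover have "u = P (i - 1) \<odot> neg C u'" using u(3) by (simp add: cmp_neg neg_cmp)
    ultimately show "?B T u v" using u by (intro bexI[of _ "neg C u'"] bexI[of _ "neg C v'"]) auto
  next
    assume "?B T u v"
    then obtain u' v' where u: "u' \<in> homset C T (dm C (P (i - 1)))" "v' \<in> homset C T (dm C (Y (i - 2)))"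
      "u = P (i - 1) \<odot> u'" "v = h (i - 1) \<odot> u' \<oplus> Y (i - 2) \<odot> v'" by blast
    have "neg C v = h (i - 1) \<odot> neg C u' \<oplus> Y (i - 2) \<odot> neg C v'"
      unfolding u(4) by (simp add: cmp_neg neg_pls)
    moreover have "u = neg C (P (i - 1)) \<odot> neg C u'" using u(3) by (simp add: cmp_neg neg_cmp)
    ultimately show "?A T u (neg C v)" using u by (intro bexI[of _ "neg C u'"] bexI[of _ "neg C v'"]) auto
  qed
  have 4: "(\<forall>v\<in>homset C T A. Q v) \<longleftrightarrow> (\<forall>v\<in>homset C T A. Q (neg C v))" for T A Q
  proof -
    have "v \<in> homset C T A \<Longrightarrow> neg C v \<in> homset C T A" for v by simp
    then show ?thesis by (metis neg_neg)
  qed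
  have "triangular_exact_at C S (\<lambda>i. neg C (P i)) h (\<lambda>i. Y (i - 1)) i \<longleftrightarrow> (\<forall>T\<in>S. \<forall>u\<in>homset C T (dm C (P i)). \<forall>v\<in>homset C T (dm C (Y (i - 1))).
     neg C (P i) \<odot> u = zer C T (cd C (P i)) \<and> h i \<odot> u \<oplus> Y (i - 1) \<odot> v = zer C T (cd C (Y (i - 1))) \<longrightarrow> ?A T u v)"
    unfolding triangular_exact_at_def e by (simp add: d(1,5))
  also have "\<dots> \<longleftrightarrow> (\<forall>T\<in>S. \<forall>u\<in>homset C T (dm C (P i)). \<forall>v\<in>homset C T (dm C (Y (i - 1))).
     neg C (P i) \<odot> u = zer C T (cd C (P i)) \<and> h i \<odot> u \<oplus> Y (i - 1) \<odot> neg C v = zer C T (cd C (Y (i - 1))) \<longrightarrow> ?A T u (neg C v))"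
    by (subst 4) (rule refl)
  also have "\<dots> \<longleftrightarrow> pullback_exact_at C S h P Y i"
    unfolding pullback_exact_at_def by (simp only: 1 2 3 c cong: ball_cong)
  finally show ?thesis .
qed

lemma int_complex_neg:
  assumes "int_complex C S X" shows "int_complex C S (\<lambda>i. neg C (X i))"
proof -
  note d = int_complexD[OF assms]
  show ?thesis unfolding int_complex_def by (simp add: d neg_cmp cmp_neg)
qed

lemma int_complex_shift:
  assumes "int_complex C S X" shows "int_complex C S (\<lambda>i. X (i + k))"
proof -
  note d = int_complexD[OF assms]
  have e: "i + 1 + k = i + k + 1" "i + 2 + k = i + k + 2" for i by auto
  show ?thesis unfolding int_complex_def e using d by blast
qed

lemma int_complex_shift_neg: "int_complex C S X \<Longrightarrow> int_complex C S (\<lambda>i. X (i - 1))"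
  using int_complex_shift[of S X "-1"] by simp

lemma cone_cov_exact_iff:
  assumes P: "int_complex C S1 P" and Y: "int_complex C S1 Y" and W: "int_complex C S2 W" and
    h: "\<And>i. h i \<in> homset C (dm C (P i)) (dm C (Y i))"
    and t: "triangular C P h (\<lambda>i. neg C (Y (i - 1))) W i1 i2 p1 p2 \<or> triangular C (\<lambda>i. neg C (P i)) h (\<lambda>i. Y (i - 1)) W i1 i2 p1 p2"
  shows "cov_exact_at C S W i \<longleftrightarrow> pullback_exact_at C S h P Y i"
  using t
proof
  assume t: "triangular C P h (\<lambda>i. neg C (Y (i - 1))) W i1 i2 p1 p2"
  show ?thesis using triangular_cov_exact_iff[OF P int_complex_neg[OF int_complex_shift_neg[OF Y]] W t] triangular_exact_neg_right[OF P Y h] by simp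
next
  assume t: "triangular C (\<lambda>i. neg C (P i)) h (\<lambda>i. Y (i - 1)) W i1 i2 p1 p2"
  show ?thesis using triangular_cov_exact_iff[OF int_complex_neg[OF P] int_complex_shift_neg[OF Y] W t] triangular_exact_neg_left[OF P Y h] by simp
qed

text \<open>
  Over \<open>opp C\<close> the complex \<open>W\<close> is the cone of the reversed map from \<open>Y\<close> to \<open>P\<close>, formed with the
  other sign convention; so this is the dual of \<open>cone_cov_exact_iff\<close>.
\<close>

lemma cone_contra_exact_iff:
  assumes P: "int_complex C S1 P" and Y: "int_complex C S1 Y" and W: "int_complex C S2 W" and
    h: "\<And>i. h i \<in> homset C (dm C (P i)) (dm C (Y i))"
    and t: "triangular C P h (\<lambda>i. neg C (Y (i - 1))) W i1 i2 p1 p2 \<or> triangular C (\<lambda>i. neg C (P i)) h (\<lambda>i. Y (i - 1)) W i1 i2 p1 p2"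
  shows "contra_exact_at C S W i \<longleftrightarrow> pushout_exact_at C S h P Y (i - 1)"
proof -
  interpret o: arrow_category "opp C" by (rule opp_arrow_category)
  have e: "reflect 1 (\<lambda>i. neg C (Y (i - 1))) = (\<lambda>i. neg (opp C) (reflect 0 Y i))"
    "reflect 1 P = (\<lambda>i. reflect 0 P (i - 1))" "reflect 1 (\<lambda>i. neg C (P i)) = (\<lambda>i. neg (opp C) (reflect 0 P (i - 1)))"
    "reflect 1 (\<lambda>i. Y (i - 1)) = reflect 0 Y"
    by (auto simp: reflect_def)
  have t': "triangular (opp C) (reflect 0 Y) (reflect 1 h) (\<lambda>i. neg (opp C) (reflect 0 P (i - 1))) (reflect 1 W)
      (reflect 2 p2) (reflect 2 p1) (reflect 2 i2) (reflect 2 i1) \<or>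
    triangular (opp C) (\<lambda>i. neg (opp C) (reflect 0 Y i)) (reflect 1 h) (\<lambda>i. reflect 0 P (i - 1)) (reflect 1 W)
      (reflect 2 p2) (reflect 2 p1) (reflect 2 i2) (reflect 2 i1)"
    using t
  proof
    assume t: "triangular C P h (\<lambda>i. neg C (Y (i - 1))) W i1 i2 p1 p2"
    show ?thesis using triangular_opp[OF P int_complex_neg[OF int_complex_shift_neg[OF Y]] W t, of 1] unfolding e by simp
  next
    assume t: "triangular C (\<lambda>i. neg C (P i)) h (\<lambda>i. Y (i - 1)) W i1 i2 p1 p2"
    show ?thesis using triangular_opp[OF int_complex_neg[OF P] int_complex_shift_neg[OF Y] W t, of 1] unfolding e by simp
  qed
  have h': "reflect 1 h i \<in> homset (opp C) (dm (opp C) (reflect 0 Y i)) (dm (opp C) (reflect 0 P i))" for i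
    using h[of "1 - i"] int_complexD(3)[OF P, of "- i"] int_complexD(3)[OF Y, of "- i"] by (simp add: reflect_def)
  have "cov_exact_at (opp C) S (reflect 1 W) (2 - i) = pullback_exact_at (opp C) S (reflect 1 h) (reflect 0 Y) (reflect 0 P) (2 - i)"
    by (rule o.cone_cov_exact_iff[OF int_complex_opp[OF Y] int_complex_opp[OF P] int_complex_opp[OF W] h' t'])
  then show ?thesis using pullback_exact_opp[of C S 0 h Y P "2 - i"] by (simp add: cov_exact_opp)
qed

lemma triangular_exists:
  assumes a: "int_complex C S a" and c: "int_complex C S c"
    and b: "\<And>i. b i \<in> homset C (dm C (a i)) (dm C (c (i + 1)))"
    and r: "\<And>i. b (i + 1) \<odot> a i \<oplus> c (i + 1) \<odot> b i = zer C (dm C (a i)) (dm C (c (i + 2)))"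
    and bp: "\<And>i. biproduct C (dm C (a i)) (dm C (c i)) (s i) (i1 i) (i2 i) (p1 i) (p2 i)" and s: "\<And>i. s i \<in> S'"
  shows "\<exists>W. int_complex C S' W \<and> (\<forall>i. dm C (W i) = s i) \<and> triangular C a b c W i1 i2 p1 p2"
proof -
  note d = int_complexD[OF a] int_complexD[OF c]
  define W where "W i = i1 (i + 1) \<odot> a i \<odot> p1 i \<oplus> i2 (i + 1) \<odot> b i \<odot> p1 i \<oplus> i2 (i + 1) \<odot> c i \<odot> p2 i" for i
  have b': "arr C (b i)" "dm C (b i) = dm C (a i)" "cd C (b i) = dm C (c (i + 1))" for i using b[of i] by auto
  have td: "arr C (i1 i)" "dm C (i1 i) = dm C (a i)" "cd C (i1 i) = s i"
    "arr C (i2 i)" "dm C (i2 i) = dm C (c i)" "cd C (i2 i) = s i"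
    "arr C (p1 i)" "dm C (p1 i) = s i" "cd C (p1 i) = dm C (a i)"
    "arr C (p2 i)" "dm C (p2 i) = s i" "cd C (p2 i) = dm C (c i)" for i
    using bp[of i] unfolding biproduct_def by auto
  have Wt: "arr C (W i)" "dm C (W i) = s i" "cd C (W i) = s (i + 1)" for i
    by (simp_all add: W_def td b' d)
  have t: "triangular C a b c W i1 i2 p1 p2" unfolding triangular_def Wt using bp b' by (simp add: d W_def)
  have "W (i + 1) \<odot> W i = zer C (s i) (s (i + 2))" for i
  proof -
    have e: "i + 1 + 1 = i + 2" by simp
    have sO: "s j \<in> Ob C" for j using dm_Ob[OF Wt(1)[of j]] Wt(2) by simp
    have aa: "a (i + 1) \<odot> a i \<odot> p1 i = zer C (s i) (dm C (a (i + 2)))"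
      using int_complex_sq_cmp[OF a refl, of "p1 i" i] by (simp add: td)
    have cc: "c (i + 1) \<odot> c i \<odot> p2 i = zer C (s i) (dm C (c (i + 2)))"
      using int_complex_sq_cmp[OF c refl, of "p2 i" i] by (simp add: td)
    have ba: "b (i + 1) \<odot> a i \<odot> p1 i \<oplus> c (i + 1) \<odot> b i \<odot> p1 i = zer C (s i) (dm C (c (i + 2)))"
    proof -
      have "b (i + 1) \<odot> a i \<odot> p1 i \<oplus> c (i + 1) \<odot> b i \<odot> p1 i = (b (i + 1) \<odot> a i \<oplus> c (i + 1) \<odot> b i) \<odot> p1 i"
        by (simp add: pls_cmp cmp_assoc)
      then show ?thesis unfolding r by (simp add: td d)
    qed
    have Wi: "p1 (i + 1) \<odot> W i = a i \<odot> p1 i" "p2 (i + 1) \<odot> W i = b i \<odot> p1 i \<oplus> c i \<odot> p2 i"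
      by (simp_all add: W_def[of i] cmp_pls triangular_biproduct_cmp[OF t] td b' d sO)
    have "W (i + 1) \<odot> W i = i1 (i + 2) \<odot> a (i + 1) \<odot> (p1 (i + 1) \<odot> W i) \<oplus>
        i2 (i + 2) \<odot> b (i + 1) \<odot> (p1 (i + 1) \<odot> W i) \<oplus> i2 (i + 2) \<odot> c (i + 1) \<odot> (p2 (i + 1) \<odot> W i)"
      by (subst W_def[of "i + 1"]) (simp add: pls_cmp cmp_assoc add.commute)
    also have "\<dots> = i1 (i + 2) \<odot> (a (i + 1) \<odot> a i \<odot> p1 i) \<oplus>
        i2 (i + 2) \<odot> ((b (i + 1) \<odot> a i \<odot> p1 i \<oplus> c (i + 1) \<odot> b i \<odot> p1 i) \<oplus> c (i + 1) \<odot> c i \<odot> p2 i)"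
      unfolding Wi by (simp add: cmp_pls pls_assoc)
    also have "\<dots> = zer C (s i) (s (i + 2))"
      unfolding aa ba cc by (simp add: td sO d)
    finally show ?thesis .
  qed
  then have "int_complex C S' W" unfolding int_complex_def Wt using Wt(1) s by blast
  then show ?thesis using t Wt(2) by blast
qed

lemma biproduct_zero_right: "A \<in> Ob C \<Longrightarrow> biproduct C A (zo C) A (idt C A) (zer C (zo C) A) (idt C A) (zer C A (zo C))"
  by (simp add: biproduct_def zo_zero)

lemma biproduct_zero_left: "A \<in> Ob C \<Longrightarrow> biproduct C (zo C) A A (zer C (zo C) A) (idt C A) (zer C A (zo C)) (idt C A)"
  by (simp add: biproduct_def zo_zero)

text \<open>
  Biproducts with \<open>zo\<close> are chosen to be the other summand itself. As a result, cones of bounded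
  complexes are bounded, and their first and last terms are equal to terms of the given complexes
  and not merely isomorphic.
\<close>

lemma biproduct_family:
  assumes bp: "\<And>A B. \<lbrakk>A \<in> S; B \<in> S\<rbrakk> \<Longrightarrow> \<exists>s i1 i2 p1 p2. s \<in> S \<and> biproduct C A B s i1 i2 p1 p2"
    and A: "\<And>i. A i \<in> S" and B: "\<And>i. B i \<in> S" and SO: "S \<subseteq> Ob C"
  shows "\<exists>s i1 i2 p1 p2. \<forall>i::int. s i \<in> S \<and> biproduct C (A i) (B i) (s i) (i1 i) (i2 i) (p1 i) (p2 i) \<and>
    (B i = zo C \<longrightarrow> s i = A i \<and> i1 i = idt C (A i) \<and> p1 i = idt C (A i)) \<and>
    (A i = zo C \<longrightarrow> s i = B i \<and> i2 i = idt C (B i) \<and> p2 i = idt C (B i))"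
proof -
  define Q where "Q i z \<longleftrightarrow> (case z of (s, i1, i2, p1, p2) \<Rightarrow> s \<in> S \<and> biproduct C (A i) (B i) s i1 i2 p1 p2 \<and>
    (B i = zo C \<longrightarrow> s = A i \<and> i1 = idt C (A i) \<and> p1 = idt C (A i)) \<and>
    (A i = zo C \<longrightarrow> s = B i \<and> i2 = idt C (B i) \<and> p2 = idt C (B i)))" for i z
  have "\<exists>z. Q i z" for i
  proof -
    have O: "A i \<in> Ob C" "B i \<in> Ob C" using A B SO by auto
    consider "B i = zo C" | "B i \<noteq> zo C" "A i = zo C" | "B i \<noteq> zo C" "A i \<noteq> zo C" by blast
    then show ?thesis
    proof cases
      case 1
      then show ?thesis using biproduct_zero_right[OF O(1)] A[of i]
        by (intro exI[of _ "(A i, idt C (A i), zer C (zo C) (A i), idt C (A i), zer C (A i) (zo C))"]) (auto simp: Q_def zo_zero)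
    next
      case 2
      then show ?thesis using biproduct_zero_left[OF O(2)] B[of i]
        by (intro exI[of _ "(B i, zer C (zo C) (B i), idt C (B i), zer C (B i) (zo C), idt C (B i))"]) (auto simp: Q_def)
    next
      case 3
      then show ?thesis using bp[OF A[of i] B[of i]] by (auto simp: Q_def)
    qed
  qed
  then obtain F where F: "Q i (F i)" for i by metis
  show ?thesis
    by (rule exI[of _ "\<lambda>i. fst (F i)"], rule exI[of _ "\<lambda>i. fst (snd (F i))"],
        rule exI[of _ "\<lambda>i. fst (snd (snd (F i)))"], rule exI[of _ "\<lambda>i. fst (snd (snd (snd (F i))))"],
        rule exI[of _ "\<lambda>i. snd (snd (snd (snd (F i))))"], rule allI)
      (rule F[unfolded Q_def case_prod_unfold])
qed

section \<open>Composition of admissible monomorphisms\<close>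

text \<open>
  The chain map \<open>r : W \<rightarrow> X[1]\<close> (in degrees at least \<open>0\<close>) is the identity of \<open>X\<^sub>1\<close> in degree \<open>0\<close>
  and the projection \<open>M \<oplus> X\<^sub>2 \<rightarrow> X\<^sub>2\<close> in degree \<open>1\<close>. Cancelling these two contractible parts in
  the cone of \<open>r\<close> leaves \<open>M \<rightarrow> W\<^sub>2 \<rightarrow> W\<^sub>3 \<oplus> X\<^sub>3 \<rightarrow> \<dots> \<rightarrow> W\<^bsub>N+1\<^esub> \<oplus> X\<^bsub>N+1\<^esub>\<close>, and \<open>X\<^sub>0\<close> becomes the
  kernel of its first arrow via \<open>X\<^sub>0 \<rightarrow> X\<^sub>1 \<rightarrow> M\<close>. This sequence \<open>Z\<close> is the cone of a chain map \<open>b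
  : a \<rightarrow> Y\<close> for \<open>a = (X\<^sub>0 \<rightarrow> M \<rightarrow> W\<^sub>2 \<rightarrow> W\<^sub>3 \<rightarrow> \<dots>)\<close> and \<open>Y = (X\<^sub>3 \<rightarrow> X\<^sub>4 \<rightarrow> \<dots>)\<close>, placed in degrees \<open>2,
  3, \<dots>\<close>. In high degrees its exactness follows from that of \<open>W\<close> and \<open>X\<close> as for any cone; in low
  degrees the cancelled terms are restored by hand.
\<close>

lemma splice_n_exact:
  assumes N: "1 \<le> N" and B: "B \<subseteq> Ob C" "zo C \<in> B"
    and bp: "\<And>A A'. \<lbrakk>A \<in> B; A' \<in> B\<rbrakk> \<Longrightarrow> \<exists>s i1 i2 p1 p2. s \<in> B \<and> biproduct C A A' s i1 i2 p1 p2"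
    and X: "int_complex C B X" "bounded_in C 0 (N + 1) X" "n_exact_for C N (Ob C) X"
    and W: "int_complex C B W" "bounded_in C 0 (N + 1) W" "n_exact_for C N (Ob C) W"
    and W1: "biproduct C M (dm C (X 2)) (dm C (W 1)) j1 j2 q1 q2" and M: "M \<in> B"
    and g: "g \<in> homset C (dm C (X 1)) M"
    and W0: "W 0 = j1 \<odot> g \<oplus> j2 \<odot> X 1"
  shows "\<exists>Z. int_complex C B Z \<and> bounded_in C 0 (N + 1) Z \<and> n_exact_for C N (Ob C) Z \<and> Z 0 = g \<odot> X 0"
proof -
  note XC = X(1) and WC = W(1)
  note d = int_complexD[OF XC] int_complexD[OF WC]
  have eX: "i \<le> N \<Longrightarrow> cov_exact_at C (Ob C) X i" "1 \<le> i \<Longrightarrow> contra_exact_at C (Ob C) X i"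
    and eW: "i \<le> N \<Longrightarrow> cov_exact_at C (Ob C) W i" "1 \<le> i \<Longrightarrow> contra_exact_at C (Ob C) W i" for i
    using X(3) W(3) unfolding n_exact_for_def by auto
  have bX: "i < 0 \<or> i > N + 1 \<Longrightarrow> dm C (X i) = zo C" and bW: "i < 0 \<or> i > N + 1 \<Longrightarrow> dm C (W i) = zo C" for i
    using X(2) W(2) unfolding bounded_in_def by auto
  have jq: "arr C j1" "dm C j1 = M" "cd C j1 = dm C (W 1)" "arr C j2" "dm C j2 = dm C (X 2)" "cd C j2 = dm C (W 1)"
    "arr C q1" "dm C q1 = dm C (W 1)" "cd C q1 = M" "arr C q2" "dm C q2 = dm C (W 1)" "cd C q2 = dm C (X 2)"
    and jqe: "q1 \<odot> j1 = idt C M" "q2 \<odot> j2 = idt C (dm C (X 2))" "q1 \<odot> j2 = zer C (dm C (X 2)) M"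
    "q2 \<odot> j1 = zer C M (dm C (X 2))" "j1 \<odot> q1 \<oplus> j2 \<odot> q2 = idt C (dm C (W 1))"
    using W1 unfolding biproduct_def by auto
  have MO: "M \<in> Ob C" using M B by auto
  have cX: "cd C (X 0) = dm C (X 1)" "cd C (X 1) = dm C (X 2)" "cd C (X 2) = dm C (X 3)"
    and cW: "cd C (W 0) = dm C (W 1)" "cd C (W 1) = dm C (W 2)" "cd C (W 2) = dm C (W 3)"
    using d(3)[of 0] d(3)[of 1] d(3)[of 2] d(7)[of 0] d(7)[of 1] d(7)[of 2] by auto
  have g': "arr C g" "dm C g = dm C (X 1)" "cd C g = M" using g by auto
  have dW0: "dm C (W 0) = dm C (X 1)" using W0 g' jq d cX by simp
  have jqc: "q1 \<odot> j1 \<odot> u = u" "q1 \<odot> j2 \<odot> v = zer C (dm C v) M" "q2 \<odot> j2 \<odot> v = v"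
    "q2 \<odot> j1 \<odot> u = zer C (dm C u) (dm C (X 2))"
    if "arr C u" "cd C u = M" "arr C v" "cd C v = dm C (X 2)" for u v
    using that MO d(1)[of 2] by (simp_all add: cmp_assoc[symmetric] jqe)
  (* The components 1 and q2 in degrees 0 and 1 commute with the differentials because W 0 = (g, X 1),
     so contravariant exactness of W extends them to r. *)
  have "\<exists>f. f 0 = idt C (dm C (X 1)) \<and> f (0 + 1) = q2 \<and> (\<forall>i\<ge>0. f i \<in> homset C (dm C (W i)) (dm C (X (i + 1)))) \<and>
    (\<forall>i\<ge>0. f (i + 1) \<odot> W i = X (i + 1) \<odot> f i)"
    by (rule chain_map_extends_above[OF WC int_complex_shift[OF int_complex_Ob[OF XC], of 1]])
      (use eW dW0 d(1)[of 1] jq jqc[of g "X 1"] g' cX W0 MO in \<open>auto simp: cmp_pls\<close>)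
  then obtain r where r0: "r 0 = idt C (dm C (X 1))" and r1: "r 1 = q2" and
    r: "\<And>i. 0 \<le> i \<Longrightarrow> r i \<in> homset C (dm C (W i)) (dm C (X (i + 1)))"
    and rs: "\<And>i. 0 \<le> i \<Longrightarrow> r (i + 1) \<odot> W i = X (i + 1) \<odot> r i" by auto
  have rt: "arr C (r i)" "dm C (r i) = dm C (W i)" "cd C (r i) = dm C (X (i + 1))" if "0 \<le> i" for i
    using r[OF that] by auto
  have r2: "r 2 \<odot> W 1 = X 2 \<odot> q2" using rs[of 1] r1 by simp
  have r2c: "r 2 \<odot> W 1 \<odot> u = X 2 \<odot> q2 \<odot> u" for u using r2 by (metis cmp_assoc)
  have rsc: "r (i + 1) \<odot> W i \<odot> u = X (i + 1) \<odot> r i \<odot> u" if "0 \<le> i" for i u using rs[OF that] by (metis cmp_assoc)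
  have W0u: "W 0 \<odot> u = j1 \<odot> g \<odot> u \<oplus> j2 \<odot> X 1 \<odot> u" for u by (simp add: W0 pls_cmp cmp_assoc)
  have W10: "W 1 \<odot> W 0 = zer C (dm C (X 1)) (dm C (W 2))" using int_complex_sq[OF WC, of 1 0] dW0 by simp
  have X10: "X 1 \<odot> X 0 = zer C (dm C (X 0)) (dm C (X 2))" using int_complex_sq[OF XC, of 1 0] by simp
  (* The composite of g X 0 with W 1 j1 vanishes as W 0 X 0 = (g X 0, X 1 X 0) = j1 g X 0. *)
  define a where "a i = (if 2 \<le> i then W i else if i = 1 then W 1 \<odot> j1 else if i = 0 then g \<odot> X 0 else X i)" for i
  have ad: "dm C (a i) = (if 2 \<le> i then dm C (W i) else if i = 1 then M else dm C (X i))" for i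
    by (auto simp: a_def jq g' d(1,5) cX cW)
  have aa: "arr C (a i)" for i by (auto simp: a_def jq g' d(1,5) cX cW)
  have ac: "cd C (a i) = dm C (a (i + 1))" for i
  proof -
    consider "2 \<le> i" | "i = 1" | "i = 0" | "i = -1" | "i < -1" by linarith
    then show ?thesis by cases (auto simp: ad, auto simp: a_def jq g' d(1,3,5,7) cX cW)
  qed
  have ac2: "cd C (a (i + 1)) = dm C (a (i + 2))" for i using ac[of "i + 1"] by (simp add: add.commute)
  have a10: "a 1 \<odot> a 0 = zer C (dm C (X 0)) (dm C (W 2))"
  proof -
    have "W 1 \<odot> (j1 \<odot> g \<odot> X 0 \<oplus> j2 \<odot> X 1 \<odot> X 0) = (W 1 \<odot> W 0) \<odot> X 0" by (simp add: W0u cmp_assoc)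
    also have "\<dots> = zer C (dm C (X 0)) (dm C (W 2))" unfolding W10 by (simp add: cX d)
    finally have "W 1 \<odot> (j1 \<odot> g \<odot> X 0 \<oplus> j2 \<odot> X 1 \<odot> X 0) = zer C (dm C (X 0)) (dm C (W 2))" .
    then show ?thesis by (simp add: a_def X10 jq g' cX d cmp_assoc)
  qed
  have aC: "int_complex C B a" unfolding int_complex_def
  proof (intro allI conjI)
    fix i
    show "arr C (a i)" by (rule aa)
    show "dm C (a i) \<in> B" using d M by (auto simp: ad)
    show "cd C (a i) = dm C (a (i + 1))" by (rule ac)
    consider "2 \<le> i" | "i = 1" | "i = 0" | "i < 0" by linarith
    then show "a (i + 1) \<odot> a i = zer C (dm C (a i)) (dm C (a (i + 2)))"
    proof cases
      case 1 then show ?thesis by (simp add: a_def d)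
    next
      case 2
      have "W 2 \<odot> W 1 \<odot> j1 = zer C M (dm C (W 3))" using int_complex_sq_cmp[OF WC, of 2 1 j1] jq by simp
      then show ?thesis using 2 jq d MO by (simp add: a_def ad cW)
    next
      case 3 then show ?thesis using a10 by (simp add: ad)
    next
      case 4
      then have "dm C (a i) = zo C" using bX by (simp add: ad)
      then show ?thesis using of_zo[of "a (i + 1) \<odot> a i" "dm C (a i)" "dm C (a (i + 2))"] aa ac ac2 by simp
    qed
  qed
  define Y where "Y = (\<lambda>i. trunc_ge C 3 X (i + 1))"
  define b where "b i = (if 2 \<le> i then r i else zer C (dm C (a i)) (zo C))" for i
  have YC: "int_complex C B Y" unfolding Y_def by (rule int_complex_shift[OF int_complex_trunc_ge[OF XC B(2)]])
  note Yd = int_complexD[OF YC]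
  have Ydm: "dm C (Y i) = (if 2 \<le> i then dm C (X (i + 1)) else zo C)" for i
    unfolding Y_def trunc_ge_dm[OF XC] by auto
  have bt: "b i \<in> homset C (dm C (a i)) (dm C (Y i))" for i
  proof (cases "2 \<le> i")
    case True then show ?thesis using rt[of i] by (simp add: b_def ad Ydm)
  next
    case False
    have "dm C (a i) \<in> Ob C" using aa by simp
    then show ?thesis using False by (simp add: b_def Ydm)
  qed
  have bt': "arr C (b i)" "dm C (b i) = dm C (a i)" "cd C (b i) = dm C (Y i)" for i using bt[of i] by auto
  have Yi: "Y i = X (i + 1)" if "2 \<le> i" for i using that by (simp add: Y_def trunc_ge_def)
  have bc: "b (i + 1) \<odot> a i = Y i \<odot> b i" for i
  proof -
    consider "2 \<le> i" | "i = 1" | "i \<le> 0" by linarith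
    then show ?thesis
    proof cases
      case 1 then show ?thesis using rs[of i] by (simp add: a_def b_def Yi)
    next
      case 2
      have "b 2 \<odot> a 1 = X 2 \<odot> q2 \<odot> j1" using r2c by (simp add: a_def b_def)
      also have "\<dots> = zer C M (dm C (X 3))" unfolding jqe using MO d by (simp add: cX)
      finally have "b 2 \<odot> a 1 = zer C M (dm C (X 3))" .
      moreover have "Y 1 \<odot> b 1 = zer C M (dm C (X 3))"
        using cmp_through_zo[of "b 1" M "dm C (Y 1)" "Y 1" "dm C (X 3)"] bt[of 1] Yd(1,3) by (simp add: Ydm ad)
      ultimately show ?thesis using 2 by simp
    next
      case 3
      have "b (i + 1) \<odot> a i = zer C (dm C (a i)) (zo C)" "Y i \<odot> b i = zer C (dm C (a i)) (zo C)"
        using 3 Yd bt' aa ac by (intro to_zo[OF _ refl]; simp add: Ydm)+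
      then show ?thesis by simp
    qed
  qed
  (* The convention with diagonal (a, -Y) gives Z 0 = a 0, without a sign. *)
  have cC: "int_complex C B (\<lambda>i. neg C (Y (i - 1)))" by (rule int_complex_neg[OF int_complex_shift_neg[OF YC]])
  have cdm: "dm C (neg C (Y (i - 1))) = dm C (Y (i - 1))" for i using Yd by simp
  obtain s i1 i2 p1 p2 where bs: "\<And>i::int. s i \<in> B \<and> biproduct C (dm C (a i)) (dm C (Y (i - 1))) (s i) (i1 i) (i2 i) (p1 i) (p2 i) \<and>
    (dm C (Y (i - 1)) = zo C \<longrightarrow> s i = dm C (a i) \<and> i1 i = idt C (dm C (a i)) \<and> p1 i = idt C (dm C (a i))) \<and>
    (dm C (a i) = zo C \<longrightarrow> s i = dm C (Y (i - 1)) \<and> i2 i = idt C (dm C (Y (i - 1))) \<and> p2 i = idt C (dm C (Y (i - 1))))"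
    using biproduct_family[OF bp _ _ B(1), of "\<lambda>i. dm C (a i)" "\<lambda>i. dm C (Y (i - 1))"] int_complexD(2)[OF aC] Yd(2) by blast
  have "\<exists>Z. int_complex C B Z \<and> (\<forall>i. dm C (Z i) = s i) \<and> triangular C a b (\<lambda>i. neg C (Y (i - 1))) Z i1 i2 p1 p2"
  proof (rule triangular_exists[OF aC cC])
    fix i
    show "b i \<in> homset C (dm C (a i)) (dm C (neg C (Y (i + 1 - 1))))" using bt[of i] Yd by simp
    have "b (i + 1) \<odot> a i \<oplus> neg C (Y i) \<odot> b i = zer C (dm C (a i)) (dm C (Y (i + 1)))"
      unfolding neg_cmp bc using bt' Yd by (simp add: pls_neg)
    then show "b (i + 1) \<odot> a i \<oplus> neg C (Y (i + 1 - 1)) \<odot> b i = zer C (dm C (a i)) (dm C (neg C (Y (i + 2 - 1))))"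
      using Yd by (simp add: add.commute)
    show "biproduct C (dm C (a i)) (dm C (neg C (Y (i - 1)))) (s i) (i1 i) (i2 i) (p1 i) (p2 i)"
      unfolding cdm using bs by blast
    show "s i \<in> B" using bs by blast
  qed
  then obtain Z where ZC: "int_complex C B Z" and Zd: "\<And>i. dm C (Z i) = s i" and Zt: "triangular C a b (\<lambda>i. neg C (Y (i - 1))) Z i1 i2 p1 p2"
    by blast
  have "bounded_in C 0 (N + 1) Z" unfolding bounded_in_def
  proof (intro allI impI)
    fix i assume i: "i < 0 \<or> i > N + 1"
    have "dm C (a i) = zo C" "dm C (Y (i - 1)) = zo C" using i N bX[of i] bW[of i] by (auto simp: ad Ydm)
    then show "dm C (Z i) = zo C" using bs[of i] Zd by simp
  qed
  moreover have "Z 0 = g \<odot> X 0"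
  proof -
    have z: "dm C (Y 0) = zo C" "dm C (Y (-1)) = zo C" by (simp_all add: Ydm)
    have i1: "i1 1 = idt C M" "p1 0 = idt C (dm C (X 0))" using bs[of 1] bs[of 0] z by (simp_all add: ad)
    have td: "arr C (i2 1)" "dm C (i2 1) = zo C" "cd C (i2 1) = M" "arr C (p2 0)" "dm C (p2 0) = dm C (X 0)" "cd C (p2 0) = zo C"
      using triangularD[OF aC cC Zt] bs[of 1] bs[of 0] z by (simp_all add: Zd cdm ad)
    have b0: "b 0 = zer C (dm C (X 0)) (zo C)" by (simp add: b_def ad)
    have p0: "p2 0 = zer C (dm C (X 0)) (zo C)" using to_zo[of "p2 0"] td by simp
    have "Z 0 = i1 1 \<odot> a 0 \<odot> p1 0 \<oplus> i2 1 \<odot> b 0 \<odot> p1 0 \<oplus> i2 1 \<odot> neg C (Y (-1)) \<odot> p2 0"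
      using triangular_eq[OF Zt, of 0] by simp
    also have "\<dots> = g \<odot> X 0"
      unfolding i1 b0 p0 using td Yd z MO g' cX by (simp add: a_def d)
    finally show ?thesis .
  qed
  moreover have "cov_exact_at C (Ob C) Z i" if iN: "i \<le> N" for i
  proof -
    have "pullback_exact_at C (Ob C) b a Y i" unfolding pullback_exact_at_def
    proof (intro ballI impI, elim conjE)
      fix T u v assume T: "T \<in> Ob C" and u: "u \<in> homset C T (dm C (a i))" and v: "v \<in> homset C T (dm C (Y (i - 1)))"
        and e1: "a i \<odot> u = zer C T (cd C (a i))" and e2: "b i \<odot> u = Y (i - 1) \<odot> v"
      have vz: "v = zer C T (zo C)" if "i \<le> 2" using v that by (intro to_zo[of v T "dm C (Y (i - 1))"]) (auto simp: Ydm)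
      have goalz: "\<exists>u'\<in>homset C T (dm C (a (i - 1))). \<exists>v'\<in>homset C T (dm C (Y (i - 2))).
           u = a (i - 1) \<odot> u' \<and> v = b (i - 1) \<odot> u' \<oplus> Y (i - 2) \<odot> v'"
        if i2: "i \<le> 2" and u': "u' \<in> homset C T (dm C (a (i - 1)))" "u = a (i - 1) \<odot> u'" for u'
      proof (rule bexI[OF _ u'(1)], rule bexI[of _ "zer C T (dm C (Y (i - 2)))"], intro conjI u'(2))
        have c: "cd C (Y (i - 2)) = dm C (Y (i - 1))" using Yd(3)[of "i - 2"] by simp
        have "b (i - 1) \<odot> u' \<oplus> Y (i - 2) \<odot> zer C T (dm C (Y (i - 2))) = zer C T (zo C)"
          by (rule to_zo[of _ T "dm C (Y (i - 1))"]) (use i2 u' bt' T Yd c in \<open>simp_all add: Ydm\<close>)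
        then show "v = b (i - 1) \<odot> u' \<oplus> Y (i - 2) \<odot> zer C T (dm C (Y (i - 2)))" using vz[OF i2] by simp
      qed (use T Yd in simp)
      consider "i < 0" | "i = 0" | "i = 1" | "i = 2" | "3 \<le> i" by linarith
      then show "\<exists>u'\<in>homset C T (dm C (a (i - 1))). \<exists>v'\<in>homset C T (dm C (Y (i - 2))).
           u = a (i - 1) \<odot> u' \<and> v = b (i - 1) \<odot> u' \<oplus> Y (i - 2) \<odot> v'"
      proof cases
        case 1
        have c: "cd C (a (i - 1)) = dm C (a i)" using ac[of "i - 1"] by simp
        have z: "dm C (a i) = zo C" using 1 bX[of i] by (simp add: ad)
        have "u = zer C T (zo C)" using to_zo[OF u z] .
        then have "u = a (i - 1) \<odot> zer C T (dm C (a (i - 1)))" using aa T c z by simp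
        then show ?thesis using 1 aa T by (intro goalz[of "zer C T (dm C (a (i - 1)))"]) auto
      next
        case 2
        (* As g X 0 u = 0 and X 1 X 0 = 0, also W 0 X 0 u = 0; and both W 0 and X 0 are monomorphisms. *)
        have u0: "arr C u" "dm C u = T" "cd C u = dm C (X 0)" using u 2 by (auto simp: ad)
        have a0c: "cd C (a 0) = M" using ac[of 0] by (simp add: ad)
        have gx: "g \<odot> X 0 \<odot> u = zer C T M" using e1 2 a0c by (simp add: a_def cmp_assoc)
        have X1u: "X 1 \<odot> X 0 \<odot> u = zer C T (dm C (X 2))" using int_complex_sq_cmp[OF XC, of 1 0 u] u0 by simp
        have "W 0 \<odot> X 0 \<odot> u = zer C T (dm C (W 1))"
          unfolding W0u gx X1u using jq T MO d by simp
        then obtain w where w: "w \<in> homset C T (dm C (W (0 - 1)))" "X 0 \<odot> u = W (0 - 1) \<odot> w"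
          by - (rule cov_exactD[OF eW(1)[of 0] WC, of "X 0 \<odot> u" T], use u0 N T d cX dW0 in auto)
        have "X 0 \<odot> u = zer C T (dm C (X 1))"
          unfolding w(2) by (rule cmp_through_zo[OF w(1)]) (use bW[of "-1"] d(7)[of "-1"] dW0 d in auto)
        then obtain w' where w': "w' \<in> homset C T (dm C (X (0 - 1)))" "u = X (0 - 1) \<odot> w'"
          by - (rule cov_exactD[OF eX(1)[of 0] XC, of u T], use u0 N T in auto)
        then show ?thesis using 2 by (intro goalz[of w']) (auto simp: ad, auto simp: a_def)
      next
        case 3
        (* Exactness of W gives j1 u = W 0 m, that is u = g m and X 1 m = 0, and then m factors through X 0. *)
        have u0: "arr C u" "dm C u = T" "cd C u = M" using u 3 by (auto simp: ad)
        have "W 1 \<odot> j1 \<odot> u = zer C T (dm C (W 2))" using e1 3 ac[of 1] by (simp add: a_def ad cmp_assoc jq d cW)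
        then obtain m where m: "m \<in> homset C T (dm C (W (1 - 1)))" "j1 \<odot> u = W (1 - 1) \<odot> m"
          by - (rule cov_exactD[OF eW(1)[of 1] WC, of "j1 \<odot> u" T], use u0 N T jq in auto)
        have m': "arr C m" "dm C m = T" "cd C m = dm C (X 1)" "j1 \<odot> u = j1 \<odot> g \<odot> m \<oplus> j2 \<odot> X 1 \<odot> m"
          using m dW0 by (auto simp: W0u)
        have jm: "q1 \<odot> j1 \<odot> u = g \<odot> m" "q2 \<odot> j1 \<odot> u = X 1 \<odot> m"
          unfolding m'(4) using jqc[of "g \<odot> m" "X 1 \<odot> m"] m'(1-3) g' cX d MO by (simp_all add: cmp_pls)
        have ju: "q1 \<odot> j1 \<odot> u = u" "q2 \<odot> j1 \<odot> u = zer C T (dm C (X 2))"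
          using jqc[of u "X 1 \<odot> m"] u0 m'(1-3) d cX by simp_all
        have ug: "u = g \<odot> m" and Xm: "X 1 \<odot> m = zer C T (dm C (X 2))"
          using jm ju by (metis, metis)
        obtain f where f: "f \<in> homset C T (dm C (X (1 - 1)))" "m = X (1 - 1) \<odot> f"
          by (rule cov_exactD[OF eX(1)[of 1] XC, of m T]) (use m' N T Xm in auto)
        show ?thesis
          by (rule goalz[of f]) (use 3 f ug g' cX in \<open>auto simp: ad a_def cmp_assoc d(1)\<close>)
      next
        case 4
        (* Exactness of W gives u = W 1 y with y in M + X_2, where X 2 q2 y = r 2 u = 0. Hence q2 y = X 1 m, and
           subtracting W 0 m from y moves y into M. *)
        have u0: "arr C u" "dm C u = T" "cd C u = dm C (W 2)" using u 4 by (auto simp: ad)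
        have Wu: "W 2 \<odot> u = zer C T (dm C (W 3))" using e1 4 by (simp add: a_def cW)
        have ru: "r 2 \<odot> u = zer C T (dm C (X 3))"
        proof -
          have c: "cd C (Y 1) = dm C (X 3)" using Yd(3)[of 1] by (simp add: Ydm)
          have "r 2 \<odot> u = Y 1 \<odot> v" using e2 4 by (simp add: b_def)
          also have "\<dots> = zer C T (dm C (X 3))"
            by (rule cmp_through_zo[of v T "dm C (Y 1)"]) (use v 4 Yd c in \<open>auto simp: Ydm\<close>)
          finally show ?thesis .
        qed
        obtain y where y: "y \<in> homset C T (dm C (W (2 - 1)))" "u = W (2 - 1) \<odot> y"
          by (rule cov_exactD[OF eW(1)[of 2] WC, of u T]) (use u0 iN 4 T Wu in auto)
        have y': "arr C y" "dm C y = T" "cd C y = dm C (W 1)" "u = W 1 \<odot> y" using y by auto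
        have "X 2 \<odot> q2 \<odot> y = zer C T (dm C (X 3))" using ru unfolding y'(4) r2c .
        then obtain m where m: "m \<in> homset C T (dm C (X (2 - 1)))" "q2 \<odot> y = X (2 - 1) \<odot> m"
          by - (rule cov_exactD[OF eX(1)[of 2] XC, of "q2 \<odot> y" T], use y' iN 4 T jq in auto)
        have m': "arr C m" "dm C m = T" "cd C m = dm C (X 1)" "q2 \<odot> y = X 1 \<odot> m" using m by auto
        let ?w = "q1 \<odot> y \<oplus> neg C (g \<odot> m)"
        have "y = (j1 \<odot> q1 \<oplus> j2 \<odot> q2) \<odot> y" unfolding jqe using y' by simp
        also have "\<dots> = j1 \<odot> q1 \<odot> y \<oplus> j2 \<odot> X 1 \<odot> m" by (simp add: pls_cmp cmp_assoc m')
        also have "\<dots> = j1 \<odot> ?w \<oplus> W 0 \<odot> m"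
        proof -
          have n: "neg C (j1 \<odot> g \<odot> m) \<oplus> j1 \<odot> g \<odot> m = zer C T (dm C (W 1))"
            using m' g' jq by (subst pls_commute) (simp add: pls_neg)
          have "j1 \<odot> ?w \<oplus> W 0 \<odot> m = j1 \<odot> q1 \<odot> y \<oplus> (neg C (j1 \<odot> g \<odot> m) \<oplus> j1 \<odot> g \<odot> m) \<oplus> j2 \<odot> X 1 \<odot> m"
            by (simp add: W0u cmp_pls cmp_neg pls_assoc)
          also have "\<dots> = j1 \<odot> q1 \<odot> y \<oplus> j2 \<odot> X 1 \<odot> m" unfolding n using m' jq d cX by simp
          finally show ?thesis by simp
        qed
        finally have "u = W 1 \<odot> (j1 \<odot> ?w \<oplus> W 0 \<odot> m)" using y'(4) by simp
        also have "\<dots> = W 1 \<odot> j1 \<odot> ?w"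
        proof -
          have "W 1 \<odot> W 0 \<odot> m = (W 1 \<odot> W 0) \<odot> m" by (simp add: cmp_assoc)
          also have "\<dots> = zer C T (dm C (W 2))" unfolding W10 using m' d by simp
          finally have z: "W 1 \<odot> W 0 \<odot> m = zer C T (dm C (W 2))" .
          show ?thesis unfolding cmp_pls[of "W 1" "j1 \<odot> ?w"] z using y' m' g' jq d cW by simp
        qed
        finally have uu: "u = W 1 \<odot> j1 \<odot> ?w" .
        have "?w \<in> homset C T M" using y' m' g' jq by simp
        then show ?thesis
          by (intro goalz[of ?w]) (use 4 uu ad[of 1] in \<open>simp_all add: a_def cmp_assoc\<close>)
      next
        case 5
        have u0: "arr C u" "dm C u = T" "cd C u = dm C (W i)" using u 5 by (auto simp: ad)
        have v0: "arr C v" "dm C v = T" "cd C v = dm C (X i)" using v 5 by (auto simp: Ydm)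
        have cm: "cd C (W (i - 1)) = dm C (W i)" "cd C (X (i - 1)) = dm C (X i)"
          using d(7)[of "i - 1"] d(3)[of "i - 1"] by auto
        have Wu: "W i \<odot> u = zer C T (dm C (W (i + 1)))" using e1 5 by (simp add: a_def d)
        have ru: "r i \<odot> u = X i \<odot> v" using e2 5 by (simp add: b_def Yi)
        obtain w where w: "w \<in> homset C T (dm C (W (i - 1)))" "u = W (i - 1) \<odot> w"
          by (rule cov_exactD[OF eW(1)[OF iN] WC _ T Wu]) (use u0 in auto)
        have rt1: "arr C (r (i - 1))" "dm C (r (i - 1)) = dm C (W (i - 1))" "cd C (r (i - 1)) = dm C (X i)"
          using rt[of "i - 1"] 5 by auto
        have "X i \<odot> v = X i \<odot> r (i - 1) \<odot> w" using ru rsc[of "i - 1" w] 5 w by simp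
        then obtain x where x: "x \<in> homset C T (dm C (X (i - 1)))" "v = r (i - 1) \<odot> w \<oplus> X (i - 1) \<odot> x"
          by (rule cov_exact_diff[OF eX(1)[OF iN] XC, rotated 3]) (use v0 w T rt1 in auto)
        show ?thesis
        proof (cases "i = 3")
          case False
          then have i4: "4 \<le> i" using 5 by simp
          then show ?thesis using w x
            by (intro bexI[of _ w] bexI[of _ x]) (auto simp: ad a_def b_def Ydm Yi)
        next
          case True
          (* The boundary X 2 x comes from the cancelled term X_2. Since r 2 W 1 j2 = X 2, adding W 1 j2 x to w
             absorbs it, without changing W 2 w. *)
          have w': "arr C w" "dm C w = T" "cd C w = dm C (W 2)" "u = W 2 \<odot> w" using w True by auto
          have x': "arr C x" "dm C x = T" "cd C x = dm C (X 2)" "v = r 2 \<odot> w \<oplus> X 2 \<odot> x" using x True by auto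
          let ?w = "w \<oplus> W 1 \<odot> j2 \<odot> x"
          have wt: "?w \<in> homset C T (dm C (W 2))" using w' x' jq d cW by simp
          have WW: "W 2 \<odot> W 1 \<odot> j2 \<odot> x = zer C T (dm C (W 3))"
            using int_complex_sq_cmp[OF WC, of 2 1 "j2 \<odot> x"] x' jq by simp
          have u1: "u = W 2 \<odot> ?w" unfolding cmp_pls WW using w' d cW by simp
          have "r 2 \<odot> W 1 \<odot> j2 \<odot> x = X 2 \<odot> x" unfolding r2c using jqc[of j1 x] jqc[of "g" x] x' g' by simp
          then have v1: "v = r 2 \<odot> ?w" using x' by (simp add: cmp_pls)
          have c: "cd C (Y 1) = dm C (X 3)" using Yd(3)[of 1] by (simp add: Ydm)
          have "Y 1 \<odot> zer C T (zo C) = zer C T (dm C (X 3))" using T Yd(1) c by (simp add: Ydm)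
          then have v2: "v = r 2 \<odot> ?w \<oplus> Y 1 \<odot> zer C T (zo C)"
            using v1 wt rt[of 2] by simp
          show ?thesis
            unfolding True
          proof (rule bexI[of _ ?w], rule bexI[of _ "zer C T (zo C)"], intro conjI)
            show "u = a (3 - 1) \<odot> ?w" using u1 by (simp add: a_def)
            show "v = b (3 - 1) \<odot> ?w \<oplus> Y (3 - 2) \<odot> zer C T (zo C)" using v2 by (simp add: b_def)
            show "zer C T (zo C) \<in> homset C T (dm C (Y (3 - 2)))" using T by (simp add: Ydm)
            show "?w \<in> homset C T (dm C (a (3 - 1)))" using wt by (simp add: ad)
          qed
        qed
      qed
    qed
    then show ?thesis using cone_cov_exact_iff[OF aC YC ZC bt disjI1[OF Zt]] by blast
  qed
  moreover have "contra_exact_at C (Ob C) Z j" if j1': "1 \<le> j" for j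
  proof -
    have "pushout_exact_at C (Ob C) b a Y (j - 1)" unfolding pushout_exact_at_def
    proof (intro ballI impI, elim conjE)
      fix T u v assume T: "T \<in> Ob C" and u: "u \<in> homset C (cd C (Y (j - 1 - 1))) T" and v: "v \<in> homset C (cd C (a (j - 1))) T"
        and e1: "u \<odot> Y (j - 1 - 1) = zer C (dm C (Y (j - 1 - 1))) T" and e2: "u \<odot> b (j - 1) = v \<odot> a (j - 1)"
      have cY: "cd C (Y (j - 1 - 1)) = dm C (Y (j - 1))" and ca: "cd C (a (j - 1)) = dm C (a j)"
        using Yd(3)[of "j - 1 - 1"] ac[of "j - 1"] by auto
      have ut: "arr C u" "dm C u = dm C (Y (j - 1))" "cd C u = T" and vt: "arr C v" "dm C v = dm C (a j)" "cd C v = T"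
        using u v cY ca by auto
      have jj: "j - 1 + 1 = j" by simp
      have fin: "\<exists>u'\<in>homset C (cd C (Y (j - 1))) T. \<exists>v'\<in>homset C (cd C (a (j - 1 + 1))) T.
          u = u' \<odot> Y (j - 1) \<and> v = u' \<odot> b (j - 1 + 1) \<oplus> v' \<odot> a (j - 1 + 1)"
        if "u' \<in> homset C (dm C (Y j)) T" "v' \<in> homset C (dm C (a (j + 1))) T" "u = u' \<odot> Y (j - 1)" "v = u' \<odot> b j \<oplus> v' \<odot> a j" for u' v'
      proof -
        have yy: "cd C (Y (j - 1)) = dm C (Y j)" using Yd(3)[of "j - 1"] by simp
        show ?thesis unfolding jj yy ac[of j] using that by blast
      qed
      consider "j = 1" | "j = 2" | "3 \<le> j" using j1' by linarith
      then show "\<exists>u'\<in>homset C (cd C (Y (j - 1))) T. \<exists>v'\<in>homset C (cd C (a (j - 1 + 1))) T.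
          u = u' \<odot> Y (j - 1) \<and> v = u' \<odot> b (j - 1 + 1) \<oplus> v' \<odot> a (j - 1 + 1)"
      proof cases
        case 1
        (* Exactness of X gives v g = c X 1, so v q1 and c q2 agree on W 0. By exactness of W they differ by w W 1,
           and restriction along j1 yields v = w W 1 j1. *)
        have v1: "arr C v" "dm C v = M" "cd C v = T" using vt 1 by (auto simp: ad)
        have Y0: "cd C (Y 0) = zo C" using Yd(3)[of 0] by (simp add: Ydm)
        have uz: "u = zer C (zo C) T" by (rule of_zo[of u "dm C (Y 0)"]) (use ut 1 in \<open>auto simp: Ydm\<close>)
        have "v \<odot> g \<odot> X 0 = zer C (dm C (X 0)) T"
        proof -
          have "v \<odot> g \<odot> X 0 = u \<odot> b 0" using e2 1 by (simp add: a_def)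
          also have "\<dots> = zer C (dm C (X 0)) T"
            by (rule cmp_through_zo[of "b 0" _ "dm C (Y 0)"]) (use bt'[of 0] ut 1 in \<open>auto simp: Ydm ad\<close>)
          finally show ?thesis .
        qed
        then have "(v \<odot> g) \<odot> X (1 - 1) = zer C (dm C (X (1 - 1))) T" by (simp add: cmp_assoc)
        then obtain c where c: "c \<in> homset C (dm C (X (1 + 1))) T" "v \<odot> g = c \<odot> X 1"
          by (rule contra_exactD[OF eX(2)[of 1] XC, rotated 3]) (use v1 g' T in auto)
        have c': "arr C c" "dm C c = dm C (X 2)" "cd C c = T" using c by auto
        have "(v \<odot> q1) \<odot> W 0 = v \<odot> g" "(c \<odot> q2) \<odot> W 0 = c \<odot> X 1"
          unfolding W0 using v1 c' g' jq d cX jqc[of g "X 1"] MO by (simp_all add: cmp_assoc cmp_pls)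
        then have "(v \<odot> q1) \<odot> W (1 - 1) = (c \<odot> q2) \<odot> W (1 - 1)" using c by simp
        then obtain w where w: "w \<in> homset C (dm C (W (1 + 1))) T" "v \<odot> q1 = c \<odot> q2 \<oplus> w \<odot> W 1"
          by (rule contra_exact_diff[OF eW(2)[of 1] WC, rotated 4]) (use v1 c' T jq in auto)
        have w': "arr C w" "dm C w = dm C (W 2)" "cd C w = T" using w by auto
        have "v = (v \<odot> q1) \<odot> j1" using v1 by (simp add: cmp_assoc jqe)
        also have "\<dots> = w \<odot> W 1 \<odot> j1" unfolding w(2) using c' w' jq MO d cW by (simp add: pls_cmp cmp_assoc jqe)
        finally have vv: "v = w \<odot> W 1 \<odot> j1" .
        have b1: "zer C (zo C) T \<odot> b 1 = zer C M T" using bt'[of 1] T by (simp add: Ydm ad)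
        show ?thesis
        proof (rule fin[of "zer C (zo C) T" w])
          show "zer C (zo C) T \<in> homset C (dm C (Y j)) T" using T 1 by (simp add: Ydm)
          show "w \<in> homset C (dm C (a (j + 1))) T" using w' 1 by (simp add: ad)
          show "u = zer C (zo C) T \<odot> Y (j - 1)" using uz 1 Yd(1) Y0 T by (simp add: Ydm)
          have "zer C M T \<oplus> w \<odot> W 1 \<odot> j1 = v" using vv v1 by simp
          then show "v = zer C (zo C) T \<odot> b j \<oplus> w \<odot> a j" using 1 b1 by (simp add: a_def)
        qed
      next
        case 2
        (* Here v W 1 vanishes on M, and its restriction c to X_2 vanishes on X 1, so c = c3 X 2. Then v and
           c3 r 2 agree on W 1, and by exactness of W they differ by w W 2. *)
        have v1: "arr C v" "dm C v = dm C (W 2)" "cd C v = T" using vt 2 by (auto simp: ad)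
        have cY1: "cd C (Y 1) = dm C (X 3)" using Yd(3)[of 1] by (simp add: Ydm)
        have uz: "u = zer C (zo C) T" by (rule of_zo[of u "dm C (Y 1)"]) (use ut 2 in \<open>auto simp: Ydm\<close>)
        have vW: "v \<odot> W 1 \<odot> j1 = zer C M T"
        proof -
          have "v \<odot> W 1 \<odot> j1 = u \<odot> b 1" using e2 2 by (simp add: a_def)
          also have "\<dots> = zer C M T"
            by (rule cmp_through_zo[of "b 1" _ "dm C (Y 1)"]) (use bt'[of 1] ut 2 in \<open>auto simp: Ydm ad\<close>)
          finally show ?thesis .
        qed
        define c where "c = v \<odot> W 1 \<odot> j2"
        have c': "c \<in> homset C (dm C (X 2)) T" using v1 jq d cW by (simp add: c_def)
        have vWq: "v \<odot> W 1 = c \<odot> q2"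
        proof -
          have "v \<odot> W 1 = v \<odot> W 1 \<odot> (j1 \<odot> q1 \<oplus> j2 \<odot> q2)" unfolding jqe using d v1 cW by simp
          also have "\<dots> = (v \<odot> W 1 \<odot> j1) \<odot> q1 \<oplus> c \<odot> q2" by (simp add: c_def cmp_pls cmp_assoc)
          also have "\<dots> = c \<odot> q2" unfolding vW using jq T c' by simp
          finally show ?thesis .
        qed
        have "c \<odot> X 1 = zer C (dm C (X 1)) T"
        proof -
          have "c \<odot> X 1 = c \<odot> q2 \<odot> W 0" unfolding W0 using c' g' jq d cX jqc[of g "X 1"] by (simp add: cmp_pls)
          also have "\<dots> = v \<odot> W 1 \<odot> W 0" using vWq by (metis cmp_assoc)
          also have "\<dots> = zer C (dm C (X 1)) T" unfolding W10 using v1 d by simp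
          finally show ?thesis .
        qed
        then obtain c3 where c3: "c3 \<in> homset C (dm C (X (2 + 1))) T" "c = c3 \<odot> X 2"
          by - (rule contra_exactD[OF eX(2)[of 2] XC c' T], auto)
        have c3': "arr C c3" "dm C c3 = dm C (X 3)" "cd C c3 = T" using c3 by auto
        have "v \<odot> W 1 = (c3 \<odot> r 2) \<odot> W 1" unfolding vWq c3(2) by (simp add: cmp_assoc r2)
        then have veq: "v \<odot> W (2 - 1) = (c3 \<odot> r 2) \<odot> W (2 - 1)" by simp
        have vh: "v \<in> homset C (dm C (W 2)) T" "c3 \<odot> r 2 \<in> homset C (dm C (W 2)) T"
          using v1 c3' rt[of 2] by simp_all
        have ex2: "contra_exact_at C (Ob C) W 2" by (rule eW(2)) simp
        obtain w where w: "w \<in> homset C (dm C (W (2 + 1))) T" "v = c3 \<odot> r 2 \<oplus> w \<odot> W 2"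
          by (rule contra_exact_diff[OF ex2 WC vh T veq])
        show ?thesis
        proof (rule fin[of c3 w])
          show "c3 \<in> homset C (dm C (Y j)) T" using c3' 2 by (simp add: Ydm)
          show "w \<in> homset C (dm C (a (j + 1))) T" using w(1) 2 by (simp add: ad)
          show "u = c3 \<odot> Y (j - 1)"
            unfolding uz by (rule of_zo[symmetric, OF _ refl]) (use 2 Yd(1) cY1 c3' in \<open>simp add: Ydm\<close>)
          show "v = c3 \<odot> b j \<oplus> w \<odot> a j" using w(2) 2 by (simp add: a_def b_def)
        qed
      next
        case 3
        have v1: "arr C v" "dm C v = dm C (W j)" "cd C v = T" using vt 3 by (auto simp: ad)
        have u1: "arr C u" "dm C u = dm C (X j)" "cd C u = T" using ut 3 by (auto simp: Ydm)
        have cm: "cd C (W (j - 1)) = dm C (W j)" "cd C (X (j - 1)) = dm C (X j)"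
          using d(7)[of "j - 1"] d(3)[of "j - 1"] by auto
        have uv: "u \<odot> r (j - 1) = v \<odot> W (j - 1)" using e2 3 by (simp add: a_def b_def)
        have "u \<odot> X (j - 1) = zer C (dm C (X (j - 1))) T"
        proof (cases "j = 3")
          case False
          then show ?thesis using e1 3 Yi[of "j - 1 - 1"] by simp
        next
          case True
          (* X_2 is not a term of Y, so u X 2 = 0 has to be derived from the relation between u and v. *)
          have "u \<odot> X 2 = u \<odot> X 2 \<odot> q2 \<odot> j2" using d cX by (simp add: jqe)
          also have "\<dots> = u \<odot> r 2 \<odot> W 1 \<odot> j2" by (simp add: r2c)
          also have "\<dots> = (u \<odot> r 2) \<odot> W 1 \<odot> j2" by (simp add: cmp_assoc)
          also have "\<dots> = v \<odot> W 2 \<odot> W 1 \<odot> j2" using uv True by (simp add: cmp_assoc)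
          also have "\<dots> = zer C (dm C (X 2)) T"
            using int_complex_sq_cmp[OF WC, of 2 1 j2] jq v1 True d by simp
          finally show ?thesis using True by simp
        qed
        then have uX: "u \<odot> X (j - 1) = zer C (dm C (X (j - 1))) T" .
        have uh: "u \<in> homset C (dm C (X j)) T" using u1 by simp
        obtain u' where u': "u' \<in> homset C (dm C (X (j + 1))) T" "u = u' \<odot> X j"
          by (rule contra_exactD[OF eX(2)[OF j1'] XC uh T uX])
        have rsj: "r j \<odot> W (j - 1) = X j \<odot> r (j - 1)" using rs[of "j - 1"] 3 by simp
        have "v \<odot> W (j - 1) = (u' \<odot> X j) \<odot> r (j - 1)" using uv u'(2) by simp
        then have veq: "v \<odot> W (j - 1) = (u' \<odot> r j) \<odot> W (j - 1)"
          using rsj by (simp add: cmp_assoc)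
        have vh: "v \<in> homset C (dm C (W j)) T" "u' \<odot> r j \<in> homset C (dm C (W j)) T"
          using v1 u'(1) rt[of j] 3 by simp_all
        obtain w where w: "w \<in> homset C (dm C (W (j + 1))) T" "v = u' \<odot> r j \<oplus> w \<odot> W j"
          by (rule contra_exact_diff[OF eW(2)[OF j1'] WC vh T veq])
        show ?thesis
          by (rule fin[of u' w]) (use u' w 3 Yi[of "j - 1"] in \<open>auto simp: Ydm ad a_def b_def\<close>)
      qed
    qed
    then show ?thesis using cone_contra_exact_iff[OF aC YC ZC bt disjI1[OF Zt]] by blast
  qed
  ultimately show ?thesis using ZC unfolding n_exact_for_def by blast
qed

lemma n_exact_for_mono: "n_exact_for C N S X \<Longrightarrow> S' \<subseteq> S \<Longrightarrow> n_exact_for C N S' X"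
  unfolding n_exact_for_def cov_exact_at_def contra_exact_at_def by blast

lemma n_exact_complex_with_terms_in: "n_exact_complex C N (Ob C) X \<Longrightarrow> B \<subseteq> Ob C \<Longrightarrow> (\<And>i. dm C (X i) \<in> B) \<Longrightarrow> n_exact_complex C N B X"
  unfolding n_exact_complex_def using n_exact_for_mono[of N "Ob C" X B] by (auto simp: int_complex_def)

lemma trunc_le_opp:
  assumes "int_complex C S X"
  shows "reflect N (trunc_le C N X) = trunc_ge (opp C) 1 (reflect N X)"
proof -
  interpret o: arrow_category "opp C" by (rule opp_arrow_category)
  have "reflect N (trunc_ge (opp C) 1 (reflect N X)) = trunc_le C N X"
    using o.trunc_ge_opp[OF int_complex_opp[OF assms], of N 1 N] by simp
  then show ?thesis by (metis reflect_reflect)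
qed

lemma trunc_le_dm:
  assumes "int_complex C S X"
  shows "dm C (trunc_le C k X i) = (if i \<le> k then dm C (X i) else zo C)"
  using int_complexD[OF assms] by (auto simp: trunc_le_def)

lemma int_complex_trunc_le:
  assumes X: "int_complex C S X" and z: "zo C \<in> S"
  shows "int_complex C S (trunc_le C N X)"
proof -
  interpret o: arrow_category "opp C" by (rule opp_arrow_category)
  have "int_complex (opp C) S (trunc_ge (opp C) 1 (reflect N X))"
    by (rule o.int_complex_trunc_ge[OF int_complex_opp[OF X]]) (simp add: z)
  then have "int_complex (opp (opp C)) S (reflect N (trunc_ge (opp C) 1 (reflect N X)))" by (rule o.int_complex_opp)
  then show ?thesis unfolding trunc_le_opp[OF X, symmetric] by simp
qed

end

definition monos_compose :: "('o, 'a) arrows \<Rightarrow> (int \<Rightarrow> 'a) set \<Rightarrow> bool" where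
  "monos_compose C XX \<longleftrightarrow>
     (\<forall>X\<in>XX. \<forall>Y\<in>XX. cd C (X 0) = dm C (Y 0) \<longrightarrow> (\<exists>Z\<in>XX. Z 0 = Y 0 \<odot>\<^bsub>C\<^esub> X 0))"

text \<open>
  One half of the axioms of an \<open>n\<close>-exact structure, chosen such that the other half is the same
  statement for the opposite category.
\<close>

definition half_n_exact :: "('o, 'a) arrows \<Rightarrow> int \<Rightarrow> 'o set \<Rightarrow> (int \<Rightarrow> 'a) set \<Rightarrow> bool" where
  "half_n_exact C N S XX \<longleftrightarrow> (\<forall>X\<in>XX. n_exact_complex C N S X) \<and> weak_iso_class C N S XX \<and> monos_compose C XX \<and> has_pullbacks C N S XX"

definition n_exact_structure :: "('o, 'a) arrows \<Rightarrow> int \<Rightarrow> 'o set \<Rightarrow> (int \<Rightarrow> 'a) set \<Rightarrow> bool" where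
  "n_exact_structure C N S XX \<longleftrightarrow> half_n_exact C N S XX \<and> half_n_exact (opp C) N S (reflect N ` XX)"

lemma reflect_image [simp]: "reflect k ` reflect k ` XX = XX"
  by (auto simp: image_image)

lemma n_exact_structure_opp: "n_exact_structure C N S XX \<Longrightarrow> n_exact_structure (opp C) N S (reflect N ` XX)"
  by (simp add: n_exact_structure_def)

context arrow_category
begin

text \<open>
  The cobase change of \<open>Y\<close> along \<open>X\<^sub>1 \<rightarrow> X\<^sub>2\<close>, taken with terms in \<open>B\<close>, has a cone \<open>W\<close> to which
  \<open>splice_n_exact\<close> applies. The resulting sequence \<open>Z\<close> and the member of \<open>XX\<close> provided by the
  composition axiom have the same first differential, so the identities in degrees \<open>0\<close> and \<open>1\<close>
  extend to a weak isomorphism between them.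
\<close>

lemma monos_compose_with_terms_in:
  assumes N: "1 \<le> N" and B: "B \<subseteq> Ob C" "zo C \<in> B"
    and bp: "\<And>A A'. \<lbrakk>A \<in> B; A' \<in> B\<rbrakk> \<Longrightarrow> \<exists>s i1 i2 p1 p2. s \<in> B \<and> biproduct C A A' s i1 i2 p1 p2"
    and nX: "\<And>X. X \<in> XX \<Longrightarrow> n_exact_complex C N (Ob C) X" and wk: "weak_iso_class C N (Ob C) XX"
    and E1: "monos_compose C XX"
    and cbc: "has_base_changes (opp C) N (Ob C) (reflect N ` XX)" and cbcB: "has_base_changes (opp C) N B (reflect N ` with_terms_in C B XX)"
  shows "monos_compose C (with_terms_in C B XX)"
  unfolding monos_compose_def
proof (intro ballI impI)
  fix X Y assume X: "X \<in> with_terms_in C B XX" and Y: "Y \<in> with_terms_in C B XX" and XY: "cd C (X 0) = dm C (Y 0)"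
  interpret o: arrow_category "opp C" by (rule opp_arrow_category)
  have nB: "n_exact_complex C N B X" "X \<in> XX" "n_exact_complex C N (Ob C) X" if "X \<in> with_terms_in C B XX" for X
    using that n_exact_complex_with_terms_in[OF nX B(1)] nX by (auto simp: with_terms_in_def)
  have XC: "int_complex C B X" and YC: "int_complex C B Y" using nB(1)[OF X] nB(1)[OF Y] by (auto simp: n_exact_complex_def)
  note d = int_complexD[OF XC] int_complexD[OF YC]
  have X1: "dm C (X 1) = dm C (Y 0)" using XY d(3)[of 0] by simp
  have cY: "cd C (Y N) = dm C (Y (N + 1))" "cd C (Y (-1)) = dm C (Y 0)" using d(7)[of N] d(7)[of "-1"] by auto
  (* A cobase change of Y along X 1 is a base change over the opposite category. *)
  obtain P h where P: "P \<in> reflect N ` with_terms_in C B XX" and h: "int_chain_map (opp C) P (reflect N Y) h"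
    "h 0 = idt (opp C) (dm (opp C) (reflect N Y 0))" "h (N + 1) = X 1"
  proof (rule base_changeE[OF cbcB])
    show "reflect N Y \<in> reflect N ` with_terms_in C B XX" using Y by blast
    show "X 1 \<in> homset (opp C) (dm C (X 2)) (dm (opp C) (reflect N Y (N + 1)))"
      using d(1)[of 1] d(3)[of 1] X1 cY by (simp add: reflect_def)
    show "dm C (X 2) \<in> B" by (rule d(2))
  qed
  obtain Y' where Y': "Y' \<in> with_terms_in C B XX" "P = reflect N Y'" using P by blast
  have YC': "int_complex C B Y'" using nB(1)[OF Y'(1)] by (auto simp: n_exact_complex_def)
  note d' = int_complexD[OF YC']
  define q where "q = reflect (N + 1) h"
  have h': "h = reflect (N + 1) q" by (simp add: q_def)
  have q: "int_chain_map C Y Y' q"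
    using o.int_chain_map_opp[OF int_complex_opp[OF YC'] int_complex_opp[OF YC] h(1)[unfolded Y'(2)], of N] by (simp add: q_def)
  note dq = int_chain_mapD[OF q]
  have q0: "q 0 = X 1" using h(3) by (simp add: h' reflect_def)
  have qN: "q (N + 1) = idt C (dm C (Y (N + 1)))" using h(2) cY by (simp add: h' reflect_def)
  have Y'0: "dm C (Y' 0) = dm C (X 2)" using dq(3)[of 0] q0 d(3)[of 1] by simp
  have Y'N: "dm C (Y' (N + 1)) = dm C (Y (N + 1))" using dq(3)[of "N + 1"] qN d(5)[of "N + 1"] by simp
  have e: "n_exact_for C N (Ob C) Y" "n_exact_for C N (Ob C) Y'" "bounded_in C 0 (N + 1) Y" "bounded_in C 0 (N + 1) Y'"
    using nB(3)[OF Y] nB(3)[OF Y'(1)] by (auto simp: n_exact_complex_def)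
  (* The cone of the map k between the truncations has the first differential (Y 0, q 0) = (Y 0, X 1). Its
     contravariant exactness is the dual of that of a base change; for its covariant exactness the
     truncation matters in degree N alone, where it is harmless as q is the identity in degree N + 1. *)
  define P1 P2 where "P1 = trunc_le C N Y" and "P2 = trunc_le C N Y'"
  have PC: "int_complex C B P1" "int_complex C B P2" unfolding P1_def P2_def by (intro int_complex_trunc_le YC YC' B)+
  note dP = int_complexD[OF PC(1)] int_complexD[OF PC(2)]
  have Pd: "dm C (P1 i) = (if i \<le> N then dm C (Y i) else zo C)" "dm C (P2 i) = (if i \<le> N then dm C (Y' i) else zo C)" for i
    unfolding P1_def P2_def by (simp_all add: trunc_le_dm[OF YC] trunc_le_dm[OF YC'])
  have Pi: "P1 i = Y i" "P2 i = Y' i" if "i < N" for i using that by (simp_all add: P1_def P2_def trunc_le_def)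
  define k where "k i = (if i \<le> N then q i else zer C (zo C) (zo C))" for i
  have kt: "k i \<in> homset C (dm C (P1 i)) (dm C (P2 i))" for i using dq by (auto simp: k_def Pd)
  have kt': "arr C (k i)" "dm C (k i) = dm C (P1 i)" "cd C (k i) = dm C (P2 i)" for i using kt[of i] by auto
  have ks: "k (i + 1) \<odot> P1 i = P2 i \<odot> k i" for i
  proof (cases "i < N")
    case True then show ?thesis using dq(4)[of i] by (simp add: k_def Pi)
  next
    case False
    have "k (i + 1) \<odot> P1 i = zer C (dm C (P1 i)) (zo C)" "P2 i \<odot> k i = zer C (dm C (P1 i)) (zo C)"
      by (rule to_zo[OF _ refl], use False dP kt' in \<open>simp add: Pd\<close>)+
    then show ?thesis by simp
  qed
  have con: "pushout_exact_at C (Ob C) k P1 P2 i" if "0 \<le> i" for i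
  proof -
    have "pullback_exact_at (opp C) (Ob C) (\<lambda>i. if 1 \<le> i then h i else zer (opp C) (zo (opp C)) (zo (opp C)))
        (trunc_ge (opp C) 1 P) (trunc_ge (opp C) 1 (reflect N Y)) (N + 1 - i)"
    proof (rule o.cone_base_change[OF N])
      show "n_exact_complex (opp C) N (Ob C) (reflect N Y)" "n_exact_complex (opp C) N (Ob C) P"
        unfolding Y'(2) by (intro n_exact_complex_opp nB Y Y')+
      fix T u v assume T: "T \<in> Ob C" and u: "u \<in> homset (opp C) T (dm (opp C) (P (N + 1)))"
        and v: "v \<in> homset (opp C) T (dm (opp C) (reflect N Y N))" and eq: "h (N + 1) \<odot>\<^bsub>opp C\<^esub> u = reflect N Y N \<odot>\<^bsub>opp C\<^esub> v"
      have Pm: "P \<in> reflect N ` XX" using Y' nB(2) by blast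
      obtain R p where R: "R \<in> reflect N ` XX" "int_chain_map (opp C) R P p" "p 0 = idt (opp C) (dm (opp C) (P 0))" "p (N + 1) = u"
        by (rule base_changeE[OF cbc Pm u T])
      have nR: "n_exact_complex (opp C) N (Ob C) R" using R(1) nX n_exact_complex_opp by blast
      have YN: "n_exact_complex (opp C) N (Ob C) (reflect N Y)" by (intro n_exact_complex_opp nB Y)
      have PN: "n_exact_complex (opp C) N (Ob C) P" unfolding Y'(2) by (intro n_exact_complex_opp nB Y')
      have P0: "dm (opp C) (P 0) = dm (opp C) (reflect N Y 0)"
        unfolding Y'(2) using cY d'(3)[of N] Y'N by (simp add: reflect_def)
      have "\<exists>v\<in>homset (opp C) (dm (opp C) u) (dm (opp C) (P N)). u = P N \<odot>\<^bsub>opp C\<^esub> v"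
      proof (rule o.lift_along_last[OF N _ _ h(1), of "Ob C" "idt C (cd C (P 0))" R p u v])
        show "int_complex (opp C) (Ob C) P" "int_complex (opp C) (Ob C) (reflect N Y)" using PN YN by (auto simp: n_exact_complex_def)
        have aP: "arr C (P 0)" by (simp add: Y'(2) reflect_def d')
        show "idt C (cd C (P 0)) \<in> homset (opp C) (dm (opp C) (reflect N Y 0)) (dm (opp C) (P 0))"
          using P0[symmetric] aP by simp
        show "idt C (cd C (P 0)) \<odot>\<^bsub>opp C\<^esub> h 0 = idt (opp C) (dm (opp C) (P 0))"
          unfolding h(2) P0[symmetric] using aP by simp
        show "cov_exact_at (opp C) (Ob C) (reflect N Y) i" if "i \<le> N" for i using YN that by (auto simp: n_exact_complex_def n_exact_for_def)
        show "dm (opp C) (reflect N Y (- 1)) = zo (opp C)" using YN by (auto simp: n_exact_complex_def bounded_in_def)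
        show "h (N + 1) \<odot>\<^bsub>opp C\<^esub> u = reflect N Y N \<odot>\<^bsub>opp C\<^esub> v" by (rule eq)
        show "v \<in> homset (opp C) (dm (opp C) u) (dm (opp C) (reflect N Y N))" using u v by auto
      qed (use nR R in auto)
      then show "\<exists>w\<in>homset (opp C) T (dm (opp C) (P N)). u = P N \<odot>\<^bsub>opp C\<^esub> w" using u by auto
    qed (use h that in auto)
    moreover have "(\<lambda>i. if 1 \<le> i then h i else zer (opp C) (zo (opp C)) (zo (opp C))) = reflect (N + 1) k"
      by (rule ext) (auto simp: h' k_def reflect_def)
    ultimately have "pullback_exact_at (opp C) (Ob C) (reflect (N + 1) k) (reflect N P2) (reflect N P1) (N + 1 - i)"
      unfolding P1_def P2_def trunc_le_opp[OF YC] trunc_le_opp[OF YC'] Y'(2) by simp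
    then show ?thesis by (simp add: pullback_exact_opp)
  qed
  have cov: "pullback_exact_at C (Ob C) k P1 P2 i" if iN: "i \<le> N" for i
    unfolding pullback_exact_at_def
  proof (intro ballI impI, elim conjE)
    fix T u v assume T: "T \<in> Ob C" and u: "u \<in> homset C T (dm C (P1 i))" and v: "v \<in> homset C T (dm C (P2 (i - 1)))"
      and e1: "P1 i \<odot> u = zer C T (cd C (P1 i))" and e2: "k i \<odot> u = P2 (i - 1) \<odot> v"
    have u': "arr C u" "dm C u = T" "cd C u = dm C (Y i)" and v': "arr C v" "dm C v = T" "cd C v = dm C (Y' (i - 1))"
      using u v iN by (auto simp: Pd)
    have ex: "cov_exact_at C (Ob C) Y i" "cov_exact_at C (Ob C) Y' (i - 1)" using e iN by (auto simp: n_exact_for_def)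
    have e3: "q i \<odot> u = Y' (i - 1) \<odot> v" using e2 iN by (simp add: k_def Pi)
    have Yu: "Y i \<odot> u = zer C T (dm C (Y (i + 1)))"
    proof (cases "i = N")
      case False then show ?thesis using e1 iN by (simp add: Pi d)
    next
      case True
      have "Y N \<odot> u = q (N + 1) \<odot> Y N \<odot> u" using qN u' True d by simp
      also have "\<dots> = Y' N \<odot> q N \<odot> u" by (rule int_chain_map_cmp[OF q refl])
      also have "\<dots> = Y' N \<odot> Y' (N - 1) \<odot> v" using e3 True by simp
      also have "\<dots> = zer C T (dm C (Y' (N + 1)))"
        using int_complex_sq_cmp[OF YC', of N "N - 1" v] v' True by (simp add: add.commute)
      finally show ?thesis using True Y'N by simp
    qed
    obtain w where w: "w \<in> homset C T (dm C (Y (i - 1)))" "u = Y (i - 1) \<odot> w"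
      by (rule cov_exactD[OF ex(1) YC _ T Yu]) (use u' in simp)
    have "Y' (i - 1) \<odot> v = Y' (i - 1) \<odot> q (i - 1) \<odot> w"
      using e3 int_chain_map_cmp[OF q, of i "i - 1" w] w(2) by simp
    then obtain x where x: "x \<in> homset C T (dm C (Y' (i - 1 - 1)))" "v = q (i - 1) \<odot> w \<oplus> Y' (i - 1 - 1) \<odot> x"
      by (rule cov_exact_diff[OF ex(2) YC', rotated 3]) (use v' w T dq in auto)
    then show "\<exists>u'\<in>homset C T (dm C (P1 (i - 1))). \<exists>v'\<in>homset C T (dm C (P2 (i - 2))).
        u = P1 (i - 1) \<odot> u' \<and> v = k (i - 1) \<odot> u' \<oplus> P2 (i - 2) \<odot> v'"
      using w iN by (intro bexI[of _ w] bexI[of _ x]) (auto simp: Pd Pi k_def)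
  qed
  have cC: "int_complex C B (\<lambda>i. neg C (P2 (i - 1)))" by (rule int_complex_neg[OF int_complex_shift_neg[OF PC(2)]])
  have cdm: "dm C (neg C (P2 (i - 1))) = dm C (P2 (i - 1))" for i using dP by simp
  obtain s i1 i2 p1 p2 where bs: "\<And>i::int. s i \<in> B \<and> biproduct C (dm C (P1 i)) (dm C (P2 (i - 1))) (s i) (i1 i) (i2 i) (p1 i) (p2 i) \<and>
    (dm C (P2 (i - 1)) = zo C \<longrightarrow> s i = dm C (P1 i) \<and> i1 i = idt C (dm C (P1 i)) \<and> p1 i = idt C (dm C (P1 i))) \<and>
    (dm C (P1 i) = zo C \<longrightarrow> s i = dm C (P2 (i - 1)) \<and> i2 i = idt C (dm C (P2 (i - 1))) \<and> p2 i = idt C (dm C (P2 (i - 1))))"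
    using biproduct_family[OF bp _ _ B(1), of "\<lambda>i. dm C (P1 i)" "\<lambda>i. dm C (P2 (i - 1))"] dP by blast
  have "\<exists>W. int_complex C B W \<and> (\<forall>i. dm C (W i) = s i) \<and> triangular C P1 k (\<lambda>i. neg C (P2 (i - 1))) W i1 i2 p1 p2"
  proof (rule triangular_exists[OF PC(1) cC])
    fix i
    show "k i \<in> homset C (dm C (P1 i)) (dm C (neg C (P2 (i + 1 - 1))))" using kt[of i] dP by simp
    have "k (i + 1) \<odot> P1 i \<oplus> neg C (P2 i) \<odot> k i = zer C (dm C (P1 i)) (dm C (P2 (i + 1)))"
      unfolding neg_cmp ks using kt' dP by (simp add: pls_neg)
    then show "k (i + 1) \<odot> P1 i \<oplus> neg C (P2 (i + 1 - 1)) \<odot> k i = zer C (dm C (P1 i)) (dm C (neg C (P2 (i + 2 - 1))))"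
      using dP by (simp add: add.commute)
    show "biproduct C (dm C (P1 i)) (dm C (neg C (P2 (i - 1)))) (s i) (i1 i) (i2 i) (p1 i) (p2 i)"
      unfolding cdm using bs by blast
    show "s i \<in> B" using bs by blast
  qed
  then obtain W where WC: "int_complex C B W" and Wd: "\<And>i. dm C (W i) = s i" and Wt: "triangular C P1 k (\<lambda>i. neg C (P2 (i - 1))) W i1 i2 p1 p2"
    by blast
  have bW: "bounded_in C 0 (N + 1) W" unfolding bounded_in_def
  proof (intro allI impI)
    fix i assume i: "i < 0 \<or> i > N + 1"
    have "dm C (P1 i) = zo C" "dm C (P2 (i - 1)) = zo C" using i N e(3,4) by (auto simp: Pd bounded_in_def)
    then show "dm C (W i) = zo C" using bs[of i] Wd by simp
  qed
  have eW: "n_exact_for C N (Ob C) W" unfolding n_exact_for_def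
    using cone_cov_exact_iff[OF PC WC kt disjI1[OF Wt]] cone_contra_exact_iff[OF PC WC kt disjI1[OF Wt]] cov con by auto
  have b1: "biproduct C (dm C (Y 1)) (dm C (X 2)) (dm C (W 1)) (i1 1) (i2 1) (p1 1) (p2 1)"
    using bs[of 1] N Y'0 by (simp add: Pd Wd)
  have W0: "W 0 = i1 1 \<odot> Y 0 \<oplus> i2 1 \<odot> X 1"
  proof -
    have z: "dm C (P2 (-1)) = zo C" using e(4) N by (auto simp: Pd bounded_in_def)
    have p10: "p1 0 = idt C (dm C (Y 0))" using bs[of 0] z N by (simp add: Pd)
    have td: "arr C (p2 0)" "dm C (p2 0) = dm C (Y 0)" "cd C (p2 0) = zo C"
      using triangularD[OF PC(1) cC Wt] bs[of 0] z N by (simp_all add: Wd cdm Pd)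
    have p20: "p2 0 = zer C (dm C (Y 0)) (zo C)" using to_zo[of "p2 0"] td by simp
    have cc: "cd C (P2 (-1)) = dm C (X 2)" using dP(7)[of "-1"] Y'0 N by (simp add: Pd)
    have t1: "arr C (i1 1)" "dm C (i1 1) = dm C (Y 1)" "cd C (i1 1) = dm C (W 1)" "arr C (i2 1)" "dm C (i2 1) = dm C (X 2)" "cd C (i2 1) = dm C (W 1)"
      using b1 unfolding biproduct_def by auto
    have c0: "cd C (X 1) = dm C (X 2)" "cd C (Y 0) = dm C (Y 1)" using d(3)[of 1] d(7)[of 0] by auto
    have "W 0 = i1 1 \<odot> P1 0 \<odot> p1 0 \<oplus> i2 1 \<odot> k 0 \<odot> p1 0 \<oplus> i2 1 \<odot> neg C (P2 (-1)) \<odot> p2 0"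
      using triangular_eq[OF Wt, of 0] by simp
    also have "\<dots> = i1 1 \<odot> Y 0 \<oplus> i2 1 \<odot> X 1"
      unfolding p10 p20 using N td dP z cc q0 t1 d d'(1) X1 c0 by (simp add: k_def Pi)
    finally show ?thesis .
  qed
  have eX: "n_exact_for C N (Ob C) X" "bounded_in C 0 (N + 1) X" using nB(3)[OF X] by (auto simp: n_exact_complex_def)
  have g: "Y 0 \<in> homset C (dm C (X 1)) (dm C (Y 1))" using d X1 d(7)[of 0] by simp
  obtain Z where Z: "int_complex C B Z" "bounded_in C 0 (N + 1) Z" "n_exact_for C N (Ob C) Z" "Z 0 = Y 0 \<odot> X 0"
    using splice_n_exact[OF N B bp XC eX(2,1) WC bW eW b1 d(6) g W0] by blast
  have nZ: "n_exact_complex C N (Ob C) Z" using Z int_complex_Ob by (auto simp: n_exact_complex_def)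
  obtain Z' where Z': "Z' \<in> XX" "Z' 0 = Y 0 \<odot> X 0"
    using E1 nB(2)[OF X] nB(2)[OF Y] XY unfolding monos_compose_def by blast
  have nZ': "n_exact_complex C N (Ob C) Z'" by (rule nX[OF Z'(1)])
  have ZC: "int_complex C (Ob C) Z" "int_complex C (Ob C) Z'" using nZ nZ' by (auto simp: n_exact_complex_def)
  have ZZ: "Z 0 = Z' 0" using Z Z' by simp
  have dZ: "dm C (Z 0) = dm C (Z' 0)" "dm C (Z' 1) = dm C (Z 1)"
    using ZZ int_complexD(3)[OF ZC(1), of 0] int_complexD(3)[OF ZC(2), of 0] by auto
  obtain f where f: "int_chain_map C Z Z' f" "f 0 = idt C (dm C (Z 0))" "f (0 + 1) = idt C (dm C (Z 1))"
  proof (rule int_chain_map_extend[OF ZC, of 0])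
    show "cov_exact_at C (Ob C) Z' i" if "i \<le> 0" for i using nZ' N that by (auto simp: n_exact_complex_def n_exact_for_def)
    show "contra_exact_at C (Ob C) Z i" if "i > 0" for i using nZ that by (auto simp: n_exact_complex_def n_exact_for_def)
    show "idt C (dm C (Z 0)) \<in> homset C (dm C (Z 0)) (dm C (Z' 0))" "idt C (dm C (Z 1)) \<in> homset C (dm C (Z (0 + 1))) (dm C (Z' (0 + 1)))"
      using int_complexD(1)[OF ZC(1)] dZ(1)[symmetric] dZ(2) by auto
    show "idt C (dm C (Z 1)) \<odot> Z 0 = Z' 0 \<odot> idt C (dm C (Z 0))"
      unfolding ZZ[symmetric] using int_complexD[OF ZC(1), of 0] by simp
  qed
  have "weak_iso_map C N Z Z' f" unfolding weak_iso_map_def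
    using N f int_complexD(1)[OF ZC(1)] by (auto simp: iso_arr_def intro!: exI[of _ 0])
  then have "Z \<in> XX" using wk nZ nZ' Z'(1) unfolding weak_iso_class_def by blast
  then have "Z \<in> with_terms_in C B XX" using Z(1) by (auto simp: with_terms_in_def int_complex_def)
  then show "\<exists>Z\<in>with_terms_in C B XX. Z 0 = Y 0 \<odot> X 0" using Z(4) by blast
qed

section \<open>Restriction of an n-exact structure\<close>

lemma weak_iso_map_opp:
  assumes "int_complex C S X" "int_complex C S Y" "weak_iso_map C N X Y f"
  shows "weak_iso_map (opp C) N (reflect N Y) (reflect N X) (reflect (N + 1) f)"
proof -
  have e: "N + 1 - (N - k) = k + 1" "N + 1 - (N - k + 1) = k" for k :: int by auto
  have "\<exists>j. 0 \<le> j \<and> j \<le> N \<and> iso_arr C (f (N + 1 - j)) \<and> iso_arr C (f (N + 1 - (j + 1)))"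
    if "0 \<le> k" "k \<le> N" "iso_arr C (f k)" "iso_arr C (f (k + 1))" for k
    by (rule exI[of _ "N - k"]) (unfold e, use that in simp)
  then show ?thesis
    using assms int_chain_map_opp[OF assms(1,2)] unfolding weak_iso_map_def reflect_def by auto
qed

text \<open>
  In a weak isomorphism between sequences that are exact relative to \<open>B\<close>, one of which is in the
  class, the other one is exact relative to all objects, by \<open>n_exact_of_weak_iso_map\<close> or its
  dual; closure of \<open>XX\<close> then applies.
\<close>

lemma half_n_exact_with_terms_in:
  assumes N: "1 \<le> N" and B: "B \<subseteq> Ob C" "zo C \<in> B"
    and bp: "\<And>A A'. \<lbrakk>A \<in> B; A' \<in> B\<rbrakk> \<Longrightarrow> \<exists>s i1 i2 p1 p2. s \<in> B \<and> biproduct C A A' s i1 i2 p1 p2"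
    and ne: "n_exact_structure C N (Ob C) XX" and ext: "extension_closed_in C N B XX"
  shows "half_n_exact C N B (with_terms_in C B XX)"
proof -
  interpret o: arrow_category "opp C" by (rule opp_arrow_category)
  have nX: "\<And>X. X \<in> XX \<Longrightarrow> n_exact_complex C N (Ob C) X" and wk: "weak_iso_class C N (Ob C) XX" and E1: "monos_compose C XX"
    and pu: "has_pullbacks C N (Ob C) XX" and wko: "weak_iso_class (opp C) N (Ob C) (reflect N ` XX)"
    and puo: "has_pullbacks (opp C) N (Ob C) (reflect N ` XX)" 
    and nXo: "\<And>X. X \<in> reflect N ` XX \<Longrightarrow> n_exact_complex (opp C) N (Ob C) X"
    using ne unfolding n_exact_structure_def half_n_exact_def by blast+
  have cX: "int_complex C (Ob C) X" if "X \<in> XX" for X using nX[OF that] by (simp add: n_exact_complex_def)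
  have cXo: "int_complex (opp C) (Ob C) X" if "X \<in> reflect N ` XX" for X using nXo[OF that] by (simp add: n_exact_complex_def)
  have bc1: "has_base_changes C N (Ob C) XX" by (rule has_base_changes_if_has_pullbacks[OF N subset_refl nX wk pu])
  have bco: "has_base_changes (opp C) N (Ob C) (reflect N ` XX)" by (rule o.has_base_changes_if_has_pullbacks[OF N _ nXo wko puo]) simp
  have bcB: "has_base_changes C N B (with_terms_in C B XX)" by (rule has_base_changes_with_terms_in[OF B(1) bc1 cX ext])
  have so: "with_terms_in (opp C) B (reflect N ` XX) = reflect N ` with_terms_in C B XX" by (rule with_terms_in_opp[OF cX])
  have bcBo: "has_base_changes (opp C) N B (reflect N ` with_terms_in C B XX)"
    unfolding so[symmetric] by (rule o.has_base_changes_with_terms_in) (use B bco cXo extension_closed_in_opp[OF cX ext] in auto)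
  have nB: "n_exact_complex C N B X" if "X \<in> with_terms_in C B XX" for X
    using that n_exact_complex_with_terms_in[OF nX B(1)] by (auto simp: with_terms_in_def)
  have nBo: "n_exact_complex (opp C) N B X" if "X \<in> reflect N ` with_terms_in C B XX" for X
    using that nB n_exact_complex_opp by blast
  have cObj: "X \<in> with_terms_in C B XX" if "n_exact_complex C N B X" "X \<in> XX" for X
    using that by (auto simp: with_terms_in_def n_exact_complex_def int_complex_def)
  have up: "n_exact_complex C N (Ob C) X" if "n_exact_complex C N B X" "n_exact_for C N (Ob C) X" for X
    using that int_complex_Ob by (auto simp: n_exact_complex_def)
  have "weak_iso_class C N B (with_terms_in C B XX)" unfolding weak_iso_class_def
  proof (intro allI impI iffI)
    fix X Y f assume X: "n_exact_complex C N B X" and Y: "n_exact_complex C N B Y" and f: "weak_iso_map C N X Y f"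
    {
      assume XX: "X \<in> with_terms_in C B XX"
      then have X': "n_exact_complex C N (Ob C) X" "X \<in> XX" using nX by (auto simp: with_terms_in_def)
      have "n_exact_for C N (Ob C) Y"
        by (rule n_exact_of_weak_iso_map[OF N X Y f bcB nB XX]) (use X' in \<open>auto simp: n_exact_complex_def\<close>)
      then have "Y \<in> XX" using wk X' up[OF Y] f unfolding weak_iso_class_def by blast
      then show "Y \<in> with_terms_in C B XX" by (rule cObj[OF Y])
    next
      assume YY: "Y \<in> with_terms_in C B XX"
      then have Y': "n_exact_complex C N (Ob C) Y" "Y \<in> XX" using nX by (auto simp: with_terms_in_def)
      have fo: "weak_iso_map (opp C) N (reflect N Y) (reflect N X) (reflect (N + 1) f)"
        by (rule weak_iso_map_opp[OF _ _ f, of B]) (use X Y in \<open>auto simp: n_exact_complex_def\<close>)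
      have "n_exact_for (opp C) N (Ob C) (reflect N X)"
        by (rule o.n_exact_of_weak_iso_map[OF N n_exact_complex_opp[OF Y] n_exact_complex_opp[OF X] fo bcBo nBo])
          (use YY Y' n_exact_complex_opp in \<open>auto simp: n_exact_complex_def n_exact_for_opp\<close>)
      then have "n_exact_for C N (Ob C) X" by (simp add: n_exact_for_opp)
      then have "X \<in> XX" using wk Y' up[OF X] f unfolding weak_iso_class_def by blast
      then show "X \<in> with_terms_in C B XX" by (rule cObj[OF X])
    }
  qed
  moreover have "monos_compose C (with_terms_in C B XX)"
    by (rule monos_compose_with_terms_in[OF N B bp nX wk E1 bco bcBo])
  moreover have "has_pullbacks C N B (with_terms_in C B XX)"
    by (rule has_pullbacks_if_has_base_changes[OF N B(2) nB bcB])
  ultimately show ?thesis using nB by (simp add: half_n_exact_def)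
qed

theorem n_exact_structure_with_terms_in:
  assumes N: "1 \<le> N" and B: "B \<subseteq> Ob C" "zo C \<in> B"
    and bp: "\<And>A A'. \<lbrakk>A \<in> B; A' \<in> B\<rbrakk> \<Longrightarrow> \<exists>s i1 i2 p1 p2. s \<in> B \<and> biproduct C A A' s i1 i2 p1 p2"
    and ne: "n_exact_structure C N (Ob C) XX" and ext: "extension_closed_in C N B XX"
  shows "n_exact_structure C N B (with_terms_in C B XX)"
proof -
  interpret o: arrow_category "opp C" by (rule opp_arrow_category)
  have cX: "int_complex C (Ob C) X" if "X \<in> XX" for X
    using ne that unfolding n_exact_structure_def half_n_exact_def n_exact_complex_def by blast
  have "half_n_exact (opp C) N B (with_terms_in (opp C) B (reflect N ` XX))"
  proof (rule o.half_n_exact_with_terms_in[OF N])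
    fix A A' assume "A \<in> B" "A' \<in> B"
    then obtain s i1 i2 p1 p2 where "s \<in> B" "biproduct C A' A s i1 i2 p1 p2" using bp by blast
    then show "\<exists>s i1 i2 p1 p2. s \<in> B \<and> biproduct (opp C) A A' s i1 i2 p1 p2"
      using biproduct_opp[OF pls_commute] by blast
  qed (use B n_exact_structure_opp[OF ne] extension_closed_in_opp[OF cX ext] in auto)
  moreover have "half_n_exact C N B (with_terms_in C B XX)" by (rule half_n_exact_with_terms_in[OF N B bp ne ext])
  moreover have "with_terms_in (opp C) B (reflect N ` XX) = reflect N ` with_terms_in C B XX" by (rule with_terms_in_opp[OF cX])
  ultimately show ?thesis by (simp add: n_exact_structure_def)
qed

end

section \<open>The arrows of an additive category\<close>

definition valid_arrow :: "('o, 'm) category_data \<Rightarrow> ('o \<times> 'm \<times> 'o) option \<Rightarrow> bool" where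
  "valid_arrow D x \<longleftrightarrow> (case x of None \<Rightarrow> False | Some (A, f, B) \<Rightarrow> A \<in> obj D \<and> B \<in> obj D \<and> f \<in> mor D A B)"

abbreviation src :: "('o \<times> 'm \<times> 'o) option \<Rightarrow> 'o" where "src x \<equiv> fst (the x)"
abbreviation morph :: "('o \<times> 'm \<times> 'o) option \<Rightarrow> 'm" where "morph x \<equiv> fst (snd (the x))"
abbreviation tgt :: "('o \<times> 'm \<times> 'o) option \<Rightarrow> 'o" where "tgt x \<equiv> snd (snd (the x))"

text \<open>
  An arrow is a triple of source, morphism and target, since hom-sets need not be disjoint.
  Undefined values are \<open>None\<close>, except that \<open>neg\<close> returns its argument, so that it is an
  involution on all values.
\<close>

definition arrow_data :: "('o, 'm) category_data \<Rightarrow> 'o \<Rightarrow> ('o, ('o \<times> 'm \<times> 'o) option) arrows" where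
  "arrow_data D Z = \<lparr>Ob = obj D, arr = valid_arrow D, dm = src, cd = tgt,
     cmp = (\<lambda>g f. if valid_arrow D g \<and> valid_arrow D f \<and> tgt f = src g then Some (src f, morph g \<cdot>\<^bsub>D\<^esub> morph f, tgt g) else None),
     pls = (\<lambda>f g. if valid_arrow D f \<and> valid_arrow D g \<and> src f = src g \<and> tgt f = tgt g
       then Some (src f, morph f \<boxplus>\<^bsub>D\<^esub> morph g, tgt f) else None),
     neg = (\<lambda>f. if valid_arrow D f then Some (src f, neg_mor D (src f) (tgt f) (morph f), tgt f) else f),
     zer = (\<lambda>A B. if A \<in> obj D \<and> B \<in> obj D then Some (A, zero_mor D A B, B) else None),
     idt = (\<lambda>A. if A \<in> obj D then Some (A, ident D A, A) else None), zo = Z\<rparr>"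

lemma arrow_data_sel [simp]:
  "Ob (arrow_data D Z) = obj D" "arr (arrow_data D Z) = valid_arrow D" "dm (arrow_data D Z) = src" "cd (arrow_data D Z) = tgt" "zo (arrow_data D Z) = Z"
  by (simp_all add: arrow_data_def)

lemma valid_arrow_Some [simp]: "valid_arrow D (Some (A, f, B)) \<longleftrightarrow> A \<in> obj D \<and> B \<in> obj D \<and> f \<in> mor D A B"
  by (simp add: valid_arrow_def)

lemma valid_arrow_None [simp]: "\<not> valid_arrow D None" by (simp add: valid_arrow_def)

lemma valid_arrowE:
  assumes "valid_arrow D x" obtains A f B where "x = Some (A, f, B)" "A \<in> obj D" "B \<in> obj D" "f \<in> mor D A B"
  using assms by (auto simp: valid_arrow_def split: option.splits)

locale pointed_category = additive_category D for D :: "('o, 'm) category_data" (structure) +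
  fixes Z :: 'o
  assumes zero_Z: "is_zero_object D Z"
begin

abbreviation C where "C \<equiv> arrow_data D Z"

lemma group_facts:
  assumes "A \<in> obj D" "B \<in> obj D"
  shows plus_closed: "\<lbrakk>f \<in> mor D A B; g \<in> mor D A B\<rbrakk> \<Longrightarrow> f \<boxplus> g \<in> mor D A B"
    and plus_ass: "\<lbrakk>f \<in> mor D A B; g \<in> mor D A B; h \<in> mor D A B\<rbrakk> \<Longrightarrow> (f \<boxplus> g) \<boxplus> h = f \<boxplus> (g \<boxplus> h)"
    and plus_comm: "\<lbrakk>f \<in> mor D A B; g \<in> mor D A B\<rbrakk> \<Longrightarrow> f \<boxplus> g = g \<boxplus> f"
    and zero_closed: "zero_mor D A B \<in> mor D A B"
    and plus_zero: "f \<in> mor D A B \<Longrightarrow> f \<boxplus> zero_mor D A B = f"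
    and neg_closed: "f \<in> mor D A B \<Longrightarrow> neg_mor D A B f \<in> mor D A B"
    and plus_neg: "f \<in> mor D A B \<Longrightarrow> f \<boxplus> neg_mor D A B f = zero_mor D A B"
proof -
  interpret G: comm_group "mor_group D A B" by (rule mor_comm_group[OF assms])
  have s: "carrier (mor_group D A B) = mor D A B" "mult (mor_group D A B) = plus_mor D" "one (mor_group D A B) = zero_mor D A B"
    by (simp_all add: mor_group_def)
  show "\<lbrakk>f \<in> mor D A B; g \<in> mor D A B\<rbrakk> \<Longrightarrow> f \<boxplus> g \<in> mor D A B" using G.m_closed[of f g] unfolding s .
  show "\<lbrakk>f \<in> mor D A B; g \<in> mor D A B; h \<in> mor D A B\<rbrakk> \<Longrightarrow> (f \<boxplus> g) \<boxplus> h = f \<boxplus> (g \<boxplus> h)" using G.m_assoc[of f g h] unfolding s .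
  show "\<lbrakk>f \<in> mor D A B; g \<in> mor D A B\<rbrakk> \<Longrightarrow> f \<boxplus> g = g \<boxplus> f" using G.m_comm[of f g] unfolding s .
  show "zero_mor D A B \<in> mor D A B" using G.one_closed unfolding s .
  show "f \<in> mor D A B \<Longrightarrow> f \<boxplus> zero_mor D A B = f" using G.r_one[of f] unfolding s .
  show "f \<in> mor D A B \<Longrightarrow> neg_mor D A B f \<in> mor D A B" using G.inv_closed[of f] unfolding s neg_mor_def .
  show "f \<in> mor D A B \<Longrightarrow> f \<boxplus> neg_mor D A B f = zero_mor D A B" using G.r_inv[of f] unfolding s neg_mor_def .
qed

lemma Z_obj [simp]: "Z \<in> obj D" using zero_Z by (simp add: is_zero_object_def)

lemma arrow_data_ops [simp]:
  "\<lbrakk>A \<in> obj D; B \<in> obj D; E \<in> obj D; f \<in> mor D A B; g \<in> mor D B E\<rbrakk> \<Longrightarrow>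
    cmp C (Some (B, g, E)) (Some (A, f, B)) = Some (A, g \<cdot> f, E)"
  "\<lbrakk>A \<in> obj D; B \<in> obj D; f \<in> mor D A B; g \<in> mor D A B\<rbrakk> \<Longrightarrow>
    pls C (Some (A, f, B)) (Some (A, g, B)) = Some (A, f \<boxplus> g, B)"
  "\<lbrakk>A \<in> obj D; B \<in> obj D; f \<in> mor D A B\<rbrakk> \<Longrightarrow> neg C (Some (A, f, B)) = Some (A, neg_mor D A B f, B)"
  "\<lbrakk>A \<in> obj D; B \<in> obj D\<rbrakk> \<Longrightarrow> zer C A B = Some (A, zero_mor D A B, B)"
  "A \<in> obj D \<Longrightarrow> idt C A = Some (A, ident D A, A)"
  by (simp_all add: arrow_data_def)

sublocale arrow_category C
proof
  fix f g h f' g' :: "('o \<times> 'm \<times> 'o) option" and A B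
  show "\<not> arr C (cmp C g f) \<Longrightarrow> \<not> arr C (cmp C g' f') \<Longrightarrow> cmp C g f = cmp C g' f'"
    by (auto simp: arrow_data_def elim!: valid_arrowE intro: comp_closed)
  show "\<not> arr C (pls C g f) \<Longrightarrow> \<not> arr C (pls C g' f') \<Longrightarrow> pls C g f = pls C g' f'"
    by (auto simp: arrow_data_def elim!: valid_arrowE intro: plus_closed)
  show "\<not> arr C f \<Longrightarrow> neg C f = f" by (simp add: arrow_data_def)
  show "arr C f \<Longrightarrow> dm C f \<in> Ob C \<and> cd C f \<in> Ob C" by (auto elim: valid_arrowE)
  show c: "arr C (cmp C g f) \<longleftrightarrow> arr C f \<and> arr C g \<and> cd C f = dm C g" for g f
    by (auto simp: arrow_data_def elim!: valid_arrowE intro: comp_closed)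
  show "\<lbrakk>arr C f; arr C g; cd C f = dm C g\<rbrakk> \<Longrightarrow> dm C (cmp C g f) = dm C f"
    "\<lbrakk>arr C f; arr C g; cd C f = dm C g\<rbrakk> \<Longrightarrow> cd C (cmp C g f) = cd C g"
    by (auto simp: arrow_data_def)
  show p: "arr C (pls C f g) \<longleftrightarrow> arr C f \<and> arr C g \<and> dm C f = dm C g \<and> cd C f = cd C g" for f g
    by (auto simp: arrow_data_def elim!: valid_arrowE intro: plus_closed)
  show "\<lbrakk>arr C f; arr C g; dm C f = dm C g; cd C f = cd C g\<rbrakk> \<Longrightarrow> dm C (pls C f g) = dm C g"
    "\<lbrakk>arr C f; arr C g; dm C f = dm C g; cd C f = cd C g\<rbrakk> \<Longrightarrow> cd C (pls C f g) = cd C g"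
    by (auto simp: arrow_data_def)
  (* Each law below is first proved for composable arrows; otherwise both of its sides are None. *)
  have nc: "cmp C x y = None" if "\<not> (valid_arrow D x \<and> valid_arrow D y \<and> tgt y = src x)" for x y
    unfolding arrow_data_def using that by auto
  have np: "pls C x y = None" if "\<not> (valid_arrow D x \<and> valid_arrow D y \<and> src y = src x \<and> tgt y = tgt x)" for x y
    unfolding arrow_data_def using that by auto
  show "cmp C (cmp C h g) f = cmp C h (cmp C g f)"
  proof (cases "valid_arrow D f \<and> valid_arrow D g \<and> valid_arrow D h \<and> tgt f = src g \<and> tgt g = src h")
    case True
    then show ?thesis by (auto elim!: valid_arrowE simp: comp_closed comp_assoc)
  next
    case False
    have "cmp C (cmp C h g) f = None"
    proof (cases "valid_arrow D g \<and> valid_arrow D h \<and> tgt g = src h")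
      case True
      then have "src (cmp C h g) = src g" by (simp add: arrow_data_def)
      then show ?thesis using False True by (intro nc) auto
    next
      case F: False
      have "cmp C h g = None" by (rule nc) (use F in auto)
      then show ?thesis by (simp add: nc[of None f])
    qed
    moreover have "cmp C h (cmp C g f) = None"
    proof (cases "valid_arrow D f \<and> valid_arrow D g \<and> tgt f = src g")
      case True
      then have "tgt (cmp C g f) = tgt g" by (simp add: arrow_data_def)
      then show ?thesis using False True by (intro nc) auto
    next
      case F: False
      have "cmp C g f = None" by (rule nc) (use F in auto)
      then show ?thesis by (simp add: nc[of h None])
    qed
    ultimately show ?thesis by simp
  qed
  show "pls C (pls C h g) f = pls C h (pls C g f)"
  proof (cases "valid_arrow D f \<and> valid_arrow D g \<and> valid_arrow D h \<and> src f = src g \<and> tgt f = tgt g \<and> src h = src g \<and> tgt h = tgt g")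
    case True
    then show ?thesis by (auto elim!: valid_arrowE simp: plus_closed plus_ass)
  next
    case False
    have "pls C (pls C h g) f = None"
    proof (cases "valid_arrow D g \<and> valid_arrow D h \<and> src g = src h \<and> tgt g = tgt h")
      case True
      then have "src (pls C h g) = src g" "tgt (pls C h g) = tgt g" by (simp_all add: arrow_data_def)
      then show ?thesis using False True by (intro np) auto
    next
      case F: False
      have "pls C h g = None" by (rule np) (use F in auto)
      then show ?thesis by (simp add: np[of None f])
    qed
    moreover have "pls C h (pls C g f) = None"
    proof (cases "valid_arrow D f \<and> valid_arrow D g \<and> src f = src g \<and> tgt f = tgt g")
      case True
      then have "src (pls C g f) = src g" "tgt (pls C g f) = tgt g" by (simp_all add: arrow_data_def)
      then show ?thesis using False True by (intro np) auto
    next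
      case F: False
      have "pls C g f = None" by (rule np) (use F in auto)
      then show ?thesis by (simp add: np[of h None])
    qed
    ultimately show ?thesis by simp
  qed
  show "pls C g f = pls C f g"
    by (auto simp: arrow_data_def elim!: valid_arrowE intro: plus_comm)
  show "arr C (neg C f) \<longleftrightarrow> arr C f" by (auto simp: arrow_data_def elim!: valid_arrowE intro: neg_closed)
  show "arr C f \<Longrightarrow> dm C (neg C f) = dm C f" "arr C f \<Longrightarrow> cd C (neg C f) = cd C f"
    by (auto simp: arrow_data_def)
  show "arr C (zer C A B) \<longleftrightarrow> A \<in> Ob C \<and> B \<in> Ob C" by (auto simp: arrow_data_def zero_closed)
  show "\<lbrakk>A \<in> Ob C; B \<in> Ob C\<rbrakk> \<Longrightarrow> dm C (zer C A B) = A" "\<lbrakk>A \<in> Ob C; B \<in> Ob C\<rbrakk> \<Longrightarrow> cd C (zer C A B) = B"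
    by auto
  show "\<lbrakk>arr C f; dm C f = A; cd C f = B\<rbrakk> \<Longrightarrow> pls C f (zer C A B) = f"
    by (auto elim!: valid_arrowE simp: zero_closed plus_zero)
  show "arr C f \<Longrightarrow> pls C f (neg C f) = zer C (dm C f) (cd C f)"
    by (auto elim!: valid_arrowE simp: neg_closed plus_neg)
  show "cmp C h (pls C f g) = pls C (cmp C h f) (cmp C h g)"
  proof (cases "valid_arrow D f \<and> valid_arrow D g \<and> valid_arrow D h \<and> src f = src g \<and> tgt f = tgt g \<and> tgt g = src h")
    case True
    then show ?thesis by (auto elim!: valid_arrowE simp: plus_closed comp_closed comp_plus)
  next
    case False
    have "cmp C h (pls C f g) = None"
    proof (cases "valid_arrow D f \<and> valid_arrow D g \<and> src f = src g \<and> tgt f = tgt g")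
      case True
      then have "tgt (pls C f g) = tgt g" by (simp add: arrow_data_def)
      then show ?thesis using False True by (intro nc) auto
    next
      case F: False
      have "pls C f g = None" by (rule np) (use F in auto)
      then show ?thesis by (simp add: nc[of h None])
    qed
    moreover have "pls C (cmp C h f) (cmp C h g) = None"
    proof (cases "valid_arrow D f \<and> valid_arrow D g \<and> valid_arrow D h \<and> tgt f = src h \<and> tgt g = src h")
      case True
      then have "src (cmp C h f) = src f" "src (cmp C h g) = src g" by (simp_all add: arrow_data_def)
      then show ?thesis using False True by (intro np) auto
    qed (intro np, use c in auto)
    ultimately show ?thesis by simp
  qed
  show "cmp C (pls C f g) h = pls C (cmp C f h) (cmp C g h)"
  proof (cases "valid_arrow D f \<and> valid_arrow D g \<and> valid_arrow D h \<and> src f = src g \<and> tgt f = tgt g \<and> tgt h = src g")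
    case True
    then show ?thesis by (auto elim!: valid_arrowE simp: plus_closed comp_closed plus_comp)
  next
    case False
    have "cmp C (pls C f g) h = None"
    proof (cases "valid_arrow D f \<and> valid_arrow D g \<and> src f = src g \<and> tgt f = tgt g")
      case True
      then have "src (pls C f g) = src g" by (simp add: arrow_data_def)
      then show ?thesis using False True by (intro nc) auto
    next
      case F: False
      have "pls C f g = None" by (rule np) (use F in auto)
      then show ?thesis by (simp add: nc[of None h])
    qed
    moreover have "pls C (cmp C f h) (cmp C g h) = None"
    proof (cases "valid_arrow D f \<and> valid_arrow D g \<and> valid_arrow D h \<and> tgt h = src f \<and> tgt h = src g")
      case True
      then have "tgt (cmp C f h) = tgt f" "tgt (cmp C g h) = tgt g" by (auto simp: arrow_data_def)
      then show ?thesis using False True by (intro np) auto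
    qed (intro np, use c in auto)
    ultimately show ?thesis by simp
  qed
  show "arr C (idt C A) \<longleftrightarrow> A \<in> Ob C" by (auto simp: arrow_data_def ident_closed)
  show "A \<in> Ob C \<Longrightarrow> dm C (idt C A) = A" "A \<in> Ob C \<Longrightarrow> cd C (idt C A) = A" by auto
  show "\<lbrakk>arr C f; dm C f = A\<rbrakk> \<Longrightarrow> cmp C f (idt C A) = f" "\<lbrakk>arr C f; cd C f = A\<rbrakk> \<Longrightarrow> cmp C (idt C A) f = f"
    by (auto elim!: valid_arrowE simp: ident_closed comp_ident ident_comp)
  show "zo C \<in> Ob C" by simp
  have "ident D Z = zero_mor D Z Z"
    using zero_Z ident_closed[of Z] zero_closed[of Z Z] unfolding is_zero_object_def by blast
  then show "idt C (zo C) = zer C (zo C) (zo C)" by simp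
qed

(* Domains, codomains, zeros and identities stay folded, so that the rules of arrow_category apply to
   them. *)
declare arrow_data_sel(2-4) [simp del] arrow_data_ops(4,5) [simp del]

lemma Some_sel [simp]:
  "arr C (Some (A, f, B)) \<longleftrightarrow> A \<in> obj D \<and> B \<in> obj D \<and> f \<in> mor D A B"
  "dm C (Some (A, f, B)) = A" "cd C (Some (A, f, B)) = B"
  by (simp_all add: arrow_data_sel)

lemma arr_eq_Some:
  assumes "arr C x"
  shows "x = Some (dm C x, morph x, cd C x)" "morph x \<in> mor D (dm C x) (cd C x)" "dm C x \<in> obj D" "cd C x \<in> obj D"
  using assms by (auto simp: arrow_data_sel elim!: valid_arrowE)

lemmas zer_Some = arrow_data_ops(4) and idt_Some = arrow_data_ops(5)

section \<open>Translation of complexes\<close>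

definition lift_obj :: "nat \<Rightarrow> ('o, 'm) cpx \<Rightarrow> int \<Rightarrow> 'o" where
  "lift_obj m X i = (if 0 \<le> i \<and> i \<le> int m then cobj X (nat i) else Z)"

text \<open>
  Outside the range of the complex both ends of the arrow are \<open>Z\<close>, or one is \<open>Z\<close> and the other is
  an end of the complex, so the padding arrows are zero arrows. Together with extensionality of
  complexes this makes \<open>lift_cpx\<close> a bijection from complexes to bounded integer-indexed
  complexes, with inverse \<open>unlift_cpx\<close>.
\<close>

definition lift_cpx :: "nat \<Rightarrow> ('o, 'm) cpx \<Rightarrow> int \<Rightarrow> ('o \<times> 'm \<times> 'o) option" where
  "lift_cpx m X i = (if 0 \<le> i \<and> i < int m then Some (cobj X (nat i), cdiff X (nat i), cobj X (Suc (nat i)))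
     else zer C (lift_obj m X i) (lift_obj m X (i + 1)))"

definition unlift_cpx :: "nat \<Rightarrow> (int \<Rightarrow> ('o \<times> 'm \<times> 'o) option) \<Rightarrow> ('o, 'm) cpx" where
  "unlift_cpx m W = \<lparr>cobj = (\<lambda>i\<in>{..m}. dm C (W (int i))), cdiff = (\<lambda>i\<in>{..<m}. morph (W (int i)))\<rparr>"

definition lift_map :: "nat \<Rightarrow> ('o, 'm) cpx \<Rightarrow> ('o, 'm) cpx \<Rightarrow> (nat \<Rightarrow> 'm) \<Rightarrow> int \<Rightarrow> ('o \<times> 'm \<times> 'o) option" where
  "lift_map m X Y f i = (if 0 \<le> i \<and> i \<le> int m then Some (cobj X (nat i), f (nat i), cobj Y (nat i)) else zer C Z Z)"

lemma full_sel [simp]: "obj (full_subcategory D S) = S" "mor (full_subcategory D S) = mor D"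
  "comp (full_subcategory D S) = comp D" "zero_mor (full_subcategory D S) = zero_mor D"
  "ident (full_subcategory D S) = ident D" "plus_mor (full_subcategory D S) = plus_mor D"
  by (simp_all add: full_subcategory_def)

lemma full_group [simp]: "mor_group (full_subcategory D S) = mor_group D"
  by (intro ext) (simp add: mor_group_def)

lemma full_neg [simp]: "neg_mor (full_subcategory D S) = neg_mor D"
  by (intro ext) (simp add: neg_mor_def)

lemma full_obj [simp]: "full_subcategory D (obj D) = D"
  by (simp add: full_subcategory_def)

lemma complexes_fullD:
  assumes "X \<in> complexes (full_subcategory D S) m"
  shows "i \<le> m \<Longrightarrow> cobj X i \<in> S" "i < m \<Longrightarrow> cdiff X i \<in> mor D (cobj X i) (cobj X (Suc i))"
    "Suc i < m \<Longrightarrow> cdiff X (Suc i) \<cdot> cdiff X i = zero_mor D (cobj X i) (cobj X (Suc (Suc i)))"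
  using assms unfolding complexes_def by auto

lemma complexes_full:
  assumes "S \<subseteq> obj D"
  shows "X \<in> complexes (full_subcategory D S) m \<longleftrightarrow> X \<in> complexes D m \<and> (\<forall>i\<le>m. cobj X i \<in> S)"
  using assms unfolding complexes_def by (auto simp: PiE_iff)

context
  fixes S assumes SO: "S \<subseteq> obj D" and ZS: "Z \<in> S"
begin

lemma lift_obj_in: "X \<in> complexes (full_subcategory D S) m \<Longrightarrow> lift_obj m X i \<in> S"
  using complexes_fullD(1)[of X S m "nat i"] ZS by (auto simp: lift_obj_def)

lemma lift_cpx_facts:
  assumes X: "X \<in> complexes (full_subcategory D S) m"
  shows lift_cpx_complex: "int_complex C S (lift_cpx m X)" and lift_cpx_dm: "dm C (lift_cpx m X i) = lift_obj m X i"
    and lift_cpx_bounded: "bounded_in C 0 (int m) (lift_cpx m X)"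
proof -
  note c = complexes_fullD[OF X]
  have zO: "lift_obj m X i \<in> obj D" for i using lift_obj_in[OF X] SO by auto
  have e: "nat (i + 1) = Suc (nat i)" if "0 \<le> i" for i using that by simp
  have dm: "dm C (lift_cpx m X i) = lift_obj m X i" for i
  proof (cases "0 \<le> i \<and> i < int m")
    case True then show ?thesis by (simp add: lift_cpx_def lift_obj_def)
  next
    case False then show ?thesis using zO by (simp add: lift_cpx_def del: de_Morgan_conj)
  qed
  have cd: "cd C (lift_cpx m X i) = lift_obj m X (i + 1)" for i
  proof (cases "0 \<le> i \<and> i < int m")
    case True then show ?thesis by (simp add: lift_cpx_def lift_obj_def e)
  next
    case False then show ?thesis using zO by (simp add: lift_cpx_def del: de_Morgan_conj)
  qed
  have ar: "arr C (lift_cpx m X i)" for i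
  proof (cases "0 \<le> i \<and> i < int m")
    case True
    then have "nat i < m" by auto
    then have "cobj X (nat i) \<in> obj D" "cobj X (Suc (nat i)) \<in> obj D" "cdiff X (nat i) \<in> mor D (cobj X (nat i)) (cobj X (Suc (nat i)))"
      using c(1)[of "nat i"] c(1)[of "Suc (nat i)"] c(2)[of "nat i"] SO by auto
    then show ?thesis using True by (simp add: lift_cpx_def)
  next
    case False
    then show ?thesis using zO by (simp add: lift_cpx_def del: de_Morgan_conj)
  qed
  show "dm C (lift_cpx m X i) = lift_obj m X i" by (rule dm)
  show "bounded_in C 0 (int m) (lift_cpx m X)" by (auto simp: bounded_in_def dm lift_obj_def)
  show "int_complex C S (lift_cpx m X)" unfolding int_complex_def
  proof (intro allI conjI)
    fix i
    show "arr C (lift_cpx m X i)" using ar by simp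
    show "dm C (lift_cpx m X i) \<in> S" using dm lift_obj_in[OF X] by simp
    show "cd C (lift_cpx m X i) = dm C (lift_cpx m X (i + 1))" using dm cd by simp
    have two: "i + 1 + 1 = i + 2" by simp
    show "cmp C (lift_cpx m X (i + 1)) (lift_cpx m X i) = zer C (dm C (lift_cpx m X i)) (dm C (lift_cpx m X (i + 2)))"
    proof (cases "0 \<le> i \<and> i + 1 < int m")
      case True
      then have lt: "Suc (nat i) < m" by auto
      have s: "lift_cpx m X i = Some (cobj X (nat i), cdiff X (nat i), cobj X (Suc (nat i)))"
        "lift_cpx m X (i + 1) = Some (cobj X (Suc (nat i)), cdiff X (Suc (nat i)), cobj X (Suc (Suc (nat i))))"
        using True by (simp_all add: lift_cpx_def e)
      have zi: "lift_obj m X i = cobj X (nat i)" using True by (simp add: lift_obj_def)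
      have z2: "lift_obj m X (i + 2) = cobj X (Suc (Suc (nat i)))" using True by (simp add: lift_obj_def nat_add_distrib)
      have o: "cobj X (nat i) \<in> obj D" "cobj X (Suc (nat i)) \<in> obj D" "cobj X (Suc (Suc (nat i))) \<in> obj D"
        using c(1) lt SO by auto
      show ?thesis using c(2)[of "nat i"] c(2)[of "Suc (nat i)"] c(3)[OF lt] lt o
        unfolding dm zi z2 unfolding s by (simp add: zer_Some)
    next
      case False
      show ?thesis
      proof (cases "0 \<le> i")
        case True
        then have "lift_cpx m X (i + 1) = zer C (lift_obj m X (i + 1)) (lift_obj m X (i + 2))"
          using False by (simp add: lift_cpx_def two)
        then show ?thesis using ar[of i] dm cd zO cmp_zer zer_cmp[of "lift_cpx m X i" "lift_obj m X (i + 1)" "lift_obj m X (i + 2)"]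
          by (simp)
      next
        case False
        then have "lift_cpx m X i = zer C (lift_obj m X i) (lift_obj m X (i + 1))" by (simp add: lift_cpx_def)
        then show ?thesis using ar[of "i + 1"] dm cd[of "i + 1", unfolded two] zO cmp_zer[of "lift_cpx m X (i + 1)" "lift_obj m X (i + 1)" "lift_obj m X i"]
          by (simp)
      qed
    qed
  qed
qed

lemma unlift_lift: "X \<in> complexes (full_subcategory D S) m \<Longrightarrow> unlift_cpx m (lift_cpx m X) = X"
proof -
  assume X: "X \<in> complexes (full_subcategory D S) m"
  have "cobj X \<in> extensional {..m}" "cdiff X \<in> extensional {..<m}"
    using X by (auto simp: complexes_def PiE_iff)
  moreover have "dm C (lift_cpx m X (int i)) = cobj X i" if "i \<le> m" for i using that lift_cpx_dm[OF X] by (simp add: lift_obj_def)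
  moreover have "morph (lift_cpx m X (int i)) = cdiff X i" if "i < m" for i using that by (simp add: lift_cpx_def)
  ultimately have "(\<lambda>i\<in>{..m}. dm C (lift_cpx m X (int i))) = cobj X" "(\<lambda>i\<in>{..<m}. morph (lift_cpx m X (int i))) = cdiff X"
    by (auto simp: restrict_def extensional_def fun_eq_iff)
  then show ?thesis unfolding unlift_cpx_def by simp
qed

lemma unlift_facts:
  assumes W: "int_complex C S W" and b: "bounded_in C 0 (int m) W"
  shows unlift_complexes: "unlift_cpx m W \<in> complexes (full_subcategory D S) m" and lift_unlift: "lift_cpx m (unlift_cpx m W) = W"
proof -
  note d = int_complexD[OF W]
  note w = arr_eq_Some[OF d(1)]
  have Ws: "W i = Some (dm C (W i), morph (W i), cd C (W i))" for i by (rule w(1))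
  have mo: "morph (W i) \<in> mor D (dm C (W i)) (cd C (W i))" for i by (rule w(2))
  have ob: "dm C (W i) \<in> obj D" for i by (rule w(3))
  have nx: "cd C (W i) = dm C (W (i + 1))" for i using d(3)[of i] by simp
  have i1: "int (Suc i) = int i + 1" "int (Suc (Suc i)) = int i + 2" for i by auto
  have sq: "morph (W (i + 1)) \<cdot> morph (W i) = zero_mor D (dm C (W i)) (dm C (W (i + 2)))" for i
  proof -
    have "cmp C (Some (dm C (W (i + 1)), morph (W (i + 1)), cd C (W (i + 1)))) (Some (dm C (W i), morph (W i), cd C (W i))) =
       zer C (dm C (W i)) (dm C (W (i + 2)))"
      using d(4)[of i] Ws[symmetric] by simp
    moreover have "cd C (W (i + 1)) = dm C (W (i + 2))" using nx[of "i + 1"] by (simp add: add.commute)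
    ultimately show ?thesis using mo[of i] mo[of "i + 1"] ob[of i] ob[of "i+1"] ob[of "i + 2"] nx[of i] by (simp add: zer_Some)
  qed
  show "unlift_cpx m W \<in> complexes (full_subcategory D S) m"
  proof -
    have "morph (W (int x)) \<in> mor D (dm C (W (int x))) (dm C (W (1 + int x)))" for x
      using mo[of "int x"] nx[of "int x"] by (simp add: add.commute)
    moreover have "morph (W (1 + int x)) \<cdot> morph (W (int x)) = zero_mor D (dm C (W (int x))) (dm C (W (int x + 2)))" for x
      using sq[of "int x"] by (simp add: add.commute)
    ultimately show ?thesis using d(2) unfolding complexes_def unlift_cpx_def by (auto simp: add.commute)
  qed
  show "lift_cpx m (unlift_cpx m W) = W"
  proof (rule ext)
    fix i
    have zo: "lift_obj m (unlift_cpx m W) i = dm C (W i)" for i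
      using b by (auto simp: lift_obj_def unlift_cpx_def bounded_in_def)
    show "lift_cpx m (unlift_cpx m W) i = W i"
    proof (cases "0 \<le> i \<and> i < int m")
      case True
      then have lt: "nat i < m" "nat i \<le> m" "Suc (nat i) \<le> m" by auto
      then show ?thesis using True Ws[of i] nx[of i] by (simp add: lift_cpx_def unlift_cpx_def add.commute)
    next
      case False
      then have z: "dm C (W i) = Z \<or> cd C (W i) = Z" using b nx[of i] by (auto simp: bounded_in_def)
      have "W i = zer C (dm C (W i)) (cd C (W i))"
        using z from_zo[of "W i"] into_zo[of "W i"] d(1)[of i] by auto
      then show ?thesis using False by (simp add: lift_cpx_def zo nx del: de_Morgan_conj)
    qed
  qed
qed

lemma lift_chain_map:
  assumes f: "chain_map (full_subcategory D S) m X Y f"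
  shows "int_chain_map C (lift_cpx m X) (lift_cpx m Y) (lift_map m X Y f)"
proof -
  have X: "X \<in> complexes (full_subcategory D S) m" and Y: "Y \<in> complexes (full_subcategory D S) m"
    and fm: "\<And>i. i \<le> m \<Longrightarrow> f i \<in> mor D (cobj X i) (cobj Y i)"
    and fc: "\<And>i. i < m \<Longrightarrow> f (Suc i) \<cdot> cdiff X i = cdiff Y i \<cdot> f i"
    using f by (auto simp: chain_map_def)
  note d = int_complexD[OF lift_cpx_complex[OF X]] int_complexD[OF lift_cpx_complex[OF Y]]
  have cobj_obj: "i \<le> m \<Longrightarrow> cobj X i \<in> obj D" "i \<le> m \<Longrightarrow> cobj Y i \<in> obj D" for i
    using complexes_fullD(1)[OF X] complexes_fullD(1)[OF Y] SO by auto
  have t: "lift_map m X Y f i \<in> homset C (dm C (lift_cpx m X i)) (dm C (lift_cpx m Y i))" for i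
  proof (cases "0 \<le> i \<and> i \<le> int m")
    case True
    then have "nat i \<le> m" by auto
    then show ?thesis using True cobj_obj fm by (simp add: lift_map_def lift_cpx_dm[OF X] lift_cpx_dm[OF Y] lift_obj_def)
  next
    case False
    then show ?thesis using zero_closed by (auto simp: lift_map_def lift_cpx_dm[OF X] lift_cpx_dm[OF Y] lift_obj_def)
  qed
  then have t': "arr C (lift_map m X Y f i)" "dm C (lift_map m X Y f i) = dm C (lift_cpx m X i)" "cd C (lift_map m X Y f i) = dm C (lift_cpx m Y i)" for i
    using t[of i] by auto
  show ?thesis unfolding int_chain_map_def
  proof (intro allI conjI t)
    fix i
    show "cmp C (lift_map m X Y f (i + 1)) (lift_cpx m X i) = cmp C (lift_cpx m Y i) (lift_map m X Y f i)"
    proof (cases "0 \<le> i \<and> i < int m")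
      case True
      then have lt: "nat i < m" "nat (i + 1) = Suc (nat i)" by auto
      then show ?thesis using True fm[of "nat i"] fm[of "Suc (nat i)"] fc[of "nat i"] cobj_obj[of "nat i"] cobj_obj[of "Suc (nat i)"]
          complexes_fullD(2)[OF X, of "nat i"] complexes_fullD(2)[OF Y, of "nat i"]
        by (simp add: lift_map_def lift_cpx_def)
    next
      case False
      show ?thesis
      proof (cases "i < 0")
        case True
        then have z: "dm C (lift_cpx m X i) = zo C" by (simp add: lift_cpx_dm[OF X] lift_obj_def)
        show ?thesis
          by (rule trans[OF of_zo[OF _ z] of_zo[OF _ z, symmetric]]) (use t' d in auto)
      next
        case False
        then have z: "dm C (lift_cpx m Y (i + 1)) = zo C" using \<open>\<not> (0 \<le> i \<and> i < int m)\<close> by (simp add: lift_cpx_dm[OF Y] lift_obj_def)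
        show ?thesis
          by (rule trans[OF to_zo[OF _ z] to_zo[OF _ z, symmetric]]) (use t' d in auto)
      qed
    qed
  qed
qed

lemma unlift_chain_map:
  assumes X: "X \<in> complexes (full_subcategory D S) m" and Y: "Y \<in> complexes (full_subcategory D S) m"
    and f: "int_chain_map C (lift_cpx m X) (lift_cpx m Y) \<phi>"
  shows "chain_map (full_subcategory D S) m X Y (\<lambda>i. morph (\<phi> (int i)))"
    "lift_map m X Y (\<lambda>i. morph (\<phi> (int i))) = \<phi>"
proof -
  note d = int_chain_mapD[OF f]
  note w = arr_eq_Some[OF d(1), unfolded d(2,3) lift_cpx_dm[OF X] lift_cpx_dm[OF Y]]
  have s: "\<phi> i = Some (lift_obj m X i, morph (\<phi> i), lift_obj m Y i)" for i by (rule w(1))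
  have m: "morph (\<phi> i) \<in> mor D (lift_obj m X i) (lift_obj m Y i)" "lift_obj m X i \<in> obj D" "lift_obj m Y i \<in> obj D" for i
    by (rule w(2), rule w(3), rule w(4))
  have lift_obj: "lift_obj m X (int i) = cobj X i" "lift_obj m Y (int i) = cobj Y i" if "i \<le> m" for i using that by (simp_all add: lift_obj_def)
  show "chain_map (full_subcategory D S) m X Y (\<lambda>i. morph (\<phi> (int i)))" unfolding chain_map_def
  proof (intro conjI allI impI X Y)
    fix i
    show "morph (\<phi> (int i)) \<in> mor (full_subcategory D S) (cobj X i) (cobj Y i)" if "i \<le> m" using m(1)[of "int i"] lift_obj[OF that] by simp
    assume i: "i < m"
    have e: "int i + 1 = int (Suc i)" and n: "nat (1 + int i) = Suc i" by simp_all
    have "cmp C (Some (cobj X (Suc i), morph (\<phi> (int (Suc i))), cobj Y (Suc i))) (Some (cobj X i, cdiff X i, cobj X (Suc i))) =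
      cmp C (Some (cobj Y i, cdiff Y i, cobj Y (Suc i))) (Some (cobj X i, morph (\<phi> (int i)), cobj Y i))"
      using d(4)[of "int i", unfolded e] s[of "int i"] s[of "int (Suc i)"] i n by (simp add: lift_cpx_def lift_obj_def)
    then show "morph (\<phi> (int (Suc i))) \<cdot>\<^bsub>full_subcategory D S\<^esub> cdiff X i = cdiff Y i \<cdot>\<^bsub>full_subcategory D S\<^esub> morph (\<phi> (int i))"
      using m[of "int i"] m[of "int (Suc i)"] i lift_obj[of i] lift_obj[of "Suc i"] complexes_fullD(2)[OF X i] complexes_fullD(2)[OF Y i] by simp
  qed
  show "lift_map m X Y (\<lambda>i. morph (\<phi> (int i))) = \<phi>"
  proof (rule ext)
    fix i
    show "lift_map m X Y (\<lambda>i. morph (\<phi> (int i))) i = \<phi> i"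
    proof (cases "0 \<le> i \<and> i \<le> int m")
      case True then show ?thesis using s[of i] by (simp add: lift_map_def lift_obj_def)
    next
      case False
      then have z: "lift_obj m X i = Z" "lift_obj m Y i = Z" by (auto simp: lift_obj_def)
      have "\<phi> i = zer C (zo C) (zo C)"
        by (rule to_zo[OF _ refl]) (use d(1-3)[of i] in \<open>auto simp: lift_cpx_dm[OF X] lift_cpx_dm[OF Y] z\<close>)
      then show ?thesis using False by (simp only: lift_map_def if_False arrow_data_sel)
    qed
  qed
qed

end

end

section \<open>The axioms in dual pairs\<close>

definition has_pushouts :: "('o, 'a) arrows \<Rightarrow> int \<Rightarrow> 'o set \<Rightarrow> (int \<Rightarrow> 'a) set \<Rightarrow> bool" where
  "has_pushouts C N S XX \<longleftrightarrow> (\<forall>X\<in>XX. \<forall>t. arr C t \<and> cd C t \<in> S \<and> dm C t = dm C (X 0) \<longrightarrow>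
     (\<exists>P h. int_complex C S P \<and> bounded_in C 0 N P \<and> int_chain_map C (trunc_le C N X) P h \<and> h 0 = t \<and>
        (\<forall>i\<ge>0. pushout_exact_at C S h (trunc_le C N X) P i) \<and> (\<exists>Q\<in>XX. Q 0 = P 0)))"

definition epis_compose :: "('o, 'a) arrows \<Rightarrow> int \<Rightarrow> (int \<Rightarrow> 'a) set \<Rightarrow> bool" where
  "epis_compose C N XX \<longleftrightarrow>
     (\<forall>X\<in>XX. \<forall>Y\<in>XX. cd C (X N) = dm C (Y N) \<longrightarrow> (\<exists>Z\<in>XX. Z N = Y N \<odot>\<^bsub>C\<^esub> X N))"

lemma all_reflect: "(\<forall>i\<le>N + 1. P (N + 1 - i)) \<longleftrightarrow> (\<forall>i\<ge>0. P (i::int))"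
proof
  assume a: "\<forall>i\<le>N + 1. P (N + 1 - i)"
  show "\<forall>i\<ge>0. P i"
  proof (intro allI impI)
    fix i :: int assume "0 \<le> i"
    then show "P i" using a[rule_format, of "N + 1 - i"] by simp
  qed
qed auto

context arrow_category
begin

lemma has_pullbacks_opp_iff:
  assumes c: "\<And>X. X \<in> XX \<Longrightarrow> int_complex C S X" and z: "zo C \<in> S"
  shows "has_pullbacks (opp C) N S (reflect N ` XX) \<longleftrightarrow> has_pushouts C N S XX"
proof
  interpret o: arrow_category "opp C" by (rule opp_arrow_category)
  assume p: "has_pullbacks (opp C) N S (reflect N ` XX)"
  show "has_pushouts C N S XX" unfolding has_pushouts_def
  proof (intro ballI allI impI, elim conjE)
    fix X t assume X: "X \<in> XX" and t: "arr C t" "cd C t \<in> S" "dm C t = dm C (X 0)"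
    note XC = c[OF X]
    have "cd C (X (-1)) = dm C (X 0)" using int_complexD(3)[OF XC, of "-1"] by simp
    then have "cd (opp C) t = dm (opp C) (reflect N X (N + 1))" using t by (simp add: reflect_def)
    then obtain P h Q where P: "int_complex (opp C) S P" "bounded_in (opp C) 1 (N + 1) P" "int_chain_map (opp C) P (trunc_ge (opp C) 1 (reflect N X)) h"
      "h (N + 1) = t" "\<And>i. i \<le> N + 1 \<Longrightarrow> pullback_exact_at (opp C) S h P (trunc_ge (opp C) 1 (reflect N X)) i"
      and Q: "Q \<in> XX" "reflect N Q N = P N"
      using p X t unfolding has_pullbacks_def by fastforce
    note tr = trunc_le_opp[OF XC, symmetric]
    define P' h' where "P' = reflect N P" and "h' = reflect (N + 1) h"
    have P': "P = reflect N P'" "h = reflect (N + 1) h'" by (simp_all add: P'_def h'_def)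
    have C1: "int_complex C S P'" using o.int_complex_opp[OF P(1), of N] by (simp add: P'_def)
    have C2: "bounded_in C 0 N P'" using o.bounded_in_opp[OF P(1,2), of N] by (simp add: P'_def)
    have C3: "int_chain_map C (trunc_le C N X) P' h'"
      using o.int_chain_map_opp[OF P(1) _ P(3), of N] o.int_complex_trunc_ge[OF int_complex_opp[OF XC], of 1 N] z
      unfolding tr by (simp add: P'_def h'_def)
    have "\<forall>i\<le>N + 1. pushout_exact_at C S h' (trunc_le C N X) P' (N + 1 - i)"
      using P(5) unfolding tr P' pullback_exact_opp by blast
    then have C4: "\<forall>i\<ge>0. pushout_exact_at C S h' (trunc_le C N X) P' i" unfolding all_reflect .
    have C5: "h' 0 = t" "Q 0 = P' 0" using P(4) Q(2) by (simp_all add: P'_def h'_def reflect_def)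
    show "\<exists>P h. int_complex C S P \<and> bounded_in C 0 N P \<and> int_chain_map C (trunc_le C N X) P h \<and> h 0 = t \<and>
        (\<forall>i\<ge>0. pushout_exact_at C S h (trunc_le C N X) P i) \<and> (\<exists>Q\<in>XX. Q 0 = P 0)"
      using C1 C2 C3 C4 C5 Q(1) by blast
  qed
next
  interpret o: arrow_category "opp C" by (rule opp_arrow_category)
  assume p: "has_pushouts C N S XX"
  show "has_pullbacks (opp C) N S (reflect N ` XX)" unfolding has_pullbacks_def
  proof (intro ballI allI impI, elim conjE)
    fix X' t assume "X' \<in> reflect N ` XX" and t: "arr (opp C) t" "dm (opp C) t \<in> S" "cd (opp C) t = dm (opp C) (X' (N + 1))"
    then obtain X where X: "X \<in> XX" "X' = reflect N X" by blast
    note XC = c[OF X(1)]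
    have "cd C (X (-1)) = dm C (X 0)" using int_complexD(3)[OF XC, of "-1"] by simp
    then have "dm C t = dm C (X 0)" using t X by (simp add: reflect_def)
    then obtain P h Q where P: "int_complex C S P" "bounded_in C 0 N P" "int_chain_map C (trunc_le C N X) P h"
      "h 0 = t" "\<And>i. 0 \<le> i \<Longrightarrow> pushout_exact_at C S h (trunc_le C N X) P i"
      and Q: "Q \<in> XX" "Q 0 = P 0"
      using p X t unfolding has_pushouts_def by (simp, blast)
    note tr = trunc_le_opp[OF XC]
    have C1: "int_complex (opp C) S (reflect N P)" by (rule int_complex_opp[OF P(1)])
    have C2: "bounded_in (opp C) 1 (N + 1) (reflect N P)" using bounded_in_opp[OF P(1,2), of N] by simp
    have C3: "int_chain_map (opp C) (reflect N P) (trunc_ge (opp C) 1 X') (reflect (N + 1) h)"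
      using int_chain_map_opp[OF int_complex_trunc_le[OF XC z] P(1,3), of N] unfolding tr X .
    have "\<forall>i\<le>N + 1. pushout_exact_at C S h (trunc_le C N X) P (N + 1 - i)"
      using P(5) by simp
    then have C4: "\<forall>i\<le>N + 1. pullback_exact_at (opp C) S (reflect (N + 1) h) (reflect N P) (trunc_ge (opp C) 1 X') i"
      unfolding X tr[symmetric] pullback_exact_opp .
    have C5: "reflect (N + 1) h (N + 1) = t" "reflect N Q N = reflect N P N"
      using P(4) Q(2) by (simp_all add: reflect_def)
    show "\<exists>P h. int_complex (opp C) S P \<and> bounded_in (opp C) 1 (N + 1) P \<and> int_chain_map (opp C) P (trunc_ge (opp C) 1 X') h \<and> h (N + 1) = t \<and>
        (\<forall>i\<le>N + 1. pullback_exact_at (opp C) S h P (trunc_ge (opp C) 1 X') i) \<and> (\<exists>Q\<in>reflect N ` XX. Q N = P N)"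
      using C1 C2 C3 C4 C5 Q(1) by blast
  qed
qed

lemma weak_iso_class_opp:
  assumes "weak_iso_class C N S XX"
  shows "weak_iso_class (opp C) N S (reflect N ` XX)"
  unfolding weak_iso_class_def
proof (intro allI impI)
  interpret o: arrow_category "opp C" by (rule opp_arrow_category)
  fix X Y f assume X: "n_exact_complex (opp C) N S X" and Y: "n_exact_complex (opp C) N S Y" and f: "weak_iso_map (opp C) N X Y f"
  have i: "X \<in> reflect N ` XX \<longleftrightarrow> reflect N X \<in> XX" for X by (metis image_eqI imageE reflect_reflect)
  have "weak_iso_map (opp (opp C)) N (reflect N Y) (reflect N X) (reflect (N + 1) f)"
    by (rule o.weak_iso_map_opp[OF _ _ f, of S]) (use X Y in \<open>auto simp: n_exact_complex_def\<close>)
  then show "X \<in> reflect N ` XX \<longleftrightarrow> Y \<in> reflect N ` XX"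
    using assms o.n_exact_complex_opp[OF X] o.n_exact_complex_opp[OF Y] unfolding i weak_iso_class_def by auto
qed

text \<open>
  The half of the axioms over the opposite category is written out in terms of \<open>C\<close>, as needed for
  the comparison with the axioms of an \<open>n\<close>-exact category.
\<close>

lemma n_exact_structure_iff:
  assumes z: "zo C \<in> S"
  shows "n_exact_structure C N S XX \<longleftrightarrow> (\<forall>X\<in>XX. n_exact_complex C N S X) \<and> weak_iso_class C N S XX \<and> monos_compose C XX \<and>
    epis_compose C N XX \<and> has_pullbacks C N S XX \<and> has_pushouts C N S XX"
proof (cases "\<forall>X\<in>XX. n_exact_complex C N S X")
  case True
  then have c: "int_complex C S X" if "X \<in> XX" for X using that by (auto simp: n_exact_complex_def)
  have e: "monos_compose (opp C) (reflect N ` XX) \<longleftrightarrow> epis_compose C N XX"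
    unfolding monos_compose_def epis_compose_def by (auto simp: reflect_def)
  show ?thesis
  proof -
    have p: "has_pullbacks (opp C) N S (reflect N ` XX) \<longleftrightarrow> has_pushouts C N S XX" by (rule has_pullbacks_opp_iff[OF c z])
    have n: "\<forall>X\<in>reflect N ` XX. n_exact_complex (opp C) N S X" using True n_exact_complex_opp by blast
    show ?thesis
      unfolding n_exact_structure_def half_n_exact_def e p using True n weak_iso_class_opp[of N S XX] by blast
  qed
next
  case False
  then show ?thesis unfolding n_exact_structure_def half_n_exact_def by blast
qed

end

section \<open>Translation of exactness\<close>

context pointed_category
begin

lemma homset_image:
  assumes "A \<in> obj D" "B \<in> obj D"
  shows "homset C A B = (\<lambda>f. Some (A, f, B)) ` mor D A B"
proof
  show "homset C A B \<subseteq> (\<lambda>f. Some (A, f, B)) ` mor D A B"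
  proof
    fix u assume "u \<in> homset C A B"
    then have u: "arr C u" "dm C u = A" "cd C u = B" by auto
    note s = arr_eq_Some(1,2)[OF u(1), unfolded u(2,3)]
    show "u \<in> (\<lambda>f. Some (A, f, B)) ` mor D A B" using s by blast
  qed
qed (use assms in auto)

lemma homset_all: "A \<in> obj D \<Longrightarrow> B \<in> obj D \<Longrightarrow> (\<forall>u\<in>homset C A B. P u) \<longleftrightarrow> (\<forall>f\<in>mor D A B. P (Some (A, f, B)))"
  by (simp only: homset_image ball_simps)

lemma homset_ex: "A \<in> obj D \<Longrightarrow> B \<in> obj D \<Longrightarrow> (\<exists>u\<in>homset C A B. P u) \<longleftrightarrow> (\<exists>f\<in>mor D A B. P (Some (A, f, B)))"
  by (simp only: homset_image bex_simps)

lemma kernel_mor_iff: "x \<in> kernel (mor_group D A B) (mor_group D A' B') h \<longleftrightarrow> x \<in> mor D A B \<and> h x = zero_mor D A' B'"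
  by (auto simp: kernel_def mor_group_def)

lemma lift_cpx_int: "i < m \<Longrightarrow> lift_cpx m X (int i) = Some (cobj X i, cdiff X i, cobj X (Suc i))"
  by (simp add: lift_cpx_def)

context
  fixes S assumes SO: "S \<subseteq> obj D" and ZS: "Z \<in> S"
begin

context
  fixes X n assumes X: "X \<in> complexes (full_subcategory D S) (Suc n)"
begin

lemma lift_cpx_ends: "dm C (lift_cpx (Suc n) X i) = lift_obj (Suc n) X i" "cd C (lift_cpx (Suc n) X i) = lift_obj (Suc n) X (i + 1)"
  using lift_cpx_dm[OF SO ZS X] int_complexD(3)[OF lift_cpx_complex[OF SO ZS X]] by auto

lemma lift_obj_int: "i \<le> Suc n \<Longrightarrow> lift_obj (Suc n) X (int i) = cobj X i"
  by (simp add: lift_obj_def)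

lemma cobj_obj: "i \<le> Suc n \<Longrightarrow> cobj X i \<in> obj D" using complexes_fullD(1)[OF X] SO by auto

lemma cov_exact_first:
  "cov_exact_at C S (lift_cpx (Suc n) X) 0 \<longleftrightarrow> (\<forall>T\<in>S. kernel (mor_group D T (cobj X 0)) (mor_group D T (cobj X 1)) (\<lambda>g. cdiff X 0 \<cdot> g)
         = {zero_mor D T (cobj X 0)})"
proof -
  have e: "lift_obj (Suc n) X 0 = cobj X 0" "lift_obj (Suc n) X 1 = cobj X 1" "lift_obj (Suc n) X (- 1) = Z"
    using lift_obj_int[of 0] lift_obj_int[of 1] by (simp_all add: lift_obj_def)
  have z: "lift_cpx (Suc n) X 0 = Some (cobj X 0, cdiff X 0, cobj X 1)" using lift_cpx_int[of 0 "Suc n" X] by simp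
  have dd: "cdiff X 0 \<in> mor D (cobj X 0) (cobj X 1)" using complexes_fullD(2)[OF X, of 0] by simp
  have zm: "lift_cpx (Suc n) X (- 1) = zer C Z (cobj X 0)" by (simp add: lift_cpx_def lift_obj_def)
  have O: "cobj X 0 \<in> obj D" "cobj X 1 \<in> obj D" using cobj_obj by auto
  have 1: "(\<exists>v\<in>homset C T Z. u = cmp C (zer C Z (cobj X 0)) v) \<longleftrightarrow> u = zer C T (cobj X 0)" if "T \<in> obj D" for T u
  proof -
    have "cmp C (zer C Z (cobj X 0)) v = zer C T (cobj X 0)" if "v \<in> homset C T Z" for v
      using that O by simp
    moreover have "zer C T Z \<in> homset C T Z" using \<open>T \<in> obj D\<close> by simp
    ultimately show ?thesis by metis
  qed
  have "cov_exact_at C S (lift_cpx (Suc n) X) 0 \<longleftrightarrow> (\<forall>T\<in>S. \<forall>u\<in>homset C T (cobj X 0). cmp C (lift_cpx (Suc n) X 0) u = zer C T (cobj X 1) \<longrightarrow> u = zer C T (cobj X 0))"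
    unfolding cov_exact_at_def lift_cpx_ends using 1 SO by (simp add: e zm subset_iff del: homset_iff)
  also have "\<dots> \<longleftrightarrow> (\<forall>T\<in>S. \<forall>f\<in>mor D T (cobj X 0). cdiff X 0 \<cdot> f = zero_mor D T (cobj X 1) \<longrightarrow> f = zero_mor D T (cobj X 0))"
    using SO O dd by (intro ball_cong refl) (auto simp: homset_all z zer_Some subset_iff)
  also have "\<dots> \<longleftrightarrow> (\<forall>T\<in>S. kernel (mor_group D T (cobj X 0)) (mor_group D T (cobj X 1)) (\<lambda>g. cdiff X 0 \<cdot> g)
         = {zero_mor D T (cobj X 0)})"
  proof (intro ball_cong refl)
    fix T assume "T \<in> S"
    then have T: "T \<in> obj D" using SO by auto
    have "cmp C (lift_cpx (Suc n) X 0) (zer C T (cobj X 0)) = zer C T (cobj X 1)"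
      using T O cmp_zer[of "lift_cpx (Suc n) X 0" "cobj X 0" T] dd by (simp add: z)
    then have "cdiff X 0 \<cdot> zero_mor D T (cobj X 0) = zero_mor D T (cobj X 1)"
      using T O dd zero_closed[of T "cobj X 0"] by (simp add: z zer_Some)
    then show "(\<forall>f\<in>mor D T (cobj X 0). cdiff X 0 \<cdot> f = zero_mor D T (cobj X 1) \<longrightarrow> f = zero_mor D T (cobj X 0)) \<longleftrightarrow>
      kernel (mor_group D T (cobj X 0)) (mor_group D T (cobj X 1)) (\<lambda>g. cdiff X 0 \<cdot> g) = {zero_mor D T (cobj X 0)}"
      using zero_closed[OF T O(1)] by (auto simp: kernel_mor_iff set_eq_iff)
  qed
  finally show ?thesis .
qed

lemma cov_exact_inner:
  assumes i: "i < n"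
  shows "cov_exact_at C S (lift_cpx (Suc n) X) (int i + 1) \<longleftrightarrow> (\<forall>T\<in>S.
    kernel (mor_group D T (cobj X (Suc i))) (mor_group D T (cobj X (Suc (Suc i)))) (\<lambda>g. cdiff X (Suc i) \<cdot> g)
           = (\<lambda>g. cdiff X i \<cdot> g) ` mor D T (cobj X i))"
proof -
  have e: "lift_obj (Suc n) X (int i) = cobj X i" "lift_obj (Suc n) X (int i + 1) = cobj X (Suc i)" "lift_obj (Suc n) X (int i + 1 + 1) = cobj X (Suc (Suc i))"
    using lift_obj_int[of i] lift_obj_int[of "Suc i"] lift_obj_int[of "Suc (Suc i)"] i by (simp_all add: add.commute)
  have z: "lift_cpx (Suc n) X (int i) = Some (cobj X i, cdiff X i, cobj X (Suc i))"
    "lift_cpx (Suc n) X (int i + 1) = Some (cobj X (Suc i), cdiff X (Suc i), cobj X (Suc (Suc i)))"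
    using lift_cpx_int[of i "Suc n" X] lift_cpx_int[of "Suc i" "Suc n" X] i by (simp_all add: add.commute)
  have dd: "cdiff X i \<in> mor D (cobj X i) (cobj X (Suc i))" "cdiff X (Suc i) \<in> mor D (cobj X (Suc i)) (cobj X (Suc (Suc i)))"
    "cdiff X (Suc i) \<cdot> cdiff X i = zero_mor D (cobj X i) (cobj X (Suc (Suc i)))"
    using complexes_fullD[OF X] i by auto
  have O: "cobj X i \<in> obj D" "cobj X (Suc i) \<in> obj D" "cobj X (Suc (Suc i)) \<in> obj D" using cobj_obj i by auto
  have "cov_exact_at C S (lift_cpx (Suc n) X) (int i + 1) \<longleftrightarrow> (\<forall>T\<in>S. \<forall>f\<in>mor D T (cobj X (Suc i)).
    cdiff X (Suc i) \<cdot> f = zero_mor D T (cobj X (Suc (Suc i))) \<longrightarrow> (\<exists>g\<in>mor D T (cobj X i). f = cdiff X i \<cdot> g))"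
    unfolding cov_exact_at_def lift_cpx_ends e add_diff_cancel_right'
    using SO O dd(1,2) by (intro ball_cong refl) (auto simp: homset_all homset_ex z zer_Some subset_iff)
  also have "\<dots> \<longleftrightarrow> (\<forall>T\<in>S. kernel (mor_group D T (cobj X (Suc i))) (mor_group D T (cobj X (Suc (Suc i)))) (\<lambda>g. cdiff X (Suc i) \<cdot> g)
           = (\<lambda>g. cdiff X i \<cdot> g) ` mor D T (cobj X i))"
  proof (intro ball_cong refl)
    fix T assume "T \<in> S"
    then have T: "T \<in> obj D" using SO by auto
    have im: "cdiff X i \<cdot> g \<in> mor D T (cobj X (Suc i)) \<and> cdiff X (Suc i) \<cdot> (cdiff X i \<cdot> g) = zero_mor D T (cobj X (Suc (Suc i)))"
      if g: "g \<in> mor D T (cobj X i)" for g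
    proof
      show m: "cdiff X i \<cdot> g \<in> mor D T (cobj X (Suc i))" by (rule comp_closed[OF T O(1,2) g dd(1)])
      have "cmp C (lift_cpx (Suc n) X (int i + 1)) (cmp C (lift_cpx (Suc n) X (int i)) (Some (T, g, cobj X i))) = zer C T (cobj X (Suc (Suc i)))"
        using int_complex_sq_cmp[OF lift_cpx_complex[OF SO ZS X] refl, of "Some (T, g, cobj X i)" "int i"] g T O e
        by (simp add: lift_cpx_ends add.commute)
      then show "cdiff X (Suc i) \<cdot> (cdiff X i \<cdot> g) = zero_mor D T (cobj X (Suc (Suc i)))"
        using m g T O dd by (simp add: z zer_Some)
    qed
    then show "(\<forall>f\<in>mor D T (cobj X (Suc i)). cdiff X (Suc i) \<cdot> f = zero_mor D T (cobj X (Suc (Suc i))) \<longrightarrow> (\<exists>g\<in>mor D T (cobj X i). f = cdiff X i \<cdot> g)) \<longleftrightarrow>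
     kernel (mor_group D T (cobj X (Suc i))) (mor_group D T (cobj X (Suc (Suc i)))) (\<lambda>g. cdiff X (Suc i) \<cdot> g)
           = (\<lambda>g. cdiff X i \<cdot> g) ` mor D T (cobj X i)"
      by (auto simp: kernel_mor_iff set_eq_iff)
  qed
  finally show ?thesis .
qed

lemma cov_exact_negative: "i < 0 \<Longrightarrow> cov_exact_at C S (lift_cpx (Suc n) X) i"
  unfolding cov_exact_at_def lift_cpx_ends
proof (intro ballI impI)
  fix T u assume i: "i < 0" and T: "T \<in> S" and u: "u \<in> homset C T (lift_obj (Suc n) X i)"
  have z: "lift_obj (Suc n) X i = Z" "lift_obj (Suc n) X (i - 1) = Z" using i by (auto simp: lift_obj_def)
  have "u = zer C T Z" using to_zo[OF u] z by simp
  moreover have "cmp C (lift_cpx (Suc n) X (i - 1)) (zer C T Z) = zer C T Z"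
    using int_complexD(1)[OF lift_cpx_complex[OF SO ZS X]] T SO by (subst cmp_zer) (auto simp: lift_cpx_ends z)
  ultimately show "\<exists>v\<in>homset C T (lift_obj (Suc n) X (i - 1)). u = cmp C (lift_cpx (Suc n) X (i - 1)) v"
    using T SO by (intro bexI[of _ "zer C T Z"]) (auto simp: z)
qed

lemma covariantly_exact_iff: "covariantly_exact (full_subcategory D S) n X \<longleftrightarrow> (\<forall>i\<le>int n. cov_exact_at C S (lift_cpx (Suc n) X) i)"
proof -
  have "(\<forall>i\<le>int n. cov_exact_at C S (lift_cpx (Suc n) X) i) \<longleftrightarrow> cov_exact_at C S (lift_cpx (Suc n) X) 0 \<and> (\<forall>i<n. cov_exact_at C S (lift_cpx (Suc n) X) (int i + 1))"
  proof
    assume r: "cov_exact_at C S (lift_cpx (Suc n) X) 0 \<and> (\<forall>i<n. cov_exact_at C S (lift_cpx (Suc n) X) (int i + 1))"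
    show "\<forall>i\<le>int n. cov_exact_at C S (lift_cpx (Suc n) X) i"
    proof (intro allI impI)
      fix i assume i: "i \<le> int n"
      consider "i < 0" | "i = 0" | "0 < i" by linarith
      then show "cov_exact_at C S (lift_cpx (Suc n) X) i"
      proof cases
        case 3
        then have "nat (i - 1) < n" "int (nat (i - 1)) + 1 = i" using i by auto
        then show ?thesis using r by metis
      qed (use cov_exact_negative r in auto)
    qed
  qed auto
  then show ?thesis unfolding covariantly_exact_def using cov_exact_first cov_exact_inner by auto
qed

lemma contra_exact_last:
  "contra_exact_at C S (lift_cpx (Suc n) X) (int n + 1) \<longleftrightarrow> (\<forall>T\<in>S. kernel (mor_group D (cobj X (Suc n)) T) (mor_group D (cobj X n) T) (\<lambda>g. g \<cdot> cdiff X n)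
         = {zero_mor D (cobj X (Suc n)) T})"
proof -
  have e: "lift_obj (Suc n) X (int n) = cobj X n" "lift_obj (Suc n) X (int n + 1) = cobj X (Suc n)" "lift_obj (Suc n) X (int n + 1 + 1) = Z"
    using lift_obj_int[of n] lift_obj_int[of "Suc n"] by (simp_all add: lift_obj_def add.commute)
  have z: "lift_cpx (Suc n) X (int n) = Some (cobj X n, cdiff X n, cobj X (Suc n))" using lift_cpx_int[of n "Suc n" X] by simp
  have dd: "cdiff X n \<in> mor D (cobj X n) (cobj X (Suc n))" using complexes_fullD(2)[OF X, of n] by simp
  have zm: "lift_cpx (Suc n) X (int n + 1) = zer C (cobj X (Suc n)) Z" by (simp add: lift_cpx_def lift_obj_def nat_add_distrib)
  have O: "cobj X n \<in> obj D" "cobj X (Suc n) \<in> obj D" using cobj_obj by auto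
  have 1: "(\<exists>v\<in>homset C Z T. u = cmp C v (zer C (cobj X (Suc n)) Z)) \<longleftrightarrow> u = zer C (cobj X (Suc n)) T" if "T \<in> obj D" for T u
  proof -
    have "cmp C v (zer C (cobj X (Suc n)) Z) = zer C (cobj X (Suc n)) T" if "v \<in> homset C Z T" for v
      using that O by simp
    moreover have "zer C Z T \<in> homset C Z T" using \<open>T \<in> obj D\<close> by simp
    ultimately show ?thesis by metis
  qed
  have "contra_exact_at C S (lift_cpx (Suc n) X) (int n + 1) \<longleftrightarrow> (\<forall>T\<in>S. \<forall>u\<in>homset C (cobj X (Suc n)) T. cmp C u (lift_cpx (Suc n) X (int n)) = zer C (cobj X n) T \<longrightarrow> u = zer C (cobj X (Suc n)) T)"
    unfolding contra_exact_at_def lift_cpx_ends e add_diff_cancel_right' unfolding zm using 1 SO by (simp add: subset_iff del: homset_iff)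
  also have "\<dots> \<longleftrightarrow> (\<forall>T\<in>S. \<forall>f\<in>mor D (cobj X (Suc n)) T. f \<cdot> cdiff X n = zero_mor D (cobj X n) T \<longrightarrow> f = zero_mor D (cobj X (Suc n)) T)"
    using SO O dd by (intro ball_cong refl) (auto simp: homset_all z zer_Some subset_iff)
  also have "\<dots> \<longleftrightarrow> (\<forall>T\<in>S. kernel (mor_group D (cobj X (Suc n)) T) (mor_group D (cobj X n) T) (\<lambda>g. g \<cdot> cdiff X n)
         = {zero_mor D (cobj X (Suc n)) T})"
  proof (intro ball_cong refl)
    fix T assume "T \<in> S"
    then have T: "T \<in> obj D" using SO by auto
    have "cmp C (zer C (cobj X (Suc n)) T) (lift_cpx (Suc n) X (int n)) = zer C (cobj X n) T"
      using T O zer_cmp[of "lift_cpx (Suc n) X (int n)" "cobj X (Suc n)" T] dd by (simp add: z)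
    then have "zero_mor D (cobj X (Suc n)) T \<cdot> cdiff X n = zero_mor D (cobj X n) T"
      using T O dd zero_closed[of "cobj X (Suc n)" T] by (simp add: z zer_Some)
    then show "(\<forall>f\<in>mor D (cobj X (Suc n)) T. f \<cdot> cdiff X n = zero_mor D (cobj X n) T \<longrightarrow> f = zero_mor D (cobj X (Suc n)) T) \<longleftrightarrow>
      kernel (mor_group D (cobj X (Suc n)) T) (mor_group D (cobj X n) T) (\<lambda>g. g \<cdot> cdiff X n) = {zero_mor D (cobj X (Suc n)) T}"
      using zero_closed[OF O(2) T] by (auto simp: kernel_mor_iff set_eq_iff)
  qed
  finally show ?thesis .
qed

lemma contra_exact_inner:
  assumes i: "i < n"
  shows "contra_exact_at C S (lift_cpx (Suc n) X) (int i + 1) \<longleftrightarrow> (\<forall>T\<in>S.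
    kernel (mor_group D (cobj X (Suc i)) T) (mor_group D (cobj X i) T) (\<lambda>g. g \<cdot> cdiff X i)
           = (\<lambda>g. g \<cdot> cdiff X (Suc i)) ` mor D (cobj X (Suc (Suc i))) T)"
proof -
  have e: "lift_obj (Suc n) X (int i) = cobj X i" "lift_obj (Suc n) X (int i + 1) = cobj X (Suc i)" "lift_obj (Suc n) X (int i + 1 + 1) = cobj X (Suc (Suc i))"
    using lift_obj_int[of i] lift_obj_int[of "Suc i"] lift_obj_int[of "Suc (Suc i)"] i by (simp_all add: add.commute)
  have z: "lift_cpx (Suc n) X (int i) = Some (cobj X i, cdiff X i, cobj X (Suc i))"
    "lift_cpx (Suc n) X (int i + 1) = Some (cobj X (Suc i), cdiff X (Suc i), cobj X (Suc (Suc i)))"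
    using lift_cpx_int[of i "Suc n" X] lift_cpx_int[of "Suc i" "Suc n" X] i by (simp_all add: add.commute)
  have dd: "cdiff X i \<in> mor D (cobj X i) (cobj X (Suc i))" "cdiff X (Suc i) \<in> mor D (cobj X (Suc i)) (cobj X (Suc (Suc i)))"
    "cdiff X (Suc i) \<cdot> cdiff X i = zero_mor D (cobj X i) (cobj X (Suc (Suc i)))"
    using complexes_fullD[OF X] i by auto
  have O: "cobj X i \<in> obj D" "cobj X (Suc i) \<in> obj D" "cobj X (Suc (Suc i)) \<in> obj D" using cobj_obj i by auto
  have "contra_exact_at C S (lift_cpx (Suc n) X) (int i + 1) \<longleftrightarrow> (\<forall>T\<in>S. \<forall>f\<in>mor D (cobj X (Suc i)) T.
    f \<cdot> cdiff X i = zero_mor D (cobj X i) T \<longrightarrow> (\<exists>g\<in>mor D (cobj X (Suc (Suc i))) T. f = g \<cdot> cdiff X (Suc i)))"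
    unfolding contra_exact_at_def lift_cpx_ends e add_diff_cancel_right'
    using SO O dd(1,2) by (intro ball_cong refl) (auto simp: homset_all homset_ex z zer_Some subset_iff)
  also have "\<dots> \<longleftrightarrow> (\<forall>T\<in>S. kernel (mor_group D (cobj X (Suc i)) T) (mor_group D (cobj X i) T) (\<lambda>g. g \<cdot> cdiff X i)
           = (\<lambda>g. g \<cdot> cdiff X (Suc i)) ` mor D (cobj X (Suc (Suc i))) T)"
  proof (intro ball_cong refl)
    fix T assume "T \<in> S"
    then have T: "T \<in> obj D" using SO by auto
    have im: "g \<cdot> cdiff X (Suc i) \<in> mor D (cobj X (Suc i)) T \<and> (g \<cdot> cdiff X (Suc i)) \<cdot> cdiff X i = zero_mor D (cobj X i) T"
      if g: "g \<in> mor D (cobj X (Suc (Suc i))) T" for g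
    proof
      show m: "g \<cdot> cdiff X (Suc i) \<in> mor D (cobj X (Suc i)) T" by (rule comp_closed[OF O(2,3) T dd(2) g])
      have "cmp C (Some (cobj X (Suc (Suc i)), g, T)) (zer C (cobj X i) (cobj X (Suc (Suc i)))) = zer C (cobj X i) T"
        using g T O by simp
      then have "g \<cdot> zero_mor D (cobj X i) (cobj X (Suc (Suc i))) = zero_mor D (cobj X i) T"
        using g T O zero_closed[of "cobj X i" "cobj X (Suc (Suc i))"] by (simp add: zer_Some)
      then show "(g \<cdot> cdiff X (Suc i)) \<cdot> cdiff X i = zero_mor D (cobj X i) T"
        using comp_assoc[OF O T dd(1,2) g] dd(3) by simp
    qed
    then show "(\<forall>f\<in>mor D (cobj X (Suc i)) T. f \<cdot> cdiff X i = zero_mor D (cobj X i) T \<longrightarrow> (\<exists>g\<in>mor D (cobj X (Suc (Suc i))) T. f = g \<cdot> cdiff X (Suc i))) \<longleftrightarrow>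
     kernel (mor_group D (cobj X (Suc i)) T) (mor_group D (cobj X i) T) (\<lambda>g. g \<cdot> cdiff X i)
           = (\<lambda>g. g \<cdot> cdiff X (Suc i)) ` mor D (cobj X (Suc (Suc i))) T"
      by (auto simp: kernel_mor_iff set_eq_iff)
  qed
  finally show ?thesis .
qed

lemma contra_exact_beyond: "i > int n + 1 \<Longrightarrow> contra_exact_at C S (lift_cpx (Suc n) X) i"
  unfolding contra_exact_at_def lift_cpx_ends diff_add_cancel
proof (intro ballI impI)
  fix T u assume i: "i > int n + 1" and T: "T \<in> S" and u: "u \<in> homset C (lift_obj (Suc n) X i) T"
  have z: "lift_obj (Suc n) X i = Z" "lift_obj (Suc n) X (i + 1) = Z" using i by (auto simp: lift_obj_def)
  have "u = zer C Z T" using of_zo[OF u] z by simp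
  moreover have "cmp C (zer C Z T) (lift_cpx (Suc n) X i) = zer C Z T"
    using int_complexD(1)[OF lift_cpx_complex[OF SO ZS X]] T SO by (subst zer_cmp) (auto simp: lift_cpx_ends z)
  ultimately show "\<exists>v\<in>homset C (lift_obj (Suc n) X (i + 1)) T. u = cmp C v (lift_cpx (Suc n) X i)"
    using T SO by (intro bexI[of _ "zer C Z T"]) (auto simp: z)
qed

lemma contravariantly_exact_iff: "contravariantly_exact (full_subcategory D S) n X \<longleftrightarrow> (\<forall>i\<ge>1. contra_exact_at C S (lift_cpx (Suc n) X) i)"
proof -
  have "(\<forall>i\<ge>1. contra_exact_at C S (lift_cpx (Suc n) X) i) \<longleftrightarrow> contra_exact_at C S (lift_cpx (Suc n) X) (int n + 1) \<and> (\<forall>i<n. contra_exact_at C S (lift_cpx (Suc n) X) (int i + 1))"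
  proof
    assume r: "contra_exact_at C S (lift_cpx (Suc n) X) (int n + 1) \<and> (\<forall>i<n. contra_exact_at C S (lift_cpx (Suc n) X) (int i + 1))"
    show "\<forall>i\<ge>1. contra_exact_at C S (lift_cpx (Suc n) X) i"
    proof (intro allI impI)
      fix i :: int assume i: "1 \<le> i"
      consider "i > int n + 1" | "i = int n + 1" | "i \<le> int n" by linarith
      then show "contra_exact_at C S (lift_cpx (Suc n) X) i"
      proof cases
        case 3
        then have "nat (i - 1) < n" "int (nat (i - 1)) + 1 = i" using i by auto
        then show ?thesis using r by metis
      qed (use contra_exact_beyond r in auto)
    qed
  qed auto
  then show ?thesis unfolding contravariantly_exact_def using contra_exact_last contra_exact_inner by auto
qed

end

lemma n_exact_complex_lift_iff:
  assumes "X \<in> complexes (full_subcategory D S) (Suc n)"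
  shows "n_exact_sequence (full_subcategory D S) n X \<longleftrightarrow> n_exact_complex C (int n) S (lift_cpx (Suc n) X)"
  using covariantly_exact_iff[OF assms] contravariantly_exact_iff[OF assms] lift_cpx_complex[OF SO ZS assms] lift_cpx_bounded[OF SO ZS assms] assms
  by (simp add: n_exact_sequence_def n_exact_complex_def n_exact_for_def add.commute)

end
end

section \<open>Translation of cones\<close>

text \<open>
  Under this condition biproducts in \<open>D\<close> of objects of \<open>S\<close> are biproducts in the full subcategory
  on \<open>S\<close>.
\<close>

definition biproduct_closed :: "('o, 'm) category_data \<Rightarrow> 'o set \<Rightarrow> bool" where
  "biproduct_closed D S \<longleftrightarrow> (\<forall>A\<in>S. \<forall>B\<in>S. \<forall>s i1 i2 p1 p2. is_biproduct D A B s i1 i2 p1 p2 \<longrightarrow> s \<in> S)"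

context pointed_category
begin

lemma eval_first:
  assumes o: "A \<in> obj D" "X1 \<in> obj D" "Y0 \<in> obj D" "E \<in> obj D"
    and m: "nx \<in> mor D A X1" "f \<in> mor D A Y0" "i1 \<in> mor D X1 E" "i2 \<in> mor D Y0 E"
  shows "Some (A, (i1 \<cdot> nx) \<boxplus> (i2 \<cdot> f), E) =
    pls C (cmp C (Some (X1, i1, E)) (Some (A, nx, X1))) (cmp C (Some (Y0, i2, E)) (Some (A, f, Y0)))"
    "(i1 \<cdot> nx) \<boxplus> (i2 \<cdot> f) \<in> mor D A E"
proof -
  have "i1 \<cdot> nx \<in> mor D A E" "i2 \<cdot> f \<in> mor D A E"
    by (rule comp_closed[OF o(1,2,4) m(1,3)], rule comp_closed[OF o(1,3,4) m(2,4)])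
  then show "Some (A, (i1 \<cdot> nx) \<boxplus> (i2 \<cdot> f), E) =
    pls C (cmp C (Some (X1, i1, E)) (Some (A, nx, X1))) (cmp C (Some (Y0, i2, E)) (Some (A, f, Y0)))"
    "(i1 \<cdot> nx) \<boxplus> (i2 \<cdot> f) \<in> mor D A E"
    using o m plus_closed by auto
qed

lemma eval_mid:
  assumes o: "W0 \<in> obj D" "X1 \<in> obj D" "X2 \<in> obj D" "Y0 \<in> obj D" "Y1 \<in> obj D" "W1 \<in> obj D"
    and m: "p1 \<in> mor D W0 X1" "p2 \<in> mor D W0 Y0" "nx \<in> mor D X1 X2" "f \<in> mor D X1 Y1" "dy \<in> mor D Y0 Y1"
      "i1 \<in> mor D X2 W1" "i2 \<in> mor D Y1 W1"
  shows "Some (W0, (i1 \<cdot> nx \<cdot> p1) \<boxplus> (i2 \<cdot> f \<cdot> p1) \<boxplus> (i2 \<cdot> dy \<cdot> p2), W1) =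
    pls C (cmp C (Some (X2, i1, W1)) (cmp C (Some (X1, nx, X2)) (Some (W0, p1, X1))))
      (pls C (cmp C (Some (Y1, i2, W1)) (cmp C (Some (X1, f, Y1)) (Some (W0, p1, X1))))
        (cmp C (Some (Y1, i2, W1)) (cmp C (Some (Y0, dy, Y1)) (Some (W0, p2, Y0)))))"
proof -
  note a = comp_closed[OF o(2,3,6) m(3,6)] comp_closed[OF o(2,5,6) m(4,7)] comp_closed[OF o(4,5,6) m(5,7)]
  note b = comp_closed[OF o(1,2,6) m(1) a(1)] comp_closed[OF o(1,2,6) m(1) a(2)] comp_closed[OF o(1,4,6) m(2) a(3)]
  note c = plus_closed[OF o(1,6) b(1,2)]
  show ?thesis unfolding cmp_assoc[symmetric] pls_assoc[symmetric] using o m a b c by simp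
qed

context
  fixes S assumes SO: "S \<subseteq> obj D" and ZS: "Z \<in> S"
begin

lemma biproduct_lift_iff:
  assumes A: "A \<in> S" and B: "B \<in> S"
  shows "is_biproduct (full_subcategory D S) A B s i1 i2 p1 p2 \<longleftrightarrow>
    s \<in> S \<and> biproduct C A B s (Some (A, i1, s)) (Some (B, i2, s)) (Some (s, p1, A)) (Some (s, p2, B))"
proof (cases "s \<in> S \<and> i1 \<in> mor D A s \<and> i2 \<in> mor D B s \<and> p1 \<in> mor D s A \<and> p2 \<in> mor D s B")
  case True
  have O: "A \<in> obj D" "B \<in> obj D" "s \<in> obj D" using A B True SO by auto
  have m: "i1 \<cdot> p1 \<in> mor D s s" "i2 \<cdot> p2 \<in> mor D s s"
    using comp_closed[of s A s p1 i1] comp_closed[of s B s p2 i2] True O by auto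
  show ?thesis using True O m by (simp add: is_biproduct_def biproduct_def idt_Some zer_Some)
next
  case False
  then show ?thesis using SO by (auto simp: is_biproduct_def biproduct_def)
qed

context
  fixes n X Y f
  assumes n: "1 \<le> n" and X: "X \<in> complexes (full_subcategory D S) n" and Y: "Y \<in> complexes (full_subcategory D S) n"
    and fm: "\<And>i. i \<le> n \<Longrightarrow> f i \<in> mor D (cobj X i) (cobj Y i)"
begin

lemma lift_cpx_sel: "dm C (lift_cpx n X i) = lift_obj n X i" "cd C (lift_cpx n X i) = lift_obj n X (i + 1)" "arr C (lift_cpx n X i)"
  "dm C (lift_cpx n Y i) = lift_obj n Y i" "cd C (lift_cpx n Y i) = lift_obj n Y (i + 1)" "arr C (lift_cpx n Y i)"
  using lift_cpx_dm[OF SO ZS X] int_complexD[OF lift_cpx_complex[OF SO ZS X]] lift_cpx_dm[OF SO ZS Y] int_complexD[OF lift_cpx_complex[OF SO ZS Y]] by auto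

lemma lift_obj_obj: "lift_obj n X i \<in> obj D" "lift_obj n Y i \<in> obj D"
  using lift_obj_in[OF SO ZS X, of i] lift_obj_in[OF SO ZS Y, of i] SO by auto

lemma lift_map_sel: "arr C (lift_map n X Y f i)" "dm C (lift_map n X Y f i) = lift_obj n X i" "cd C (lift_map n X Y f i) = lift_obj n Y i"
proof -
  have "arr C (lift_map n X Y f i) \<and> dm C (lift_map n X Y f i) = lift_obj n X i \<and> cd C (lift_map n X Y f i) = lift_obj n Y i"
  proof (cases "0 \<le> i \<and> i \<le> int n")
    case True
    then have "nat i \<le> n" by auto
    then show ?thesis using True fm[of "nat i"] complexes_fullD(1)[OF X, of "nat i"] complexes_fullD(1)[OF Y, of "nat i"] SO
      by (auto simp: lift_map_def lift_obj_def)
  next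
    case False
    then show ?thesis by (auto simp: lift_map_def lift_obj_def)
  qed
  then show "arr C (lift_map n X Y f i)" "dm C (lift_map n X Y f i) = lift_obj n X i" "cd C (lift_map n X Y f i) = lift_obj n Y i" by auto
qed

text \<open>
  The column, the inner matrices and the row that make up the differential of a cone, rewritten
  as expressions in arrows.
\<close>

lemma cone_diffs:
  assumes bp: "\<forall>k<n. is_biproduct (full_subcategory D S) (cobj X (Suc k)) (cobj Y k) (cobj W (Suc k))
         (i1 (Suc k)) (i2 (Suc k)) (p1 (Suc k)) (p2 (Suc k))"
  shows "Some (cobj X 0, (i1 1 \<cdot> neg_mor D (cobj X 0) (cobj X 1) (cdiff X 0)) \<boxplus> (i2 1 \<cdot> f 0), cobj W 1) =
     pls C (cmp C (Some (cobj X 1, i1 1, cobj W 1)) (neg C (lift_cpx n X 0))) (cmp C (Some (cobj Y 0, i2 1, cobj W 1)) (lift_map n X Y f 0))"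
   and "Suc k < n \<Longrightarrow> Some (cobj W (Suc k),
          (i1 (Suc (Suc k)) \<cdot> neg_mor D (cobj X (Suc k)) (cobj X (Suc (Suc k))) (cdiff X (Suc k)) \<cdot> p1 (Suc k))
          \<boxplus> (i2 (Suc (Suc k)) \<cdot> f (Suc k) \<cdot> p1 (Suc k))
          \<boxplus> (i2 (Suc (Suc k)) \<cdot> cdiff Y k \<cdot> p2 (Suc k)), cobj W (Suc (Suc k))) =
     pls C (cmp C (Some (cobj X (Suc (Suc k)), i1 (Suc (Suc k)), cobj W (Suc (Suc k)))) (cmp C (neg C (lift_cpx n X (int (Suc k)))) (Some (cobj W (Suc k), p1 (Suc k), cobj X (Suc k)))))
      (pls C (cmp C (Some (cobj Y (Suc k), i2 (Suc (Suc k)), cobj W (Suc (Suc k)))) (cmp C (lift_map n X Y f (int (Suc k))) (Some (cobj W (Suc k), p1 (Suc k), cobj X (Suc k)))))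
        (cmp C (Some (cobj Y (Suc k), i2 (Suc (Suc k)), cobj W (Suc (Suc k)))) (cmp C (lift_cpx n Y (int k)) (Some (cobj W (Suc k), p2 (Suc k), cobj Y k)))))"
   and "Some (cobj W n, (f n \<cdot> p1 n) \<boxplus> (cdiff Y (n - 1) \<cdot> p2 n), cobj Y n) =
     pls C (cmp C (lift_map n X Y f (int n)) (Some (cobj W n, p1 n, cobj X n))) (cmp C (lift_cpx n Y (int n - 1)) (Some (cobj W n, p2 n, cobj Y (n - 1))))"
   and "\<And>k. k < n \<Longrightarrow> cobj W (Suc k) \<in> S"
proof -
  have b: "cobj W (Suc k) \<in> S" "i1 (Suc k) \<in> mor D (cobj X (Suc k)) (cobj W (Suc k))" "i2 (Suc k) \<in> mor D (cobj Y k) (cobj W (Suc k))"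
    "p1 (Suc k) \<in> mor D (cobj W (Suc k)) (cobj X (Suc k))" "p2 (Suc k) \<in> mor D (cobj W (Suc k)) (cobj Y k)" if "k < n" for k
    using bp that by (auto simp: is_biproduct_def)
  have O: "i \<le> n \<Longrightarrow> cobj X i \<in> obj D" "i \<le> n \<Longrightarrow> cobj Y i \<in> obj D" "k < n \<Longrightarrow> cobj W (Suc k) \<in> obj D" for i k
    using complexes_fullD(1)[OF X] complexes_fullD(1)[OF Y] b(1) SO by auto
  have nx: "neg C (lift_cpx n X (int i)) = Some (cobj X i, neg_mor D (cobj X i) (cobj X (Suc i)) (cdiff X i), cobj X (Suc i))"
    "neg_mor D (cobj X i) (cobj X (Suc i)) (cdiff X i) \<in> mor D (cobj X i) (cobj X (Suc i))"
    "lift_cpx n Y (int i) = Some (cobj Y i, cdiff Y i, cobj Y (Suc i))" if "i < n" for i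
    using that O(1)[of i] O(1)[of "Suc i"] complexes_fullD(2)[OF X that] neg_closed lift_cpx_int[OF that] by auto
  have lift_map_sel: "lift_map n X Y f (int i) = Some (cobj X i, f i, cobj Y i)" if "i \<le> n" for i using that by (simp add: lift_map_def)
  show "\<And>k. k < n \<Longrightarrow> cobj W (Suc k) \<in> S" by (rule b(1))
  show "Some (cobj X 0, (i1 1 \<cdot> neg_mor D (cobj X 0) (cobj X 1) (cdiff X 0)) \<boxplus> (i2 1 \<cdot> f 0), cobj W 1) =
     pls C (cmp C (Some (cobj X 1, i1 1, cobj W 1)) (neg C (lift_cpx n X 0))) (cmp C (Some (cobj Y 0, i2 1, cobj W 1)) (lift_map n X Y f 0))"
    using eval_first[of "cobj X 0" "cobj X 1" "cobj Y 0" "cobj W 1" "neg_mor D (cobj X 0) (cobj X 1) (cdiff X 0)" "f 0" "i1 1" "i2 1"]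
      O(1)[of 0] O(1)[of 1] O(2)[of 0] O(3)[of 0] nx[of 0] lift_map_sel[of 0] b(2,3)[of 0] fm[of 0] n by simp
  show "Some (cobj W (Suc k),
          (i1 (Suc (Suc k)) \<cdot> neg_mor D (cobj X (Suc k)) (cobj X (Suc (Suc k))) (cdiff X (Suc k)) \<cdot> p1 (Suc k))
          \<boxplus> (i2 (Suc (Suc k)) \<cdot> f (Suc k) \<cdot> p1 (Suc k))
          \<boxplus> (i2 (Suc (Suc k)) \<cdot> cdiff Y k \<cdot> p2 (Suc k)), cobj W (Suc (Suc k))) =
     pls C (cmp C (Some (cobj X (Suc (Suc k)), i1 (Suc (Suc k)), cobj W (Suc (Suc k)))) (cmp C (neg C (lift_cpx n X (int (Suc k)))) (Some (cobj W (Suc k), p1 (Suc k), cobj X (Suc k)))))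
      (pls C (cmp C (Some (cobj Y (Suc k), i2 (Suc (Suc k)), cobj W (Suc (Suc k)))) (cmp C (lift_map n X Y f (int (Suc k))) (Some (cobj W (Suc k), p1 (Suc k), cobj X (Suc k)))))
        (cmp C (Some (cobj Y (Suc k), i2 (Suc (Suc k)), cobj W (Suc (Suc k)))) (cmp C (lift_cpx n Y (int k)) (Some (cobj W (Suc k), p2 (Suc k), cobj Y k)))))"
    if k: "Suc k < n"
  proof -
    have k': "k < n" "Suc k \<le> n" "Suc (Suc k) \<le> n" "k \<le> n" using k by auto
    show ?thesis unfolding nx(1)[OF k] nx(3)[OF k'(1)] lift_map_sel[OF k'(2)]
      by (rule eval_mid) (use O k k' b[OF k] b[OF k'(1)] nx(2)[OF k] fm complexes_fullD(2)[OF Y k'(1)] in auto)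
  qed
  obtain m where m: "n = Suc m" using n by (cases n) auto
  have z1: "lift_cpx n Y (int n - 1) = lift_cpx n Y (int m)" using m by simp
  have mm: "f n \<cdot> p1 n \<in> mor D (cobj W n) (cobj Y n)" "cdiff Y m \<cdot> p2 n \<in> mor D (cobj W n) (cobj Y n)"
    using comp_closed[of "cobj W n" "cobj X n" "cobj Y n" "p1 n" "f n"] comp_closed[of "cobj W n" "cobj Y m" "cobj Y n" "p2 n" "cdiff Y m"]
      b[of m] O(1,2)[of n] O(2)[of m] O(3)[of m] fm[of n] complexes_fullD(2)[OF Y, of m] m by auto
  show "Some (cobj W n, (f n \<cdot> p1 n) \<boxplus> (cdiff Y (n - 1) \<cdot> p2 n), cobj Y n) =
     pls C (cmp C (lift_map n X Y f (int n)) (Some (cobj W n, p1 n, cobj X n))) (cmp C (lift_cpx n Y (int n - 1)) (Some (cobj W n, p2 n, cobj Y (n - 1))))"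
    unfolding z1 using b[of m] O(1,2)[of n] O(2)[of m] O(3)[of m] fm[of n] complexes_fullD(2)[OF Y, of m] nx(3)[of m] lift_map_sel[of n] mm m by auto
qed

text \<open>
  At the two ends of the cone one summand is the padding object \<open>Z\<close>; there the biproduct is
  completed by identities and zero arrows, and the column and the row become matrices of the
  inner shape.
\<close>

lemma triangular_of_cone:
  assumes c: "is_cone (full_subcategory D S) n X Y f W"
  shows "\<exists>I1 I2 P1 P2. triangular C (\<lambda>i. neg C (lift_cpx n X i)) (lift_map n X Y f) (\<lambda>i. lift_cpx n Y (i - 1)) (lift_cpx (Suc n) W) I1 I2 P1 P2"
proof -
  have W: "W \<in> complexes (full_subcategory D S) (Suc n)" and W0: "cobj W 0 = cobj X 0" and Wn: "cobj W (Suc n) = cobj Y n"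
    using c by (auto simp: is_cone_def)
  obtain i1 i2 p1 p2 where bp: "\<And>k. k < n \<Longrightarrow> is_biproduct (full_subcategory D S) (cobj X (Suc k)) (cobj Y k) (cobj W (Suc k))
         (i1 (Suc k)) (i2 (Suc k)) (p1 (Suc k)) (p2 (Suc k))"
    and d0: "cdiff W 0 = (i1 1 \<cdot> neg_mor D (cobj X 0) (cobj X 1) (cdiff X 0)) \<boxplus> (i2 1 \<cdot> f 0)"
    and dk: "\<And>k. Suc k < n \<Longrightarrow> cdiff W (Suc k) =
          (i1 (Suc (Suc k)) \<cdot> neg_mor D (cobj X (Suc k)) (cobj X (Suc (Suc k))) (cdiff X (Suc k)) \<cdot> p1 (Suc k))
          \<boxplus> (i2 (Suc (Suc k)) \<cdot> f (Suc k) \<cdot> p1 (Suc k))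
          \<boxplus> (i2 (Suc (Suc k)) \<cdot> cdiff Y k \<cdot> p2 (Suc k))"
    and dn: "cdiff W n = (f n \<cdot> p1 n) \<boxplus> (cdiff Y (n - 1) \<cdot> p2 n)"
    using c unfolding is_cone_def full_sel full_neg by blast
  have bpa: "\<forall>k<n. is_biproduct (full_subcategory D S) (cobj X (Suc k)) (cobj Y k) (cobj W (Suc k))
         (i1 (Suc k)) (i2 (Suc k)) (p1 (Suc k)) (p2 (Suc k))" using bp by blast
  note cdf = cone_diffs[OF bpa]
  define I1 where "I1 i = (if i \<le> 0 then idt C (lift_obj n X i) else if i \<le> int n then Some (cobj X (nat i), i1 (nat i), cobj W (nat i)) else zer C Z (lift_obj n Y (i - 1)))" for i
  define I2 where "I2 i = (if i \<le> 0 then zer C Z (lift_obj n X i) else if i \<le> int n then Some (cobj Y (nat i - 1), i2 (nat i), cobj W (nat i)) else idt C (lift_obj n Y (i - 1)))" for i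
  define P1 where "P1 i = (if i \<le> 0 then idt C (lift_obj n X i) else if i \<le> int n then Some (cobj W (nat i), p1 (nat i), cobj X (nat i)) else zer C (lift_obj n Y (i - 1)) Z)" for i
  define P2 where "P2 i = (if i \<le> 0 then zer C (lift_obj n X i) Z else if i \<le> int n then Some (cobj W (nat i), p2 (nat i), cobj Y (nat i - 1)) else idt C (lift_obj n Y (i - 1)))" for i
  note WC = lift_cpx_complex[OF SO ZS W]
  have Wd: "dm C (lift_cpx (Suc n) W i) = lift_obj (Suc n) W i" "cd C (lift_cpx (Suc n) W i) = lift_obj (Suc n) W (i + 1)" "arr C (lift_cpx (Suc n) W i)" for i
    using lift_cpx_dm[OF SO ZS W] int_complexD[OF WC] by auto
  have zW: "lift_obj (Suc n) W i = (if i \<le> 0 then lift_obj n X i else if i \<le> int n then cobj W (nat i) else lift_obj n Y (i - 1))" for i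
  proof -
    consider "i < 0" | "i = 0" | "0 < i" "i \<le> int n" | "i = int n + 1" | "i > int n + 1" by linarith
    then show ?thesis
    proof cases
      case 4
      then have "nat i = Suc n" by auto
      then show ?thesis using 4 Wn by (simp add: lift_obj_def)
    qed (auto simp: lift_obj_def W0)
  qed
  have bb: "biproduct C (lift_obj n X i) (lift_obj n Y (i - 1)) (lift_obj (Suc n) W i) (I1 i) (I2 i) (P1 i) (P2 i)" for i
  proof -
    consider "i \<le> 0" | "0 < i" "i \<le> int n" | "int n < i" by linarith
    then show ?thesis
    proof cases
      case 1
      then have "lift_obj n Y (i - 1) = Z" by (simp add: lift_obj_def)
      then show ?thesis using 1 biproduct_zero_right[of "lift_obj n X i"] lift_obj_obj by (simp add: I1_def I2_def P1_def P2_def zW)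
    next
      case 2
      define k where "k = nat i - 1"
      have k: "k < n" "nat i = Suc k" "i = int (Suc k)" using 2 by (auto simp: k_def)
      have "cobj X (Suc k) \<in> S" "cobj Y k \<in> S" using complexes_fullD(1)[OF X] complexes_fullD(1)[OF Y] k by auto
      then have "biproduct C (cobj X (Suc k)) (cobj Y k) (cobj W (Suc k)) (Some (cobj X (Suc k), i1 (Suc k), cobj W (Suc k)))
        (Some (cobj Y k, i2 (Suc k), cobj W (Suc k))) (Some (cobj W (Suc k), p1 (Suc k), cobj X (Suc k))) (Some (cobj W (Suc k), p2 (Suc k), cobj Y k))"
        using biproduct_lift_iff bp[OF k(1)] by blast
      then show ?thesis using 2 k by (simp add: I1_def I2_def P1_def P2_def zW lift_obj_def)
    next
      case 3
      then have "lift_obj n X i = Z" by (simp add: lift_obj_def)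
      then show ?thesis using 3 biproduct_zero_left[of "lift_obj n Y (i - 1)"] lift_obj_obj by (simp add: I1_def I2_def P1_def P2_def zW)
    qed
  qed
  have I: "I1 i \<in> homset C (lift_obj n X i) (lift_obj (Suc n) W i)" "I2 i \<in> homset C (lift_obj n Y (i - 1)) (lift_obj (Suc n) W i)"
    "P1 i \<in> homset C (lift_obj (Suc n) W i) (lift_obj n X i)" "P2 i \<in> homset C (lift_obj (Suc n) W i) (lift_obj n Y (i - 1))" for i
    using bb[of i] unfolding biproduct_def by auto
  have I': "arr C (I1 i)" "dm C (I1 i) = lift_obj n X i" "cd C (I1 i) = lift_obj (Suc n) W i"
    "arr C (I2 i)" "dm C (I2 i) = lift_obj n Y (i - 1)" "cd C (I2 i) = lift_obj (Suc n) W i"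
    "arr C (P1 i)" "dm C (P1 i) = lift_obj (Suc n) W i" "cd C (P1 i) = lift_obj n X i"
    "arr C (P2 i)" "dm C (P2 i) = lift_obj (Suc n) W i" "cd C (P2 i) = lift_obj n Y (i - 1)" for i
    using I[of i] by auto
  define R where "R i = pls C (cmp C (I1 (i + 1)) (cmp C (neg C (lift_cpx n X i)) (P1 i)))
     (pls C (cmp C (I2 (i + 1)) (cmp C (lift_map n X Y f i) (P1 i))) (cmp C (I2 (i + 1)) (cmp C (lift_cpx n Y (i - 1)) (P2 i))))" for i
  have Rh: "R i \<in> homset C (lift_obj (Suc n) W i) (lift_obj (Suc n) W (i + 1))" for i
    unfolding R_def using I'[of i] I'[of "i + 1"] lift_map_sel lift_cpx_sel by simp
  have Rt: "arr C (R i)" "dm C (R i) = lift_obj (Suc n) W i" "cd C (R i) = lift_obj (Suc n) W (i + 1)" for i using Rh[of i] by auto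
  have eq: "lift_cpx (Suc n) W i = R i" for i
  proof -
    consider "i < 0" | "i = 0" | "0 < i" "i < int n" | "i = int n" | "i > int n" by linarith
    then show ?thesis
    proof cases
      case 1
      then have z: "lift_obj (Suc n) W i = Z" by (simp add: lift_obj_def)
      show ?thesis
        by (rule trans[OF of_zo of_zo[symmetric]]) (use Wd Rt z in auto)
    next
      case 2
      have x1: "lift_obj n X 1 = cobj X 1" "lift_obj n X 0 = cobj X 0" "lift_obj n Y 0 = cobj Y 0" "lift_obj n Y (-1) = Z"
        using n by (simp_all add: lift_obj_def)
      have p: "P1 0 = idt C (cobj X 0)" "P2 0 = zer C (cobj X 0) Z" by (simp_all add: P1_def P2_def x1)
      have i: "I1 1 = Some (cobj X 1, i1 1, cobj W 1)" "I2 1 = Some (cobj Y 0, i2 1, cobj W 1)" using n by (simp_all add: I1_def I2_def)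
      have "lift_cpx (Suc n) W 0 = Some (cobj X 0, cdiff W 0, cobj W 1)" using W0 by (simp add: lift_cpx_def)
      also have "\<dots> = pls C (cmp C (I1 1) (neg C (lift_cpx n X 0))) (cmp C (I2 1) (lift_map n X Y f 0))"
        unfolding d0 i by (rule cdf(1))
      also have "\<dots> = R 0"
      proof -
        have "cmp C (I2 1) (cmp C (lift_cpx n Y (- 1)) (P2 0)) = zer C (cobj X 0) (lift_obj (Suc n) W 1)"
          unfolding p using I'(4-6)[of 1] lift_cpx_sel lift_obj_obj[of 0] x1 by simp
        then show ?thesis unfolding R_def using I'[of 1] lift_map_sel lift_cpx_sel lift_obj_obj[of 0] x1 by (simp add: p)
      qed
      finally show ?thesis using 2 by simp
    next
      case 3
      define k where "k = nat i - 1"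
      have k: "Suc k < n" "nat i = Suc k" "i = int (Suc k)" "nat (i + 1) = Suc (Suc k)" "i - 1 = int k" using 3 by (auto simp: k_def)
      have "lift_cpx (Suc n) W i = Some (cobj W (Suc k), cdiff W (Suc k), cobj W (Suc (Suc k)))"
        unfolding k(3) by (rule lift_cpx_int) (use k(1) in simp)
      also have "\<dots> = R i"
      proof -
        have a: "0 < i" "i \<le> int n" "0 < i + 1" "i + 1 \<le> int n" "nat i - 1 = k" "nat (i + 1) - 1 = Suc k"
          using 3 k by auto
        have v: "I1 (i + 1) = Some (cobj X (Suc (Suc k)), i1 (Suc (Suc k)), cobj W (Suc (Suc k)))"
          "I2 (i + 1) = Some (cobj Y (Suc k), i2 (Suc (Suc k)), cobj W (Suc (Suc k)))"
          using a(3,4,6) by (simp_all only: I1_def I2_def k(4) not_le[symmetric] if_False if_True)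
        have w: "P1 i = Some (cobj W (Suc k), p1 (Suc k), cobj X (Suc k))" "P2 i = Some (cobj W (Suc k), p2 (Suc k), cobj Y k)"
          using a(1,2,5) by (simp_all only: P1_def P2_def k(2) not_le[symmetric] if_False if_True)
        show ?thesis unfolding dk[OF k(1)] cdf(2)[OF k(1)] R_def v w k(5) k(3)[symmetric] ..
      qed
      finally show ?thesis .
    next
      case 4
      have z: "lift_obj n X (int n + 1) = Z" by (simp add: lift_obj_def)
      have zn: "lift_obj n Y (int n) = cobj Y n" "lift_obj n X (int n) = cobj X n" "lift_obj (Suc n) W (int n + 1) = cobj Y n" using Wn zW[of "int n + 1"] by (simp_all add: lift_obj_def)
      have i: "I1 (int n + 1) = zer C Z (cobj Y n)" "I2 (int n + 1) = idt C (cobj Y n)" using n zn by (simp_all add: I1_def I2_def)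
      have p: "P1 (int n) = Some (cobj W n, p1 n, cobj X n)" "P2 (int n) = Some (cobj W n, p2 n, cobj Y (n - 1))" using n by (simp_all add: P1_def P2_def)
      have "lift_cpx (Suc n) W (int n) = Some (cobj W n, cdiff W n, cobj Y n)" using Wn by (simp add: lift_cpx_def)
      also have "\<dots> = pls C (cmp C (lift_map n X Y f (int n)) (P1 (int n))) (cmp C (lift_cpx n Y (int n - 1)) (P2 (int n)))"
        unfolding dn p by (rule cdf(3))
      also have "\<dots> = R (int n)"
      proof -
        have O: "cobj Y n \<in> obj D" using lift_obj_obj(2)[of "int n"] zn by simp
        have "cmp C (I1 (int n + 1)) (cmp C (neg C (lift_cpx n X (int n))) (P1 (int n))) = zer C (lift_obj (Suc n) W (int n)) (cobj Y n)"
          unfolding i using I'(7-9)[of "int n"] lift_cpx_sel zn z O by simp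
        then show ?thesis unfolding R_def using I'[of "int n"] lift_map_sel lift_cpx_sel O zn by (simp add: i)
      qed
      finally show ?thesis using 4 by simp
    next
      case 5
      then have z: "lift_obj (Suc n) W (i + 1) = Z" by (simp add: lift_obj_def)
      show ?thesis
        by (rule trans[OF to_zo to_zo[symmetric]]) (use Wd Rt z in auto)
    qed
  qed
  have "triangular C (\<lambda>i. neg C (lift_cpx n X i)) (lift_map n X Y f) (\<lambda>i. lift_cpx n Y (i - 1)) (lift_cpx (Suc n) W) I1 I2 P1 P2"
    unfolding triangular_def
  proof (intro allI conjI)
    fix i
    show "biproduct C (dm C (neg C (lift_cpx n X i))) (dm C (lift_cpx n Y (i - 1))) (dm C (lift_cpx (Suc n) W i)) (I1 i) (I2 i) (P1 i) (P2 i)"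
      using bb[of i] by (simp add: lift_cpx_sel Wd)
    show "lift_map n X Y f i \<in> homset C (dm C (neg C (lift_cpx n X i))) (cd C (lift_cpx n Y (i - 1)))"
      using lift_map_sel lift_cpx_sel by simp
    show "lift_cpx (Suc n) W i = pls C (cmp C (I1 (i + 1)) (cmp C (neg C (lift_cpx n X i)) (P1 i)))
       (pls C (cmp C (I2 (i + 1)) (cmp C (lift_map n X Y f i) (P1 i))) (cmp C (I2 (i + 1)) (cmp C (lift_cpx n Y (i - 1)) (P2 i))))"
      using eq[of i] by (simp add: R_def)
  qed
  then show ?thesis by blast
qed

text \<open>
  Conversely, biproducts that are strict with respect to \<open>Z\<close> turn the matrices at the two ends
  into a column and a row.
\<close>

lemma cone_of_triangular:
  assumes WC: "int_complex C S W" and t: "triangular C (\<lambda>i. neg C (lift_cpx n X i)) (lift_map n X Y f) (\<lambda>i. lift_cpx n Y (i - 1)) W I1 I2 P1 P2"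
    and bl: "\<And>i. lift_obj n Y (i - 1) = Z \<Longrightarrow> dm C (W i) = lift_obj n X i \<and> I1 i = idt C (lift_obj n X i) \<and> P1 i = idt C (lift_obj n X i)"
    and br: "\<And>i. lift_obj n X i = Z \<Longrightarrow> dm C (W i) = lift_obj n Y (i - 1) \<and> I2 i = idt C (lift_obj n Y (i - 1)) \<and> P2 i = idt C (lift_obj n Y (i - 1))"
  shows "is_cone (full_subcategory D S) n X Y f (unlift_cpx (Suc n) W)" "lift_cpx (Suc n) (unlift_cpx (Suc n) W) = W"
    "unlift_cpx (Suc n) W \<in> complexes (full_subcategory D S) (Suc n)"
proof -
  have bW: "bounded_in C 0 (int (Suc n)) W" unfolding bounded_in_def
  proof (intro allI impI)
    fix i assume "i < 0 \<or> i > int (Suc n)"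
    then have "lift_obj n Y (i - 1) = Z" "lift_obj n X i = Z" by (auto simp: lift_obj_def)
    then show "dm C (W i) = zo C" using bl[of i] by simp
  qed
  let ?V = "unlift_cpx (Suc n) W"
  show V: "?V \<in> complexes (full_subcategory D S) (Suc n)" by (rule unlift_complexes[OF SO ZS WC bW])
  show zV: "lift_cpx (Suc n) ?V = W" by (rule lift_unlift[OF SO ZS WC bW])
  have ob: "dm C (W (int i)) = cobj ?V i" if "i \<le> Suc n" for i using that by (simp add: unlift_cpx_def)
  have V0: "cobj ?V 0 = cobj X 0" using ob[of 0] bl[of 0] by (simp add: lift_obj_def)
  have Vn: "cobj ?V (Suc n) = cobj Y n" using ob[of "Suc n"] br[of "int (Suc n)"] by (simp add: lift_obj_def)
  have aC: "int_complex C S (\<lambda>i. neg C (lift_cpx n X i))" "int_complex C S (\<lambda>i. lift_cpx n Y (i - 1))"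
    by (rule int_complex_neg[OF lift_cpx_complex[OF SO ZS X]], rule int_complex_shift_neg[OF lift_cpx_complex[OF SO ZS Y]])
  have ad: "dm C (neg C (lift_cpx n X i)) = lift_obj n X i" for i using lift_cpx_sel by simp
  note td = triangularD[OF aC t, unfolded ad lift_cpx_sel]
  define i1 i2 p1 p2 where "i1 k = morph (I1 (int k))" and "i2 k = morph (I2 (int k))" and "p1 k = morph (P1 (int k))" and "p2 k = morph (P2 (int k))" for k
  have lift_obj_int: "lift_obj n X (int i) = cobj X i" "lift_obj n Y (int i) = cobj Y i" if "i \<le> n" for i using that by (simp_all add: lift_obj_def)
  have IS: "I1 (int (Suc k)) = Some (cobj X (Suc k), i1 (Suc k), cobj ?V (Suc k))"
    "I2 (int (Suc k)) = Some (cobj Y k, i2 (Suc k), cobj ?V (Suc k))"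
    "P1 (int (Suc k)) = Some (cobj ?V (Suc k), p1 (Suc k), cobj X (Suc k))"
    "P2 (int (Suc k)) = Some (cobj ?V (Suc k), p2 (Suc k), cobj Y k)" if "k < n" for k
  proof -
    have e: "int (Suc k) - 1 = int k" by simp
    have o: "dm C (W (int (Suc k))) = cobj ?V (Suc k)" "lift_obj n X (int (Suc k)) = cobj X (Suc k)" "lift_obj n Y (int k) = cobj Y k"
      using ob[of "Suc k"] lift_obj_int[of "Suc k"] lift_obj_int[of k] that by auto
    show "I1 (int (Suc k)) = Some (cobj X (Suc k), i1 (Suc k), cobj ?V (Suc k))"
      using arr_eq_Some(1)[OF td(1), of "int (Suc k)"] unfolding td o i1_def .
    show "I2 (int (Suc k)) = Some (cobj Y k, i2 (Suc k), cobj ?V (Suc k))"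
      using arr_eq_Some(1)[OF td(4), of "int (Suc k)"] unfolding td o i2_def e .
    show "P1 (int (Suc k)) = Some (cobj ?V (Suc k), p1 (Suc k), cobj X (Suc k))"
      using arr_eq_Some(1)[OF td(7), of "int (Suc k)"] unfolding td o p1_def .
    show "P2 (int (Suc k)) = Some (cobj ?V (Suc k), p2 (Suc k), cobj Y k)"
      using arr_eq_Some(1)[OF td(10), of "int (Suc k)"] unfolding td o p2_def e .
  qed
  have bp: "is_biproduct (full_subcategory D S) (cobj X (Suc k)) (cobj Y k) (cobj ?V (Suc k)) (i1 (Suc k)) (i2 (Suc k)) (p1 (Suc k)) (p2 (Suc k))"
    if k: "k < n" for k
  proof -
    have e: "int (Suc k) - 1 = int k" by simp
    have o: "dm C (W (int (Suc k))) = cobj ?V (Suc k)" "lift_obj n X (int (Suc k)) = cobj X (Suc k)" "lift_obj n Y (int k) = cobj Y k"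
      using ob[of "Suc k"] lift_obj_int[of "Suc k"] lift_obj_int[of k] that by auto
    have S': "cobj X (Suc k) \<in> S" "cobj Y k \<in> S" "cobj ?V (Suc k) \<in> S"
      using complexes_fullD(1)[OF X, of "Suc k"] complexes_fullD(1)[OF Y, of k] complexes_fullD(1)[OF V, of "Suc k"] k by auto
    have "biproduct C (lift_obj n X (int (Suc k))) (lift_obj n Y (int (Suc k) - 1)) (dm C (W (int (Suc k)))) (I1 (int (Suc k))) (I2 (int (Suc k))) (P1 (int (Suc k))) (P2 (int (Suc k)))"
      using t unfolding triangular_def ad lift_cpx_sel by blast
    then show ?thesis unfolding biproduct_lift_iff[OF S'(1,2)] using S'(3) unfolding e o IS[OF k] by blast
  qed
  have bpa: "\<forall>k<n. is_biproduct (full_subcategory D S) (cobj X (Suc k)) (cobj Y k) (cobj ?V (Suc k))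
         (i1 (Suc k)) (i2 (Suc k)) (p1 (Suc k)) (p2 (Suc k))" using bp by blast
  note cdf = cone_diffs[OF bpa]
  note tW = triangular_eq[OF t]
  have Wi: "W (int i) = Some (cobj ?V i, cdiff ?V i, cobj ?V (Suc i))" if "i \<le> n" for i
    using zV lift_cpx_int[of i "Suc n" ?V] that by simp
  show "is_cone (full_subcategory D S) n X Y f ?V"
    unfolding is_cone_def full_sel full_neg
  proof (intro conjI V V0 Vn, rule exI[of _ i1], rule exI[of _ i2], rule exI[of _ p1], rule exI[of _ p2],
      intro conjI allI impI bp)
    have o: "lift_obj n X 0 = cobj X 0" "lift_obj n Y (- 1) = Z" "lift_obj n Y 0 = cobj Y 0" "lift_obj n X 1 = cobj X 1" "dm C (W 0) = cobj X 0" "dm C (W 1) = cobj ?V 1"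
      using lift_obj_int[of 0] lift_obj_int[of 1] n ob[of 0] ob[of 1] V0 by (simp_all add: lift_obj_def)
    have p: "P1 0 = idt C (cobj X 0)" "P2 0 = zer C (cobj X 0) Z"
      using bl[of 0] to_zo[of "P2 0" "cobj X 0" Z] td(10-12)[of 0] o by simp_all
    have q: "cmp C (I2 1) (cmp C (lift_cpx n Y (- 1)) (P2 0)) = zer C (cobj X 0) (cobj ?V 1)"
      unfolding p using td(4-6)[of 1] lift_cpx_sel lift_obj_obj[of 0] o by simp
    have i: "I1 1 = Some (cobj X 1, i1 1, cobj ?V 1)" "I2 1 = Some (cobj Y 0, i2 1, cobj ?V 1)" using IS[of 0] n by simp_all
    have "Some (cobj X 0, cdiff ?V 0, cobj ?V 1) = W 0" using Wi[of 0] V0 by simp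
    also have "\<dots> = pls C (cmp C (I1 1) (neg C (lift_cpx n X 0))) (cmp C (I2 1) (lift_map n X Y f 0))"
      by (subst tW) (use td(1-6)[of 1] lift_map_sel lift_cpx_sel lift_obj_obj[of 0] o q in \<open>simp add: p\<close>)
    also have "\<dots> = Some (cobj X 0, (i1 1 \<cdot> neg_mor D (cobj X 0) (cobj X 1) (cdiff X 0)) \<boxplus> (i2 1 \<cdot> f 0), cobj ?V 1)"
      unfolding i by (rule cdf(1)[symmetric])
    finally show "cdiff ?V 0 = (i1 1 \<cdot> neg_mor D (cobj X 0) (cobj X 1) (cdiff X 0)) \<boxplus> (i2 1 \<cdot> f 0)" by simp
  next
    fix k assume k: "Suc k < n"
    have e: "int (Suc k) + 1 = int (Suc (Suc k))" "int (Suc k) - 1 = int k" by auto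
    have "Some (cobj ?V (Suc k), cdiff ?V (Suc k), cobj ?V (Suc (Suc k))) = W (int (Suc k))" using Wi[of "Suc k"] k by simp
    also have "\<dots> = Some (cobj ?V (Suc k),
          (i1 (Suc (Suc k)) \<cdot> neg_mor D (cobj X (Suc k)) (cobj X (Suc (Suc k))) (cdiff X (Suc k)) \<cdot> p1 (Suc k))
          \<boxplus> (i2 (Suc (Suc k)) \<cdot> f (Suc k) \<cdot> p1 (Suc k))
          \<boxplus> (i2 (Suc (Suc k)) \<cdot> cdiff Y k \<cdot> p2 (Suc k)), cobj ?V (Suc (Suc k)))"
      unfolding cdf(2)[OF k] by (subst tW) (use k in \<open>simp only: e IS Suc_lessD\<close>)
    finally show "cdiff ?V (Suc k) =
          (i1 (Suc (Suc k)) \<cdot> neg_mor D (cobj X (Suc k)) (cobj X (Suc (Suc k))) (cdiff X (Suc k)) \<cdot> p1 (Suc k))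
          \<boxplus> (i2 (Suc (Suc k)) \<cdot> f (Suc k) \<cdot> p1 (Suc k))
          \<boxplus> (i2 (Suc (Suc k)) \<cdot> cdiff Y k \<cdot> p2 (Suc k))" by simp
  next
    obtain m where m: "n = Suc m" using n by (cases n) auto
    have o: "lift_obj n X (int n + 1) = Z" "lift_obj n Y (int n) = cobj Y n" "lift_obj n X (int n) = cobj X n" "dm C (W (int n)) = cobj ?V n" "dm C (W (int n + 1)) = cobj Y n"
      using lift_obj_int[of n] ob[of n] ob[of "Suc n"] Vn by (simp_all add: lift_obj_def add.commute)
    have O: "cobj Y n \<in> obj D" "cobj X n \<in> obj D" using lift_obj_obj[of "int n"] o by simp_all
    have i: "I2 (int n + 1) = idt C (cobj Y n)" using br[of "int n + 1"] o by simp
    have j: "I1 (int n + 1) = zer C Z (cobj Y n)"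
      using of_zo[of "I1 (int n + 1)" Z "cobj Y n"] td(1-3)[of "int n + 1"] o by simp
    have q: "cmp C (I1 (int n + 1)) (cmp C (neg C (lift_cpx n X (int n))) (P1 (int n))) = zer C (cobj ?V n) (cobj Y n)"
      unfolding j using td(7-9)[of "int n"] lift_cpx_sel o O by simp
    have p: "P1 (int n) = Some (cobj ?V n, p1 n, cobj X n)" "P2 (int n) = Some (cobj ?V n, p2 n, cobj Y (n - 1))" using IS[of m] m by simp_all
    have "Some (cobj ?V n, cdiff ?V n, cobj Y n) = W (int n)" using Wi[of n] Vn by simp
    also have "\<dots> = pls C (cmp C (lift_map n X Y f (int n)) (P1 (int n))) (cmp C (lift_cpx n Y (int n - 1)) (P2 (int n)))"
      by (subst tW) (use td(7-12)[of "int n"] lift_map_sel lift_cpx_sel O o q in \<open>simp add: i\<close>)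
    also have "\<dots> = Some (cobj ?V n, (f n \<cdot> p1 n) \<boxplus> (cdiff Y (n - 1) \<cdot> p2 n), cobj Y n)"
      unfolding p by (rule cdf(3)[symmetric])
    finally show "cdiff ?V n = (f n \<cdot> p1 n) \<boxplus> (cdiff Y (n - 1) \<cdot> p2 n)" by simp
  qed
qed

end

context
  assumes bpS: "biproduct_closed D S"
begin

lemma biproducts_exist: "A \<in> S \<Longrightarrow> B \<in> S \<Longrightarrow> \<exists>s i1 i2 p1 p2. s \<in> S \<and> biproduct C A B s i1 i2 p1 p2"
proof -
  assume A: "A \<in> S" and B: "B \<in> S"
  then obtain s i1 i2 p1 p2 where b: "is_biproduct D A B s i1 i2 p1 p2" using biproduct_exists SO by blast
  have "s \<in> S" using bpS A B b unfolding biproduct_closed_def by blast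
  then have "is_biproduct (full_subcategory D S) A B s i1 i2 p1 p2" using b by (simp add: is_biproduct_def)
  then show ?thesis unfolding biproduct_lift_iff[OF A B] by blast
qed

lemma cone_exists:
  assumes n: "1 \<le> n" and f: "chain_map (full_subcategory D S) n X Y f"
  shows "\<exists>W. is_cone (full_subcategory D S) n X Y f W"
proof -
  have X: "X \<in> complexes (full_subcategory D S) n" and Y: "Y \<in> complexes (full_subcategory D S) n"
    and fm: "\<And>i. i \<le> n \<Longrightarrow> f i \<in> mor D (cobj X i) (cobj Y i)"
    using f by (auto simp: chain_map_def)
  note XC = lift_cpx_complex[OF SO ZS X] and YC = lift_cpx_complex[OF SO ZS Y]
  note dX = int_complexD[OF XC] and dY = int_complexD[OF YC]
  note F = int_chain_mapD[OF lift_chain_map[OF SO ZS f]]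
  have ad: "dm C (neg C (lift_cpx n X i)) = lift_obj n X i" for i using dX lift_cpx_dm[OF SO ZS X] by simp
  note cY = lift_cpx_dm[OF SO ZS Y]
  have SO': "S \<subseteq> Ob C" using SO by simp
  obtain s i1 i2 p1 p2 where bs: "\<And>i::int. s i \<in> S \<and> biproduct C (lift_obj n X i) (lift_obj n Y (i - 1)) (s i) (i1 i) (i2 i) (p1 i) (p2 i) \<and>
    (lift_obj n Y (i - 1) = zo C \<longrightarrow> s i = lift_obj n X i \<and> i1 i = idt C (lift_obj n X i) \<and> p1 i = idt C (lift_obj n X i)) \<and>
    (lift_obj n X i = zo C \<longrightarrow> s i = lift_obj n Y (i - 1) \<and> i2 i = idt C (lift_obj n Y (i - 1)) \<and> p2 i = idt C (lift_obj n Y (i - 1)))"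
    using biproduct_family[OF biproducts_exist lift_obj_in[OF SO ZS X] lift_obj_in[OF SO ZS Y] SO', of "\<lambda>i. i" "\<lambda>i. i - 1"] by blast
  have "\<exists>W. int_complex C S W \<and> (\<forall>i. dm C (W i) = s i) \<and>
    triangular C (\<lambda>i. neg C (lift_cpx n X i)) (lift_map n X Y f) (\<lambda>i. lift_cpx n Y (i - 1)) W i1 i2 p1 p2"
  proof (rule triangular_exists[OF int_complex_neg[OF XC] int_complex_shift_neg[OF YC]])
    fix i
    show "lift_map n X Y f i \<in> homset C (dm C (neg C (lift_cpx n X i))) (dm C (lift_cpx n Y (i + 1 - 1)))"
      using F dX by simp
    have e: "i + 1 - 1 = i" "i + 2 - 1 = i + 1" by auto
    have "pls C (neg C (cmp C (lift_cpx n Y i) (lift_map n X Y f i))) (cmp C (lift_cpx n Y i) (lift_map n X Y f i)) =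
       zer C (dm C (lift_cpx n X i)) (dm C (lift_cpx n Y (i + 1)))"
      using F dX dY by (subst pls_commute) (simp add: pls_neg)
    then show "pls C (cmp C (lift_map n X Y f (i + 1)) (neg C (lift_cpx n X i))) (cmp C (lift_cpx n Y (i + 1 - 1)) (lift_map n X Y f i)) =
         zer C (dm C (neg C (lift_cpx n X i))) (dm C (lift_cpx n Y (i + 2 - 1)))"
      unfolding e cmp_neg F(4) using dX by simp
    show "biproduct C (dm C (neg C (lift_cpx n X i))) (dm C (lift_cpx n Y (i - 1))) (s i) (i1 i) (i2 i) (p1 i) (p2 i)"
      unfolding ad cY using bs by blast
    show "s i \<in> S" using bs by blast
  qed
  then obtain W where W: "int_complex C S W" "\<And>i. dm C (W i) = s i" "triangular C (\<lambda>i. neg C (lift_cpx n X i)) (lift_map n X Y f) (\<lambda>i. lift_cpx n Y (i - 1)) W i1 i2 p1 p2"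
    by blast
  have "is_cone (full_subcategory D S) n X Y f (unlift_cpx (Suc n) W)"
    by (rule cone_of_triangular[OF n X Y fm W(1,3)]) (use bs W(2) in auto)
  then show ?thesis by blast
qed

text \<open>
  The conditions on the right do not mention the cone. So exactness of one cone of \<open>f\<close> is that of
  all of them, and \<open>n\<close>-pullback and \<open>n\<close>-pushout diagrams are described by \<open>f\<close> alone.
\<close>

lemma cone_exact_iff:
  assumes n: "1 \<le> n" and f: "chain_map (full_subcategory D S) n X Y f" and W: "is_cone (full_subcategory D S) n X Y f W"
  shows "covariantly_exact (full_subcategory D S) n W \<longleftrightarrow> (\<forall>i\<le>int n. pullback_exact_at C S (lift_map n X Y f) (lift_cpx n X) (lift_cpx n Y) i)"
    "contravariantly_exact (full_subcategory D S) n W \<longleftrightarrow> (\<forall>i\<ge>0. pushout_exact_at C S (lift_map n X Y f) (lift_cpx n X) (lift_cpx n Y) i)"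
proof -
  have X: "X \<in> complexes (full_subcategory D S) n" and Y: "Y \<in> complexes (full_subcategory D S) n"
    and fm: "\<And>i. i \<le> n \<Longrightarrow> f i \<in> mor D (cobj X i) (cobj Y i)"
    using f by (auto simp: chain_map_def)
  have WC: "W \<in> complexes (full_subcategory D S) (Suc n)" using W by (simp add: is_cone_def)
  note XC = lift_cpx_complex[OF SO ZS X] and YC = lift_cpx_complex[OF SO ZS Y]
  have F: "lift_map n X Y f i \<in> homset C (dm C (lift_cpx n X i)) (dm C (lift_cpx n Y i))" for i
    using int_chain_mapD[OF lift_chain_map[OF SO ZS f]] by simp
  obtain I1 I2 P1 P2 where t: "triangular C (\<lambda>i. neg C (lift_cpx n X i)) (lift_map n X Y f) (\<lambda>i. lift_cpx n Y (i - 1)) (lift_cpx (Suc n) W) I1 I2 P1 P2"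
    using triangular_of_cone[OF n X Y fm W] by blast
  show "covariantly_exact (full_subcategory D S) n W \<longleftrightarrow> (\<forall>i\<le>int n. pullback_exact_at C S (lift_map n X Y f) (lift_cpx n X) (lift_cpx n Y) i)"
    unfolding covariantly_exact_iff[OF SO ZS WC] cone_cov_exact_iff[OF XC YC lift_cpx_complex[OF SO ZS WC] F disjI2[OF t]] by blast
  have "(\<forall>i\<ge>1. P (i - 1)) \<longleftrightarrow> (\<forall>i\<ge>0. P (i::int))" for P
  proof
    assume a: "\<forall>i\<ge>1. P (i - 1)"
    show "\<forall>i\<ge>0. P i"
    proof (intro allI impI)
      fix i :: int assume "0 \<le> i"
      then show "P i" using a[rule_format, of "i + 1"] by simp
    qed
  qed auto
  then show "contravariantly_exact (full_subcategory D S) n W \<longleftrightarrow> (\<forall>i\<ge>0. pushout_exact_at C S (lift_map n X Y f) (lift_cpx n X) (lift_cpx n Y) i)"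
    unfolding contravariantly_exact_iff[OF SO ZS WC] cone_contra_exact_iff[OF XC YC lift_cpx_complex[OF SO ZS WC] F disjI2[OF t]] by blast
qed

lemma n_pullback_iff:
  assumes n: "1 \<le> n"
  shows "n_pullback_diagram (full_subcategory D S) n X Y f \<longleftrightarrow> chain_map (full_subcategory D S) n X Y f \<and>
    (\<forall>i\<le>int n. pullback_exact_at C S (lift_map n X Y f) (lift_cpx n X) (lift_cpx n Y) i)"
  unfolding n_pullback_diagram_def using cone_exists[OF n] cone_exact_iff(1)[OF n] by blast

lemma n_pushout_iff:
  assumes n: "1 \<le> n"
  shows "n_pushout_diagram (full_subcategory D S) n X Y f \<longleftrightarrow> chain_map (full_subcategory D S) n X Y f \<and>
    (\<forall>i\<ge>0. pushout_exact_at C S (lift_map n X Y f) (lift_cpx n X) (lift_cpx n Y) i)"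
  unfolding n_pushout_diagram_def using cone_exists[OF n] cone_exact_iff(2)[OF n] by blast

end
end
end

section \<open>Translation of the axioms\<close>

lemma (in arrow_category) int_chain_map_shift:
  assumes "int_chain_map C X Y f" shows "int_chain_map C (\<lambda>i. X (i + k)) (\<lambda>i. Y (i + k)) (\<lambda>i. f (i + k))"
proof -
  have e: "i + 1 + k = i + k + 1" for i by simp
  show ?thesis using assms unfolding int_chain_map_def e by blast
qed

lemma pullback_exact_shift:
  "pullback_exact_at C S (\<lambda>i. h (i + k)) (\<lambda>i. P (i + k)) (\<lambda>i. Y (i + k)) i = pullback_exact_at C S h P Y (i + k)"
proof -
  have e: "i - 1 + k = i + k - 1" "i - 2 + k = i + k - 2" by auto
  show ?thesis unfolding pullback_exact_at_def e by (rule refl)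
qed

context pointed_category
begin

lemma zero_comp: "\<lbrakk>A \<in> obj D; B \<in> obj D; E \<in> obj D; f \<in> mor D A B\<rbrakk> \<Longrightarrow> zero_mor D B E \<cdot> f = zero_mor D A E"
  using zer_cmp[of "Some (A, f, B)" B E] zero_closed[of B E] by (simp add: zer_Some)

lemma comp_zero: "\<lbrakk>A \<in> obj D; B \<in> obj D; E \<in> obj D; f \<in> mor D B E\<rbrakk> \<Longrightarrow> f \<cdot> zero_mor D A B = zero_mor D A E"
  using cmp_zer[of "Some (B, f, E)" B A] zero_closed[of A B] by (simp add: zer_Some)

lemma iso_iff:
  assumes "A \<in> obj D" "B \<in> obj D"
  shows "is_iso (full_subcategory D S) A B f \<longleftrightarrow> iso_arr C (Some (A, f, B))"
proof (cases "f \<in> mor D A B")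
  case True
  have "(\<exists>g\<in>homset C B A. cmp C g (Some (A, f, B)) = idt C A \<and> cmp C (Some (A, f, B)) g = idt C B) \<longleftrightarrow>
    (\<exists>g\<in>mor D B A. g \<cdot> f = ident D A \<and> f \<cdot> g = ident D B)"
    unfolding homset_ex[OF assms(2,1)] using assms True by (intro bex_cong refl) (simp add: idt_Some)
  then show ?thesis using assms True by (simp add: is_iso_def iso_arr_def)
next
  case False
  then show ?thesis using assms by (simp add: is_iso_def iso_arr_def)
qed

context
  fixes S assumes SO: "S \<subseteq> obj D" and ZS: "Z \<in> S"
begin

text \<open>
  Dropping the first term reindexes the complex to start in degree \<open>0\<close>, whereas \<open>trunc_ge\<close> keeps
  the degrees.
\<close>

lemma lift_drop_first:
  assumes X: "X \<in> complexes (full_subcategory D S) (Suc n)"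
  shows "drop_first n X \<in> complexes (full_subcategory D S) n"
    "lift_cpx n (drop_first n X) = (\<lambda>i. trunc_ge C 1 (lift_cpx (Suc n) X) (i + 1))"
proof -
  show "drop_first n X \<in> complexes (full_subcategory D S) n"
    using X by (auto simp: complexes_def drop_first_def PiE_iff)
  show "lift_cpx n (drop_first n X) = (\<lambda>i. trunc_ge C 1 (lift_cpx (Suc n) X) (i + 1))"
  proof
    fix i
    consider "i < -1" | "i = -1" | "0 \<le> i" "i < int n" | "i = int n" "0 \<le> i" | "int n < i" by linarith
    then show "lift_cpx n (drop_first n X) i = trunc_ge C 1 (lift_cpx (Suc n) X) (i + 1)"
    proof cases
      case 1 then show ?thesis by (simp add: trunc_ge_def lift_cpx_def lift_obj_def)
    next
      case 2
      have "lift_obj n (drop_first n X) 0 = cobj X 1" "dm C (lift_cpx (Suc n) X 1) = cobj X 1"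
        using lift_cpx_dm[OF SO ZS X] by (simp_all add: lift_obj_def drop_first_def)
      then show ?thesis using 2 by (simp add: trunc_ge_def) (simp add: lift_cpx_def lift_obj_def)
    next
      case 3
      then have "nat i < n" "nat (i + 1) = Suc (nat i)" by auto
      then show ?thesis using 3 by (simp add: trunc_ge_def lift_cpx_def drop_first_def)
    next
      case 4
      then show ?thesis by (simp add: trunc_ge_def lift_cpx_def lift_obj_def drop_first_def nat_add_distrib)
    next
      case 5 then show ?thesis by (simp add: trunc_ge_def lift_cpx_def lift_obj_def)
    qed
  qed
qed

lemma lift_drop_last:
  assumes X: "X \<in> complexes (full_subcategory D S) (Suc n)"
  shows "drop_last n X \<in> complexes (full_subcategory D S) n"
    "lift_cpx n (drop_last n X) = trunc_le C (int n) (lift_cpx (Suc n) X)"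
proof -
  show "drop_last n X \<in> complexes (full_subcategory D S) n"
    using X by (auto simp: complexes_def drop_last_def PiE_iff)
  show "lift_cpx n (drop_last n X) = trunc_le C (int n) (lift_cpx (Suc n) X)"
  proof
    fix i
    consider "i < -1" | "i = -1" | "0 \<le> i" "i < int n" | "i = int n" "0 \<le> i" | "int n < i" by linarith
    then show "lift_cpx n (drop_last n X) i = trunc_le C (int n) (lift_cpx (Suc n) X) i"
    proof cases
      case 1 then show ?thesis by (simp add: trunc_le_def lift_cpx_def lift_obj_def)
    next
      case 2 then show ?thesis by (simp add: trunc_le_def lift_cpx_def lift_obj_def drop_last_def)
    next
      case 3
      then have "nat i < n" by auto
      then show ?thesis using 3 by (simp add: trunc_le_def lift_cpx_def drop_last_def)
    next
      case 4
      then have "dm C (lift_cpx (Suc n) X (int n)) = cobj X n"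
        using lift_cpx_dm[OF SO ZS X] by (simp add: lift_obj_def)
      then show ?thesis using 4 by (simp add: trunc_le_def) (simp add: lift_cpx_def lift_obj_def drop_last_def)
    next
      case 5 then show ?thesis by (simp add: trunc_le_def lift_cpx_def lift_obj_def)
    qed
  qed
qed

context
  fixes n \<X>
  assumes n: "1 \<le> n" and XS: "\<X> \<subseteq> complexes (full_subcategory D S) (Suc n)"
    and bpS: "biproduct_closed D S"
begin

lemma lift_mem:
  assumes "X \<in> complexes (full_subcategory D S) (Suc n)"
  shows "lift_cpx (Suc n) X \<in> lift_cpx (Suc n) ` \<X> \<longleftrightarrow> X \<in> \<X>"
proof
  assume "lift_cpx (Suc n) X \<in> lift_cpx (Suc n) ` \<X>"
  then obtain Y where Y: "Y \<in> \<X>" "lift_cpx (Suc n) X = lift_cpx (Suc n) Y" by blast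
  have YC: "Y \<in> complexes (full_subcategory D S) (Suc n)" using Y XS by blast
  have "X = Y" using unlift_lift[OF SO ZS assms] unlift_lift[OF SO ZS YC] Y(2) by metis
  then show "X \<in> \<X>" using Y by simp
qed blast

lemma mono_iff: "admissible_mono \<X> A B f \<longleftrightarrow> (\<exists>W\<in>lift_cpx (Suc n) ` \<X>. W 0 = Some (A, f, B))"
  using lift_cpx_int[of 0 "Suc n"] by (auto simp: admissible_mono_def)

lemma epi_iff: "admissible_epi n \<X> A B f \<longleftrightarrow> (\<exists>W\<in>lift_cpx (Suc n) ` \<X>. W (int n) = Some (A, f, B))"
  using lift_cpx_int[of n "Suc n"] by (auto simp: admissible_epi_def)

lemma arr_lift_cpx: "W \<in> lift_cpx (Suc n) ` \<X> \<Longrightarrow> arr C (W i)"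
  using lift_cpx_complex[OF SO ZS] XS int_complexD(1) by blast

lemma E1_iff: "monos_compose C (lift_cpx (Suc n) ` \<X>) \<longleftrightarrow>
    (\<forall>A B E f g. admissible_mono \<X> A B f \<longrightarrow> admissible_mono \<X> B E g \<longrightarrow> admissible_mono \<X> A E (g \<cdot> f))"
proof
  assume c: "monos_compose C (lift_cpx (Suc n) ` \<X>)"
  show "\<forall>A B E f g. admissible_mono \<X> A B f \<longrightarrow> admissible_mono \<X> B E g \<longrightarrow> admissible_mono \<X> A E (g \<cdot> f)"
  proof (intro allI impI)
    fix A B E f g assume "admissible_mono \<X> A B f" "admissible_mono \<X> B E g"
    then obtain V W where V: "V \<in> lift_cpx (Suc n) ` \<X>" "V 0 = Some (A, f, B)" and W: "W \<in> lift_cpx (Suc n) ` \<X>" "W 0 = Some (B, g, E)"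
      unfolding mono_iff by blast
    then obtain U where "U \<in> lift_cpx (Suc n) ` \<X>" "U 0 = cmp C (W 0) (V 0)"
      using c unfolding monos_compose_def by fastforce
    moreover have "cmp C (W 0) (V 0) = Some (A, g \<cdot> f, E)"
      using arr_lift_cpx[OF V(1), of 0] arr_lift_cpx[OF W(1), of 0] unfolding V(2) W(2) by simp
    ultimately show "admissible_mono \<X> A E (g \<cdot> f)" unfolding mono_iff by auto
  qed
next
  assume c: "\<forall>A B E f g. admissible_mono \<X> A B f \<longrightarrow> admissible_mono \<X> B E g \<longrightarrow> admissible_mono \<X> A E (g \<cdot> f)"
  show "monos_compose C (lift_cpx (Suc n) ` \<X>)" unfolding monos_compose_def
  proof (intro ballI impI)
    fix V W assume V: "V \<in> lift_cpx (Suc n) ` \<X>" and W: "W \<in> lift_cpx (Suc n) ` \<X>" and e: "cd C (V 0) = dm C (W 0)"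
    obtain A f B where v: "V 0 = Some (A, f, B)" using V lift_cpx_int[of 0 "Suc n"] by auto
    obtain B' g E where w: "W 0 = Some (B', g, E)" using W lift_cpx_int[of 0 "Suc n"] by auto
    have B: "B' = B" using e v w by simp
    have "admissible_mono \<X> A B f" "admissible_mono \<X> B E g" using V W v w B unfolding mono_iff by auto
    then have "admissible_mono \<X> A E (g \<cdot> f)" using c by blast
    moreover have "cmp C (W 0) (V 0) = Some (A, g \<cdot> f, E)"
      using arr_lift_cpx[OF V, of 0] arr_lift_cpx[OF W, of 0] unfolding v w B by simp
    ultimately show "\<exists>U\<in>lift_cpx (Suc n) ` \<X>. U 0 = cmp C (W 0) (V 0)" unfolding mono_iff by simp
  qed
qed

lemma E1_op_iff: "epis_compose C (int n) (lift_cpx (Suc n) ` \<X>) \<longleftrightarrow>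
    (\<forall>A B E f g. admissible_epi n \<X> A B f \<longrightarrow> admissible_epi n \<X> B E g \<longrightarrow> admissible_epi n \<X> A E (g \<cdot> f))"
proof
  assume c: "epis_compose C (int n) (lift_cpx (Suc n) ` \<X>)"
  show "\<forall>A B E f g. admissible_epi n \<X> A B f \<longrightarrow> admissible_epi n \<X> B E g \<longrightarrow> admissible_epi n \<X> A E (g \<cdot> f)"
  proof (intro allI impI)
    fix A B E f g assume "admissible_epi n \<X> A B f" "admissible_epi n \<X> B E g"
    then obtain V W where V: "V \<in> lift_cpx (Suc n) ` \<X>" "V (int n) = Some (A, f, B)" and W: "W \<in> lift_cpx (Suc n) ` \<X>" "W (int n) = Some (B, g, E)"
      unfolding epi_iff by blast
    then obtain U where "U \<in> lift_cpx (Suc n) ` \<X>" "U (int n) = cmp C (W (int n)) (V (int n))"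
      using c unfolding epis_compose_def by fastforce
    moreover have "cmp C (W (int n)) (V (int n)) = Some (A, g \<cdot> f, E)"
      using arr_lift_cpx[OF V(1), of "int n"] arr_lift_cpx[OF W(1), of "int n"] unfolding V(2) W(2) by simp
    ultimately show "admissible_epi n \<X> A E (g \<cdot> f)" unfolding epi_iff by auto
  qed
next
  assume c: "\<forall>A B E f g. admissible_epi n \<X> A B f \<longrightarrow> admissible_epi n \<X> B E g \<longrightarrow> admissible_epi n \<X> A E (g \<cdot> f)"
  show "epis_compose C (int n) (lift_cpx (Suc n) ` \<X>)" unfolding epis_compose_def
  proof (intro ballI impI)
    fix V W assume V: "V \<in> lift_cpx (Suc n) ` \<X>" and W: "W \<in> lift_cpx (Suc n) ` \<X>" and e: "cd C (V (int n)) = dm C (W (int n))"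
    obtain A f B where v: "V (int n) = Some (A, f, B)" using V lift_cpx_int[of n "Suc n"] by auto
    obtain B' g E where w: "W (int n) = Some (B', g, E)" using W lift_cpx_int[of n "Suc n"] by auto
    have B: "B' = B" using e v w by simp
    have "admissible_epi n \<X> A B f" "admissible_epi n \<X> B E g" using V W v w B unfolding epi_iff by auto
    then have "admissible_epi n \<X> A E (g \<cdot> f)" using c by blast
    moreover have "cmp C (W (int n)) (V (int n)) = Some (A, g \<cdot> f, E)"
      using arr_lift_cpx[OF V, of "int n"] arr_lift_cpx[OF W, of "int n"] unfolding v w B by simp
    ultimately show "\<exists>U\<in>lift_cpx (Suc n) ` \<X>. U (int n) = cmp C (W (int n)) (V (int n))" unfolding epi_iff by simp
  qed
qed

lemma weak_iso_lift:
  assumes f: "chain_map (full_subcategory D S) (Suc n) X Y f"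
  shows "(\<exists>k \<le> Suc n. let l = Suc k mod (n + 2) in
       is_iso (full_subcategory D S) (cobj X k) (cobj Y k) (f k) \<and> is_iso (full_subcategory D S) (cobj X l) (cobj Y l) (f l)) \<longleftrightarrow>
    weak_iso_map C (int n) (lift_cpx (Suc n) X) (lift_cpx (Suc n) Y) (lift_map (Suc n) X Y f)"
proof -
  have X: "X \<in> complexes (full_subcategory D S) (Suc n)" and Y: "Y \<in> complexes (full_subcategory D S) (Suc n)"
    using f by (auto simp: chain_map_def)
  define P where "P k \<longleftrightarrow> is_iso (full_subcategory D S) (cobj X k) (cobj Y k) (f k)" for k
  define Q where "Q i \<longleftrightarrow> iso_arr C (lift_map (Suc n) X Y f i)" for i
  have PQ: "P k \<longleftrightarrow> Q (int k)" if "k \<le> Suc n" for k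
  proof -
    have "cobj X k \<in> obj D" "cobj Y k \<in> obj D" using complexes_fullD(1)[OF X that] complexes_fullD(1)[OF Y that] SO by auto
    then show ?thesis unfolding P_def Q_def using that by (simp add: iso_iff lift_map_def)
  qed
  have "(\<exists>k\<le>Suc n. P k \<and> P (Suc k mod (n + 2))) \<longleftrightarrow> (\<exists>k\<le>n. P k \<and> P (Suc k)) \<or> (P 0 \<and> P (Suc n))"
  proof
    assume "\<exists>k\<le>Suc n. P k \<and> P (Suc k mod (n + 2))"
    then obtain k where k: "k \<le> Suc n" "P k" "P (Suc k mod (n + 2))" by blast
    show "(\<exists>k\<le>n. P k \<and> P (Suc k)) \<or> (P 0 \<and> P (Suc n))"
    proof (cases "k = Suc n")
      case True then show ?thesis using k by simp
    next
      case False then have "k \<le> n" using k by simp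
      then show ?thesis using k by (intro disjI1 exI[of _ k]) simp
    qed
  next
    assume "(\<exists>k\<le>n. P k \<and> P (Suc k)) \<or> (P 0 \<and> P (Suc n))"
    then show "\<exists>k\<le>Suc n. P k \<and> P (Suc k mod (n + 2))"
    proof
      assume "\<exists>k\<le>n. P k \<and> P (Suc k)"
      then obtain k where "k \<le> n" "P k" "P (Suc k)" by blast
      then show ?thesis by (intro exI[of _ k]) simp
    next
      assume "P 0 \<and> P (Suc n)"
      then show ?thesis by (intro exI[of _ "Suc n"]) simp
    qed
  qed
  also have "\<dots> \<longleftrightarrow> (\<exists>k. 0 \<le> k \<and> k \<le> int n \<and> Q k \<and> Q (k + 1)) \<or> Q 0 \<and> Q (int n + 1)"
  proof -
    have "(\<exists>k\<le>n. P k \<and> P (Suc k)) \<longleftrightarrow> (\<exists>k. 0 \<le> k \<and> k \<le> int n \<and> Q k \<and> Q (k + 1))"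
    proof
      assume "\<exists>k\<le>n. P k \<and> P (Suc k)"
      then obtain k where "k \<le> n" "P k" "P (Suc k)" by blast
      then show "\<exists>k. 0 \<le> k \<and> k \<le> int n \<and> Q k \<and> Q (k + 1)"
        using PQ[of k] PQ[of "Suc k"] by (intro exI[of _ "int k"]) (simp add: add.commute)
    next
      assume "\<exists>k. 0 \<le> k \<and> k \<le> int n \<and> Q k \<and> Q (k + 1)"
      then obtain k where k: "0 \<le> k" "k \<le> int n" "Q k" "Q (k + 1)" by blast
      have "int (nat k) = k" "int (Suc (nat k)) = k + 1" "nat k \<le> n" using k by auto
      then show "\<exists>k\<le>n. P k \<and> P (Suc k)"
        using PQ[of "nat k"] PQ[of "Suc (nat k)"] k by (intro exI[of _ "nat k"]) (simp add: add.commute)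
    qed
    then show ?thesis using PQ[of 0] PQ[of "Suc n"] by (simp add: add.commute)
  qed
  finally show ?thesis
    using lift_chain_map[OF SO ZS f] unfolding weak_iso_map_def P_def Q_def Let_def by simp
qed

lemma weak_iff: "weak_iso_class C (int n) S (lift_cpx (Suc n) ` \<X>) \<longleftrightarrow>
    (\<forall>X Y f. weak_isomorphism (full_subcategory D S) n X Y f \<longrightarrow> (X \<in> \<X> \<longleftrightarrow> Y \<in> \<X>))"
proof
  assume w: "weak_iso_class C (int n) S (lift_cpx (Suc n) ` \<X>)"
  show "\<forall>X Y f. weak_isomorphism (full_subcategory D S) n X Y f \<longrightarrow> (X \<in> \<X> \<longleftrightarrow> Y \<in> \<X>)"
  proof (intro allI impI)
    fix X Y f assume f: "weak_isomorphism (full_subcategory D S) n X Y f"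
    then have X: "X \<in> complexes (full_subcategory D S) (Suc n)" and Y: "Y \<in> complexes (full_subcategory D S) (Suc n)"
      and e: "n_exact_sequence (full_subcategory D S) n X" "n_exact_sequence (full_subcategory D S) n Y"
      by (auto simp: weak_isomorphism_def n_exact_sequence_def)
    have "weak_iso_map C (int n) (lift_cpx (Suc n) X) (lift_cpx (Suc n) Y) (lift_map (Suc n) X Y f)"
      using f weak_iso_lift unfolding weak_isomorphism_def by blast
    then have "lift_cpx (Suc n) X \<in> lift_cpx (Suc n) ` \<X> \<longleftrightarrow> lift_cpx (Suc n) Y \<in> lift_cpx (Suc n) ` \<X>"
      using w e unfolding n_exact_complex_lift_iff[OF SO ZS X] n_exact_complex_lift_iff[OF SO ZS Y] weak_iso_class_def by blast
    then show "X \<in> \<X> \<longleftrightarrow> Y \<in> \<X>" using lift_mem X Y by simp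
  qed
next
  assume w: "\<forall>X Y f. weak_isomorphism (full_subcategory D S) n X Y f \<longrightarrow> (X \<in> \<X> \<longleftrightarrow> Y \<in> \<X>)"
  show "weak_iso_class C (int n) S (lift_cpx (Suc n) ` \<X>)" unfolding weak_iso_class_def
  proof (intro allI impI)
    fix V W \<phi> assume V: "n_exact_complex C (int n) S V" and W: "n_exact_complex C (int n) S W" and f: "weak_iso_map C (int n) V W \<phi>"
    have V': "int_complex C S V" "bounded_in C 0 (int (Suc n)) V" and W': "int_complex C S W" "bounded_in C 0 (int (Suc n)) W"
      using V W by (auto simp: n_exact_complex_def add.commute)
    define X Y where "X = unlift_cpx (Suc n) V" and "Y = unlift_cpx (Suc n) W"
    have X: "X \<in> complexes (full_subcategory D S) (Suc n)" "lift_cpx (Suc n) X = V" and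
      Y: "Y \<in> complexes (full_subcategory D S) (Suc n)" "lift_cpx (Suc n) Y = W"
      unfolding X_def Y_def using unlift_facts[OF SO ZS V'] unlift_facts[OF SO ZS W'] by auto
    define g where "g = (\<lambda>i. morph (\<phi> (int i)))"
    have "int_chain_map C (lift_cpx (Suc n) X) (lift_cpx (Suc n) Y) \<phi>" using f unfolding X Y weak_iso_map_def by blast
    then have g: "chain_map (full_subcategory D S) (Suc n) X Y g" "lift_map (Suc n) X Y g = \<phi>"
      unfolding g_def using unlift_chain_map[OF SO ZS X(1) Y(1)] by auto
    have "weak_isomorphism (full_subcategory D S) n X Y g"
      unfolding weak_isomorphism_def weak_iso_lift[OF g(1)] g(2) n_exact_complex_lift_iff[OF SO ZS X(1)] n_exact_complex_lift_iff[OF SO ZS Y(1)] X(2) Y(2)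
      using V W f g(1) by blast
    then have "X \<in> \<X> \<longleftrightarrow> Y \<in> \<X>" using w by blast
    then show "V \<in> lift_cpx (Suc n) ` \<X> \<longleftrightarrow> W \<in> lift_cpx (Suc n) ` \<X>"
      using lift_mem[OF X(1)] lift_mem[OF Y(1)] unfolding X(2) Y(2) by simp
  qed
qed

lemma E2_op_iff: "has_pullbacks C (int n) S (lift_cpx (Suc n) ` \<X>) \<longleftrightarrow>
    (\<forall>X\<in>\<X>. \<forall>E\<in>S. \<forall>g\<in>mor D E (cobj X (Suc n)).
      \<exists>Y h. n_pullback_diagram (full_subcategory D S) n Y (drop_first n X) h \<and> cobj Y n = E \<and> h n = g \<and>
            admissible_epi n \<X> (cobj Y (n - 1)) (cobj Y n) (cdiff Y (n - 1)))"
proof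
  obtain m where m: "n = Suc m" using n by (cases n) auto
  assume p: "has_pullbacks C (int n) S (lift_cpx (Suc n) ` \<X>)"
  show "\<forall>X\<in>\<X>. \<forall>E\<in>S. \<forall>g\<in>mor D E (cobj X (Suc n)).
      \<exists>Y h. n_pullback_diagram (full_subcategory D S) n Y (drop_first n X) h \<and> cobj Y n = E \<and> h n = g \<and>
            admissible_epi n \<X> (cobj Y (n - 1)) (cobj Y n) (cdiff Y (n - 1))"
  proof (intro ballI)
    fix X E g assume X: "X \<in> \<X>" and E: "E \<in> S" and g: "g \<in> mor D E (cobj X (Suc n))"
    have XC: "X \<in> complexes (full_subcategory D S) (Suc n)" using X XS by blast
    have o: "E \<in> obj D" "cobj X (Suc n) \<in> obj D" using E SO complexes_fullD(1)[OF XC, of "Suc n"] by auto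
    have dX: "dm C (lift_cpx (Suc n) X (int n + 1)) = cobj X (Suc n)" using lift_cpx_dm[OF SO ZS XC, of "int n + 1"] by (simp add: lift_obj_def nat_add_distrib)
    obtain P h Q where P: "int_complex C S P" "bounded_in C 1 (int n + 1) P" "int_chain_map C P (trunc_ge C 1 (lift_cpx (Suc n) X)) h" "h (int n + 1) = Some (E, g, cobj X (Suc n))"
      "\<And>i. i \<le> int n + 1 \<Longrightarrow> pullback_exact_at C S h P (trunc_ge C 1 (lift_cpx (Suc n) X)) i" and Q: "Q \<in> lift_cpx (Suc n) ` \<X>" "Q (int n) = P (int n)"
      using p[unfolded has_pullbacks_def, rule_format, of "lift_cpx (Suc n) X" "Some (E, g, cobj X (Suc n))"] X o E g dX by auto
    note df = lift_drop_first[OF XC]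
    define V where "V = (\<lambda>i. P (i + 1))"
    have V: "int_complex C S V" "bounded_in C 0 (int n) V" using int_complex_shift[OF P(1), of 1] P(2) by (auto simp: V_def bounded_in_def)
    define Y where "Y = unlift_cpx n V"
    have Y: "Y \<in> complexes (full_subcategory D S) n" "lift_cpx n Y = V" unfolding Y_def using unlift_facts[OF SO ZS V] by auto
    have cm: "int_chain_map C (lift_cpx n Y) (lift_cpx n (drop_first n X)) (\<lambda>i. h (i + 1))"
      unfolding Y(2) df(2) V_def by (rule int_chain_map_shift[OF P(3)])
    define k where "k = (\<lambda>i. morph (h (int i + 1)))"
    have k: "chain_map (full_subcategory D S) n Y (drop_first n X) k" "lift_map n Y (drop_first n X) k = (\<lambda>i. h (i + 1))"
      unfolding k_def using unlift_chain_map[OF SO ZS Y(1) df(1) cm] by auto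
    have "pullback_exact_at C S (lift_map n Y (drop_first n X) k) (lift_cpx n Y) (lift_cpx n (drop_first n X)) i" if "i \<le> int n" for i
      unfolding k(2) Y(2) df(2) V_def pullback_exact_shift using P(5)[of "i + 1"] that by simp
    then have pb: "n_pullback_diagram (full_subcategory D S) n Y (drop_first n X) k"
      unfolding n_pullback_iff[OF SO ZS bpS n] using k(1) by blast
    have "dm C (P (int n + 1)) = E" using int_chain_mapD(2)[OF P(3), of "int n + 1"] P(4) by simp
    then have Yn: "cobj Y n = E" by (simp add: Y_def unlift_cpx_def V_def)
    have kn: "k n = g" using P(4) by (simp add: k_def)
    have "P (int n) = V (int m)" unfolding V_def m by (simp add: add.commute)
    also have "\<dots> = lift_cpx n Y (int m)" by (simp only: Y(2))
    also have "\<dots> = Some (cobj Y m, cdiff Y m, cobj Y n)" using lift_cpx_int[of m n Y] m by simp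
    finally have "admissible_epi n \<X> (cobj Y (n - 1)) (cobj Y n) (cdiff Y (n - 1))"
      unfolding epi_iff using Q m by auto
    then show "\<exists>Y h. n_pullback_diagram (full_subcategory D S) n Y (drop_first n X) h \<and> cobj Y n = E \<and> h n = g \<and>
            admissible_epi n \<X> (cobj Y (n - 1)) (cobj Y n) (cdiff Y (n - 1))"
      using pb Yn kn by blast
  qed
next
  obtain m where m: "n = Suc m" using n by (cases n) auto
  assume p: "\<forall>X\<in>\<X>. \<forall>E\<in>S. \<forall>g\<in>mor D E (cobj X (Suc n)).
      \<exists>Y h. n_pullback_diagram (full_subcategory D S) n Y (drop_first n X) h \<and> cobj Y n = E \<and> h n = g \<and>
            admissible_epi n \<X> (cobj Y (n - 1)) (cobj Y n) (cdiff Y (n - 1))"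
  show "has_pullbacks C (int n) S (lift_cpx (Suc n) ` \<X>)" unfolding has_pullbacks_def
  proof (intro ballI allI impI, elim conjE)
    fix V t assume "V \<in> lift_cpx (Suc n) ` \<X>" and t: "arr C t" "dm C t \<in> S" "cd C t = dm C (V (int n + 1))"
    then obtain X where X: "X \<in> \<X>" "V = lift_cpx (Suc n) X" by blast
    have XC: "X \<in> complexes (full_subcategory D S) (Suc n)" using X XS by blast
    have dX: "dm C (lift_cpx (Suc n) X (int n + 1)) = cobj X (Suc n)" using lift_cpx_dm[OF SO ZS XC, of "int n + 1"] by (simp add: lift_obj_def nat_add_distrib)
    have ct: "cd C t = cobj X (Suc n)" using t(3) X dX by simp
    note ts = arr_eq_Some[OF t(1), unfolded ct]
    obtain Y h where Y: "n_pullback_diagram (full_subcategory D S) n Y (drop_first n X) h" "cobj Y n = dm C t" "h n = morph t"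
      "admissible_epi n \<X> (cobj Y (n - 1)) (cobj Y n) (cdiff Y (n - 1))"
      using p X(1) t(2) ts(2) by blast
    have h: "chain_map (full_subcategory D S) n Y (drop_first n X) h"
      "\<And>i. i \<le> int n \<Longrightarrow> pullback_exact_at C S (lift_map n Y (drop_first n X) h) (lift_cpx n Y) (lift_cpx n (drop_first n X)) i"
      using Y(1) unfolding n_pullback_iff[OF SO ZS bpS n] by auto
    have YC: "Y \<in> complexes (full_subcategory D S) n" using h(1) by (simp add: chain_map_def)
    note df = lift_drop_first[OF XC]
    define P H where "P = (\<lambda>i. lift_cpx n Y (i + (-1)))" and "H = (\<lambda>i. lift_map n Y (drop_first n X) h (i + (-1)))"
    have tr: "trunc_ge C 1 V = (\<lambda>i. lift_cpx n (drop_first n X) (i + (-1)))" unfolding df(2) X(2) by simp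
    have C1: "int_complex C S P" unfolding P_def by (rule int_complex_shift[OF lift_cpx_complex[OF SO ZS YC]])
    have C2: "bounded_in C 1 (int n + 1) P" using lift_cpx_bounded[OF SO ZS YC] by (auto simp: bounded_in_def P_def)
    have C3: "int_chain_map C P (trunc_ge C 1 V) H" unfolding P_def H_def tr by (rule int_chain_map_shift[OF lift_chain_map[OF SO ZS h(1)]])
    have C4: "pullback_exact_at C S H P (trunc_ge C 1 V) i" if "i \<le> int n + 1" for i
      unfolding P_def H_def tr pullback_exact_shift using h(2)[of "i - 1"] that by simp
    have C5: "H (int n + 1) = t"
    proof -
      have "H (int n + 1) = Some (cobj Y n, h n, cobj X (Suc n))" by (simp add: H_def lift_map_def drop_first_def)
      then show ?thesis using Y(2,3) ts(1) by simp
    qed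
    have "P (int n) = Some (cobj Y (n - 1), cdiff Y (n - 1), cobj Y n)"
      using lift_cpx_int[of m n Y] m by (simp add: P_def)
    then have C6: "\<exists>Q\<in>lift_cpx (Suc n) ` \<X>. Q (int n) = P (int n)" using Y(4) unfolding epi_iff by simp
    show "\<exists>P h. int_complex C S P \<and> bounded_in C 1 (int n + 1) P \<and> int_chain_map C P (trunc_ge C 1 V) h \<and> h (int n + 1) = t \<and>
        (\<forall>i\<le>int n + 1. pullback_exact_at C S h P (trunc_ge C 1 V) i) \<and> (\<exists>Q\<in>lift_cpx (Suc n) ` \<X>. Q (int n) = P (int n))"
      using C1 C2 C3 C4 C5 C6 by blast
  qed
qed

lemma E2_iff: "has_pushouts C (int n) S (lift_cpx (Suc n) ` \<X>) \<longleftrightarrow>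
    (\<forall>X\<in>\<X>. \<forall>B\<in>S. \<forall>f\<in>mor D (cobj X 0) B.
      \<exists>Y h. n_pushout_diagram (full_subcategory D S) n (drop_last n X) Y h \<and> cobj Y 0 = B \<and> h 0 = f \<and>
            admissible_mono \<X> (cobj Y 0) (cobj Y 1) (cdiff Y 0))"
proof
  assume p: "has_pushouts C (int n) S (lift_cpx (Suc n) ` \<X>)"
  show "\<forall>X\<in>\<X>. \<forall>B\<in>S. \<forall>f\<in>mor D (cobj X 0) B.
      \<exists>Y h. n_pushout_diagram (full_subcategory D S) n (drop_last n X) Y h \<and> cobj Y 0 = B \<and> h 0 = f \<and>
            admissible_mono \<X> (cobj Y 0) (cobj Y 1) (cdiff Y 0)"
  proof (intro ballI)
    fix X B f assume X: "X \<in> \<X>" and B: "B \<in> S" and f: "f \<in> mor D (cobj X 0) B"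
    have XC: "X \<in> complexes (full_subcategory D S) (Suc n)" using X XS by blast
    have o: "B \<in> obj D" "cobj X 0 \<in> obj D" using B SO complexes_fullD(1)[OF XC, of 0] by auto
    have dX: "dm C (lift_cpx (Suc n) X 0) = cobj X 0" using lift_cpx_dm[OF SO ZS XC, of 0] by (simp add: lift_obj_def)
    obtain P h Q where P: "int_complex C S P" "bounded_in C 0 (int n) P" "int_chain_map C (trunc_le C (int n) (lift_cpx (Suc n) X)) P h" "h 0 = Some (cobj X 0, f, B)"
      "\<And>i. 0 \<le> i \<Longrightarrow> pushout_exact_at C S h (trunc_le C (int n) (lift_cpx (Suc n) X)) P i" and Q: "Q \<in> lift_cpx (Suc n) ` \<X>" "Q 0 = P 0"
      using p[unfolded has_pushouts_def, rule_format, of "lift_cpx (Suc n) X" "Some (cobj X 0, f, B)"] X o B f dX by auto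
    note dl = lift_drop_last[OF XC]
    define Y where "Y = unlift_cpx n P"
    have Y: "Y \<in> complexes (full_subcategory D S) n" "lift_cpx n Y = P" unfolding Y_def using unlift_facts[OF SO ZS P(1,2)] by auto
    have cm: "int_chain_map C (lift_cpx n (drop_last n X)) (lift_cpx n Y) h" unfolding Y(2) dl(2) by (rule P(3))
    define k where "k = (\<lambda>i. morph (h (int i)))"
    have k: "chain_map (full_subcategory D S) n (drop_last n X) Y k" "lift_map n (drop_last n X) Y k = h"
      unfolding k_def using unlift_chain_map[OF SO ZS dl(1) Y(1) cm] by auto
    have po: "n_pushout_diagram (full_subcategory D S) n (drop_last n X) Y k"
      unfolding n_pushout_iff[OF SO ZS bpS n] k(2) Y(2) dl(2) using k(1) P(5) by blast
    have "dm C (P 0) = B" using int_chain_mapD(3)[OF P(3), of 0] P(4) by simp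
    then have Y0: "cobj Y 0 = B" by (simp add: Y_def unlift_cpx_def)
    have k0: "k 0 = f" using P(4) by (simp add: k_def)
    have "P 0 = Some (cobj Y 0, cdiff Y 0, cobj Y 1)" using lift_cpx_int[of 0 n Y] n Y(2) by simp
    then have "admissible_mono \<X> (cobj Y 0) (cobj Y 1) (cdiff Y 0)" unfolding mono_iff using Q by auto
    then show "\<exists>Y h. n_pushout_diagram (full_subcategory D S) n (drop_last n X) Y h \<and> cobj Y 0 = B \<and> h 0 = f \<and>
            admissible_mono \<X> (cobj Y 0) (cobj Y 1) (cdiff Y 0)"
      using po Y0 k0 by blast
  qed
next
  assume p: "\<forall>X\<in>\<X>. \<forall>B\<in>S. \<forall>f\<in>mor D (cobj X 0) B.
      \<exists>Y h. n_pushout_diagram (full_subcategory D S) n (drop_last n X) Y h \<and> cobj Y 0 = B \<and> h 0 = f \<and>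
            admissible_mono \<X> (cobj Y 0) (cobj Y 1) (cdiff Y 0)"
  show "has_pushouts C (int n) S (lift_cpx (Suc n) ` \<X>)" unfolding has_pushouts_def
  proof (intro ballI allI impI, elim conjE)
    fix V t assume "V \<in> lift_cpx (Suc n) ` \<X>" and t: "arr C t" "cd C t \<in> S" "dm C t = dm C (V 0)"
    then obtain X where X: "X \<in> \<X>" "V = lift_cpx (Suc n) X" by blast
    have XC: "X \<in> complexes (full_subcategory D S) (Suc n)" using X XS by blast
    have dt: "dm C t = cobj X 0" using lift_cpx_dm[OF SO ZS XC, of 0] t(3) X by (simp add: lift_obj_def)
    note ts = arr_eq_Some[OF t(1), unfolded dt]
    obtain Y h where Y: "n_pushout_diagram (full_subcategory D S) n (drop_last n X) Y h" "cobj Y 0 = cd C t" "h 0 = morph t"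
      "admissible_mono \<X> (cobj Y 0) (cobj Y 1) (cdiff Y 0)"
      using p X(1) t(2) ts(2) by blast
    note dl = lift_drop_last[OF XC]
    have h: "chain_map (full_subcategory D S) n (drop_last n X) Y h"
      "\<And>i. 0 \<le> i \<Longrightarrow> pushout_exact_at C S (lift_map n (drop_last n X) Y h) (trunc_le C (int n) V) (lift_cpx n Y) i"
      using Y(1) unfolding n_pushout_iff[OF SO ZS bpS n] dl(2) X(2) by auto
    have YC: "Y \<in> complexes (full_subcategory D S) n" using h(1) by (simp add: chain_map_def)
    have C3: "int_chain_map C (trunc_le C (int n) V) (lift_cpx n Y) (lift_map n (drop_last n X) Y h)"
      using lift_chain_map[OF SO ZS h(1)] unfolding dl(2) X(2) .
    have C5: "lift_map n (drop_last n X) Y h 0 = t"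
    proof -
      have "lift_map n (drop_last n X) Y h 0 = Some (cobj X 0, h 0, cobj Y 0)" by (simp add: lift_map_def drop_last_def)
      then show ?thesis using Y(2,3) ts(1) by simp
    qed
    have "lift_cpx n Y 0 = Some (cobj Y 0, cdiff Y 0, cobj Y 1)" using lift_cpx_int[of 0 n Y] n by simp
    then have C6: "\<exists>Q\<in>lift_cpx (Suc n) ` \<X>. Q 0 = lift_cpx n Y 0" using Y(4) unfolding mono_iff by simp
    show "\<exists>P h. int_complex C S P \<and> bounded_in C 0 (int n) P \<and> int_chain_map C (trunc_le C (int n) V) P h \<and> h 0 = t \<and>
        (\<forall>i\<ge>0. pushout_exact_at C S h (trunc_le C (int n) V) P i) \<and> (\<exists>Q\<in>lift_cpx (Suc n) ` \<X>. Q 0 = P 0)"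
      using lift_cpx_complex[OF SO ZS YC] lift_cpx_bounded[OF SO ZS YC] C3 h(2) C5 C6 by blast
  qed
qed

text \<open>
  The right side consists of the axioms of an \<open>n\<close>-exact category for the full subcategory on \<open>S\<close>,
  up to membership of the zero complexes. It is used with all objects of \<open>D\<close> as \<open>S\<close>, and then
  with \<open>\<B>\<close>.
\<close>

lemma n_exact_structure_lift_iff:
  "n_exact_structure C (int n) S (lift_cpx (Suc n) ` \<X>) \<longleftrightarrow>
    (\<forall>X\<in>\<X>. n_exact_sequence (full_subcategory D S) n X) \<and>
    (\<forall>X Y f. weak_isomorphism (full_subcategory D S) n X Y f \<longrightarrow> (X \<in> \<X> \<longleftrightarrow> Y \<in> \<X>)) \<and>
    (\<forall>A B E f g. admissible_mono \<X> A B f \<longrightarrow> admissible_mono \<X> B E g \<longrightarrow> admissible_mono \<X> A E (g \<cdot> f)) \<and>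
    (\<forall>A B E f g. admissible_epi n \<X> A B f \<longrightarrow> admissible_epi n \<X> B E g \<longrightarrow> admissible_epi n \<X> A E (g \<cdot> f)) \<and>
    (\<forall>X\<in>\<X>. \<forall>E\<in>S. \<forall>g\<in>mor D E (cobj X (Suc n)).
      \<exists>Y h. n_pullback_diagram (full_subcategory D S) n Y (drop_first n X) h \<and> cobj Y n = E \<and> h n = g \<and>
            admissible_epi n \<X> (cobj Y (n - 1)) (cobj Y n) (cdiff Y (n - 1))) \<and>
    (\<forall>X\<in>\<X>. \<forall>B\<in>S. \<forall>f\<in>mor D (cobj X 0) B.
      \<exists>Y h. n_pushout_diagram (full_subcategory D S) n (drop_last n X) Y h \<and> cobj Y 0 = B \<and> h 0 = f \<and>
            admissible_mono \<X> (cobj Y 0) (cobj Y 1) (cdiff Y 0))"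
proof -
  have z: "zo C \<in> S" using ZS by simp
  have ns: "(\<forall>V\<in>lift_cpx (Suc n) ` \<X>. n_exact_complex C (int n) S V) \<longleftrightarrow> (\<forall>X\<in>\<X>. n_exact_sequence (full_subcategory D S) n X)"
    using n_exact_complex_lift_iff[OF SO ZS] XS by (simp add: subset_iff)
  show ?thesis
    unfolding n_exact_structure_iff[OF z] ns weak_iff E1_iff E1_op_iff E2_op_iff E2_iff by (rule refl)
qed

end
end
end

section \<open>The full subcategory\<close>

lemma (in additive_category) full_additive:
  assumes "additive_subcategory D \<B>"
  shows "additive_category (full_subcategory D \<B>)"
proof -
  have B: "\<B> \<subseteq> obj D" using assms by (simp add: additive_subcategory_def)
  then have o: "A \<in> obj D" if "A \<in> \<B>" for A using that by blast
  obtain Z where Z: "Z \<in> \<B>" "is_zero_object D Z" using assms unfolding additive_subcategory_def by blast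
  have s: "obj (full_subcategory D \<B>) = \<B>" "mor (full_subcategory D \<B>) = mor D"
    "comp (full_subcategory D \<B>) = comp D" "zero_mor (full_subcategory D \<B>) = zero_mor D"
    "ident (full_subcategory D \<B>) = ident D" "plus_mor (full_subcategory D \<B>) = plus_mor D"
    "mor_group (full_subcategory D \<B>) = mor_group D"
    by (simp_all add: full_subcategory_def mor_group_def fun_eq_iff)
  show ?thesis
  proof (rule additive_category.intro; (unfold s)?)
    show "\<exists>Z. is_zero_object (full_subcategory D \<B>) Z"
    proof (rule exI[of _ Z], unfold is_zero_object_def s, intro conjI ballI)
      show "Z \<in> \<B>" by (rule Z(1))
      fix A assume "A \<in> \<B>"
      then have "A \<in> obj D" by (rule o)
      then have u: "(\<exists>!f. f \<in> mor D A Z) \<and> (\<exists>!f. f \<in> mor D Z A)"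
        using Z(2) by (simp only: is_zero_object_def)
      show "\<exists>!f. f \<in> mor D A Z" by (rule conjunct1[OF u])
      show "\<exists>!f. f \<in> mor D Z A" by (rule conjunct2[OF u])
    qed
    fix A B assume A: "A \<in> \<B>" "B \<in> \<B>"
    then obtain S i1 i2 p1 p2 where b: "is_biproduct D A B S i1 i2 p1 p2" using biproduct_exists o by blast
    then have "S \<in> \<B>" using assms A unfolding additive_subcategory_def by blast
    then show "\<exists>S i1 i2 p1 p2. is_biproduct (full_subcategory D \<B>) A B S i1 i2 p1 p2"
      using b by (intro exI[of _ S] exI) (auto simp: is_biproduct_def s)
  qed (use o in \<open>auto intro: ident_closed comp_closed comp_assoc comp_ident ident_comp mor_comm_group comp_plus plus_comp\<close>)
qed

context pointed_category
begin

text \<open>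
  An object is a zero object iff its identity is the zero morphism, and this does not refer to
  other objects.
\<close>

lemma zero_object_full:
  assumes B: "\<B> \<subseteq> obj D" and z: "is_zero_object (full_subcategory D \<B>) A"
  shows "is_zero_object D A"
proof -
  have A: "A \<in> \<B>" "A \<in> obj D" using z B by (auto simp: is_zero_object_def)
  have i: "ident D A = zero_mor D A A"
    using z A ident_closed[of A] zero_closed[of A A] unfolding is_zero_object_def by (metis full_sel(1,2))
  have "f = zero_mor D T A" if "T \<in> obj D" "f \<in> mor D T A" for T f
    using ident_comp[OF that(1) A(2) that(2)] zero_comp[OF that(1) A(2) A(2) that(2)] i by simp
  moreover have "f = zero_mor D A T" if "T \<in> obj D" "f \<in> mor D A T" for T f
    using comp_ident[OF A(2) that(1) that(2)] comp_zero[OF A(2) A(2) that(1) that(2)] i by simp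
  ultimately show ?thesis using A zero_closed unfolding is_zero_object_def by metis
qed

lemma homotopy_equivalent_refl:
  assumes Y: "Y \<in> complexes D (Suc n)"
  shows "homotopy_equivalent_between D n (cobj Y 0) (cobj Y (Suc n)) Y Y"
proof -
  note d = complexes_fullD[of Y "obj D" "Suc n", simplified, OF Y]
  have id: "ident D (cobj Y i) \<in> mor D (cobj Y i) (cobj Y i)" if "i \<le> Suc n" for i using ident_closed d(1) that by simp
  have idc: "ident D (cobj Y (Suc i)) \<cdot> cdiff Y i = cdiff Y i \<cdot> ident D (cobj Y i)" if "i < Suc n" for i
    using ident_comp[OF _ _ d(2)[OF that]] comp_ident[OF _ _ d(2)[OF that]] d(1)[of i] d(1)[of "Suc i"] that by simp
  have c: "chain_map_between D n (cobj Y 0) (cobj Y (Suc n)) Y Y (\<lambda>i. ident D (cobj Y i))"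
    using Y id idc by (auto simp: chain_map_between_def complexes_between_def chain_map_def)
  have z: "(ident D (cobj Y i) \<cdot> ident D (cobj Y i)) \<boxplus> neg_mor D (cobj Y i) (cobj Y i) (ident D (cobj Y i)) = zero_mor D (cobj Y i) (cobj Y i)"
    if "i \<le> Suc n" for i
    using comp_ident[OF _ _ id[OF that]] plus_neg[OF _ _ id[OF that]] d(1)[OF that] by simp
  have cz: "cdiff Y i \<cdot> zero_mor D T (cobj Y i) = zero_mor D T (cobj Y (Suc i))"
    and zc: "zero_mor D (cobj Y (Suc i)) T \<cdot> cdiff Y i = zero_mor D (cobj Y i) T" if "i < Suc n" "T \<in> obj D" for i T
    using comp_zero[OF that(2) _ _ d(2)[OF that(1)]] zero_comp[OF _ _ that(2) d(2)[OF that(1)]] d(1)[of i] d(1)[of "Suc i"] that(1)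
    by simp_all
  have "homotopic D (Suc n) Y Y (\<lambda>i. ident D (cobj Y i) \<cdot> ident D (cobj Y i)) (\<lambda>i. ident D (cobj Y i))"
    unfolding homotopic_def null_homotopic_def
  proof (intro exI[of _ "\<lambda>i. zero_mor D (cobj Y (Suc i)) (cobj Y i)"] conjI allI impI)
    fix i
    show "zero_mor D (cobj Y (Suc i)) (cobj Y i) \<in> mor D (cobj Y (Suc i)) (cobj Y i)" if "i < Suc n"
      using that d(1) zero_closed by simp
    assume i: "Suc i < Suc n"
    have "zero_mor D (cobj Y (Suc i)) (cobj Y (Suc i)) \<boxplus> zero_mor D (cobj Y (Suc i)) (cobj Y (Suc i)) = zero_mor D (cobj Y (Suc i)) (cobj Y (Suc i))"
      using plus_zero zero_closed d(1) i by simp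
    then show "(ident D (cobj Y (Suc i)) \<cdot> ident D (cobj Y (Suc i))) \<boxplus> neg_mor D (cobj Y (Suc i)) (cobj Y (Suc i)) (ident D (cobj Y (Suc i))) =
        (cdiff Y i \<cdot> zero_mor D (cobj Y (Suc i)) (cobj Y i)) \<boxplus> (zero_mor D (cobj Y (Suc (Suc i))) (cobj Y (Suc i)) \<cdot> cdiff Y (Suc i))"
      using z[of "Suc i"] cz[of i "cobj Y (Suc i)"] zc[of "Suc i" "cobj Y (Suc i)"] i d(1) by simp
  qed (use z[of 0] z[of "Suc n"] cz[of n "cobj Y (Suc n)"] zc[of 0 "cobj Y 0"] d(1) in simp_all)
  then show ?thesis unfolding homotopy_equivalent_between_def using c by blast
qed

text \<open>
  Equality of the homotopy classes of \<open>X\<close> and \<open>Y\<close> gives the chain maps because \<open>Y\<close> lies in its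
  own class.
\<close>

lemma extension_closed_in_lift:
  assumes B: "\<B> \<subseteq> obj D" and ZB: "Z \<in> \<B>" and XS: "\<X> \<subseteq> complexes D (Suc n)" and e: "n_extension_closed D n \<X> \<B>"
  shows "extension_closed_in C (int n) \<B> (lift_cpx (Suc n) ` \<X>)"
  unfolding extension_closed_in_def
proof (intro ballI impI, elim conjE)
  fix V assume "V \<in> lift_cpx (Suc n) ` \<X>"
  then obtain X where X: "X \<in> \<X>" "V = lift_cpx (Suc n) X" by blast
  have XC: "X \<in> complexes (full_subcategory D (obj D)) (Suc n)" using X XS by auto
  note SO = subset_refl[of "obj D"]
  have XD: "X \<in> complexes D (Suc n)" using X XS by auto
  have dX: "dm C (V 0) = cobj X 0" "dm C (V (int n + 1)) = cobj X (Suc n)"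
    using lift_cpx_dm[OF SO Z_obj XC] X(2) by (simp_all add: lift_obj_def nat_add_distrib)
  assume a: "dm C (V 0) \<in> \<B>" "dm C (V (int n + 1)) \<in> \<B>"
  then obtain Y where Y: "Y \<in> complexes (full_subcategory D \<B>) (Suc n)" "Y \<in> \<X>" "homotopy_class D n X = homotopy_class D n Y"
    using e X(1) dX unfolding n_extension_closed_def by fastforce
  have YC: "Y \<in> complexes D (Suc n)" using Y XS by blast
  have "Y \<in> homotopy_class D n Y" unfolding homotopy_class_def using homotopy_equivalent_refl[OF YC] by simp
  then have "Y \<in> homotopy_class D n X" by (simp only: Y(3))
  then obtain f g where f: "chain_map_between D n (cobj X 0) (cobj X (Suc n)) X Y f" and g: "chain_map_between D n (cobj X 0) (cobj X (Suc n)) Y X g"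
    unfolding homotopy_class_def homotopy_equivalent_between_def by blast
  have Yo: "cobj Y 0 = cobj X 0" "cobj Y (Suc n) = cobj X (Suc n)" using f by (auto simp: chain_map_between_def complexes_between_def)
  have O: "cobj X 0 \<in> obj D" "cobj X (Suc n) \<in> obj D" using a B dX by auto
  have f': "chain_map (full_subcategory D (obj D)) (Suc n) X Y f" "f 0 = ident D (cobj X 0)" "f (Suc n) = ident D (cobj X (Suc n))"
    and g': "chain_map (full_subcategory D (obj D)) (Suc n) Y X g" "g 0 = ident D (cobj X 0)" "g (Suc n) = ident D (cobj X (Suc n))"
    using f g by (auto simp: chain_map_between_def)
  have m: "int_chain_map C V (lift_cpx (Suc n) Y) (lift_map (Suc n) X Y f)" "int_chain_map C (lift_cpx (Suc n) Y) V (lift_map (Suc n) Y X g)"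
    unfolding X(2) using lift_chain_map[OF SO Z_obj f'(1)] lift_chain_map[OF SO Z_obj g'(1)] by auto
  have en: "lift_map (Suc n) X Y f 0 = idt C (dm C (V 0))" "lift_map (Suc n) X Y f (int n + 1) = idt C (dm C (V (int n + 1)))"
    "lift_map (Suc n) Y X g 0 = idt C (dm C (V 0))" "lift_map (Suc n) Y X g (int n + 1) = idt C (dm C (V (int n + 1)))"
    unfolding dX using f'(2,3) g'(2,3) Yo O by (simp_all add: lift_map_def idt_Some nat_add_distrib)
  have "dm C (lift_cpx (Suc n) Y i) \<in> \<B>" for i using int_complexD(2)[OF lift_cpx_complex[OF B ZB Y(1)]] .
  then show "\<exists>Y\<in>lift_cpx (Suc n) ` \<X>. (\<forall>i. dm C (Y i) \<in> \<B>) \<and> (\<exists>f g. int_chain_map C V Y f \<and> int_chain_map C Y V g \<and>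
        f 0 = idt C (dm C (V 0)) \<and> f (int n + 1) = idt C (dm C (V (int n + 1))) \<and>
        g 0 = idt C (dm C (V 0)) \<and> g (int n + 1) = idt C (dm C (V (int n + 1))))"
    using m en Y(2) by blast
qed

lemma with_terms_in_lift:
  assumes B: "\<B> \<subseteq> obj D" and ZB: "Z \<in> \<B>" and XS: "\<X> \<subseteq> complexes D (Suc n)"
  shows "with_terms_in C \<B> (lift_cpx (Suc n) ` \<X>) = lift_cpx (Suc n) ` (\<X> \<inter> complexes (full_subcategory D \<B>) (Suc n))"
proof -
  have "(\<forall>i. dm C (lift_cpx (Suc n) X i) \<in> \<B>) \<longleftrightarrow> X \<in> complexes (full_subcategory D \<B>) (Suc n)" if X: "X \<in> \<X>" for X
  proof
    have XC: "X \<in> complexes (full_subcategory D (obj D)) (Suc n)" using X XS by auto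
    assume a: "\<forall>i. dm C (lift_cpx (Suc n) X i) \<in> \<B>"
    have "cobj X i \<in> \<B>" if "i \<le> Suc n" for i
      using a[rule_format, of "int i"] lift_cpx_dm[OF subset_refl Z_obj XC, of "int i"] that by (simp add: lift_obj_def)
    then show "X \<in> complexes (full_subcategory D \<B>) (Suc n)" using complexes_full[OF B] X XS by blast
  next
    assume "X \<in> complexes (full_subcategory D \<B>) (Suc n)"
    then show "\<forall>i. dm C (lift_cpx (Suc n) X i) \<in> \<B>" using int_complexD(2)[OF lift_cpx_complex[OF B ZB]] by blast
  qed
  then show ?thesis unfolding with_terms_in_def by blast
qed

lemma homotopy_equivalent_full:
  assumes "X \<in> complexes (full_subcategory D \<B>) (Suc n)" "Y \<in> complexes (full_subcategory D \<B>) (Suc n)" "\<B> \<subseteq> obj D"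
  shows "homotopy_equivalent_between (full_subcategory D \<B>) n A E X Y \<longleftrightarrow> homotopy_equivalent_between D n A E X Y"
proof -
  have "X \<in> complexes D (Suc n)" "Y \<in> complexes D (Suc n)" using assms complexes_full by blast+
  then show ?thesis using assms(1,2)
    unfolding homotopy_equivalent_between_def chain_map_between_def complexes_between_def chain_map_def homotopic_def null_homotopic_def
    by simp
qed

text \<open>
  Chain maps and homotopies between complexes over \<open>\<B>\<close> are the same in \<open>\<B>\<close> and in \<open>D\<close>, as the
  subcategory is full.
\<close>

lemma homotopy_class_full:
  assumes "X \<in> complexes (full_subcategory D \<B>) (Suc n)" "\<B> \<subseteq> obj D"
  shows "homotopy_class (full_subcategory D \<B>) n X = homotopy_class D n X \<inter> complexes (full_subcategory D \<B>) (Suc n)"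
proof -
  have "Y \<in> complexes (full_subcategory D \<B>) (Suc n)" if "homotopy_equivalent_between (full_subcategory D \<B>) n A E X Y" for A E Y
    using that by (auto simp: homotopy_equivalent_between_def chain_map_between_def complexes_between_def)
  then show ?thesis
    unfolding homotopy_class_def using homotopy_equivalent_full[OF assms(1) _ assms(2)] by blast
qed

text \<open>
  The classes in \<open>\<B>\<close> are obtained by intersecting some of the classes in \<open>D\<close> with a fixed set;
  they form an image of a subset of the latter.
\<close>

lemma small_full:
  assumes B: "\<B> \<subseteq> obj D" and s: "small_extension_groups D n \<X> U"
  shows "small_extension_groups (full_subcategory D \<B>) n (\<X> \<inter> complexes (full_subcategory D \<B>) (Suc n)) U"
  unfolding small_extension_groups_def full_sel
proof (intro ballI)
  fix A E assume A: "A \<in> \<B>" "E \<in> \<B>"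
  let ?M = "\<X> \<inter> complexes (full_subcategory D \<B>) (Suc n) \<inter> complexes_between (full_subcategory D \<B>) n A E"
  have M: "?M \<subseteq> \<X> \<inter> complexes_between D n A E" "?M \<subseteq> complexes (full_subcategory D \<B>) (Suc n)"
    using complexes_full[OF B] by (auto simp: complexes_between_def)
  have "homotopy_class (full_subcategory D \<B>) n ` ?M =
      (\<lambda>K. K \<inter> complexes (full_subcategory D \<B>) (Suc n)) ` homotopy_class D n ` ?M"
    unfolding image_image using homotopy_class_full[OF _ B] M(2) by (intro image_cong refl) blast
  also have "\<dots> \<lesssim> homotopy_class D n ` ?M" by (rule image_lepoll)
  also have "homotopy_class D n ` ?M \<lesssim> homotopy_class D n ` (\<X> \<inter> complexes_between D n A E)"
    by (rule subset_imp_lepoll) (use M(1) in blast)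
  finally have l: "homotopy_class (full_subcategory D \<B>) n ` ?M \<lesssim> homotopy_class D n ` (\<X> \<inter> complexes_between D n A E)" .
  have "homotopy_class D n ` (\<X> \<inter> complexes_between D n A E) \<prec> U"
    using s A B unfolding small_extension_groups_def by blast
  then show "homotopy_class (full_subcategory D \<B>) n ` ?M \<prec> U" by (rule lesspoll_trans1[OF l])
qed

end

theorem theorem5:
  fixes D :: "('o, 'm) category_data" and n :: nat and \<X> :: "('o, 'm) cpx set"
    and \<B> :: "'o set" and U :: "'u set"
  assumes "1 \<le> n"
    and "n_exact_category D n \<X>"
    and "small_extension_groups D n \<X> U"
    and "additive_subcategory D \<B>"
    and "n_extension_closed D n \<X> \<B>"
  shows "n_exact_category (full_subcategory D \<B>) n
      (\<X> \<inter> complexes (full_subcategory D \<B>) (Suc n)) \<and>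
    small_extension_groups (full_subcategory D \<B>) n
      (\<X> \<inter> complexes (full_subcategory D \<B>) (Suc n)) U"
proof -
  interpret n_exact_category D n \<X> by (rule assms(2))
  have B: "\<B> \<subseteq> obj D" using assms(4) by (simp add: additive_subcategory_def)
  obtain Z where Z: "Z \<in> \<B>" "is_zero_object D Z" using assms(4) unfolding additive_subcategory_def by blast
  interpret pointed_category D Z by unfold_locales (rule Z(2))
  let ?B = "full_subcategory D \<B>" and ?Y = "\<X> \<inter> complexes (full_subcategory D \<B>) (Suc n)"
  have XS: "\<X> \<subseteq> complexes D (Suc n)" using n_exact by (auto simp: n_exact_sequence_def)
  have XS': "\<X> \<subseteq> complexes (full_subcategory D (obj D)) (Suc n)" using XS by simp
  have bpB: "biproduct_closed D \<B>"
    using assms(4) unfolding additive_subcategory_def biproduct_closed_def by blast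
  have bpD: "biproduct_closed D (obj D)"
    by (simp add: biproduct_closed_def is_biproduct_def)
  have X1: "n_exact_structure (arrow_data D Z) (int n) (obj D) (lift_cpx (Suc n) ` \<X>)"
    unfolding n_exact_structure_lift_iff[OF subset_refl Z_obj assms(1) XS' bpD] full_obj
    by (intro conjI ballI allI impI; (rule n_exact weak_iso_closed E1 E1_op E2_op E2; assumption))
  have X2: "n_exact_structure (arrow_data D Z) (int n) \<B> (lift_cpx (Suc n) ` ?Y)"
    unfolding with_terms_in_lift[OF B Z(1) XS, symmetric]
  proof (rule n_exact_structure_with_terms_in)
    show "n_exact_structure (arrow_data D Z) (int n) (Ob (arrow_data D Z)) (lift_cpx (Suc n) ` \<X>)" using X1 by simp
    show "extension_closed_in (arrow_data D Z) (int n) \<B> (lift_cpx (Suc n) ` \<X>)" by (rule extension_closed_in_lift[OF B Z(1) XS assms(5)])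
    show "\<exists>s i1 i2 p1 p2. s \<in> \<B> \<and> biproduct (arrow_data D Z) A A' s i1 i2 p1 p2" if "A \<in> \<B>" "A' \<in> \<B>" for A A'
      by (rule biproducts_exist[OF B Z(1) bpB that])
  qed (use assms(1) B Z in auto)
  note r = X2[unfolded n_exact_structure_lift_iff[OF B Z(1) assms(1) Int_lower2 bpB]]
  note r1 = conjunct1[OF r] and r' = conjunct2[OF r]
  note r2 = conjunct1[OF r'] and r' = conjunct2[OF r']
  note r3 = conjunct1[OF r'] and r' = conjunct2[OF r']
  note r4 = conjunct1[OF r'] and r' = conjunct2[OF r']
  note r5 = conjunct1[OF r'] and r6 = conjunct2[OF r']
  have "n_exact_category ?B n ?Y"
  proof (rule n_exact_category.intro[OF full_additive[OF assms(4)]], rule n_exact_category_axioms.intro)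
    (* n_exact_structure leaves out the zero complexes; those over the subcategory are zero complexes over D. *)
    show "X \<in> ?Y" if "X \<in> complexes ?B (Suc n)" "\<forall>i\<le>Suc n. is_zero_object ?B (cobj X i)" for X
      using E0[of X] that zero_object_full[OF B] complexes_full[OF B] by blast
    show "n_exact_sequence ?B n X" if "X \<in> ?Y" for X by (rule r1[rule_format, OF that])
    show "X \<in> ?Y \<longleftrightarrow> Y \<in> ?Y" if "weak_isomorphism ?B n X Y \<phi>" for X Y \<phi> by (rule r2[rule_format, OF that])
    show "admissible_mono ?Y A E (g \<cdot>\<^bsub>?B\<^esub> f)" if "admissible_mono ?Y A A' f" "admissible_mono ?Y A' E g" for A A' E f g
      unfolding full_sel by (rule r3[rule_format, OF that])
    show "admissible_epi n ?Y A E (g \<cdot>\<^bsub>?B\<^esub> f)" if "admissible_epi n ?Y A A' f" "admissible_epi n ?Y A' E g" for A A' E f g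
      unfolding full_sel by (rule r4[rule_format, OF that])
    show "\<exists>Y h. n_pullback_diagram ?B n Y (drop_first n X) h \<and> cobj Y n = E \<and> h n = g \<and>
        admissible_epi n ?Y (cobj Y (n - 1)) (cobj Y n) (cdiff Y (n - 1))"
      if "X \<in> ?Y" "E \<in> obj ?B" "g \<in> mor ?B E (cobj X (Suc n))" for X E g
      using that unfolding full_sel by (rule r5[rule_format])
    show "\<exists>Y h. n_pushout_diagram ?B n (drop_last n X) Y h \<and> cobj Y 0 = E \<and> h 0 = f \<and>
        admissible_mono ?Y (cobj Y 0) (cobj Y 1) (cdiff Y 0)"
      if "X \<in> ?Y" "E \<in> obj ?B" "f \<in> mor ?B (cobj X 0) E" for X E f
      using that unfolding full_sel by (rule r6[rule_format])
  qed
  then show ?thesis using small_full[OF B assms(3)] by blast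
qed

end
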